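(* For $m\in\mathbb{N}$, let $N_2(m)$ be the number of equivalence classes of pairs $(P_1,P_2)$ of $2$-dimensional lattice polytopes in $\mathbb{R}^2$ of normalized mixed volume $m$ that are maximal. Then $$N_2(1)=1,\ N_2(2)=3,\ N_2(3)=6,\ N_2(4)=13,\ N_2(5)=18,$$ $$N_2(6)=38,\ N_2(7)=46,\ N_2(8)=87,\ N_2(9)=118,\ N_2(10)=202.$$
   Context: A lattice polytope in $\mathbb{R}^2$ is the convex hull of a non-empty finite subset of $\mathbb{Z}^2$. The normalized volume is $\mathrm{Vol}=2\,\mathrm{vol}$ (twice the Euclidean area), and the normalized mixed volume of two polytopes in $\mathbb{R}^2$ is $V(P_1,P_2)=\frac12\left(\mathrm{Vol}(P_1+P_2)-\mathrm{Vol}(P_1)-\mathrm{Vol}(P_2)\right)$. Two pairs of lattice polytopes in $\mathbb{R}^2$ are equivalent if one is obtained from the other by applying a common element of $\mathrm{GL}(2,\mathbb{Z})$ to both polytopes, translating each polytope independently by a vector of $\mathbb{Z}^2$, and possibly swapping the two polytopes. A pair $(P_1,P_2)$ of lattice polytopes is maximal if for every lattice polytope $Q_1\supseteq P_1$ the equality $V(Q_1,P_2)=V(P_1,P_2)$ implies $Q_1=P_1$, and for every lattice polytope $Q_2\supseteq P_2$ the equality $V(P_1,Q_2)=V(P_1,P_2)$ implies $Q_2=P_2$. *)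

theory Defs
  imports "HOL-Analysis.Analysis" "HOL-Library.Set_Algebras"
begin

definition int_lattice :: "(real^2) set" where
  "int_lattice = {x. \<forall>i. x $ i \<in> \<int>}"

definition lattice_polytope :: "(real^2) set \<Rightarrow> bool" where
  "lattice_polytope P \<longleftrightarrow>
    (\<exists>S. finite S \<and> S \<noteq> {} \<and> S \<subseteq> int_lattice \<and> P = convex hull S)"

definition normalized_volume :: "(real^2) set \<Rightarrow> real" where
  "normalized_volume P = 2 * measure lebesgue P"

text \<open>Here \<open>P + Q\<close> is the Minkowski sum from \<open>HOL-Library.Set_Algebras\<close>.\<close>

definition mixed_volume :: "(real^2) set \<Rightarrow> (real^2) set \<Rightarrow> real" where
  "mixed_volume P Q =
    (normalized_volume (P + Q) - normalized_volume P - normalized_volume Q) / 2"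

definition maximal_pair :: "(real^2) set \<Rightarrow> (real^2) set \<Rightarrow> bool" where
  "maximal_pair P1 P2 \<longleftrightarrow>
    (\<forall>Q1. lattice_polytope Q1 \<and> P1 \<subseteq> Q1 \<and> mixed_volume Q1 P2 = mixed_volume P1 P2
        \<longrightarrow> Q1 = P1) \<and>
    (\<forall>Q2. lattice_polytope Q2 \<and> P2 \<subseteq> Q2 \<and> mixed_volume P1 Q2 = mixed_volume P1 P2
        \<longrightarrow> Q2 = P2)"

definition real_matrix :: "int^2^2 \<Rightarrow> real^2^2" where
  "real_matrix A = (\<chi> i j. of_int (A $ i $ j))"

text \<open>The image of \<open>P\<close> under the affine map \<open>x \<mapsto> t + A x\<close>.  The group \<open>GL(2, \<int>)\<close>
  consists of the \<open>A :: int^2^2\<close> with \<open>invertible A\<close>, i.e. those with a two-sided inverse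
  over the integers.\<close>

definition affine_image :: "int^2^2 \<Rightarrow> real^2 \<Rightarrow> (real^2) set \<Rightarrow> (real^2) set" where
  "affine_image A t P = (\<lambda>x. t + real_matrix A *v x) ` P"

definition equivalent_pairs ::
  "(real^2) set \<times> (real^2) set \<Rightarrow> (real^2) set \<times> (real^2) set \<Rightarrow> bool" where
  "equivalent_pairs P Q \<longleftrightarrow>
    (\<exists>A s t. invertible A \<and> s \<in> int_lattice \<and> t \<in> int_lattice \<and>
      (Q = (affine_image A s (fst P), affine_image A t (snd P)) \<or>
       Q = (affine_image A s (snd P), affine_image A t (fst P))))"

definition maximal_pairs :: "nat \<Rightarrow> ((real^2) set \<times> (real^2) set) set" where
  "maximal_pairs m = {(P1, P2).
    lattice_polytope P1 \<and> lattice_polytope P2 \<and> aff_dim P1 = 2 \<and> aff_dim P2 = 2 \<and>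
    mixed_volume P1 P2 = real m \<and> maximal_pair P1 P2}"

definition equivalence_on_pairs ::
  "nat \<Rightarrow> (((real^2) set \<times> (real^2) set) \<times> ((real^2) set \<times> (real^2) set)) set" where
  "equivalence_on_pairs m =
    {(P, Q). P \<in> maximal_pairs m \<and> Q \<in> maximal_pairs m \<and> equivalent_pairs P Q}"

text \<open>Since \<open>card\<close> of an infinite set is \<open>0\<close>, a positive value of \<open>N2 m\<close> includes the
  finiteness of the set of equivalence classes.\<close>

definition N2 :: "nat \<Rightarrow> nat" where
  "N2 m = card (maximal_pairs m // equivalence_on_pairs m)"

lemma real_matrix_mult: "real_matrix (A ** B) = real_matrix A ** real_matrix B"
  by (simp add: real_matrix_def matrix_matrix_mult_def vec_eq_iff)

lemma real_matrix_1: "real_matrix (mat 1) = mat 1"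
  by (simp add: real_matrix_def mat_def vec_eq_iff)

lemma int_lattice_matrix: "x \<in> int_lattice \<Longrightarrow> real_matrix A *v x \<in> int_lattice"
  by (auto simp: int_lattice_def real_matrix_def matrix_vector_mult_def intro!: Ints_sum Ints_mult)

lemma int_lattice_add: "x \<in> int_lattice \<Longrightarrow> y \<in> int_lattice \<Longrightarrow> x + y \<in> int_lattice"
  by (auto simp: int_lattice_def)

lemma int_lattice_minus: "x \<in> int_lattice \<Longrightarrow> - x \<in> int_lattice"
  by (auto simp: int_lattice_def)

lemma affine_image_id: "affine_image (mat 1) 0 P = P"
  by (simp add: affine_image_def real_matrix_1)

lemma affine_image_comp:
  "affine_image B t (affine_image A s P) = affine_image (B ** A) (t + real_matrix B *v s) P"
  by (simp add: affine_image_def image_image real_matrix_mult matrix_vector_mul_assoc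
      matrix_vector_right_distrib add.assoc)

lemma equivalent_pairs_refl: "equivalent_pairs P P"
proof -
  have "invertible (mat 1 :: int^2^2)"
    unfolding invertible_def by (intro exI[of _ "mat 1"]) simp
  moreover have "0 \<in> int_lattice"
    by (simp add: int_lattice_def)
  ultimately show ?thesis
    unfolding equivalent_pairs_def
    by (intro exI[of _ "mat 1"] exI[of _ 0]) (simp add: affine_image_id)
qed

lemma equivalent_pairs_sym:
  assumes "equivalent_pairs P Q"
  shows "equivalent_pairs Q P"
proof -
  obtain A s t where A: "invertible A" and st: "s \<in> int_lattice" "t \<in> int_lattice"
    and Q: "Q = (affine_image A s (fst P), affine_image A t (snd P)) \<or>
            Q = (affine_image A s (snd P), affine_image A t (fst P))"
    using assms unfolding equivalent_pairs_def by blast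
  obtain B where B: "A ** B = mat 1" "B ** A = mat 1"
    using A unfolding invertible_def by blast
  have invB: "invertible B"
    using B unfolding invertible_def by blast
  define f where "f u = - (real_matrix B *v u)" for u
  have f: "f u \<in> int_lattice" if "u \<in> int_lattice" for u
    unfolding f_def using that by (intro int_lattice_minus int_lattice_matrix)
  have inv: "affine_image B (f u) (affine_image A u X) = X" for u X
    by (simp add: affine_image_comp B f_def affine_image_id)
  from Q show ?thesis
  proof
    assume "Q = (affine_image A s (fst P), affine_image A t (snd P))"
    then have "P = (affine_image B (f s) (fst Q), affine_image B (f t) (snd Q))"
      by (simp add: inv)
    then show ?thesis
      unfolding equivalent_pairs_def using invB f st by blast
  next
    assume "Q = (affine_image A s (snd P), affine_image A t (fst P))"
    then have "P = (affine_image B (f t) (snd Q), affine_image B (f s) (fst Q))"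
      by (simp add: inv)
    then show ?thesis
      unfolding equivalent_pairs_def using invB f st by blast
  qed
qed

lemma equivalent_pairs_trans:
  assumes "equivalent_pairs P Q" "equivalent_pairs Q R"
  shows "equivalent_pairs P R"
proof -
  obtain A s t where A: "invertible A" and st: "s \<in> int_lattice" "t \<in> int_lattice"
    and Q: "Q = (affine_image A s (fst P), affine_image A t (snd P)) \<or>
            Q = (affine_image A s (snd P), affine_image A t (fst P))"
    using assms(1) unfolding equivalent_pairs_def by blast
  obtain B u v where B: "invertible B" and uv: "u \<in> int_lattice" "v \<in> int_lattice"
    and R: "R = (affine_image B u (fst Q), affine_image B v (snd Q)) \<or>
            R = (affine_image B u (snd Q), affine_image B v (fst Q))"
    using assms(2) unfolding equivalent_pairs_def by blast
  define g where "g x y = y + real_matrix B *v x" for x y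
  have g: "g x y \<in> int_lattice" if "x \<in> int_lattice" "y \<in> int_lattice" for x y
    unfolding g_def using that by (intro int_lattice_add int_lattice_matrix)
  have BA: "invertible (B ** A)"
  proof -
    obtain A' where A': "A ** A' = mat 1" "A' ** A = mat 1"
      using A unfolding invertible_def by blast
    obtain B' where B': "B ** B' = mat 1" "B' ** B = mat 1"
      using B unfolding invertible_def by blast
    have "(B ** A) ** (A' ** B') = mat 1" "(A' ** B') ** (B ** A) = mat 1"
      by (metis A' B' matrix_mul_assoc matrix_mul_rid)+
    then show ?thesis
      unfolding invertible_def by blast
  qed
  have comp: "affine_image B y (affine_image A x X) = affine_image (B ** A) (g x y) X" for x y X
    by (simp add: affine_image_comp g_def)
  have PR: "equivalent_pairs P R"
    if "x \<in> int_lattice" "y \<in> int_lattice"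
      "R = (affine_image (B ** A) x (fst P), affine_image (B ** A) y (snd P)) \<or>
       R = (affine_image (B ** A) x (snd P), affine_image (B ** A) y (fst P))" for x y
    unfolding equivalent_pairs_def using that BA by blast
  from Q R consider
    "R = (affine_image (B ** A) (g s u) (fst P), affine_image (B ** A) (g t v) (snd P))"
  | "R = (affine_image (B ** A) (g t u) (snd P), affine_image (B ** A) (g s v) (fst P))"
  | "R = (affine_image (B ** A) (g s u) (snd P), affine_image (B ** A) (g t v) (fst P))"
  | "R = (affine_image (B ** A) (g t u) (fst P), affine_image (B ** A) (g s v) (snd P))"
    by (elim disjE) (simp_all add: comp)
  then show ?thesis
  proof cases
    case 1
    show ?thesis by (rule PR[OF g[OF st(1) uv(1)] g[OF st(2) uv(2)] disjI1[OF 1]])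
  next
    case 2
    show ?thesis by (rule PR[OF g[OF st(2) uv(1)] g[OF st(1) uv(2)] disjI2[OF 2]])
  next
    case 3
    show ?thesis by (rule PR[OF g[OF st(1) uv(1)] g[OF st(2) uv(2)] disjI2[OF 3]])
  next
    case 4
    show ?thesis by (rule PR[OF g[OF st(2) uv(1)] g[OF st(1) uv(2)] disjI1[OF 4]])
  qed
qed

lemma equiv_equivalence_on_pairs: "equiv (maximal_pairs m) (equivalence_on_pairs m)"
proof (rule equivI)
  show "equivalence_on_pairs m \<subseteq> maximal_pairs m \<times> maximal_pairs m"
    unfolding equivalence_on_pairs_def by auto
  show "refl_on (maximal_pairs m) (equivalence_on_pairs m)"
    unfolding refl_on_def equivalence_on_pairs_def by (auto intro: equivalent_pairs_refl)
  show "sym (equivalence_on_pairs m)"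
    unfolding sym_def equivalence_on_pairs_def by (auto intro: equivalent_pairs_sym)
  show "trans (equivalence_on_pairs m)"
    unfolding trans_def equivalence_on_pairs_def by (auto intro: equivalent_pairs_trans)
qed

end

(*
  For planar polytopes V(P, Q) is the sum over the edges of P of edge length times support
  value of Q. By Brunn-Minkowski, V(P, Q)^2 >= Vol P * Vol Q, so one of the two polygons of a
  pair with mixed volume m <= 10, say Q, satisfies Vol Q <= m.

  Up to equivalence there are 142 lattice polygons R with Vol R <= 10: removing a suitable
  vertex from a lattice polygon leaves the hull of its remaining lattice points, and the removed
  point had lattice height one over every edge it saw. So all of them arise from the unimodular
  triangle by adding one point at a time, which leaves finitely many possibilities at each step.

  For fixed R, a maximal partner P is the hull of the lattice points in the half-planes that
  belong to the edges of R, so it is determined by its support values h there. Up to translation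
  these are non-negative integers with weighted sum m, subject to convexity relations; moreover
  V(P, conv(R u {x})) > m for every lattice point x outside R. A depth-first search through all
  such h leaves 665 pairs; 133 of them are equivalent to others, and the remaining 532 are
  distinguished by invariants of their vertex sets.
*)

theory Submission
  imports Defs
begin

section \<open>Mixed volumes as sums over edges\<close>

text \<open>The relations on support vectors are only necessary conditions, so a vector that passes
  them need not come from a lattice polygon, let alone from a maximal partner. Each such vector must
  therefore be refuted or matched with an explicit polygon P. Refutation uses that a polygon T with
  support vector h satisfies V(T, L) <= b(h) for L = conv(R u {x}), with b linear up to rounding: if
  b(h) <= m, monotonicity forces V(T, L) = V(T, R), and the pair was not maximal. Matching uses that
  support values of lattice polygons are integers, so that bounds in the edge directions of R imply
  rounded bounds in all other directions; these place T inside P, and maximality of T gives T = P.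
  One search with budget 10 serves all m at once, since a leaf knows the mixed volume that has been
  used. Everything that is hard to find (enlarging points x, intermediate directions for rounding,
  affine equivalences) is stored as data, so that only elementary integer tests remain to be
  evaluated.\<close>

definition rdet :: "real^2 \<Rightarrow> real^2 \<Rightarrow> real" where
  "rdet x y = x $ 1 * y $ 2 - x $ 2 * y $ 1"

lemma rdet_simps [simp]:
  "rdet (x + y) z = rdet x z + rdet y z" "rdet x (y + z) = rdet x y + rdet x z"
  "rdet (x - y) z = rdet x z - rdet y z" "rdet x (y - z) = rdet x y - rdet x z"
  "rdet (c *\<^sub>R x) y = c * rdet x y" "rdet x (c *\<^sub>R y) = c * rdet x y"
  "rdet 0 x = 0" "rdet x 0 = 0" "rdet (- x) y = - rdet x y" "rdet x (- y) = - rdet x y" "rdet x x = 0"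
  by (simp_all add: rdet_def algebra_simps)

lemma rdet_skew: "rdet x y = - rdet y x"
  by (simp add: rdet_def)

lemma inner_vec2: "x \<bullet> y = x $ 1 * y $ 1 + x $ 2 * y $ 2" for x y :: "real^2"
  by (simp add: inner_vec_def sum_2)

lemma vec2_eq_iff: "x = y \<longleftrightarrow> x $ 1 = y $ 1 \<and> x $ 2 = y $ 2" for x y :: "'a^2"
  by (simp add: vec_eq_iff forall_2)

text \<open>Cramer's rule: the linear dependence between three vectors of the plane, with
  determinants as coefficients.\<close>

lemma rdet_cross: "rdet y z *\<^sub>R x = rdet x z *\<^sub>R y + rdet y x *\<^sub>R z"
  by (simp add: vec2_eq_iff rdet_def algebra_simps)

text \<open>Clockwise rotation by a right angle; it turns a counterclockwise edge direction into an
  outer normal.\<close>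

definition perp :: "real^2 \<Rightarrow> real^2" where
  "perp e = (\<chi> i. if i = 1 then e $ 2 else - e $ 1)"

lemma rdet_inner: "rdet x e = perp e \<bullet> x"
  by (simp add: perp_def rdet_def inner_vec2)

lemma perp_eq_0 [simp]: "perp e = 0 \<longleftrightarrow> e = 0"
  by (auto simp: perp_def vec2_eq_iff)

lemma rdet_eq_0_parallel:
  assumes "rdet x e = 0" "norm e = 1"
  shows "x = (x \<bullet> e) *\<^sub>R e"
proof -
  have 1: "e$1 * e$1 + e$2 * e$2 = 1"
    using assms(2) by (simp add: norm_eq_1 inner_vec2)
  have d: "x$1 * e$2 = x$2 * e$1"
    using assms(1) by (simp add: rdet_def)
  have "(x \<bullet> e) * e$1 = x$1 * (e$1 * e$1) + e$2 * (x$2 * e$1)"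
    by (simp add: inner_vec2 algebra_simps)
  also have "\<dots> = x$1 * (e$1 * e$1) + e$2 * (x$1 * e$2)" by (simp only: d)
  also have "\<dots> = x$1 * (e$1 * e$1 + e$2 * e$2)" by (simp add: algebra_simps)
  finally have a: "(x \<bullet> e) * e$1 = x$1" using 1 by simp
  have "(x \<bullet> e) * e$2 = e$1 * (x$1 * e$2) + x$2 * (e$2 * e$2)"
    by (simp add: inner_vec2 algebra_simps)
  also have "\<dots> = e$1 * (x$2 * e$1) + x$2 * (e$2 * e$2)" by (simp only: d)
  also have "\<dots> = x$2 * (e$1 * e$1 + e$2 * e$2)" by (simp add: algebra_simps)
  finally have b: "(x \<bullet> e) * e$2 = x$2" using 1 by simp
  show ?thesis using a b by (simp add: vec2_eq_iff)
qed

lemma rdet_eq_0_iff_parallel_unit: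
  assumes "rdet e f = 0" "norm e = 1" "norm f = 1"
  shows "e = f \<or> e = - f"
proof -
  have *: "e = (e \<bullet> f) *\<^sub>R f" using rdet_eq_0_parallel assms by blast
  then have "norm e = \<bar>e \<bullet> f\<bar> * norm f" by (metis norm_scaleR)
  then have "\<bar>e \<bullet> f\<bar> = 1" using assms by simp
  then have "e \<bullet> f = 1 \<or> e \<bullet> f = -1" by linarith
  then show ?thesis using * by force
qed

section \<open>Support values and maximal faces\<close>

text \<open>Linear functionals are indexed by counterclockwise edge directions instead of outer normals: \<open>rdet x e\<close>
  is maximal on the edge of direction \<open>e\<close>.\<close>
definition support :: "(real^2) set \<Rightarrow> real^2 \<Rightarrow> real" where
  "support K e = (SUP x\<in>K. rdet x e)"

definition max_face :: "(real^2) set \<Rightarrow> real^2 \<Rightarrow> (real^2) set" where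
  "max_face K e = {x \<in> K. \<forall>y\<in>K. rdet y e \<le> rdet x e}"

lemma continuous_on_rdet [continuous_intros]:
  "continuous_on S f \<Longrightarrow> continuous_on S (\<lambda>x. rdet (f x) e)"
  unfolding rdet_inner by (intro continuous_intros)

lemma max_face_ne: assumes "compact K" "K \<noteq> {}" shows "max_face K e \<noteq> {}"
proof -
  have "\<exists>x\<in>K. \<forall>y\<in>K. rdet y e \<le> rdet x e"
    by (rule continuous_attains_sup) (use assms in \<open>auto intro: continuous_intros\<close>)
  then show ?thesis by (auto simp: max_face_def)
qed

lemma support_max_face: "x \<in> max_face K e \<Longrightarrow> rdet x e = support K e"
  unfolding support_def max_face_def by (intro antisym cSUP_upper cSUP_least bdd_aboveI2) auto

lemma support_eqI: "x \<in> K \<Longrightarrow> (\<And>y. y \<in> K \<Longrightarrow> rdet y e \<le> rdet x e) \<Longrightarrow> support K e = rdet x e"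
  using support_max_face[of x K e] by (auto simp: max_face_def)

lemma support_ge: assumes "compact K" "x \<in> K" shows "rdet x e \<le> support K e"
proof -
  obtain y where y: "y \<in> max_face K e" using max_face_ne assms by blast
  then have "rdet x e \<le> rdet y e" using assms(2) by (simp add: max_face_def)
  then show ?thesis using support_max_face[OF y] by simp
qed

lemma max_face_altdef: "compact K \<Longrightarrow> max_face K e = {x \<in> K. rdet x e = support K e}"
  using support_max_face[of _ K e] support_ge[of K _ e] by (auto simp: max_face_def)

lemma support_mono: assumes "compact K" "compact L" "K \<subseteq> L" "K \<noteq> {}" shows "support K e \<le> support L e"
proof -
  obtain y where y: "y \<in> max_face K e" using max_face_ne assms by blast
  then have "rdet y e \<le> support L e" using assms by (intro support_ge) (auto simp: max_face_def)
  then show ?thesis using support_max_face[OF y] by simp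
qed

lemma support_scale: assumes "compact K" "K \<noteq> {}" "c \<ge> 0" shows "support K (c *\<^sub>R e) = c * support K e"
proof -
  obtain y where y: "y \<in> max_face K e" using max_face_ne assms by blast
  then have "support K (c *\<^sub>R e) = rdet y (c *\<^sub>R e)"
    using assms by (intro support_eqI) (auto simp: max_face_def mult_left_mono)
  then show ?thesis using support_max_face[OF y] by simp
qed

lemma compact_plus: "compact K \<Longrightarrow> compact L \<Longrightarrow> compact (K + L)" for K L :: "(real^2) set"
proof -
  assume "compact K" "compact L"
  moreover have "K + L = {x + y |x y. x \<in> K \<and> y \<in> L}" by (auto simp: set_plus_def)
  ultimately show ?thesis using compact_sums[of K L] by simp
qed

text \<open>The functional is additive, so a sum of two points is maximal exactly when both summands
  are.\<close>

lemma max_face_plus: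
  assumes "compact K" "compact L" "K \<noteq> {}" "L \<noteq> {}"
  shows "max_face (K + L) e = max_face K e + max_face L e" "support (K + L) e = support K e + support L e"
proof -
  obtain a b where ab: "a \<in> max_face K e" "b \<in> max_face L e"
    using max_face_ne[OF assms(1,3), of e] max_face_ne[OF assms(2,4), of e] by blast
  have "support (K + L) e = rdet (a + b) e"
  proof (rule support_eqI)
    show "a + b \<in> K + L" using ab by (auto simp: max_face_def)
    fix y assume "y \<in> K + L"
    then obtain p q where "y = p + q" "p \<in> K" "q \<in> L" by (auto simp: set_plus_def)
    then show "rdet y e \<le> rdet (a + b) e" using ab by (auto simp: max_face_def intro: add_mono)
  qed
  then show s: "support (K + L) e = support K e + support L e" using ab by (simp add: support_max_face)
  show "max_face (K + L) e = max_face K e + max_face L e"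
  proof (intro set_eqI iffI)
    fix x assume "x \<in> max_face (K + L) e"
    then have x: "x \<in> K + L" "rdet x e = support K e + support L e"
      using compact_plus[OF assms(1,2)] by (auto simp: max_face_altdef s)
    then obtain p q where pq: "x = p + q" "p \<in> K" "q \<in> L" by (auto simp: set_plus_def)
    moreover have "rdet p e \<le> support K e" "rdet q e \<le> support L e"
      using support_ge assms pq by auto
    ultimately have "p \<in> max_face K e" "q \<in> max_face L e"
      using x(2) assms by (auto simp: max_face_altdef)
    then show "x \<in> max_face K e + max_face L e" using pq by auto
  next
    fix x assume "x \<in> max_face K e + max_face L e"
    then obtain p q where "x = p + q" "p \<in> max_face K e" "q \<in> max_face L e" by (auto simp: set_plus_def)
    then show "x \<in> max_face (K + L) e" using assms compact_plus[OF assms(1,2)]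
      by (auto simp: max_face_altdef s)
  qed
qed

lemma max_face_scaled:
  assumes "compact L" "0 < s"
  shows "max_face ((*\<^sub>R) s ` L) e = (*\<^sub>R) s ` max_face L e"
  using assms by (auto simp: max_face_def)

lemma polytope_plus: 
  fixes P Q :: "(real^2) set"
  assumes "polytope P" "polytope Q" shows "polytope (P + Q)"
proof -
  obtain S T where "finite S" "P = convex hull S" "finite T" "Q = convex hull T"
    using assms by (auto simp: polytope_def)
  then show ?thesis unfolding polytope_def
    by (metis convex_hull_set_plus finite_set_plus)
qed

section \<open>Edge directions and edge lengths\<close>

definition edge_dirs :: "(real^2) set \<Rightarrow> (real^2) set" where
  "edge_dirs K = {e. norm e = 1 \<and> (\<exists>a\<in>max_face K e. \<exists>b\<in>max_face K e. a \<noteq> b)}"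

lemma dirsI: assumes "a \<in> max_face K e" "b \<in> max_face K e" "a \<noteq> b" "e \<noteq> 0"
  shows "e /\<^sub>R norm e \<in> edge_dirs K"
  using assms unfolding edge_dirs_def max_face_def by (auto simp: divide_right_mono)

lemma max_face_face_of: "compact K \<Longrightarrow> convex K \<Longrightarrow> max_face K e face_of K"
proof -
  assume K: "compact K" "convex K"
  have "max_face K e = K \<inter> {x. perp e \<bullet> x = support K e}"
    using K by (auto simp: max_face_altdef rdet_inner)
  moreover have "\<And>x. x \<in> K \<Longrightarrow> perp e \<bullet> x \<le> support K e"
    using support_ge K by (auto simp flip: rdet_inner)
  ultimately show ?thesis using K by (simp add: face_of_Int_supporting_hyperplane_le)
qed

text \<open>The relative boundary of a polyhedron is the union of its facets. A facet of a planar
  body has dimension one, so it contains two distinct points, and its exposing functional is given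
  by an edge direction.\<close>

lemma frontier_max_face:
  assumes P: "polytope K" and i: "interior K \<noteq> {}" and x: "x \<in> K" "x \<notin> interior K"
  obtains e where "e \<in> edge_dirs K" "x \<in> max_face K e"
proof -
  have ph: "polyhedron K" using P polytope_imp_polyhedron by blast
  have "rel_interior K = interior K" using i by (simp add: rel_interior_nonempty_interior)
  then obtain F where F: "F facet_of K" "x \<in> F"
    using rel_boundary_of_polyhedron[OF ph] x by auto
  then have "F exposed_face_of K" using exposed_face_of_polyhedron[OF ph] by (simp add: facet_of_def)
  then obtain a b where ab: "K \<subseteq> {x. a \<bullet> x \<le> b}" "F = K \<inter> {x. a \<bullet> x = b}"
    unfolding exposed_face_of_def by blast
  have dK: "aff_dim K = 2" using aff_dim_nonempty_interior[OF i] by simp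
  have dF: "aff_dim F = 1" using F dK by (simp add: facet_of_def)
  have a0: "a \<noteq> 0" 
  proof
    assume "a = 0" then have "F = K \<or> F = {}" using ab by auto
    then show False using dF dK by auto
  qed
  define e :: "real^2" where "e = (\<chi> i. if i = 1 then - a$2 else a$1)"
  have pe: "perp e = a" by (simp add: e_def perp_def vec2_eq_iff)
  have e0: "e \<noteq> 0" using a0 pe perp_eq_0 by metis
  have Fe: "y \<in> max_face K e" if "y \<in> F" for y
    using that ab by (auto simp: max_face_def rdet_inner pe)
  obtain y z where yz: "y \<in> F" "z \<in> F" "y \<noteq> z"
  proof -
    have "\<not> (\<exists>a. F = {a})" "F \<noteq> {}" using dF by (auto simp: aff_dim_eq_0)
    then show ?thesis using that by blast
  qed
  have "x \<in> max_face K (e /\<^sub>R norm e)" using Fe[OF F(2)] e0 by (auto simp: max_face_def divide_right_mono)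
  then show ?thesis using that dirsI[OF Fe[OF yz(1)] Fe[OF yz(2)] yz(3) e0] by blast
qed

lemma unit_perp_cases:
  assumes "norm e = 1" "rdet d e = 0" "d \<noteq> 0"
  shows "e = d /\<^sub>R norm d \<or> e = - (d /\<^sub>R norm d)"
proof -
  have "norm (d /\<^sub>R norm d) = 1" using assms by simp
  moreover have "rdet e (d /\<^sub>R norm d) = 0" using assms rdet_skew[of e d] by simp
  ultimately show ?thesis using rdet_eq_0_iff_parallel_unit assms(1) by blast
qed

text \<open>A face of a convex hull is the hull of some of the generators, so a face with two points
  contains two generators.\<close>

lemma max_face_hull_two:
  assumes "finite S" "a \<in> max_face (convex hull S) e" "b \<in> max_face (convex hull S) e" "a \<noteq> b"
  obtains v w where "v \<in> S" "w \<in> S" "v \<noteq> w" "v \<in> max_face (convex hull S) e" "w \<in> max_face (convex hull S) e"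
proof -
  have "compact S" using assms(1) finite_imp_compact by blast
  moreover have "max_face (convex hull S) e face_of convex hull S"
    using max_face_face_of calculation compact_convex_hull by (metis convex_convex_hull)
  ultimately obtain S' where S': "S' \<subseteq> S" "max_face (convex hull S) e = convex hull S'"
    using face_of_convex_hull_subset by metis
  have "S' \<noteq> {}" "\<not> (\<exists>v. S' = {v})" using S'(2) assms by auto
  then obtain v w where "v \<in> S'" "w \<in> S'" "v \<noteq> w" by blast
  then show ?thesis using that S' hull_subset[of S' convex] by (metis subsetD)
qed

text \<open>Every edge direction is a normalised difference of two of the finitely many
  generators.\<close>

lemma finite_edge_dirs: assumes "polytope K" shows "finite (edge_dirs K)"
proof -
  obtain S where S: "finite S" "K = convex hull S" using assms by (auto simp: polytope_def)
  let ?f = "\<lambda>(v,w). (w - v) /\<^sub>R norm (w - v)"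
  have "edge_dirs K \<subseteq> ?f ` (S \<times> S)"
  proof
    fix e assume e: "e \<in> edge_dirs K"
    then obtain a b where "norm e = 1" "a \<in> max_face K e" "b \<in> max_face K e" "a \<noteq> b" by (auto simp: edge_dirs_def)
    then obtain v w where vw: "v \<in> S" "w \<in> S" "v \<noteq> w" "v \<in> max_face K e" "w \<in> max_face K e"
      using max_face_hull_two S by metis
    have "rdet (w - v) e = 0" using vw by (simp add: support_max_face)
    then have "e = ?f (v,w) \<or> e = ?f (w,v)"
      using unit_perp_cases[of e "w - v"] vw \<open>norm e = 1\<close>
      by (auto simp: norm_minus_commute scaleR_diff_right)
    then show "e \<in> ?f ` (S \<times> S)" using vw by blast
  qed
  then show ?thesis using S(1) by (meson finite_SigmaI finite_imageI finite_subset)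
qed

text \<open>The extent of the face along \<open>e\<close>. It vanishes if the face is a point, which
  lets the edge sums of two polygons run over a common set of directions.\<close>

definition edge_length :: "(real^2) set \<Rightarrow> real^2 \<Rightarrow> real" where
  "edge_length K e = (SUP x\<in>max_face K e. x \<bullet> e) - (INF x\<in>max_face K e. x \<bullet> e)"

text \<open>A maximal face is a compact convex part of a line parallel to \<open>e\<close>, so it is
  spanned by its extremal points along \<open>e\<close>.\<close>

lemma max_face_segment:
  assumes "compact K" "convex K" "K \<noteq> {}" "norm e = 1"
  obtains a where "max_face K e = {a + t *\<^sub>R e |t. 0 \<le> t \<and> t \<le> edge_length K e}" "0 \<le> edge_length K e"
proof -
  let ?F = "max_face K e"
  have F: "?F = K \<inter> {x. perp e \<bullet> x = support K e}"
    using assms by (auto simp: max_face_altdef rdet_inner)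
  have cF: "compact ?F" unfolding F using assms by (intro compact_Int_closed closed_hyperplane)
  have vF: "convex ?F" using max_face_face_of[OF assms(1,2)] face_of_imp_convex by blast
  have neF: "?F \<noteq> {}" using max_face_ne assms by blast
  obtain a where a: "a \<in> ?F" "\<And>x. x \<in> ?F \<Longrightarrow> a \<bullet> e \<le> x \<bullet> e"
    using continuous_attains_inf[OF cF neF, of "\<lambda>x. x \<bullet> e"] continuous_on_inner[OF continuous_on_id continuous_on_const]
    by blast
  obtain b where b: "b \<in> ?F" "\<And>x. x \<in> ?F \<Longrightarrow> x \<bullet> e \<le> b \<bullet> e"
    using continuous_attains_sup[OF cF neF, of "\<lambda>x. x \<bullet> e"] continuous_on_inner[OF continuous_on_id continuous_on_const]
    by blast
  have "(SUP x\<in>?F. x \<bullet> e) = b \<bullet> e" using b by (intro cSup_eq_maximum) auto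
  moreover have "(INF x\<in>?F. x \<bullet> e) = a \<bullet> e" using a by (intro cInf_eq_minimum) auto
  ultimately have l: "edge_length K e = b \<bullet> e - a \<bullet> e" by (simp add: edge_length_def)
  have par: "x = a + (x \<bullet> e - a \<bullet> e) *\<^sub>R e" if "x \<in> ?F" for x
  proof -
    have "rdet (x - a) e = 0" using support_max_face[OF that] support_max_face[OF a(1)] by simp
    from rdet_eq_0_parallel[OF this assms(4)] show ?thesis by (simp add: inner_diff_left algebra_simps)
  qed
  have "?F = {a + t *\<^sub>R e |t. 0 \<le> t \<and> t \<le> edge_length K e}"
  proof (intro set_eqI iffI)
    fix x assume "x \<in> ?F"
    then show "x \<in> {a + t *\<^sub>R e |t. 0 \<le> t \<and> t \<le> edge_length K e}"
      using par[of x] a(2)[of x] b(2)[of x] unfolding l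
      by (intro CollectI exI[of _ "x \<bullet> e - a \<bullet> e"]) auto
  next
    fix x assume "x \<in> {a + t *\<^sub>R e |t. 0 \<le> t \<and> t \<le> edge_length K e}"
    then obtain t where t: "x = a + t *\<^sub>R e" "0 \<le> t" "t \<le> edge_length K e" by blast
    show "x \<in> ?F"
    proof (cases "edge_length K e = 0")
      case True then show ?thesis using t a by simp
    next
      case False
      define u where "u = t / edge_length K e"
      have u: "0 \<le> u" "u \<le> 1" "t = u * edge_length K e" using t False by (auto simp: u_def)
      have "b = a + edge_length K e *\<^sub>R e" using par[OF b(1)] l by simp
      then have "x = (1 - u) *\<^sub>R a + u *\<^sub>R b"
        using t(1) u(3) by (simp add: algebra_simps)
      then show ?thesis using vF a(1) b(1) u by (simp add: convexD_alt)
    qed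
  qed
  moreover have "0 \<le> edge_length K e" using a(2)[OF b(1)] l by simp
  ultimately show ?thesis using that by blast
qed

lemma edge_length_eqI:
  assumes "max_face K e = {a + t *\<^sub>R e |t. 0 \<le> t \<and> t \<le> l}" "0 \<le> l" "norm e = 1"
  shows "edge_length K e = l"
proof -
  have ee: "e \<bullet> e = 1" using assms(3) by (simp add: norm_eq_1)
  have "(\<lambda>x. x \<bullet> e) ` max_face K e = {a \<bullet> e .. a \<bullet> e + l}"
  proof (intro set_eqI iffI)
    fix y assume "y \<in> {a \<bullet> e .. a \<bullet> e + l}"
    then show "y \<in> (\<lambda>x. x \<bullet> e) ` max_face K e"
      using assms ee by (intro image_eqI[of _ _ "a + (y - a \<bullet> e) *\<^sub>R e"]) (auto simp: inner_add_left)
  qed (auto simp: assms(1) inner_add_left ee)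
  then show ?thesis using assms(2) by (simp add: edge_length_def)
qed

lemma edge_length_0:
  assumes "compact K" "convex K" "K \<noteq> {}" "norm e = 1" "e \<notin> edge_dirs K"
  shows "edge_length K e = 0"
proof -
  obtain a where a: "max_face K e = {a + t *\<^sub>R e |t. 0 \<le> t \<and> t \<le> edge_length K e}" "0 \<le> edge_length K e"
    using max_face_segment[OF assms(1-4)] .
  have "a \<in> max_face K e" unfolding a(1) using a(2) by (auto intro!: exI[of _ 0])
  moreover have "a + edge_length K e *\<^sub>R e \<in> max_face K e" by (subst a(1)) (use a(2) in auto)
  ultimately have "a = a + edge_length K e *\<^sub>R e" using assms(4,5) unfolding edge_dirs_def by blast
  then show ?thesis using assms(4) by auto
qed

section \<open>Areas of trapezoids and of Minkowski sums\<close>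

definition trapezoid :: "(real^2) set \<Rightarrow> (real^2) set \<Rightarrow> real^2 \<Rightarrow> (real^2) set" where
  "trapezoid K L e = {p + s *\<^sub>R q |p q s. p \<in> max_face K e \<and> q \<in> max_face L e \<and> 0 \<le> s \<and> s \<le> 1}"

text \<open>Model trapezoid: the first coordinate is the parameter \<open>s\<close>, the second the
  position along the edge, so the parallel sides have lengths \<open>k\<close> and
  \<open>k + l\<close>.\<close>

definition trapezoid0 :: "real \<Rightarrow> real \<Rightarrow> (real^2) set" where
  "trapezoid0 k l = {z. 0 \<le> z$1 \<and> z$1 \<le> 1 \<and> 0 \<le> z$2 \<and> z$2 \<le> k + z$1 * l}"

lemma std_triangle:
  defines "T \<equiv> {z::real^2. 0 \<le> z$1 \<and> 0 \<le> z$2 \<and> z$1 + z$2 \<le> 1}"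
  shows "T \<in> lmeasurable" "measure lebesgue T = 1/2"
proof -
  have B: "(Basis :: (real^2) set) = {axis 1 1, axis 2 1}"
    by (auto simp: Basis_vec_def UNIV_2)
  have ne: "axis 1 1 \<noteq> (axis 2 1 :: real^2)" by (simp add: axis_eq_axis)
  have T: "T = convex hull (insert 0 Basis)"
    unfolding T_def std_simplex by (auto simp: B ne inner_axis)
  have c: "compact T" unfolding T by (intro finite_imp_compact_convex_hull) auto
  then show m: "T \<in> lmeasurable" by (rule lmeasurable_compact)
  have "measure lebesgue T = measure lborel T"
    using c by (intro measure_completion) (auto intro: borel_compact)
  also have "\<dots> = 1/2" unfolding T content_std_simplex by (simp add: fact_2)
  finally show "measure lebesgue T = 1/2" .
qed

lemma linear_vec2:
  fixes b e :: "real^2"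
  shows "linear (\<lambda>z::real^2. z$1 *\<^sub>R b + z$2 *\<^sub>R e)"
    and "det (matrix (\<lambda>z::real^2. z$1 *\<^sub>R b + z$2 *\<^sub>R e)) = rdet b e"
proof -
  show "linear (\<lambda>z::real^2. z$1 *\<^sub>R b + z$2 *\<^sub>R e)"
    by (rule linearI) (simp_all add: algebra_simps)
  show "det (matrix (\<lambda>z::real^2. z$1 *\<^sub>R b + z$2 *\<^sub>R e)) = rdet b e"
    by (simp add: det_2 matrix_def axis_def rdet_def)
qed

lemma negligible_rdet: "e \<noteq> 0 \<Longrightarrow> negligible {x. rdet x e = c}"
  unfolding rdet_inner by (intro negligible_hyperplane) auto

text \<open>The rectangle below height \<open>k\<close> has area \<open>k\<close>; the rest is an
  affine image of the standard triangle with determinant \<open>- l\<close>, hence of area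
  \<open>l / 2\<close>.\<close>

lemma measure_trapezoid0:
  assumes "0 \<le> k" "0 \<le> l"
  shows "trapezoid0 k l \<in> lmeasurable" "measure lebesgue (trapezoid0 k l) = k + l / 2"
proof -
  define T where "T = {z::real^2. 0 \<le> z$1 \<and> 0 \<le> z$2 \<and> z$1 + z$2 \<le> 1}"
  define B where "B = cbox (0::real^2) (vector [1, k])"
  define f where "f = (\<lambda>z::real^2. z$1 *\<^sub>R (vector [-1, 0]) + z$2 *\<^sub>R (vector [0, l]) :: real^2)"
  define C where "C = (+) (vector [1, k]) ` (f ` T)"
  have lf: "linear f" "det (matrix f) = - l" unfolding f_def linear_vec2 by (auto simp: rdet_def intro: linear_vec2)
  have T: "T \<in> lmeasurable" "measure lebesgue T = 1/2" using std_triangle by (auto simp: T_def)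
  have C: "C \<in> lmeasurable" "measure lebesgue C = l / 2"
    unfolding C_def using measurable_linear_image[OF lf(1) T(1)] measure_linear_image[OF lf(1) T(1)]
    by (auto simp: measurable_translation measure_translation lf T assms)
  have Bs: "B = {z. 0 \<le> z$1 \<and> z$1 \<le> 1 \<and> 0 \<le> z$2 \<and> z$2 \<le> k}"
    by (auto simp: B_def mem_box_cart forall_2)
  have "B \<noteq> {}" using assms by (auto simp: Bs intro!: exI[of _ 0])
  then have B: "B \<in> lmeasurable" "measure lebesgue B = k"
    unfolding B_def using assms by (auto simp: content_cbox_cart UNIV_2)
  have Cs: "C = {z. 0 \<le> z$1 \<and> z$1 \<le> 1 \<and> k \<le> z$2 \<and> z$2 \<le> k + z$1 * l}"
  proof (intro set_eqI iffI)
    fix z assume "z \<in> C"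
    then obtain t where t: "z = vector [1, k] + f t" "t \<in> T" by (auto simp: C_def)
    then have z: "z$1 = 1 - t$1" "z$2 = k + t$2 * l" "0 \<le> t$1" "0 \<le> t$2" "t$2 \<le> 1 - t$1"
      by (auto simp: f_def T_def)
    then show "z \<in> {z. 0 \<le> z$1 \<and> z$1 \<le> 1 \<and> k \<le> z$2 \<and> z$2 \<le> k + z$1 * l}"
      using mult_right_mono[OF z(5) assms(2)] assms by auto
  next
    fix z :: "real^2" assume z: "z \<in> {z. 0 \<le> z$1 \<and> z$1 \<le> 1 \<and> k \<le> z$2 \<and> z$2 \<le> k + z$1 * l}"
    define t :: "real^2" where "t = vector [1 - z$1, if l = 0 then 0 else (z$2 - k) / l]"
    have "t \<in> T" using z assms by (auto simp: T_def t_def divide_le_eq)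
    moreover have "z = vector [1, k] + f t"
      using z by (auto simp: vec2_eq_iff f_def t_def)
    ultimately show "z \<in> C" by (auto simp: C_def)
  qed
  have un: "trapezoid0 k l = B \<union> C" using assms by (auto simp: trapezoid0_def Bs Cs intro: add_nonneg_nonneg order_trans[of _ k])
  have "negligible (B \<inter> C)"
    by (rule negligible_subset[OF negligible_rdet[of "axis 1 1" "- k"]]) (auto simp: Bs Cs rdet_def axis_def vec2_eq_iff)
  then have "measure lebesgue (B \<inter> C) = 0" by (rule negligible_imp_measure0)
  then show "measure lebesgue (trapezoid0 k l) = k + l / 2"
    unfolding un measure_Un3[OF B(1) C(1)] B(2) C(2) by simp
  show "trapezoid0 k l \<in> lmeasurable" unfolding un using B(1) C(1) by (rule fmeasurable.Un)
qed

text \<open>The trapezoid is a translate of the image of \<open>trapezoid0\<close> under the linear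
  map with columns \<open>b\<close> and \<open>e\<close>, where \<open>b\<close> is a point of the
  face of \<open>L\<close>; its determinant \<open>rdet b e\<close> is the support value.\<close>

lemma measure_trapezoid:
  assumes K: "compact K" "convex K" "K \<noteq> {}" and L: "compact L" "convex L" "L \<noteq> {}"
    and e: "norm e = 1" and s: "0 \<le> support L e"
  shows "trapezoid K L e \<in> lmeasurable"
    "measure lebesgue (trapezoid K L e) = support L e * (edge_length K e + edge_length L e / 2)"
proof -
  obtain a where a: "max_face K e = {a + t *\<^sub>R e |t. 0 \<le> t \<and> t \<le> edge_length K e}" "0 \<le> edge_length K e"
    using max_face_segment[OF K e] .
  obtain b where b: "max_face L e = {b + t *\<^sub>R e |t. 0 \<le> t \<and> t \<le> edge_length L e}" "0 \<le> edge_length L e"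
    using max_face_segment[OF L e] .
  define f where "f = (\<lambda>z::real^2. z$1 *\<^sub>R b + z$2 *\<^sub>R e)"
  have lf: "linear f" "det (matrix f) = rdet b e" unfolding f_def by (rule linear_vec2)+
  have "b \<in> max_face L e" using b by (auto intro!: exI[of _ 0])
  then have db: "rdet b e = support L e" by (rule support_max_face)
  have eq: "trapezoid K L e = (+) a ` (f ` trapezoid0 (edge_length K e) (edge_length L e))"
  proof (intro set_eqI iffI)
    fix x assume "x \<in> trapezoid K L e"
    then obtain t t' s where x: "x = (a + t *\<^sub>R e) + s *\<^sub>R (b + t' *\<^sub>R e)"
      "0 \<le> t" "t \<le> edge_length K e" "0 \<le> t'" "t' \<le> edge_length L e" "0 \<le> s" "s \<le> 1"
      unfolding trapezoid_def a(1) b(1) by blast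
    define z :: "real^2" where "z = vector [s, t + s * t']"
    have "z \<in> trapezoid0 (edge_length K e) (edge_length L e)"
      using x by (auto simp: trapezoid0_def z_def intro!: add_mono mult_left_mono)
    moreover have "x = a + f z" by (simp add: x f_def z_def algebra_simps)
    ultimately show "x \<in> (+) a ` (f ` trapezoid0 (edge_length K e) (edge_length L e))" by auto
  next
    fix x assume "x \<in> (+) a ` (f ` trapezoid0 (edge_length K e) (edge_length L e))"
    then obtain z where "x = a + f z" and z: "z \<in> trapezoid0 (edge_length K e) (edge_length L e)" by blast
    then have z: "x = a + z$1 *\<^sub>R b + z$2 *\<^sub>R e" "0 \<le> z$1" "z$1 \<le> 1" "0 \<le> z$2"
       "z$2 \<le> edge_length K e + z$1 * edge_length L e" by (auto simp: trapezoid0_def f_def)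
    show "x \<in> trapezoid K L e"
    proof (cases "z$2 \<le> edge_length K e")
      case True
      then have "x = (a + z$2 *\<^sub>R e) + z$1 *\<^sub>R (b + 0 *\<^sub>R e)" using z by (simp add: algebra_simps)
      then show ?thesis unfolding trapezoid_def a(1) b(1) using z b(2) True by blast
    next
      case False
      then have z1: "z$1 \<noteq> 0" using z by auto
      \<comment> \<open>The point of \<open>K\<close> is taken at the far end of its face, and the
        excess is covered by the face of \<open>L\<close>.\<close>
      define t' where "t' = (z$2 - edge_length K e) / z$1"
      have "0 \<le> t'" "t' \<le> edge_length L e" using False z z1 by (auto simp: t'_def divide_le_eq algebra_simps)
      moreover have "z$1 * t' = z$2 - edge_length K e" using z1 by (simp add: t'_def)
      then have "x = (a + edge_length K e *\<^sub>R e) + z$1 *\<^sub>R (b + t' *\<^sub>R e)"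
        using z(1) by (simp add: scaleR_add_right scaleR_diff_left)
      ultimately show ?thesis unfolding trapezoid_def a(1) b(1) using z a(2) by blast
    qed
  qed
  have m: "f ` trapezoid0 (edge_length K e) (edge_length L e) \<in> lmeasurable"
    "measure lebesgue (f ` trapezoid0 (edge_length K e) (edge_length L e)) = support L e * (edge_length K e + edge_length L e / 2)"
    using measurable_linear_image[OF lf(1) measure_trapezoid0(1)[OF a(2) b(2)]]
      measure_linear_image[OF lf(1) measure_trapezoid0(1)[OF a(2) b(2)]] measure_trapezoid0(2)[OF a(2) b(2)] s
    by (auto simp: lf db)
  then show "trapezoid K L e \<in> lmeasurable"
    "measure lebesgue (trapezoid K L e) = support L e * (edge_length K e + edge_length L e / 2)"
    unfolding eq by (auto simp: measurable_translation measure_translation)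
qed

lemma support_pos:
  assumes "compact Q" "0 \<in> interior Q" "e \<noteq> 0" shows "0 < support Q e"
proof -
  obtain d where d: "d > 0" "ball 0 d \<subseteq> Q" using assms by (meson mem_interior)
  define y where "y = (d / 2 / norm (perp e)) *\<^sub>R perp e"
  have "norm (perp e) > 0" using assms(3) by simp
  then have "y \<in> Q" using d by (intro subsetD[OF d(2)]) (simp add: y_def)
  then have "rdet y e \<le> support Q e" using support_ge assms by blast
  moreover have "rdet y e > 0" using d assms(3) by (simp add: y_def rdet_inner)
  ultimately show ?thesis by linarith
qed

text \<open>Two common points would span a line parallel to both directions. Then
  \<open>e' = - e\<close>, and \<open>Q\<close> would lie in a line, contradicting its
  interior.\<close>

lemma two_faces:
  assumes "interior Q \<noteq> {}" "norm e = 1" "norm e' = 1" "e \<noteq> e'"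
  obtains q where "max_face Q e \<inter> max_face Q e' \<subseteq> {q}"
proof (cases "max_face Q e \<inter> max_face Q e' = {}")
  case False
  then obtain x where x: "x \<in> max_face Q e" "x \<in> max_face Q e'" by blast
  have "y = x" if y: "y \<in> max_face Q e" "y \<in> max_face Q e'" for y
  proof (rule ccontr)
    assume "y \<noteq> x"
    then have d: "y - x \<noteq> 0" "rdet (y - x) e = 0" "rdet (y - x) e' = 0"
      using x y by (auto simp: support_max_face)
    then have "e' = - e" using unit_perp_cases[OF assms(2) d(2,1)] unit_perp_cases[OF assms(3) d(3,1)] assms(4) by auto
    then have "Q \<subseteq> {z. perp e \<bullet> z = rdet x e}" using x by (auto simp: max_face_def rdet_inner[symmetric] intro: antisym)
    then have "interior Q \<subseteq> interior {z. perp e \<bullet> z = rdet x e}" by (rule interior_mono)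
    moreover have "perp e \<noteq> 0" using assms(2) by auto
    ultimately show False using assms(1) by (simp add: interior_hyperplane)
  qed
  then show ?thesis using that by blast
qed blast

text \<open>The trapezoid of direction \<open>e\<close> joins a face of \<open>P\<close> to the parallel face of \<open>P + Q\<close>; together the
  trapezoids fill the ring between \<open>P\<close> and \<open>P + Q\<close> without overlap.\<close>
lemma plus_decomp:
  assumes P: "polytope P" "P \<noteq> {}" and Q: "polytope Q" "0 \<in> interior Q"
  shows "P + Q = P \<union> (\<Union>e\<in>edge_dirs P \<union> edge_dirs Q. trapezoid P Q e)"
proof (intro set_eqI iffI)
  have Q0: "0 \<in> Q" using Q interior_subset by blast
  have cv: "convex P" "convex Q" "compact P" "compact Q"
    using P Q polytope_imp_convex polytope_imp_compact by auto
  fix x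
  {
    assume "x \<in> P \<union> (\<Union>e\<in>edge_dirs P \<union> edge_dirs Q. trapezoid P Q e)"
    then show "x \<in> P + Q"
    proof
      assume "x \<in> P" then have "x + 0 \<in> P + Q" using Q0 by (rule set_plus_intro)
      then show ?thesis by simp
    next
      assume "x \<in> (\<Union>e\<in>edge_dirs P \<union> edge_dirs Q. trapezoid P Q e)"
      then obtain p q s where x: "x = p + s *\<^sub>R q" "p \<in> P" "q \<in> Q" "0 \<le> s" "s \<le> 1"
        by (auto simp: trapezoid_def max_face_def)
      have "s *\<^sub>R q + (1 - s) *\<^sub>R 0 \<in> Q" using cv(2) x Q0 by (intro convexD) auto
      then show ?thesis using x by auto
    qed
  next
    assume "x \<in> P + Q"
    then obtain p1 q1 where pq1: "x = p1 + q1" "p1 \<in> P" "q1 \<in> Q" by (auto simp: set_plus_def)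
    show "x \<in> P \<union> (\<Union>e\<in>edge_dirs P \<union> edge_dirs Q. trapezoid P Q e)"
    proof (cases "x \<in> P")
      case False
      \<comment> \<open>All representations \<open>p + s q\<close> of \<open>x\<close>. The smallest
        \<open>s\<close> puts \<open>x\<close> on the boundary of \<open>P + s Q\<close>, whose
        faces are sums of parallel faces of \<open>P\<close> and \<open>s Q\<close>.\<close>
      define C where "C = ({0..1::real} \<times> P \<times> Q) \<inter> {z. fst (snd z) + fst z *\<^sub>R snd (snd z) = x}"
      have "compact C" unfolding C_def
        using cv by (intro compact_Int_closed compact_Times closed_Collect_eq continuous_intros) auto
      moreover have "(1, p1, q1) \<in> C" using pq1 by (auto simp: C_def)
      ultimately obtain z where z: "z \<in> C" "\<And>w. w \<in> C \<Longrightarrow> fst z \<le> fst w"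
        using continuous_attains_inf[of C fst] continuous_on_fst[OF continuous_on_id] by blast
      obtain s p q where [simp]: "z = (s, p, q)" by (cases z) auto
      have s: "0 \<le> s" "s \<le> 1" "p \<in> P" "q \<in> Q" "x = p + s *\<^sub>R q" using z(1) by (auto simp: C_def)
      have s0: "0 < s" using s False by (cases "s = 0") auto
      define K where "K = P + (*\<^sub>R) s ` Q"
      have pK: "polytope K" unfolding K_def using P Q by (intro polytope_plus polytope_scaling)
      have xK: "x \<in> K" unfolding K_def s(5) using s by (intro set_plus_intro) auto
      have "(+) p ` ((*\<^sub>R) s ` interior Q) \<subseteq> K"
        unfolding K_def using s(3) interior_subset by (auto simp: set_plus_def)
      moreover have "open ((+) p ` ((*\<^sub>R) s ` interior Q))"
        using s0 by (intro open_translation open_scaling) auto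
      ultimately have iK: "interior K \<noteq> {}" using Q(2) interior_maximal[of "(+) p ` ((*\<^sub>R) s ` interior Q)" K] by blast
      have "x \<notin> interior K"
      proof
        assume "x \<in> interior K"
        then obtain d where d: "d > 0" "ball x d \<subseteq> K" by (meson mem_interior)
        \<comment> \<open>If \<open>x\<close> were interior, a point slightly beyond
          \<open>x\<close> as seen from \<open>p\<close> would still lie in \<open>K\<close>.
          Writing \<open>x\<close> as a convex combination of that point and \<open>p\<close>
          multiplies \<open>s\<close> by \<open>u < 1\<close>, against minimality. The summand 1
          avoids a division by zero.\<close>
        define t where "t = d / 2 / (1 + norm (x - p))"
        have np: "1 + norm (x - p) > 0" by (simp add: add_pos_nonneg)
        have t: "t > 0" using d np by (simp add: t_def)
        have "norm (t *\<^sub>R (x - p)) < d"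
        proof -
          have "norm (t *\<^sub>R (x - p)) = t * norm (x - p)" using t by simp
          also have "\<dots> \<le> t * (1 + norm (x - p))" using t by simp
          also have "\<dots> = d / 2" unfolding t_def using np by (metis nonzero_eq_divide_eq less_numeral_extra(3))
          finally show ?thesis using d by linarith
        qed
        then have "x + t *\<^sub>R (x - p) \<in> K" by (intro subsetD[OF d(2)]) (simp add: dist_norm)
        then obtain p' q' where p': "p' \<in> P" "q' \<in> Q" "x + t *\<^sub>R (x - p) = p' + s *\<^sub>R q'"
          by (auto simp: K_def set_plus_def)
        define u where "u = 1 / (1 + t)"
        have u: "0 < u" "u < 1" "u * (1 + t) = 1" using t by (auto simp: u_def)
        have "(1 + t) *\<^sub>R x = p' + s *\<^sub>R q' + t *\<^sub>R p"
          using p'(3) by (simp add: algebra_simps)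
        then have "u *\<^sub>R ((1 + t) *\<^sub>R x) = u *\<^sub>R (p' + s *\<^sub>R q' + t *\<^sub>R p)" by simp
        then have x: "x = (u *\<^sub>R p' + (u * t) *\<^sub>R p) + (u * s) *\<^sub>R q'"
          unfolding scaleR_scaleR u(3) by (simp add: scaleR_add_right)
        have "u *\<^sub>R p' + (u * t) *\<^sub>R p \<in> P"
          using cv(1) p'(1) s(3) u t
          by (intro convexD) (simp_all only: mult_nonneg_nonneg less_imp_le distrib_left mult_1_right)
        moreover have us: "u * s < s" "0 \<le> u * s" using u s0 by simp_all
        moreover have "u * s \<le> 1" using us(1) s(2) by linarith
        ultimately have "(u * s, u *\<^sub>R p' + (u * t) *\<^sub>R p, q') \<in> C"
          unfolding C_def using p'(2) x[symmetric] by simp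
        from z(2)[OF this] have "s \<le> u * s" by simp
        with us(1) show False by linarith
      qed
      then obtain e where e: "e \<in> edge_dirs K" "x \<in> max_face K e" using frontier_max_face[OF pK iK xK] by blast
      have mK: "max_face K e = max_face P e + (*\<^sub>R) s ` max_face Q e"
        unfolding K_def using max_face_scaled[OF cv(4) s0] max_face_plus(1)[of P "(*\<^sub>R) s ` Q" e] cv P(2) Q0
        by (auto simp: compact_scaling)
      from e(2) have "x \<in> trapezoid P Q e" using s(2) s0 unfolding mK trapezoid_def set_plus_def by fastforce
      moreover have "e \<in> edge_dirs P \<union> edge_dirs Q"
      proof -
        obtain a b where ab: "norm e = 1" "a \<in> max_face K e" "b \<in> max_face K e" "a \<noteq> b" using e by (auto simp: edge_dirs_def)
        have el: "\<exists>p\<in>max_face P e. \<exists>q\<in>max_face Q e. y = p + s *\<^sub>R q" if "y \<in> max_face K e" for y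
          using that unfolding mK by (auto elim!: set_plus_elim)
        obtain a1 a2 where a: "a1 \<in> max_face P e" "a2 \<in> max_face Q e" "a = a1 + s *\<^sub>R a2"
          using el[OF ab(2)] by blast
        obtain b1 b2 where b: "b1 \<in> max_face P e" "b2 \<in> max_face Q e" "b = b1 + s *\<^sub>R b2"
          using el[OF ab(3)] by blast
        have "a1 \<noteq> b1 \<or> a2 \<noteq> b2" using ab(4) a(3) b(3) by auto
        then have "(\<exists>a\<in>max_face P e. \<exists>b\<in>max_face P e. a \<noteq> b) \<or> (\<exists>a\<in>max_face Q e. \<exists>b\<in>max_face Q e. a \<noteq> b)"
          using a(1,2) b(1,2) by blast
        then show ?thesis using ab(1) by (simp add: edge_dirs_def)
      qed
      ultimately show ?thesis by blast
    qed auto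
  }
qed

lemma negligible_line: "negligible (range (\<lambda>s::real. p + s *\<^sub>R (q::real^2)))"
proof (cases "q = 0")
  case True
  then have "range (\<lambda>s::real. p + s *\<^sub>R q) = {p}" by (simp add: image_constant_conv)
  then show ?thesis by simp
next
  case False
  have "range (\<lambda>s::real. p + s *\<^sub>R q) \<subseteq> {x. rdet x q = rdet p q}"
    by (simp add: image_subset_iff)
  then show ?thesis using negligible_subset[OF negligible_rdet[OF False]] by blast
qed

text \<open>The hypothesis \<open>uniq\<close> is satisfied by polygons with interior and also by a
  single point; in the latter case the formula computes the area of \<open>Q\<close> itself.\<close>

lemma measure_plus_aux:
  assumes P: "polytope P" "P \<noteq> {}" and Q: "polytope Q" "0 \<in> interior Q"
    and uniq: "\<And>e e'. norm e = 1 \<Longrightarrow> norm e' = 1 \<Longrightarrow> e \<noteq> e' \<Longrightarrow> \<exists>p. max_face P e \<inter> max_face P e' \<subseteq> {p}"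
  shows "measure lebesgue (P + Q) =
    measure lebesgue P + (\<Sum>e\<in>edge_dirs P \<union> edge_dirs Q. support Q e * (edge_length P e + edge_length Q e / 2))"
proof -
  let ?U = "edge_dirs P \<union> edge_dirs Q"
  have cv: "convex P" "convex Q" "compact P" "compact Q"
    using P Q polytope_imp_convex polytope_imp_compact by auto
  have Qne: "Q \<noteq> {}" "interior Q \<noteq> {}" using Q(2) interior_subset by blast+
  have fin: "finite ?U" using finite_edge_dirs[OF P(1)] finite_edge_dirs[OF Q(1)] by simp
  have unit: "norm e = 1" if "e \<in> ?U" for e using that unfolding edge_dirs_def by blast
  have pos: "0 < support Q e" if "norm e = 1" for e
    using that support_pos[OF cv(4) Q(2), of e] norm_zero by (cases "e = 0") auto
  note mt = measure_trapezoid[OF cv(3,1) P(2) cv(4,2) Qne(1) unit less_imp_le[OF pos[OF unit]]]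
  have neg1: "negligible (P \<inter> trapezoid P Q e)" if e: "e \<in> ?U" for e
  proof (rule negligible_subset[OF negligible_rdet[of e "support P e"]])
    show "P \<inter> trapezoid P Q e \<subseteq> {x. rdet x e = support P e}"
    proof
      fix x assume "x \<in> P \<inter> trapezoid P Q e"
      then obtain p q s where x: "x \<in> P" "x = p + s *\<^sub>R q" "p \<in> max_face P e" "q \<in> max_face Q e" "0 \<le> s"
        by (auto simp: trapezoid_def)
      then have "rdet x e = support P e + s * support Q e" by (simp add: support_max_face)
      moreover have "rdet x e \<le> support P e" using support_ge cv x by blast
      moreover have "0 \<le> s * support Q e" using x(5) pos[OF unit[OF e]] by simp
      ultimately show "x \<in> {x. rdet x e = support P e}" by simp
    qed
  qed (use unit[OF e] in auto)
  \<comment> \<open>On the trapezoid of \<open>e\<close> the parameter \<open>s\<close> is the least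
    one among all representations of the point, so two trapezoids through a point assign the same
    parameter to it.\<close>
  have sle: "s \<le> s'" if "norm e = 1" "p + s *\<^sub>R q = p' + s' *\<^sub>R q'" "p \<in> max_face P e" "q \<in> max_face Q e"
      "p' \<in> P" "q' \<in> Q" "0 \<le> s'" for e p q s p' q' s'
  proof -
    have "support P e + s * support Q e = rdet (p' + s' *\<^sub>R q') e"
      using that(3,4) by (simp add: support_max_face flip: that(2))
    also have "\<dots> \<le> support P e + s' * support Q e"
      using support_ge[OF cv(3) that(5), of e] mult_left_mono[OF support_ge[OF cv(4) that(6), of e] that(7)] by simp
    finally show ?thesis using pos[OF that(1)] by (simp add: mult_le_cancel_right)
  qed
  have neg2: "negligible (trapezoid P Q e \<inter> trapezoid P Q e')" if e: "e \<in> ?U" "e' \<in> ?U" "e \<noteq> e'" for e e'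
  proof -
    note u = unit[OF e(1)] unit[OF e(2)]
    obtain p0 where p0: "max_face P e \<inter> max_face P e' \<subseteq> {p0}" using uniq[OF u e(3)] by blast
    obtain q0 where q0: "max_face Q e \<inter> max_face Q e' \<subseteq> {q0}" using two_faces[OF Qne(2) u e(3)] .
    have "trapezoid P Q e \<inter> trapezoid P Q e' \<subseteq> range (\<lambda>s. p0 + s *\<^sub>R q0)"
    proof
      fix x assume "x \<in> trapezoid P Q e \<inter> trapezoid P Q e'"
      then obtain p q s p' q' s' where
        x: "x = p + s *\<^sub>R q" "p \<in> max_face P e" "q \<in> max_face Q e" "0 \<le> s" and
        x': "x = p' + s' *\<^sub>R q'" "p' \<in> max_face P e'" "q' \<in> max_face Q e'" "0 \<le> s'"
        unfolding trapezoid_def by blast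
      have "s = s'" proof (rule antisym)
        show "s \<le> s'" using x x' by (intro sle[OF u(1), of p s q p' s' q']) (auto simp: max_face_def)
        show "s' \<le> s" using x x' by (intro sle[OF u(2), of p' s' q' p s q]) (auto simp: max_face_def)
      qed
      have le: "rdet p' e \<le> support P e" "rdet q' e \<le> support Q e"
        using support_ge cv x' by (auto simp: max_face_def)
      \<comment> \<open>Equality in the support bounds for \<open>e\<close> makes \<open>p'\<close>,
        and for nonzero \<open>s\<close> also \<open>q'\<close>, a common point of two different
        faces. Hence the overlap lies on one line.\<close>
      have eq: "support P e + s * support Q e = rdet p' e + s * rdet q' e"
      proof -
        have "rdet x e = support P e + s * support Q e" using x by (simp add: support_max_face)
        moreover have "rdet x e = rdet p' e + s * rdet q' e" unfolding x'(1) \<open>s = s'\<close> by simp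
        ultimately show ?thesis by simp
      qed
      have le2: "s * rdet q' e \<le> s * support Q e" using le x by (simp add: mult_left_mono)
      have "rdet p' e = support P e" using eq le le2 by linarith
      then have "p' \<in> max_face P e" using x'(2) cv by (auto simp: max_face_altdef)
      then have p': "p' = p0" using p0 x' by blast
      show "x \<in> range (\<lambda>s. p0 + s *\<^sub>R q0)"
      proof (cases "s = 0")
        case True
        then have "x = p0 + 0 *\<^sub>R q0" using x'(1) \<open>s = s'\<close> p' by simp
        then show ?thesis by blast
      next
        case False
        then have "s * rdet q' e = s * support Q e" using eq le le2 by linarith
        then have "rdet q' e = support Q e" using False by simp
        then have "q' \<in> max_face Q e" using x'(3) cv by (auto simp: max_face_altdef)
        then have "q' = q0" using q0 x' by blast
        then show ?thesis using x'(1) p' by blast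
      qed
    qed
    then show ?thesis using negligible_line negligible_subset by blast
  qed
  define R where "R = (\<Union>e\<in>?U. trapezoid P Q e)"
  have "measure lebesgue R = (\<Sum>e\<in>?U. measure lebesgue (trapezoid P Q e))" unfolding R_def
    using fin mt(1) neg2 by (intro measure_negligible_finite_Union_image) (auto simp: pairwise_def)
  also have "\<dots> = (\<Sum>e\<in>?U. support Q e * (edge_length P e + edge_length Q e / 2))" by (rule sum.cong) (use mt in auto)
  finally have mR: "measure lebesgue R = (\<Sum>e\<in>?U. support Q e * (edge_length P e + edge_length Q e / 2))" .
  have lR: "R \<in> lmeasurable" unfolding R_def using fin mt(1) by (intro fmeasurable.finite_UN) auto
  have "negligible (P \<inter> R)"
    unfolding R_def Int_UN_distrib using fin neg1 by (intro negligible_Union) auto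
  then have "measure lebesgue (P \<inter> R) = 0" by (rule negligible_imp_measure0)
  moreover have "P \<in> lmeasurable" using cv lmeasurable_compact by blast
  ultimately have "measure lebesgue (P \<union> R) = measure lebesgue P + measure lebesgue R"
    using lR by (simp add: measure_Un3)
  then have "measure lebesgue (P \<union> R) =
      measure lebesgue P + (\<Sum>e\<in>?U. support Q e * (edge_length P e + edge_length Q e / 2))"
    unfolding mR .
  moreover have "P \<union> R = P + Q" unfolding R_def by (rule plus_decomp[OF P Q, symmetric])
  ultimately show ?thesis by metis
qed

section \<open>The edge formula for the mixed volume\<close>

lemma interior_Basis_shift:
  assumes "c \<in> interior (Q :: (real^2) set)"
  obtains d where "d > 0" "\<And>z. norm z \<le> d \<Longrightarrow> c + z \<in> interior Q"
proof -
  have "open (interior Q)" by simp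
  then obtain d where "d > 0" "cball c d \<subseteq> interior Q" using assms open_contains_cball by blast
  then show ?thesis using that[of d] by (auto simp: dist_norm subset_eq)
qed

text \<open>The previous formula for the point \<open>{0}\<close> expresses the area of
  \<open>Q\<close> by its edges. The sum for \<open>P + Q\<close> then splits, because edge lengths
  vanish outside the edge directions.\<close>

lemma measure_plus_0:
  assumes P: "polytope P" "interior P \<noteq> {}" and Q: "polytope Q" "0 \<in> interior Q"
  shows "measure lebesgue (P + Q) =
    measure lebesgue P + measure lebesgue Q + (\<Sum>e\<in>edge_dirs P. edge_length P e * support Q e)"
proof -
  have cv: "convex P" "convex Q" "compact P" "compact Q"
    using P Q polytope_imp_convex polytope_imp_compact by auto
  have ne: "P \<noteq> {}" "Q \<noteq> {}" using P(2) Q(2) interior_subset by blast+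
  have fin: "finite (edge_dirs P)" "finite (edge_dirs Q)" using finite_edge_dirs P Q by blast+
  have d0: "edge_dirs {0} = {}" by (auto simp: edge_dirs_def max_face_def)
  have l0: "edge_length {0} e = 0" if "norm e = 1" for e
    by (rule edge_length_eqI[of _ _ 0]) (auto simp: max_face_def that)
  have unit: "norm e = 1" if "e \<in> edge_dirs K" for e K using that unfolding edge_dirs_def by blast
  have "measure lebesgue ({0} + Q) = measure lebesgue {0::real^2} +
      (\<Sum>e\<in>edge_dirs {0} \<union> edge_dirs Q. support Q e * (edge_length {0} e + edge_length Q e / 2))"
    by (rule measure_plus_aux) (auto simp: Q polytope_sing max_face_def)
  then have Qm: "measure lebesgue Q = (\<Sum>e\<in>edge_dirs Q. support Q e * (edge_length Q e / 2))"
    by (simp add: d0 l0 unit)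
  have "measure lebesgue (P + Q) =
      measure lebesgue P + (\<Sum>e\<in>edge_dirs P \<union> edge_dirs Q. support Q e * (edge_length P e + edge_length Q e / 2))"
  proof (rule measure_plus_aux[OF P(1) ne(1) Q])
    fix e e' :: "real^2" assume "norm e = 1" "norm e' = 1" "e \<noteq> e'"
    then show "\<exists>p. max_face P e \<inter> max_face P e' \<subseteq> {p}" using two_faces[OF P(2)] by metis
  qed
  also have "(\<Sum>e\<in>edge_dirs P \<union> edge_dirs Q. support Q e * (edge_length P e + edge_length Q e / 2)) =
      (\<Sum>e\<in>edge_dirs P \<union> edge_dirs Q. edge_length P e * support Q e) + (\<Sum>e\<in>edge_dirs P \<union> edge_dirs Q. support Q e * (edge_length Q e / 2))"
    by (simp add: algebra_simps sum.distrib)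
  also have "(\<Sum>e\<in>edge_dirs P \<union> edge_dirs Q. edge_length P e * support Q e) = (\<Sum>e\<in>edge_dirs P. edge_length P e * support Q e)"
  proof (rule sum.mono_neutral_right)
    show "\<forall>i\<in>edge_dirs P \<union> edge_dirs Q - edge_dirs P. edge_length P i * support Q i = 0"
      using edge_length_0[OF cv(3,1) ne(1)] unit by (metis DiffD1 DiffD2 Un_iff mult_zero_left)
  qed (use fin in auto)
  also have "(\<Sum>e\<in>edge_dirs P \<union> edge_dirs Q. support Q e * (edge_length Q e / 2)) = (\<Sum>e\<in>edge_dirs Q. support Q e * (edge_length Q e / 2))"
  proof (rule sum.mono_neutral_right)
    show "\<forall>i\<in>edge_dirs P \<union> edge_dirs Q - edge_dirs Q. support Q i * (edge_length Q i / 2) = 0"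
      using edge_length_0[OF cv(4,2) ne(2)] unit by (metis DiffD1 DiffD2 Un_iff mult_zero_right div_0)
  qed (use fin in auto)
  finally show ?thesis using Qm by simp
qed

theorem mixed_volume_support:
  assumes P: "polytope P" "interior P \<noteq> {}" and Q: "polytope Q" "interior Q \<noteq> {}"
  shows "mixed_volume P Q = (\<Sum>e\<in>edge_dirs P. edge_length P e * support Q e)"
proof -
  have cQ: "compact Q" "Q \<noteq> {}" using Q polytope_imp_compact interior_subset by auto
  \<comment> \<open>The sum of the edge vectors of \<open>P\<close>. Moving the origin to
    \<open>c\<close> changes the edge sum by \<open>rdet c w\<close>, while the mixed volume does
    not depend on \<open>c\<close>; varying \<open>c\<close> in the interior shows that
    \<open>w\<close> vanishes.\<close>
  define w where "w = (\<Sum>e\<in>edge_dirs P. edge_length P e *\<^sub>R e)"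
  have dtw: "rdet c w = (\<Sum>e\<in>edge_dirs P. edge_length P e * rdet c e)" for c
    unfolding w_def rdet_inner[of c] by (induction rule: infinite_finite_induct)
      (simp_all add: rdet_inner[symmetric])
  have key: "mixed_volume P Q = (\<Sum>e\<in>edge_dirs P. edge_length P e * support Q e) - rdet c w" if c: "c \<in> interior Q" for c
  proof -
    define Q' where "Q' = (+) (- c) ` Q"
    have "polytope Q'" unfolding Q'_def using Q polytope_translation_eq by blast
    moreover have "0 \<in> interior Q'" unfolding Q'_def interior_translation using c by force
    ultimately have m: "measure lebesgue (P + Q') =
      measure lebesgue P + measure lebesgue Q' + (\<Sum>e\<in>edge_dirs P. edge_length P e * support Q' e)"
      using measure_plus_0[OF P] by blast
    have "P + Q' = (+) (- c) ` (P + Q)"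
      unfolding Q'_def set_plus_def by (auto simp: image_iff algebra_simps) (metis add_diff_cancel_left' add.left_commute)+
    then have mm: "measure lebesgue (P + Q') = measure lebesgue (P + Q)" "measure lebesgue Q' = measure lebesgue Q"
      by (simp_all only: measure_translation Q'_def)
    have s: "support Q' e = support Q e - rdet c e" for e
    proof -
      obtain y where y: "y \<in> max_face Q e" using max_face_ne[OF cQ] by blast
      have "support Q' e = rdet (- c + y) e"
        using y by (intro support_eqI) (auto simp: Q'_def max_face_def)
      then show ?thesis using support_max_face[OF y] by simp
    qed
    have "mixed_volume P Q = (\<Sum>e\<in>edge_dirs P. edge_length P e * support Q' e)"
      using m unfolding mm mixed_volume_def normalized_volume_def by (simp add: field_simps)
    also have "\<dots> = (\<Sum>e\<in>edge_dirs P. edge_length P e * support Q e) - rdet c w"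
      by (simp add: s dtw right_diff_distrib sum_subtractf)
    finally show ?thesis .
  qed
  obtain c where c: "c \<in> interior Q" using Q(2) by blast
  then obtain d where d: "d > 0" "\<And>z. norm z \<le> d \<Longrightarrow> c + z \<in> interior Q" using interior_Basis_shift by blast
  have "rdet z w = 0" if "norm z \<le> d" for z using key[OF c] key[OF d(2)[OF that]] by simp
  from this[of "(d / norm (perp w)) *\<^sub>R perp w"] have "w = 0"
    using d(1) by (cases "w = 0") (auto simp: rdet_inner)
  then show ?thesis using key[OF c] by simp
qed

lemma mixed_volume_commute: "mixed_volume P Q = mixed_volume Q P"
  by (simp add: mixed_volume_def add.commute)

lemma edge_length_nonneg: assumes "polytope K" "K \<noteq> {}" "norm e = 1" shows "0 \<le> edge_length K e"
proof -
  have "compact K" "convex K" using assms polytope_imp_convex polytope_imp_compact by auto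
  then show ?thesis using max_face_segment[of K e] assms by metis
qed

lemma mixed_volume_mono:
  assumes P: "polytope P" "interior P \<noteq> {}" and Q: "polytope Q" "interior Q \<noteq> {}"
    and Q': "polytope Q'" "Q \<subseteq> Q'"
  shows "mixed_volume P Q \<le> mixed_volume P Q'"
proof -
  have i: "interior Q' \<noteq> {}" using Q Q' interior_mono by blast
  have ne: "P \<noteq> {}" "Q \<noteq> {}" using P Q interior_subset by blast+
  have "0 \<le> edge_length P e" if "e \<in> edge_dirs P" for e
    using edge_length_nonneg[OF P(1) ne(1)] that unfolding edge_dirs_def by blast
  then show ?thesis unfolding mixed_volume_support[OF P Q] mixed_volume_support[OF P Q'(1) i]
    using support_mono[OF _ _ Q'(2) ne(2)] Q Q' polytope_imp_compact
    by (intro sum_mono mult_left_mono) auto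
qed

text \<open>For convex \<open>P\<close> the sum \<open>P + P\<close> is the dilate by 2, of four
  times the area.\<close>

lemma mixed_volume_self:
  assumes "polytope P" shows "mixed_volume P P = normalized_volume P"
proof -
  have "P + P = (*\<^sub>R) 2 ` P"
  proof (intro set_eqI iffI)
    fix x assume "x \<in> P + P"
    then obtain a b where ab: "x = a + b" "a \<in> P" "b \<in> P" by (auto simp: set_plus_def)
    then have "(1/2) *\<^sub>R a + (1/2) *\<^sub>R b \<in> P"
      using polytope_imp_convex[OF assms] by (intro convexD) auto
    moreover have "x = 2 *\<^sub>R ((1/2) *\<^sub>R a + (1/2) *\<^sub>R b)" by (simp add: ab scaleR_add_right)
    ultimately show "x \<in> (*\<^sub>R) 2 ` P" by blast
  next
    fix x assume "x \<in> (*\<^sub>R) 2 ` P"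
    then obtain y where "y \<in> P" "x = y + y" by (auto simp: scaleR_2)
    then show "x \<in> P + P" using set_plus_intro by blast
  qed
  then show ?thesis
    using measure_lebesgue_affine[of 2 0 P] by (simp add: mixed_volume_def normalized_volume_def)
qed

section \<open>The Brunn--Minkowski inequality\<close>

text \<open>Boxes without interior are excluded, so that every box has positive area and disappears
  when a cut meets only its boundary.\<close>

definition boxes :: "(real^2) set set \<Rightarrow> bool" where
  "boxes D \<longleftrightarrow> finite D \<and> D \<noteq> {} \<and> (\<forall>B\<in>D. interior B \<noteq> {} \<and> (\<exists>l u. B = cbox l u)) \<and>
     pairwise (\<lambda>A B. interior A \<inter> interior B = {}) D"

lemma interior_cbox_vec2: "interior (cbox l u) \<noteq> {} \<longleftrightarrow> l$1 < u$1 \<and> l$2 < (u$2::real)" for l u :: "real^2"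
  by (auto simp: interval_ne_empty_cart forall_2)

lemma boxesD:
  assumes "boxes D"
  shows "finite D" "D \<noteq> {}" "B \<in> D \<Longrightarrow> interior B \<noteq> {}" "B \<in> D \<Longrightarrow> \<exists>l u. B = cbox l u"
    "A \<in> D \<Longrightarrow> B \<in> D \<Longrightarrow> A \<noteq> B \<Longrightarrow> interior A \<inter> interior B = {}"
  using assms unfolding boxes_def by (auto simp: pairwise_def)

lemma coord_inner: obtains a :: "real^2" where "a \<noteq> 0" "\<And>x. a \<bullet> x = x $ k"
proof
  show "axis k (1::real) \<noteq> (0::real^2)" by (simp add: axis_eq_0_iff)
  show "axis k 1 \<bullet> x = x $ k" for x :: "real^2" by (simp add: inner_axis' )
qed

lemma boxes_compact: "boxes D \<Longrightarrow> compact (\<Union>D)"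
  unfolding boxes_def by (intro compact_Union) auto

lemma boxes_lmeasurable: "boxes D \<Longrightarrow> \<Union>D \<in> lmeasurable"
  by (intro lmeasurable_compact boxes_compact)

lemma measure_pos_interior:
  assumes "interior S \<noteq> {}" "S \<in> lmeasurable" shows "0 < measure lebesgue (S :: (real^2) set)"
proof -
  have "\<not> negligible S" using assms(1) open_not_negligible[of "interior S"] negligible_subset interior_subset
    by (metis open_interior)
  then have "measure lebesgue S \<noteq> 0" using negligible_iff_measure0[OF assms(2)] by simp
  then show ?thesis by (simp add: less_le)
qed

lemma boxes_pos: assumes "boxes D" shows "0 < measure lebesgue (\<Union>D)"
proof (rule measure_pos_interior)
  obtain B where "B \<in> D" "interior B \<noteq> {}" using assms by (auto simp: boxes_def)
  then show "interior (\<Union>D) \<noteq> {}" using interior_mono[of B "\<Union>D"] by blast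
qed (rule boxes_lmeasurable[OF assms])

text \<open>The flag selects the side, so that both halves of a cut are treated by one
  argument.\<close>

definition halfspace :: "2 \<Rightarrow> real \<Rightarrow> bool \<Rightarrow> (real^2) set" where
  "halfspace k t b = (if b then {x. x $ k \<le> t} else {x. t \<le> x $ k})"

lemma closed_halfspace: "closed (halfspace k t b)"
  unfolding halfspace_def by (auto intro!: closed_Collect_le continuous_intros)

lemma cbox_Int_halfspace:
  "cbox l u \<inter> halfspace k t True = cbox l (\<chi> i. if i = k then min (u $ i) t else u $ i)"
  "cbox l u \<inter> halfspace k t False = cbox (\<chi> i. if i = k then max (l $ i) t else l $ i) u"
proof -
  have "x \<in> cbox l u \<inter> halfspace k t True \<longleftrightarrow> x \<in> cbox l (\<chi> i. if i = k then min (u $ i) t else u $ i)" for x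
    using exhaust_2[of k] by (auto simp: halfspace_def mem_box_cart forall_2)
  then show "cbox l u \<inter> halfspace k t True = cbox l (\<chi> i. if i = k then min (u $ i) t else u $ i)" by blast
  have "x \<in> cbox l u \<inter> halfspace k t False \<longleftrightarrow> x \<in> cbox (\<chi> i. if i = k then max (l $ i) t else l $ i) u" for x
    using exhaust_2[of k] by (auto simp: halfspace_def mem_box_cart forall_2)
  then show "cbox l u \<inter> halfspace k t False = cbox (\<chi> i. if i = k then max (l $ i) t else l $ i) u" by blast
qed

text \<open>Pieces without interior are dropped to stay within \<open>boxes\<close>.\<close>

definition cut :: "(real^2) set set \<Rightarrow> (real^2) set \<Rightarrow> (real^2) set set" where
  "cut D H = (\<lambda>B. B \<inter> H) ` {B \<in> D. interior (B \<inter> H) \<noteq> {}}"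

lemma cut_boxes: assumes "boxes D" "cut D (halfspace k t b) \<noteq> {}" shows "boxes (cut D (halfspace k t b))"
proof -
  let ?H = "halfspace k t b"
  have "\<exists>l u. B \<inter> ?H = cbox l u" if B: "B \<in> D" for B
  proof -
    obtain l u where "B = cbox l u" using boxesD(4)[OF assms(1) B] by blast
    then show ?thesis using cbox_Int_halfspace[of l u k t] by (cases b) auto
  qed
  moreover have "interior (A \<inter> ?H) \<inter> interior (B \<inter> ?H) = {}" if "A \<in> D" "B \<in> D" "A \<inter> ?H \<noteq> B \<inter> ?H" for A B
  proof -
    have "A \<noteq> B" using that by blast
    then have "interior A \<inter> interior B = {}" using assms(1) that unfolding boxes_def pairwise_def by blast
    then show ?thesis by auto
  qed
  ultimately show ?thesis using assms unfolding boxes_def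
    by (simp add: cut_def pairwise_def)
qed

text \<open>The dropped pieces are convex without interior, hence null sets.\<close>

lemma cut_measure:
  assumes "boxes D"
  shows "measure lebesgue (\<Union>(cut D (halfspace k t b))) = measure lebesgue (\<Union>D \<inter> halfspace k t b)"
proof -
  let ?H = "halfspace k t b"
  define N where "N = \<Union>((\<lambda>B. B \<inter> ?H) ` {B \<in> D. interior (B \<inter> ?H) = {}})"
  have "convex B" if "B \<in> D" for B using assms that unfolding boxes_def by (auto simp: convex_box)
  moreover have "convex ?H"
  proof -
    obtain a where "\<And>x. a \<bullet> x = x $ k" using coord_inner[of k] by blast
    then show ?thesis using convex_halfspace_le[of a t] convex_halfspace_ge[of t a] by (simp add: halfspace_def)
  qed
  ultimately have "negligible (B \<inter> ?H)" if "B \<in> D" "interior (B \<inter> ?H) = {}" for B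
    using that negligible_convex_interior convex_Int by blast
  then have N: "negligible N" unfolding N_def using assms by (intro negligible_Union) (auto simp: boxes_def)
  have "\<Union>D \<inter> ?H = \<Union>(cut D ?H) \<union> N" by (auto simp: cut_def N_def)
  moreover have "\<Union>(cut D ?H) \<in> sets lebesgue"
  proof (intro sets.finite_Union)
    show "finite (cut D ?H)" using assms by (simp add: cut_def boxes_def)
    show "cut D ?H \<subseteq> sets lebesgue"
    proof
      fix X assume "X \<in> cut D ?H"
      then obtain B where "B \<in> D" "X = B \<inter> ?H" by (auto simp: cut_def)
      moreover obtain l u where "B = cbox l u" using boxesD(4)[OF assms \<open>B \<in> D\<close>] by blast
      ultimately have "closed X" using closed_Int[OF closed_cbox closed_halfspace[of k t b]] by simp
      then show "X \<in> sets lebesgue" by (simp add: borel_closed)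
    qed
  qed
  ultimately show ?thesis using N by (simp add: measure_Un_null_set negligible_iff_null_sets)
qed

text \<open>Along a line that separates two boxes each side loses one of them; this makes the
  induction on the number of boxes decrease.\<close>

lemma card_cut: assumes "boxes D" shows "card (cut D H) \<le> card D"
    and "B \<in> D \<Longrightarrow> interior (B \<inter> H) = {} \<Longrightarrow> card (cut D H) < card D"
proof -
  let ?S = "{B \<in> D. interior (B \<inter> H) \<noteq> {}}"
  have f: "finite D" using assms by (simp add: boxes_def)
  have 1: "card (cut D H) \<le> card ?S" unfolding cut_def using f by (intro card_image_le) auto
  have 2: "card ?S \<le> card D" using f by (intro card_mono) auto
  show "card (cut D H) \<le> card D" using 1 2 by linarith
  assume "B \<in> D" "interior (B \<inter> H) = {}"
  then have "?S \<subset> D" by blast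
  then have "card ?S < card D" using f psubset_card_mono by blast
  then show "card (cut D H) < card D" using 1 by linarith
qed

lemma split_measure:
  assumes "X \<in> lmeasurable"
  shows "measure lebesgue (X \<inter> halfspace k t True) + measure lebesgue (X \<inter> halfspace k t False) = measure lebesgue X"
proof -
  have m: "X \<inter> halfspace k t b \<in> lmeasurable" for b
    using closed_halfspace assms by (intro fmeasurable_Int_fmeasurable) (auto intro: borel_closed)
  have "negligible {x::real^2. x $ k = t}"
  proof -
    obtain a :: "real^2" where "a \<noteq> 0" "\<And>x. a \<bullet> x = x $ k" using coord_inner[of k] by blast
    then show ?thesis using negligible_hyperplane[of a t] by simp
  qed
  then have "negligible ((X \<inter> halfspace k t True) \<inter> (X \<inter> halfspace k t False))"
    by (rule negligible_subset) (auto simp: halfspace_def)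
  then have "measure lebesgue ((X \<inter> halfspace k t True) \<inter> (X \<inter> halfspace k t False)) = 0"
    by (rule negligible_imp_measure0)
  moreover have "X = (X \<inter> halfspace k t True) \<union> (X \<inter> halfspace k t False)" by (auto simp: halfspace_def)
  ultimately show ?thesis using measure_Un3[OF m m] by (metis diff_zero)
qed

lemma boxes_sum_measure:
  assumes "boxes D" shows "measure lebesgue (\<Union>D \<inter> halfspace k t b) = (\<Sum>B\<in>D. measure lebesgue (B \<inter> halfspace k t b))"
proof -
  have eq: "\<Union>D \<inter> halfspace k t b = (\<Union>B\<in>D. B \<inter> halfspace k t b)" by auto
  show ?thesis unfolding eq
  proof (rule measure_negligible_finite_Union_image)
    show "finite D" using assms by (simp add: boxes_def)
    show "B \<inter> halfspace k t b \<in> lmeasurable" if "B \<in> D" for B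
      using that assms closed_halfspace[of k t b] by (intro lmeasurable_compact compact_Int_closed) (auto simp: boxes_def)
    show "pairwise (\<lambda>x y. negligible (x \<inter> halfspace k t b \<inter> (y \<inter> halfspace k t b))) D"
    proof (rule pairwiseI)
      fix x y assume xy: "x \<in> D" "y \<in> D" "x \<noteq> y"
      then have "interior (x \<inter> y) = {}" using assms by (auto simp: boxes_def pairwise_def)
      moreover have "convex (x \<inter> y)" using xy assms unfolding boxes_def by (auto intro!: convex_Int simp: convex_box)
      ultimately have "negligible (x \<inter> y)" by (simp add: negligible_convex_interior)
      then show "negligible (x \<inter> halfspace k t b \<inter> (y \<inter> halfspace k t b))" by (rule negligible_subset) auto
    qed
  qed
qed

lemma measure_cbox_vec2:
  "measure lebesgue (cbox l u) = max 0 (u$1 - l$1) * max 0 (u$2 - l$2)" for l u :: "real^2"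
proof (cases "cbox l u = {}")
  case True
  then have "\<not> (l$1 \<le> u$1 \<and> l$2 \<le> u$2)" using interval_ne_empty_cart(1)[of l u] by (simp add: forall_2)
  then have "u$1 < l$1 \<or> u$2 < l$2" by linarith
  then show ?thesis using True by auto
next
  case False
  then have "l$1 \<le> u$1" "l$2 \<le> u$2" by (auto simp: interval_ne_empty_cart forall_2)
  moreover have "measure lebesgue (cbox l u) = (\<Prod>i\<in>UNIV. u $ i - l $ i)"
    using content_cbox_cart[OF False] by simp
  ultimately show ?thesis by (simp add: UNIV_2)
qed

text \<open>Each box contributes a product of truncated affine functions of \<open>t\<close>.
  Continuity allows a second union to be divided in a prescribed ratio.\<close>

lemma continuous_cut_measure:
  assumes "boxes D" shows "continuous_on UNIV (\<lambda>t. measure lebesgue (\<Union>D \<inter> halfspace k t True))"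
  unfolding boxes_sum_measure[OF assms]
proof (intro continuous_on_sum)
  fix B assume "B \<in> D"
  then obtain l u where B: "B = cbox l u" using assms unfolding boxes_def by blast
  show "continuous_on UNIV (\<lambda>t. measure lebesgue (B \<inter> halfspace k t True))"
    unfolding B cbox_Int_halfspace measure_cbox_vec2
    using exhaust_2[of k] by (auto intro!: continuous_intros)
qed

lemma sqrt_split:
  fixes a b \<theta> :: real
  assumes "0 \<le> a" "0 \<le> b" "0 \<le> \<theta>"
  shows "(sqrt (\<theta> * a) + sqrt (\<theta> * b))\<^sup>2 = \<theta> * (sqrt a + sqrt b)\<^sup>2"
  using assms by (simp add: real_sqrt_mult flip: distrib_left) (simp add: power_mult_distrib)

text \<open>For side lengths \<open>a\<close>, \<open>b\<close> and \<open>c\<close>,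
  \<open>d\<close> the claim reduces to the inequality of arithmetic and geometric means for
  \<open>a * d\<close> and \<open>b * c\<close>.\<close>

lemma bm_box:
  fixes l u l' u' :: "real^2"
  assumes "interior (cbox l u) \<noteq> {}" "interior (cbox l' u') \<noteq> {}"
  shows "(sqrt (measure lebesgue (cbox l u)) + sqrt (measure lebesgue (cbox l' u')))\<^sup>2
      \<le> measure lebesgue (cbox l u + cbox l' u')"
proof -
  note i = assms[unfolded interior_cbox_vec2]
  have sub: "cbox (l + l') (u + u') \<subseteq> cbox l u + cbox l' u'"
  proof
    fix x assume x: "x \<in> cbox (l + l') (u + u')"
    define y :: "real^2" where "y = (\<chi> i. max (l $ i) (x $ i - u' $ i))"
    have "y \<in> cbox l u" "x - y \<in> cbox l' u'"
      using x i by (auto simp: mem_box_cart forall_2 y_def)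
    then have "y + (x - y) \<in> cbox l u + cbox l' u'" by (rule set_plus_intro)
    then show "x \<in> cbox l u + cbox l' u'" by simp
  qed
  have m: "cbox l u + cbox l' u' \<in> lmeasurable" by (intro lmeasurable_compact compact_plus) auto
  define a b c d where "a = u$1 - l$1" "b = u$2 - l$2" "c = u'$1 - l'$1" "d = u'$2 - l'$2"
  have p: "0 < a" "0 < b" "0 < c" "0 < d" using i by (auto simp: a_b_c_d_def)
  have "(sqrt (a * d) - sqrt (b * c))\<^sup>2 \<ge> 0" by simp
  then have "2 * (sqrt (a * b) * sqrt (c * d)) \<le> a * d + b * c"
    using p by (simp add: power2_diff real_sqrt_mult[symmetric] mult_ac)
  then have "(sqrt (a * b) + sqrt (c * d))\<^sup>2 \<le> (a + c) * (b + d)"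
    using p by (simp add: power2_sum algebra_simps)
  also have "\<dots> = measure lebesgue (cbox (l + l') (u + u'))"
    using p by (simp add: measure_cbox_vec2 a_b_c_d_def max_def algebra_simps)
  also have "\<dots> \<le> measure lebesgue (cbox l u + cbox l' u')"
    by (intro measure_mono_fmeasurable sub m) auto
  finally show ?thesis using p by (simp add: measure_cbox_vec2 a_b_c_d_def max_def)
qed

text \<open>If the intervals of two boxes overlapped in both coordinates, the midpoints of the
  overlaps would give a common interior point.\<close>

lemma separate_boxes:
  assumes "boxes D" "1 < card D"
  obtains k t A B where "A \<in> D" "B \<in> D" "interior (A \<inter> halfspace k t False) = {}" "interior (B \<inter> halfspace k t True) = {}"
    "A \<subseteq> halfspace k t True" "B \<subseteq> halfspace k t False"
proof -
  obtain A B where AB: "A \<in> D" "B \<in> D" "A \<noteq> B"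
    using assms(2) by (metis card_le_Suc0_iff_eq assms(1) boxes_def One_nat_def linorder_not_less)
  obtain l u where A: "A = cbox l u" "interior A \<noteq> {}" using AB(1) assms(1) using boxesD[OF assms(1)] by metis
  obtain l' u' where B: "B = cbox l' u'" "interior B \<noteq> {}" using AB(2) assms(1) unfolding boxes_def by blast
  have dis: "interior A \<inter> interior B = {}" using assms(1) AB unfolding boxes_def pairwise_def by blast
  have lu: "\<forall>i. l$i < u$i" "\<forall>i. l'$i < u'$i"
    using A(2) B(2) unfolding A(1) B(1) interior_cbox_vec2 forall_2 by auto
  have "\<exists>k. u$k \<le> l'$k \<or> u'$k \<le> l$k"
  proof (rule ccontr)
    assume n: "\<nexists>k. u$k \<le> l'$k \<or> u'$k \<le> l$k"
    define x :: "real^2" where "x = (\<chi> i. (max (l$i) (l'$i) + min (u$i) (u'$i)) / 2)"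
    have "max (l$i) (l'$i) < min (u$i) (u'$i)" for i using n lu by (simp add: not_le)
    then have "max (l$i) (l'$i) < x$i" "x$i < min (u$i) (u'$i)" for i
      unfolding x_def vec_lambda_beta by (simp_all only: less_divide_eq_numeral1 divide_less_eq_numeral1) (smt (verit))+
    then have "x \<in> interior A" "x \<in> interior B" by (simp_all add: mem_box_cart A(1) B(1))
    then show False using dis by blast
  qed
  then obtain k where k: "u$k \<le> l'$k \<or> u'$k \<le> l$k" by blast
  have *: "A \<subseteq> halfspace k t True \<and> B \<subseteq> halfspace k t False \<and>
      interior (A \<inter> halfspace k t False) = {} \<and> interior (B \<inter> halfspace k t True) = {}"
    if "A = cbox l u" "B = cbox l' u'" "u$k \<le> l'$k" "t = u$k" for l u l' u' :: "real^2" and t A B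
  proof -
    have sub: "A \<subseteq> halfspace k t True" "B \<subseteq> halfspace k t False"
      using that by (auto simp: mem_box_cart halfspace_def) (metis order_trans)
    have i: "interior {x::real^2. x $ k = t} = {}"
    proof -
      obtain a :: "real^2" where "a \<noteq> 0" "\<And>x. a \<bullet> x = x $ k" using coord_inner[of k] by blast
      then show ?thesis using interior_hyperplane[of a t] by simp
    qed
    have "A \<inter> halfspace k t False \<subseteq> {x. x $ k = t}" "B \<inter> halfspace k t True \<subseteq> {x. x $ k = t}"
      using sub by (auto simp: halfspace_def intro: antisym)
    then have "interior (A \<inter> halfspace k t False) = {}" "interior (B \<inter> halfspace k t True) = {}"
      using i interior_mono by blast+
    then show ?thesis using sub by blast
  qed
  from k consider "u$k \<le> l'$k" | "u'$k \<le> l$k" by blast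
  then show ?thesis
  proof cases
    case 1
    from *[OF A(1) B(1) 1 refl] AB(1,2) show ?thesis by (intro that[of A B k "u$k"]) simp_all
  next
    case 2
    from *[OF B(1) A(1) 2 refl] AB(1,2) show ?thesis by (intro that[of B A k "u'$k"]) simp_all
  qed
qed

text \<open>The Hadwiger--Ohmann argument: a line separating two boxes of \<open>D\<close> and a parallel line that divides \<open>E\<close>
  in the same ratio cut both unions, and on either side fewer boxes remain.\<close>
lemma bm_boxes:
  assumes "boxes D" "boxes E"
  shows "(sqrt (measure lebesgue (\<Union>D)) + sqrt (measure lebesgue (\<Union>E)))\<^sup>2 \<le> measure lebesgue (\<Union>D + \<Union>E)"
  using assms
proof (induction "card D + card E" arbitrary: D E rule: less_induct)
  case less
  have step: "(sqrt (measure lebesgue (\<Union>D)) + sqrt (measure lebesgue (\<Union>E)))\<^sup>2 \<le> measure lebesgue (\<Union>D + \<Union>E)"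
    if D: "boxes D" and E: "boxes E" and c: "1 < card D"
      and IH: "\<And>D' E'. card D' + card E' < card D + card E \<Longrightarrow> boxes D' \<Longrightarrow> boxes E' \<Longrightarrow>
        (sqrt (measure lebesgue (\<Union>D')) + sqrt (measure lebesgue (\<Union>E')))\<^sup>2 \<le> measure lebesgue (\<Union>D' + \<Union>E')"
    for D E
  proof -
    let ?m = "measure (lebesgue :: (real^2) measure)"
    obtain k t A B where AB: "A \<in> D" "B \<in> D" "interior (A \<inter> halfspace k t False) = {}"
        "interior (B \<inter> halfspace k t True) = {}" "A \<subseteq> halfspace k t True" "B \<subseteq> halfspace k t False"
      using separate_boxes[OF D c] .
    have lD: "\<Union>D \<in> lmeasurable" and lE: "\<Union>E \<in> lmeasurable" using boxes_lmeasurable D E by auto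
    have iAB: "interior A \<noteq> {}" "interior B \<noteq> {}" using D AB unfolding boxes_def by auto
    define d where "d b = ?m (\<Union>D \<inter> halfspace k t b)" for b
    have dpos: "0 < d b" for b
      unfolding d_def
    proof (rule measure_pos_interior)
      have "A \<subseteq> \<Union>D \<inter> halfspace k t True" "B \<subseteq> \<Union>D \<inter> halfspace k t False" using AB by auto
      from this[THEN interior_mono] iAB show "interior (\<Union>D \<inter> halfspace k t b) \<noteq> {}"
        by (cases b) (simp_all only:, blast+)
      show "\<Union>D \<inter> halfspace k t b \<in> lmeasurable"
        using closed_halfspace boxes_compact[OF D] by (intro lmeasurable_compact compact_Int_closed) auto
    qed
    have dsum: "d True + d False = ?m (\<Union>D)" unfolding d_def by (rule split_measure[OF lD])
    define e where "e s b = ?m (\<Union>E \<inter> halfspace k s b)" for s b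
    have esum: "e s True + e s False = ?m (\<Union>E)" for s unfolding e_def by (rule split_measure[OF lE])
    define \<theta> where "\<theta> = d True / ?m (\<Union>D)"
    have Dpos: "0 < ?m (\<Union>D)" "0 < ?m (\<Union>E)" using boxes_pos D E by auto
    have th: "0 < \<theta>" "\<theta> < 1" using dpos[of True] dpos[of False] dsum Dpos by (auto simp: \<theta>_def)
    \<comment> \<open>The cuts at \<open>- N - 1\<close> and \<open>N\<close> leave nothing and
      everything of the second union on the lower side, so the ratio \<open>\<theta>\<close> is
      attained in between.\<close>
    obtain N where N: "\<And>x. x \<in> \<Union>E \<Longrightarrow> norm x \<le> N"
      using compact_imp_bounded[OF boxes_compact[OF E]] unfolding bounded_iff by metis
    have xk: "- N \<le> x $ k" "x $ k \<le> N" if "x \<in> \<Union>E" for x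
      using N[OF that] component_le_norm_cart[of x k] by linarith+
    have "\<Union>E \<inter> halfspace k (- N - 1) True = {}" using xk(1) by (fastforce simp: halfspace_def)
    then have e0: "e (- N - 1) True = 0" by (simp add: e_def)
    have "\<Union>E \<inter> halfspace k N True = \<Union>E" using xk(2) by (auto simp: halfspace_def)
    then have e1: "e N True = ?m (\<Union>E)" by (simp add: e_def)
    have "E \<noteq> {}" "\<forall>X\<in>E. X \<noteq> {}" using E by (auto simp: boxes_def)
    then obtain x where "x \<in> \<Union>E" by blast
    then have "- N - 1 \<le> N" using xk[of x] by linarith
    moreover have "\<theta> * ?m (\<Union>E) \<le> ?m (\<Union>E)" using th Dpos by simp
    ultimately obtain s where s: "e s True = \<theta> * ?m (\<Union>E)"
      using IVT'[of "\<lambda>s. e s True" "- N - 1" "\<theta> * ?m (\<Union>E)" N] th Dpos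
        continuous_on_subset[OF continuous_cut_measure[OF E, of k] subset_UNIV]
      by (auto simp: e0 e1 simp flip: e_def)
    define \<tau> where "\<tau> b = (if b then \<theta> else 1 - \<theta>)" for b
    have \<tau>: "0 < \<tau> b" for b using th by (simp add: \<tau>_def)
    have dD: "d b = \<tau> b * ?m (\<Union>D)" for b 
    proof -
      have *: "\<theta> * ?m (\<Union>D) = d True" using Dpos by (simp add: \<theta>_def)
      show ?thesis using * dsum by (cases b) (auto simp: \<tau>_def algebra_simps)
    qed
    have et: "e s b = \<tau> b * ?m (\<Union>E)" for b using esum[of s] s by (cases b) (auto simp: \<tau>_def algebra_simps)
    \<comment> \<open>Both unions have the same fraction \<open>\<tau> b\<close> on side
      \<open>b\<close>, and the lower bound is homogeneous of degree one in the areas. So the bounds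
      for the two sides add up to the claim.\<close>
    have part: "\<tau> b * (sqrt (?m (\<Union>D)) + sqrt (?m (\<Union>E)))\<^sup>2 \<le> ?m ((\<Union>D + \<Union>E) \<inter> halfspace k (t + s) b)" for b
    proof -
      let ?D = "cut D (halfspace k t b)" and ?E = "cut E (halfspace k s b)"
      have mD: "?m (\<Union>?D) = \<tau> b * ?m (\<Union>D)" using cut_measure[OF D] dD by (simp add: d_def)
      have mE: "?m (\<Union>?E) = \<tau> b * ?m (\<Union>E)" using cut_measure[OF E] et by (simp add: e_def)
      have "0 < ?m (\<Union>?D)" "0 < ?m (\<Union>?E)" unfolding mD mE using \<tau> Dpos by simp_all
      then have "?D \<noteq> {}" "?E \<noteq> {}" by auto
      then have bx: "boxes ?D" "boxes ?E" using cut_boxes D E by blast+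
      have "card ?D < card D"
        using card_cut(2)[OF D AB(1), of "halfspace k t b"] card_cut(2)[OF D AB(2), of "halfspace k t b"] AB(3,4)
        by (cases b) simp_all
      moreover have "card ?E \<le> card E" by (rule card_cut(1)[OF E])
      ultimately have "(sqrt (?m (\<Union>?D)) + sqrt (?m (\<Union>?E)))\<^sup>2 \<le> ?m (\<Union>?D + \<Union>?E)"
        by (intro IH bx) linarith
      also have "\<dots> \<le> ?m ((\<Union>D + \<Union>E) \<inter> halfspace k (t + s) b)"
      proof (rule measure_mono_fmeasurable)
        show "\<Union>?D + \<Union>?E \<subseteq> (\<Union>D + \<Union>E) \<inter> halfspace k (t + s) b"
        proof
          fix z assume "z \<in> \<Union>?D + \<Union>?E"
          then obtain x y where z: "z = x + y" "x \<in> \<Union>?D" "y \<in> \<Union>?E" by (elim set_plus_elim)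
          then have "x \<in> \<Union>D" "y \<in> \<Union>E" "x \<in> halfspace k t b" "y \<in> halfspace k s b" by (auto simp: cut_def)
          then show "z \<in> (\<Union>D + \<Union>E) \<inter> halfspace k (t + s) b"
            using z(1) by (auto simp: halfspace_def intro!: set_plus_intro split: if_splits)
        qed
        show "\<Union>?D + \<Union>?E \<in> sets lebesgue"
          using lmeasurable_compact[OF compact_plus[OF boxes_compact[OF bx(1)] boxes_compact[OF bx(2)]]] by auto
        show "(\<Union>D + \<Union>E) \<inter> halfspace k (t + s) b \<in> lmeasurable"
          using closed_halfspace compact_plus[OF boxes_compact[OF D] boxes_compact[OF E]]
          by (intro lmeasurable_compact compact_Int_closed) auto
      qed
      finally show ?thesis unfolding mD mE using \<tau>[of b] Dpos by (simp add: sqrt_split)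
    qed
    have "(sqrt (?m (\<Union>D)) + sqrt (?m (\<Union>E)))\<^sup>2 =
      \<tau> True * (sqrt (?m (\<Union>D)) + sqrt (?m (\<Union>E)))\<^sup>2 + \<tau> False * (sqrt (?m (\<Union>D)) + sqrt (?m (\<Union>E)))\<^sup>2"
      by (simp add: \<tau>_def algebra_simps)
    also have "\<dots> \<le> ?m ((\<Union>D + \<Union>E) \<inter> halfspace k (t + s) True) + ?m ((\<Union>D + \<Union>E) \<inter> halfspace k (t + s) False)"
      by (intro add_mono part)
    also have "\<dots> = ?m (\<Union>D + \<Union>E)"
      by (intro split_measure lmeasurable_compact compact_plus boxes_compact D E)
    finally show ?thesis .
  qed
  consider "1 < card D" | "1 < card E" | "card D \<le> 1" "card E \<le> 1" by linarith
  then show ?case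
  proof cases
    case 1
    show ?thesis by (rule step[OF less.prems 1]) (use less.hyps in blast)
  next
    case 2
    have "(sqrt (measure lebesgue (\<Union>E)) + sqrt (measure lebesgue (\<Union>D)))\<^sup>2 \<le> measure lebesgue (\<Union>E + \<Union>D)"
      by (rule step[OF less.prems(2,1) 2]) (use less.hyps in \<open>simp add: add.commute\<close>)
    then show ?thesis by (simp add: add.commute)
  next
    case 3
    then have "card D = 1" "card E = 1" using boxesD(1,2)[OF less.prems(1)] boxesD(1,2)[OF less.prems(2)]
      by (auto simp: le_Suc_eq)
    then obtain A B where AB: "D = {A}" "E = {B}" by (auto simp: card_1_singleton_iff)
    then obtain l u l' u' where "A = cbox l u" "B = cbox l' u'"
      using boxesD(4)[OF less.prems(1), of A] boxesD(4)[OF less.prems(2), of B] by blast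
    moreover have "interior A \<noteq> {}" "interior B \<noteq> {}"
      using AB boxesD(3)[OF less.prems(1), of A] boxesD(3)[OF less.prems(2), of B] by simp_all
    ultimately show ?thesis using bm_box[of l u l' u'] AB by simp
  qed
qed

lemma inner_boxes:
  fixes U :: "(real^2) set"
  assumes "open U" "bounded U" "U \<noteq> {}" "0 < \<epsilon>"
  obtains D where "boxes D" "\<Union>D \<subseteq> U" "measure lebesgue U - \<epsilon> < measure lebesgue (\<Union>D)"
proof -
  obtain a where a: "U \<subseteq> cbox (-a) a" using bounded_subset_cbox_symmetric[OF assms(2)] .
  have "box (-a) a \<noteq> {}" 
  proof -
    have "U \<subseteq> interior (cbox (-a) a)" using a assms(1) by (rule interior_maximal)
    then show ?thesis using assms(3) by auto
  qed
  \<comment> \<open>With this gauge every cell of the covering is contained in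
    \<open>U\<close>.\<close>
  define g where "g x = (if x \<in> U then U else UNIV)" for x
  have g: "gauge g" using assms(1) by (auto simp: gauge_def g_def)
  obtain \<D> where D: "countable \<D>" "\<Union>\<D> \<subseteq> cbox (-a) a"
    "\<And>K. K \<in> \<D> \<Longrightarrow> interior K \<noteq> {} \<and> (\<exists>c d. K = cbox c d)"
    "pairwise (\<lambda>A B. interior A \<inter> interior B = {}) \<D>"
    "\<And>K. K \<in> \<D> \<Longrightarrow> \<exists>x \<in> U \<inter> K. K \<subseteq> g x" "U \<subseteq> \<Union>\<D>"
    using covering_lemma[OF a \<open>box (-a) a \<noteq> {}\<close> g] by metis
  have sub: "K \<subseteq> U" if "K \<in> \<D>" for K using D(5)[OF that] by (auto simp: g_def)
  then have eq: "\<Union>\<D> = U" using D(6) by blast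
  have lU: "U \<in> lmeasurable" using assms by (simp add: lmeasurable_open)
  \<comment> \<open>Capping the error by the area of \<open>U\<close> forces the finite subfamily to
    be non-empty.\<close>
  define \<epsilon>' where "\<epsilon>' = min \<epsilon> (measure lebesgue U)"
  have "0 < measure lebesgue U" using assms lU by (intro measure_pos_interior) (auto simp: interior_open)
  then have e': "\<epsilon>' > 0" "\<epsilon>' \<le> \<epsilon>" "\<epsilon>' \<le> measure lebesgue U" using assms by (auto simp: \<epsilon>'_def)
  have lm: "K \<in> lmeasurable" if "K \<in> \<D>" for K using D(3)[OF that] by auto
  have B: "measure lebesgue (\<Union>D') \<le> measure lebesgue U" if "D' \<subseteq> \<D>" "finite D'" for D'
  proof (rule measure_mono_fmeasurable)
    show "\<Union>D' \<subseteq> U" using that sub by blast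
    show "\<Union>D' \<in> sets lebesgue" using that lm by (intro sets.finite_Union) auto
  qed (rule lU)
  obtain D' where D': "D' \<subseteq> \<D>" "finite D'" "measure lebesgue (\<Union>\<D>) - \<epsilon>' < measure lebesgue (\<Union>D')"
    using measure_countable_Union_approachable[OF D(1) e'(1) lm B] by metis
  then have "D' \<noteq> {}" using e' eq by auto
  then have "boxes D'" unfolding boxes_def using D' D(3) pairwise_subset[OF D(4) D'(1)] by blast
  moreover have "\<Union>D' \<subseteq> U" using D'(1) eq by blast
  moreover have "measure lebesgue U - \<epsilon> < measure lebesgue (\<Union>D')" using D'(3) e' eq by simp
  ultimately show ?thesis using that by blast
qed

text \<open>Unions of boxes inside the two interiors lose at most an area \<open>x\<close> each. The
  lower bound is continuous in \<open>x\<close>, so an arbitrarily small \<open>e\<close> absorbs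
  the loss.\<close>

theorem brunn_minkowski:
  fixes P Q :: "(real^2) set"
  assumes P: "compact P" "convex P" "interior P \<noteq> {}" and Q: "compact Q" "convex Q" "interior Q \<noteq> {}"
  shows "(sqrt (measure lebesgue P) + sqrt (measure lebesgue Q))\<^sup>2 \<le> measure lebesgue (P + Q)"
proof (rule field_le_epsilon)
  let ?m = "measure (lebesgue :: (real^2) measure)"
  have mi: "?m (interior K) = ?m K" if "compact K" "convex K" for K
    using that by (intro measure_interior negligible_convex_frontier compact_imp_bounded)
  have bi: "bounded (interior K)" if "compact K" for K
    using that compact_imp_bounded bounded_subset interior_subset by blast
  have lPQ: "P + Q \<in> lmeasurable" using P Q by (intro lmeasurable_compact compact_plus)
  fix e :: real assume "0 < e"
  define f where "f x = (sqrt (?m P - x) + sqrt (?m Q - x))\<^sup>2" for x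
  have "continuous (at_right 0) f" unfolding f_def by (intro continuous_intros)
  then have "(f \<longlongrightarrow> f 0) (at_right 0)" by (simp add: continuous_within)
  then have "\<forall>\<^sub>F x in at_right 0. dist (f x) (f 0) < e" using \<open>0 < e\<close> by (rule tendstoD)
  moreover have pos: "0 < ?m P" "0 < ?m Q" using P Q by (auto intro!: measure_pos_interior lmeasurable_compact)
  then have "\<forall>\<^sub>F x in at_right 0. x < min (?m P) (?m Q) \<and> 0 < x"
    by (intro eventually_conj eventually_at_rightI[of 0 "min (?m P) (?m Q)"]) auto
  ultimately have "\<forall>\<^sub>F x in at_right (0::real). dist (f x) (f 0) < e \<and> x < min (?m P) (?m Q) \<and> 0 < x"
    by (rule eventually_conj)
  then obtain x where x: "dist (f x) (f 0) < e" "x < ?m P" "x < ?m Q" "0 < x"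
    using eventually_happens'[of "at_right (0::real)"] by auto
  obtain D where D: "boxes D" "\<Union>D \<subseteq> interior P" "?m P - x < ?m (\<Union>D)"
    using inner_boxes[OF open_interior bi[OF P(1)] P(3) x(4)] mi[OF P(1,2)] by metis
  obtain E where E: "boxes E" "\<Union>E \<subseteq> interior Q" "?m Q - x < ?m (\<Union>E)"
    using inner_boxes[OF open_interior bi[OF Q(1)] Q(3) x(4)] mi[OF Q(1,2)] by metis
  have "f x \<le> (sqrt (?m (\<Union>D)) + sqrt (?m (\<Union>E)))\<^sup>2"
    unfolding f_def using D E x by (intro power_mono add_mono) auto
  also have "\<dots> \<le> ?m (\<Union>D + \<Union>E)" by (rule bm_boxes[OF D(1) E(1)])
  also have "\<dots> \<le> ?m (P + Q)"
  proof (rule measure_mono_fmeasurable[OF _ _ lPQ])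
    show "\<Union>D + \<Union>E \<subseteq> P + Q" using D(2) E(2) interior_subset by (intro set_plus_mono2) blast+
    show "\<Union>D + \<Union>E \<in> sets lebesgue"
      using lmeasurable_compact[OF compact_plus[OF boxes_compact[OF D(1)] boxes_compact[OF E(1)]]] by auto
  qed
  finally show "(sqrt (?m P) + sqrt (?m Q))\<^sup>2 \<le> ?m (P + Q) + e"
    using x(1) by (simp add: f_def dist_real_def)
qed

text \<open>Expanding the square in the plane leaves twice the geometric mean of the areas on one
  side and the mixed volume on the other.\<close>

lemma minkowski_inequality:
  assumes P: "polytope P" "interior P \<noteq> {}" and Q: "polytope Q" "interior Q \<noteq> {}"
  shows "normalized_volume P * normalized_volume Q \<le> (mixed_volume P Q)\<^sup>2" "0 \<le> mixed_volume P Q"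
proof -
  let ?a = "measure lebesgue P" and ?b = "measure lebesgue Q"
  have "(sqrt ?a + sqrt ?b)\<^sup>2 \<le> measure lebesgue (P + Q)"
    using assms polytope_imp_compact polytope_imp_convex by (intro brunn_minkowski) auto
  then have 1: "2 * sqrt (?a * ?b) \<le> mixed_volume P Q"
    by (simp add: mixed_volume_def normalized_volume_def power2_sum real_sqrt_mult field_simps)
  then have "(2 * sqrt (?a * ?b))\<^sup>2 \<le> (mixed_volume P Q)\<^sup>2" by (intro power_mono) auto
  then show "normalized_volume P * normalized_volume Q \<le> (mixed_volume P Q)\<^sup>2"
    by (simp add: power_mult_distrib normalized_volume_def)
  have "0 \<le> 2 * sqrt (?a * ?b)" by simp
  then show "0 \<le> mixed_volume P Q" using 1 by linarith
qed

section \<open>Lattice polygons in integer coordinates\<close>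

type_synonym pt = "int \<times> int"

definition ivec :: "pt \<Rightarrow> real^2" where
  "ivec p = vector [real_of_int (fst p), real_of_int (snd p)]"

definition idet :: "pt \<Rightarrow> pt \<Rightarrow> int" where
  "idet p q = fst p * snd q - snd p * fst q"

definition ihull :: "pt set \<Rightarrow> (real^2) set" where
  "ihull S = convex hull (ivec ` S)"

definition isupport :: "pt set \<Rightarrow> pt \<Rightarrow> int" where
  "isupport S q = Max ((\<lambda>p. idet p q) ` S)"

lemma ivec_nth [simp]: "ivec p $ 1 = real_of_int (fst p)" "ivec p $ 2 = real_of_int (snd p)"
  by (simp_all add: ivec_def)

lemma ivec_add: "ivec (p + q) = ivec p + ivec q" and ivec_diff: "ivec (p - q) = ivec p - ivec q" and ivec_0: "ivec 0 = 0"
  by (simp_all add: vec2_eq_iff)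

lemma ivec_inj: "ivec p = ivec q \<longleftrightarrow> p = q"
  by (auto simp: vec2_eq_iff prod_eq_iff)

lemma rdet_ivec: "rdet (ivec p) (ivec q) = real_of_int (idet p q)"
  by (simp add: rdet_def idet_def)

lemma idet_simps [simp]:
  "idet (p + q) r = idet p r + idet q r" "idet (p - q) r = idet p r - idet q r"
  "idet p (q + r) = idet p q + idet p r" "idet p (q - r) = idet p q - idet p r"
  "idet p p = 0" "idet 0 p = 0" "idet p 0 = 0" "idet (- p) q = - idet p q" "idet p (- q) = - idet p q"
  by (simp_all add: idet_def algebra_simps)

lemma idet_skew: "idet p q = - idet q p" by (simp add: idet_def)

lemma range_ivec: "int_lattice = range ivec"
proof (intro set_eqI iffI)
  fix x assume "x \<in> int_lattice"
  then have "x $ 1 \<in> \<int>" "x $ 2 \<in> \<int>" by (auto simp: int_lattice_def)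
  then obtain a b where "x $ 1 = of_int a" "x $ 2 = of_int b" by (auto elim!: Ints_cases)
  then have "x = ivec (a, b)" by (simp add: vec2_eq_iff)
  then show "x \<in> range ivec" by blast
qed (auto simp: int_lattice_def forall_2)

lemma lattice_polytope_ihull: "lattice_polytope P \<longleftrightarrow> (\<exists>S. finite S \<and> S \<noteq> {} \<and> P = ihull S)"
proof
  assume "lattice_polytope P"
  then obtain T where T: "finite T" "T \<noteq> {}" "T \<subseteq> range ivec" "P = convex hull T"
    unfolding lattice_polytope_def range_ivec by blast
  obtain S where "finite S" "T = ivec ` S" using T(1,3) finite_subset_image[of T ivec UNIV] by blast
  then show "\<exists>S. finite S \<and> S \<noteq> {} \<and> P = ihull S" using T unfolding ihull_def by blast
next
  assume "\<exists>S. finite S \<and> S \<noteq> {} \<and> P = ihull S"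
  then obtain S where "finite S" "S \<noteq> {}" "P = ihull S" by blast
  then show "lattice_polytope P" unfolding lattice_polytope_def range_ivec ihull_def
    by (intro exI[of _ "ivec ` S"]) auto
qed

lemma polytope_ihull: "finite S \<Longrightarrow> polytope (ihull S)"
  unfolding ihull_def by (intro polytope_convex_hull) auto

lemma compact_ihull: "finite S \<Longrightarrow> compact (ihull S)"
  using polytope_ihull polytope_imp_compact by blast

lemma ihull_ne: "ihull S \<noteq> {} \<longleftrightarrow> S \<noteq> {}" by (simp add: ihull_def)

lemma ihull_mono: "S \<subseteq> T \<Longrightarrow> ihull S \<subseteq> ihull T" unfolding ihull_def by (intro hull_mono image_mono)

lemma ihull_inc: "p \<in> S \<Longrightarrow> ivec p \<in> ihull S" unfolding ihull_def by (auto intro: hull_inc)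

lemma ihull_minimal: "(\<And>p. p \<in> S \<Longrightarrow> ivec p \<in> C) \<Longrightarrow> convex C \<Longrightarrow> ihull S \<subseteq> C"
  unfolding ihull_def by (rule hull_minimal) auto

lemma convex_ihull: "convex (ihull S)" unfolding ihull_def by (rule convex_convex_hull)

lemma convex_rdet_le: "convex {x. rdet x e \<le> c}" unfolding rdet_inner by (rule convex_halfspace_le)

lemma ihull_face:
  assumes "p \<in> S" "\<And>q. q \<in> S \<Longrightarrow> rdet (ivec q) e \<le> rdet (ivec p) e"
  shows "ivec p \<in> max_face (ihull S) e"
proof -
  have "ihull S \<subseteq> {x. rdet x e \<le> rdet (ivec p) e}"
    by (rule ihull_minimal) (use assms convex_rdet_le in auto)
  then show ?thesis using ihull_inc[OF assms(1)] by (auto simp: max_face_def)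
qed

lemma isupport_attained:
  assumes "finite S" "S \<noteq> {}" obtains p where "p \<in> S" "isupport S q = idet p q"
proof -
  have "isupport S q \<in> (\<lambda>p. idet p q) ` S" unfolding isupport_def using assms by (intro Max_in) auto
  then show ?thesis using that by blast
qed

lemma isupport_ge: "finite S \<Longrightarrow> p \<in> S \<Longrightarrow> idet p q \<le> isupport S q"
  unfolding isupport_def by (rule Max_ge) auto

lemma isupport_le: assumes "finite S" "S \<noteq> {}" "\<And>p. p \<in> S \<Longrightarrow> idet p q \<le> c" shows "isupport S q \<le> c"
  using isupport_attained[OF assms(1,2)] assms(3) by metis

lemma support_ihull:
  assumes "finite S" "S \<noteq> {}" shows "support (ihull S) (ivec q) = of_int (isupport S q)"
proof -
  obtain p where p: "p \<in> S" "isupport S q = idet p q" using isupport_attained[OF assms] .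
  have "ivec p \<in> max_face (ihull S) (ivec q)"
    using p isupport_ge[OF assms(1), of _ q] by (intro ihull_face) (simp_all add: rdet_ivec)
  from support_max_face[OF this] show ?thesis by (simp add: rdet_ivec p)
qed

lemma noncollinear_interior:
  assumes "convex K" "a \<in> K" "b \<in> K" "c \<in> K" "rdet (b - a) (c - a) \<noteq> 0"
  shows "interior K \<noteq> {}"
proof
  assume "interior K = {}"
  then obtain n d where n: "n \<noteq> 0" "K \<subseteq> {x. n \<bullet> x = d}"
    using empty_interior_subset_hyperplane[OF assms(1)] by blast
  have p: "n \<bullet> (b - a) = 0" "n \<bullet> (c - a) = 0" using n(2) assms(2-4) by (auto simp: inner_diff_right)
  define e :: "real^2" where "e = (\<chi> i. if i = 1 then - n$2 else n$1)"
  have pe: "perp e = n" by (simp add: e_def perp_def vec2_eq_iff)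
  then have e: "e \<noteq> 0" using n(1) perp_eq_0 by metis
  have z: "rdet (b - a) e = 0" "rdet (c - a) e = 0" unfolding rdet_inner pe using p by auto
  have "rdet (b - a) (c - a) *\<^sub>R e = rdet e (c - a) *\<^sub>R (b - a) + rdet (b - a) e *\<^sub>R (c - a)" by (rule rdet_cross)
  then have "rdet (b - a) (c - a) *\<^sub>R e = 0" using z rdet_skew[of e "c - a"] by simp
  then show False using assms(5) e by simp
qed

lemma interior_ihull_noncollinear:
  assumes "interior (ihull S) \<noteq> {}" 
  obtains a b c where "a \<in> S" "b \<in> S" "c \<in> S" "idet (b - a) (c - a) \<noteq> 0"
proof (rule ccontr)
  note obt = that
  assume n: "\<not> thesis"
  have z: "idet (b - a) (c - a) = 0" if "a \<in> S" "b \<in> S" "c \<in> S" for a b c using n obt that by blast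
  have "S \<noteq> {}" using assms interior_subset[of "ihull S"] ihull_ne by blast
  then obtain a where a: "a \<in> S" by blast
  obtain e where e: "e \<noteq> 0" "\<And>b. b \<in> S \<Longrightarrow> rdet (ivec b) e = rdet (ivec a) e"
  proof (cases "S = {a}")
    case True
    show ?thesis by (rule that[of "axis 1 1"]) (use True in \<open>auto simp: axis_eq_0_iff\<close>)
  next
    case False
    then obtain b where b: "b \<in> S" "b \<noteq> a" using a by blast
    show ?thesis
    proof (rule that[of "ivec (b - a)"])
      show "ivec (b - a) \<noteq> 0" using b(2) by (simp add: ivec_diff ivec_inj)
      fix c assume "c \<in> S"
      then have "idet (c - a) (b - a) = 0" using z a b by blast
      then show "rdet (ivec c) (ivec (b - a)) = rdet (ivec a) (ivec (b - a))" unfolding rdet_ivec by simp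
    qed
  qed
  have "ihull S \<subseteq> {x. perp e \<bullet> x = rdet (ivec a) e}"
    by (rule ihull_minimal) (use e(2) convex_hyperplane in \<open>auto simp: rdet_inner\<close>)
  then have "interior (ihull S) \<subseteq> interior {x. perp e \<bullet> x = rdet (ivec a) e}" by (rule interior_mono)
  then show False using assms interior_hyperplane[of "perp e"] e(1) by auto
qed

text \<open>The segment from an interior point to \<open>x\<close> meets the boundary, and the
  functional of an edge at the crossing point keeps increasing towards \<open>x\<close>.\<close>

lemma outside_separated:
  assumes P: "polytope K" "interior K \<noteq> {}" and x: "x \<notin> K"
  obtains e where "e \<in> edge_dirs K" "support K e < rdet x e"
proof -
  have cK: "compact K" "closed K" using P polytope_imp_compact compact_imp_closed by auto
  obtain c where c: "c \<in> interior K" using P by blast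
  have "closed_segment c x \<inter> frontier K \<noteq> {}"
    using c x interior_subset by (intro connected_Int_frontier) auto
  then obtain y where y: "y \<in> closed_segment c x" "y \<in> frontier K" by blast
  then have yK: "y \<in> K" "y \<notin> interior K" using cK(2) by (auto simp: frontier_def)
  obtain e where e: "e \<in> edge_dirs K" "y \<in> max_face K e" using frontier_max_face[OF P yK] .
  obtain t where t: "y = (1 - t) *\<^sub>R c + t *\<^sub>R x" "0 \<le> t" "t \<le> 1" using y(1) by (auto simp: in_segment)
  have t1: "t < 1" using t yK x by (cases "t = 1") auto
  have ne: "norm e = 1" using e(1) by (simp add: edge_dirs_def)
  have lt: "rdet c e < rdet y e"
  proof -
    obtain d where d: "d > 0" "\<And>z. norm z \<le> d \<Longrightarrow> c + z \<in> interior K" using interior_Basis_shift[OF c] by blast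
    have pe: "perp e \<noteq> 0" using ne by auto
    define z where "z = (d / norm (perp e)) *\<^sub>R perp e"
    have "norm z = d" using pe d(1) by (simp add: z_def)
    then have "c + z \<in> K" using d(2)[of z] interior_subset by auto
    then have "rdet (c + z) e \<le> rdet y e" using e(2) unfolding max_face_def by blast
    moreover have "0 < rdet z e" using pe d(1) by (simp add: z_def rdet_inner)
    ultimately show ?thesis by simp
  qed
  have "rdet y e = rdet c e + t * (rdet x e - rdet c e)" by (simp add: t algebra_simps)
  moreover have "t * (rdet x e - rdet c e) < rdet x e - rdet c e" if "0 < rdet x e - rdet c e"
    using t1 that by simp
  moreover have "0 < rdet x e - rdet c e"
  proof (rule ccontr)
    assume "\<not> 0 < rdet x e - rdet c e"
    then have "t * (rdet x e - rdet c e) \<le> 0" using t(2) by (simp add: mult_nonneg_nonpos)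
    then show False using calculation(1) lt by linarith
  qed
  ultimately have "rdet y e < rdet x e" by linarith
  then show ?thesis using that e support_max_face[OF e(2)] by simp
qed

section \<open>Polygons given by cyclic vertex lists\<close>

definition cyclic_pairs :: "'a list \<Rightarrow> ('a \<times> 'a) list" where
  "cyclic_pairs vs = zip vs (rotate1 vs)"

text \<open>All other points lie strictly to the left of every edge. So the list runs
  counterclockwise and contains only vertices, without points inside edges.\<close>

definition convex_ok :: "pt list \<Rightarrow> bool" where
  "convex_ok vs \<longleftrightarrow> distinct vs \<and> 3 \<le> length vs \<and>
     (\<forall>(v, w) \<in> set (cyclic_pairs vs). \<forall>z\<in>set vs. z = v \<or> z = w \<or> idet (z - v) (w - v) < 0)"

lemma cyclic_pairs_mem: "(v, w) \<in> set (cyclic_pairs vs) \<Longrightarrow> v \<in> set vs" "(v, w) \<in> set (cyclic_pairs vs) \<Longrightarrow> w \<in> set vs"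
  unfolding cyclic_pairs_def by (auto dest: set_zip_leftD set_zip_rightD)

lemma cyclic_pairs_ex: "v \<in> set vs \<Longrightarrow> \<exists>w. (v, w) \<in> set (cyclic_pairs vs)"
  unfolding cyclic_pairs_def by (metis in_set_impl_in_set_zip1 length_rotate1)

lemma cyclic_pairs_ne: assumes "distinct vs" "2 \<le> length vs" "(v, w) \<in> set (cyclic_pairs vs)" shows "v \<noteq> w"
proof -
  obtain i where i: "i < length vs" "v = vs ! i" "w = rotate1 vs ! i"
    using assms(3) by (auto simp: cyclic_pairs_def set_zip)
  then have "w = vs ! (Suc i mod length vs)" using nth_rotate1 by blast
  moreover have "Suc i mod length vs \<noteq> i" "Suc i mod length vs < length vs"
    using i(1) assms(2) by (auto simp: mod_Suc)
  ultimately show ?thesis using i assms(1) by (auto simp: nth_eq_iff_index_eq)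
qed

lemma cyclic_pairs_distinct: "distinct vs \<Longrightarrow> distinct (cyclic_pairs vs)"
  unfolding cyclic_pairs_def by (rule distinct_zipI1)

context
  fixes vs :: "pt list" assumes ok: "convex_ok vs"
begin

lemma ok_simps: "distinct vs" "3 \<le> length vs" "set vs \<noteq> {}"
  using ok by (auto simp: convex_ok_def)

lemma ok_edge:
  assumes "(v, w) \<in> set (cyclic_pairs vs)"
  shows "v \<in> set vs" "w \<in> set vs" "v \<noteq> w"
    "z \<in> set vs \<Longrightarrow> z \<noteq> v \<Longrightarrow> z \<noteq> w \<Longrightarrow> idet z (w - v) < idet v (w - v)"
    "z \<in> set vs \<Longrightarrow> idet z (w - v) \<le> idet v (w - v)"
proof -
  show 1: "v \<in> set vs" "w \<in> set vs" "v \<noteq> w"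
    using cyclic_pairs_mem assms cyclic_pairs_ne[OF ok_simps(1) _ assms] ok_simps(2) by auto
  show 2: "idet z (w - v) < idet v (w - v)" if "z \<in> set vs" "z \<noteq> v" "z \<noteq> w" for z
  proof -
    have "z = v \<or> z = w \<or> idet (z - v) (w - v) < 0" using ok assms that unfolding convex_ok_def by blast
    then have "idet (z - v) (w - v) < 0" using that(2,3) by blast
    then show ?thesis by simp
  qed
  show "idet z (w - v) \<le> idet v (w - v)" if "z \<in> set vs"
  proof -
    have "idet w (w - v) = idet v (w - v)" by (simp only: idet_simps idet_skew[of w v])
    then show ?thesis using 2[OF that] by (cases "z = v"; cases "z = w") auto
  qed
qed

lemma ok_interior: "interior (ihull (set vs)) \<noteq> {}"
proof -
  obtain v where v: "v \<in> set vs" using ok_simps(3) by (meson all_not_in_conv)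
  obtain w where w: "(v, w) \<in> set (cyclic_pairs vs)" using cyclic_pairs_ex[OF v] by blast
  have "card (set vs) \<ge> 3" using ok_simps distinct_card by fastforce
  then have "\<not> set vs \<subseteq> {v, w}" using card_mono[of "{v, w}" "set vs"] by (auto simp: card_insert_if split: if_splits)
  then obtain z where z: "z \<in> set vs" "z \<noteq> v" "z \<noteq> w" by blast
  have "idet (z - v) (w - v) \<noteq> 0" using ok_edge(4)[OF w z] by simp
  then have "rdet (ivec z - ivec v) (ivec w - ivec v) \<noteq> 0" by (simp only: rdet_ivec ivec_diff[symmetric])
  then show ?thesis
    using noncollinear_interior[OF convex_ihull ihull_inc[OF v] ihull_inc[OF z(1)] ihull_inc[OF ok_edge(2)[OF w]]] by blast
qed

text \<open>A face is the hull of the generators on it, and by strictness these are \<open>v\<close>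
  and \<open>w\<close> only.\<close>

lemma ok_max_face:
  assumes "(v, w) \<in> set (cyclic_pairs vs)"
  shows "max_face (ihull (set vs)) (ivec (w - v)) = closed_segment (ivec v) (ivec w)"
proof
  let ?K = "ihull (set vs)" and ?e = "ivec (w - v)"
  note e = ok_edge[OF assms]
  have eq: "idet w (w - v) = idet v (w - v)" by (simp only: idet_simps idet_skew[of w v])
  have vw: "ivec v \<in> max_face ?K ?e" "ivec w \<in> max_face ?K ?e"
    using e eq by (auto intro!: ihull_face simp: rdet_ivec simp del: idet_simps)
  have cK: "compact ?K" "convex ?K" using compact_ihull convex_ihull by auto
  have f: "max_face ?K ?e face_of ?K" using max_face_face_of[OF cK] .
  then have "convex (max_face ?K ?e)" using face_of_imp_convex by blast
  then show "closed_segment (ivec v) (ivec w) \<subseteq> max_face ?K ?e" using vw closed_segment_subset by blast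
  have "compact (ivec ` set vs)" by (simp add: finite_imp_compact)
  then obtain S' where S': "S' \<subseteq> ivec ` set vs" "max_face ?K ?e = convex hull S'"
    using face_of_convex_hull_subset f unfolding ihull_def by metis
  have "S' \<subseteq> {ivec v, ivec w}"
  proof
    fix x assume x: "x \<in> S'"
    then obtain z where z: "x = ivec z" "z \<in> set vs" using S' by blast
    have "x \<in> max_face ?K ?e" using x S'(2) hull_inc by metis
    then have "rdet (ivec z) ?e = rdet (ivec v) ?e" using support_max_face vw z by metis
    then have "idet z (w - v) = idet v (w - v)" unfolding rdet_ivec by linarith
    then show "x \<in> {ivec v, ivec w}" using e(4)[OF z(2)] z(1) by force
  qed
  then show "max_face ?K ?e \<subseteq> closed_segment (ivec v) (ivec w)"
    unfolding S'(2) segment_convex_hull by (rule hull_mono)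
qed

definition udir :: "pt \<times> pt \<Rightarrow> real^2" where
  "udir = (\<lambda>(v, w). ivec (w - v) /\<^sub>R norm (ivec (w - v)))"

lemma max_face_scale: "0 < c \<Longrightarrow> max_face K (c *\<^sub>R e) = max_face K e"
  by (simp add: max_face_def)

lemma udir_facts:
  assumes "(v, w) \<in> set (cyclic_pairs vs)"
  shows "norm (udir (v, w)) = 1" "max_face (ihull (set vs)) (udir (v, w)) = closed_segment (ivec v) (ivec w)"
    "0 < norm (ivec (w - v))"
proof -
  have "w - v \<noteq> 0" using ok_edge(3)[OF assms] by simp
  then have "ivec (w - v) \<noteq> 0" using ivec_inj ivec_0 by metis
  then show n: "0 < norm (ivec (w - v))" by simp
  then show "norm (udir (v, w)) = 1" by (simp add: udir_def)
  show "max_face (ihull (set vs)) (udir (v, w)) = closed_segment (ivec v) (ivec w)"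
    using max_face_scale[of "inverse (norm (ivec (w - v)))"] n ok_max_face[OF assms] by (simp add: udir_def)
qed

lemma udir_edge_length: assumes "(v, w) \<in> set (cyclic_pairs vs)"
  shows "edge_length (ihull (set vs)) (udir (v, w)) = norm (ivec (w - v))"
proof (rule edge_length_eqI[of _ _ "ivec v"])
  let ?n = "norm (ivec (w - v))"
  note u = udir_facts[OF assms]
  have e: "ivec w - ivec v = ?n *\<^sub>R udir (v, w)" using u(3) by (simp add: udir_def ivec_diff[symmetric])
  show "max_face (ihull (set vs)) (udir (v, w)) = {ivec v + t *\<^sub>R udir (v, w) |t. 0 \<le> t \<and> t \<le> ?n}"
    unfolding u(2)
  proof (intro set_eqI iffI)
    fix x assume "x \<in> closed_segment (ivec v) (ivec w)"
    then obtain s where s: "x = (1 - s) *\<^sub>R ivec v + s *\<^sub>R ivec w" "0 \<le> s" "s \<le> 1" by (auto simp: in_segment)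
    then have "x = ivec v + s *\<^sub>R (ivec w - ivec v)" by (simp add: algebra_simps)
    then have "x = ivec v + (s * ?n) *\<^sub>R udir (v, w)" unfolding e by simp
    then show "x \<in> {ivec v + t *\<^sub>R udir (v, w) |t. 0 \<le> t \<and> t \<le> ?n}"
      using s u(3) by (intro CollectI exI[of _ "s * ?n"]) (auto simp: mult_left_le_one_le)
  next
    fix x assume "x \<in> {ivec v + t *\<^sub>R udir (v, w) |t. 0 \<le> t \<and> t \<le> ?n}"
    then obtain t where t: "x = ivec v + t *\<^sub>R udir (v, w)" "0 \<le> t" "t \<le> ?n" by blast
    have "(t / ?n) *\<^sub>R (ivec w - ivec v) = t *\<^sub>R udir (v, w)" unfolding e using u(3) by simp
    then have "x = (1 - t / ?n) *\<^sub>R ivec v + (t / ?n) *\<^sub>R ivec w" using t(1) by (simp add: algebra_simps)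
    then show "x \<in> closed_segment (ivec v) (ivec w)"
      using t u(3) unfolding in_segment by (intro exI[of _ "t / ?n"]) auto
  qed
qed (use udir_facts[OF assms] in auto)

lemma ok_edge_dirs: "edge_dirs (ihull (set vs)) = udir ` set (cyclic_pairs vs)"
proof (intro set_eqI iffI)
  let ?K = "ihull (set vs)"
  fix e assume "e \<in> udir ` set (cyclic_pairs vs)"
  then obtain v w where vw: "(v, w) \<in> set (cyclic_pairs vs)" "e = udir (v, w)" by auto
  have "ivec v \<in> max_face ?K e" "ivec w \<in> max_face ?K e" unfolding vw(2) udir_facts(2)[OF vw(1)] by auto
  moreover have "ivec v \<noteq> ivec w" using ok_edge(3)[OF vw(1)] ivec_inj by simp
  ultimately show "e \<in> edge_dirs ?K" unfolding edge_dirs_def using udir_facts(1)[OF vw(1)] vw(2) by blast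
next
  let ?K = "ihull (set vs)"
  fix e assume "e \<in> edge_dirs ?K"
  then obtain x y where xy: "norm e = 1" "x \<in> max_face ?K e" "y \<in> max_face ?K e" "x \<noteq> y" unfolding edge_dirs_def by blast
  have key: "e \<in> udir ` set (cyclic_pairs vs)"
    if ab: "a \<in> set vs" "b \<in> set vs" "a \<noteq> b" "ivec a \<in> max_face ?K e" and e: "e = ivec (b - a) /\<^sub>R norm (ivec (b - a))" for a b
  proof -
    obtain w where w: "(a, w) \<in> set (cyclic_pairs vs)" using cyclic_pairs_ex[OF ab(1)] by blast
    have n: "norm (ivec (b - a)) > 0" using ab(3) ivec_inj ivec_0 by (metis right_minus_eq zero_less_norm_iff)
    have "ivec w \<in> ?K" using ihull_inc ok_edge(2)[OF w] by blast
    then have "rdet (ivec w) e \<le> rdet (ivec a) e" using ab(4) by (simp add: max_face_def)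
    then have "rdet (ivec w) (ivec (b - a)) \<le> rdet (ivec a) (ivec (b - a))" using n by (simp add: e field_simps)
    then have 1: "idet w (b - a) \<le> idet a (b - a)" unfolding rdet_ivec by linarith
    \<comment> \<open>Since \<open>a\<close> is maximal in direction \<open>b - a\<close>, the
      successor \<open>w\<close> is not to the right of the line from \<open>a\<close> to
      \<open>b\<close>. If \<open>b\<close> differed from \<open>w\<close>, it would lie strictly to
      the left of the edge from \<open>a\<close> to \<open>w\<close>; the two conditions give the
      same determinant opposite signs.\<close>
    have "b = w"
    proof (rule ccontr)
      assume "b \<noteq> w"
      then have "idet b (w - a) < idet a (w - a)" using ok_edge(4)[OF w ab(2)] ab(3) by blast
      then show False using 1 idet_skew[of w b] idet_skew[of a b] idet_skew[of a w] by simp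
    qed
    then show ?thesis using w e by (auto simp: udir_def)
  qed
  obtain v' w' where "v' \<in> ivec ` set vs" "w' \<in> ivec ` set vs" "v' \<noteq> w'" "v' \<in> max_face ?K e" "w' \<in> max_face ?K e"
    using max_face_hull_two[of "ivec ` set vs" x e y] xy unfolding ihull_def by auto
  then obtain a b where ab: "a \<in> set vs" "b \<in> set vs" "a \<noteq> b" "ivec a \<in> max_face ?K e" "ivec b \<in> max_face ?K e" by auto
  have "rdet (ivec b - ivec a) e = 0" using ab by (simp add: support_max_face)
  moreover have "ivec b - ivec a \<noteq> 0" using ab(3) ivec_inj by simp
  ultimately have "e = (ivec b - ivec a) /\<^sub>R norm (ivec b - ivec a) \<or> e = - ((ivec b - ivec a) /\<^sub>R norm (ivec b - ivec a))"
    using unit_perp_cases[OF xy(1)] by blast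
  then have "e = ivec (b - a) /\<^sub>R norm (ivec (b - a)) \<or> e = ivec (a - b) /\<^sub>R norm (ivec (a - b))"
    by (auto simp: ivec_diff norm_minus_commute scaleR_diff_right)
  then show "e \<in> udir ` set (cyclic_pairs vs)" using key ab by metis
qed

text \<open>The face determines the end points of the edge as a set, and the sign of the direction
  determines their order.\<close>

lemma udir_inj: "inj_on udir (set (cyclic_pairs vs))"
proof (rule inj_onI)
  fix p q assume pq: "p \<in> set (cyclic_pairs vs)" "q \<in> set (cyclic_pairs vs)" "udir p = udir q"
  obtain v w v' w' where p: "p = (v, w)" and q: "q = (v', w')" by (cases p, cases q) auto
  have "closed_segment (ivec v) (ivec w) = closed_segment (ivec v') (ivec w')"
    using udir_facts(2) pq p q by metis
  then have "{ivec v, ivec w} = {ivec v', ivec w'}" by (simp add: closed_segment_eq)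
  then have "(v = v' \<and> w = w') \<or> (v = w' \<and> w = v')" by (auto simp: doubleton_eq_iff ivec_inj)
  moreover have "\<not> (v = w' \<and> w = v')"
  proof
    assume s: "v = w' \<and> w = v'"
    then have "udir q = - udir p" by (simp add: udir_def p q ivec_diff norm_minus_commute scaleR_diff_right)
    then have "udir p \<bullet> udir p = - (udir p \<bullet> udir p)" using pq(3) by (metis inner_minus_right)
    then show False using udir_facts(1)[of v w] pq(1) p by (simp add: norm_eq_1)
  qed
  ultimately show "p = q" using p q by simp
qed

text \<open>Homogeneity of the support function absorbs the Euclidean edge length into the lattice
  vector \<open>w - v\<close>, which turns the mixed volume into a sum of integers.\<close>

theorem ok_mixed_volume:
  assumes T: "finite T" "interior (ihull T) \<noteq> {}"
  shows "mixed_volume (ihull (set vs)) (ihull T) = of_int (\<Sum>(v, w)\<leftarrow>cyclic_pairs vs. isupport T (w - v))"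
proof -
  have Tn: "T \<noteq> {}" using T(2) interior_subset[of "ihull T"] ihull_ne by blast
  have "mixed_volume (ihull (set vs)) (ihull T) = (\<Sum>e\<in>edge_dirs (ihull (set vs)). edge_length (ihull (set vs)) e * support (ihull T) e)"
    by (rule mixed_volume_support[OF polytope_ihull ok_interior polytope_ihull T(2)]) (use T in auto)
  also have "\<dots> = (\<Sum>p\<in>set (cyclic_pairs vs). edge_length (ihull (set vs)) (udir p) * support (ihull T) (udir p))"
    unfolding ok_edge_dirs by (rule sum.reindex_cong[OF udir_inj]) auto
  also have "\<dots> = (\<Sum>p\<in>set (cyclic_pairs vs). of_int (case p of (v, w) \<Rightarrow> isupport T (w - v)))"
  proof (rule sum.cong[OF refl])
    fix p assume p: "p \<in> set (cyclic_pairs vs)"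
    obtain v w where vw: "p = (v, w)" by (cases p)
    have "edge_length (ihull (set vs)) (udir p) * support (ihull T) (udir p) = support (ihull T) (norm (ivec (w - v)) *\<^sub>R udir p)"
      using udir_edge_length p vw support_scale[OF compact_ihull[OF T(1)]] Tn ihull_ne by auto
    also have "norm (ivec (w - v)) *\<^sub>R udir p = ivec (w - v)" using udir_facts(3)[of v w] p vw by (simp add: udir_def)
    finally show "edge_length (ihull (set vs)) (udir p) * support (ihull T) (udir p) = of_int (case p of (v, w) \<Rightarrow> isupport T (w - v))"
      using vw support_ihull[OF T(1) Tn] by simp
  qed
  also have "\<dots> = of_int (\<Sum>p\<in>set (cyclic_pairs vs). case p of (v, w) \<Rightarrow> isupport T (w - v))" by simp
  also have "(\<Sum>p\<in>set (cyclic_pairs vs). case p of (v, w) \<Rightarrow> isupport T (w - v)) = (\<Sum>(v, w)\<leftarrow>cyclic_pairs vs. isupport T (w - v))"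
    by (rule sum.distinct_set_conv_list) (rule cyclic_pairs_distinct[OF ok_simps(1)])
  finally show ?thesis .
qed

lemma ok_subset:
  assumes T: "finite T" "T \<noteq> {}" "\<And>v w. (v, w) \<in> set (cyclic_pairs vs) \<Longrightarrow> isupport T (w - v) \<le> idet v (w - v)"
  shows "ihull T \<subseteq> ihull (set vs)"
proof (rule ihull_minimal[OF _ convex_ihull])
  fix p assume p: "p \<in> T"
  show "ivec p \<in> ihull (set vs)"
  proof (rule ccontr)
    assume "ivec p \<notin> ihull (set vs)"
    then obtain e where e: "e \<in> edge_dirs (ihull (set vs))" "support (ihull (set vs)) e < rdet (ivec p) e"
      using outside_separated[OF polytope_ihull ok_interior] by (metis List.finite_set)
    then obtain v w where vw: "(v, w) \<in> set (cyclic_pairs vs)" "e = udir (v, w)" unfolding ok_edge_dirs by auto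
    have "rdet (ivec v) e = support (ihull (set vs)) e"
      using udir_facts(2)[OF vw(1)] vw(2) support_max_face by (metis ends_in_segment(1))
    then have "rdet (ivec v) e < rdet (ivec p) e" using e(2) by simp
    then have "rdet (ivec v) (ivec (w - v)) < rdet (ivec p) (ivec (w - v))"
      using udir_facts(3)[OF vw(1)] by (simp add: vw(2) udir_def field_simps)
    then have "idet v (w - v) < idet p (w - v)" unfolding rdet_ivec by linarith
    then show False using T(3)[OF vw(1)] isupport_ge[OF T(1) p, of "w - v"] by linarith
  qed
qed

text \<open>Recovers the vertices from the polygon, so that invariants of vertex lists become
  invariants of pairs of polygons.\<close>

lemma ok_extreme: "{x. x extreme_point_of ihull (set vs)} = ivec ` set vs"
proof (intro set_eqI iffI)
  fix x assume "x \<in> {x. x extreme_point_of ihull (set vs)}"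
  then show "x \<in> ivec ` set vs" unfolding ihull_def using extreme_point_of_convex_hull by blast
next
  fix x assume "x \<in> ivec ` set vs"
  then obtain v where v: "x = ivec v" "v \<in> set vs" by blast
  obtain w where w: "(v, w) \<in> set (cyclic_pairs vs)" using cyclic_pairs_ex[OF v(2)] by blast
  have "max_face (ihull (set vs)) (ivec (w - v)) face_of ihull (set vs)"
    by (intro max_face_face_of compact_ihull convex_ihull) auto
  then have "closed_segment (ivec v) (ivec w) face_of ihull (set vs)" using ok_max_face[OF w] by simp
  moreover have "ivec v extreme_point_of closed_segment (ivec v) (ivec w)" by (simp add: extreme_point_of_segment)
  ultimately show "x \<in> {x. x extreme_point_of ihull (set vs)}" using extreme_point_of_face v(1) by blast
qed

end

section \<open>Equivalence of pairs and its invariants\<close>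

type_synonym mat = "int \<times> int \<times> int \<times> int"

fun lin :: "mat \<Rightarrow> pt \<Rightarrow> pt" where
  "lin (a, b, c, d) (x, y) = (a * x + b * y, c * x + d * y)"

fun unimod :: "mat \<Rightarrow> bool" where
  "unimod (a, b, c, d) \<longleftrightarrow> \<bar>a * d - b * c\<bar> = 1"

definition aff :: "mat \<Rightarrow> pt \<Rightarrow> pt \<Rightarrow> pt" where
  "aff M t p = t + lin M p"

fun to_matrix :: "mat \<Rightarrow> int^2^2" where
  "to_matrix (a, b, c, d) = vector [vector [a, b], vector [c, d]]"

lemma real_matrix_ivec: "real_matrix (to_matrix M) *v ivec p = ivec (lin M p)"
  by (cases M; cases p) (simp add: vec2_eq_iff real_matrix_def matrix_vector_mult_def sum_2)

lemma lin_add: "lin M (p + q) = lin M p + lin M q" "lin M (p - q) = lin M p - lin M q" "lin M (- p) = - lin M p"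
  by (cases M; cases p; cases q; simp add: algebra_simps)+

lemma to_matrix_surj: obtains M where "A = to_matrix M"
proof
  show "A = to_matrix (A$1$1, A$1$2, A$2$1, A$2$2)" by (simp add: vec2_eq_iff)
qed

lemma det_to_matrix: "det (to_matrix (a, b, c, d)) = a * d - b * c"
  by (simp add: det_2)

lemma invertible_to_matrix: "invertible (to_matrix M) \<longleftrightarrow> unimod M"
proof -
  obtain a b c d where M: "M = (a, b, c, d)" by (cases M) auto
  show ?thesis
  proof
    assume "invertible (to_matrix M)"
    then obtain B where "to_matrix M ** B = mat 1" unfolding invertible_def by blast
    then have "det (to_matrix M) * det B = 1" by (metis det_mul det_I)
    then have "\<bar>det (to_matrix M)\<bar> = 1" by (metis zmult_eq_1_iff abs_1 abs_minus_cancel)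
    then show "unimod M" by (simp add: M det_to_matrix del: to_matrix.simps)
  next
    assume "unimod M"
    define e where "e = a * d - b * c"
    have "\<bar>e\<bar> = 1" using \<open>unimod M\<close> by (simp add: M e_def)
    then have e: "e * e = 1" by (metis abs_mult_self_eq mult_1)
    \<comment> \<open>The adjugate times the determinant \<open>e\<close>, which is its own
      inverse.\<close>
    define B where "B = to_matrix (e * d, - e * b, - e * c, e * a)"
    have "to_matrix M ** B = mat 1" "B ** to_matrix M = mat 1"
      using e by (auto simp: M B_def vec2_eq_iff matrix_matrix_mult_def sum_2 mat_def e_def algebra_simps)
    then show "invertible (to_matrix M)" unfolding invertible_def by blast
  qed
qed

lemma affine_image_ihull: "affine_image (to_matrix M) (ivec t) (ihull S) = ihull (aff M t ` S)"
proof -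
  have l: "linear ((*v) (real_matrix (to_matrix M)))" by (rule matrix_vector_mul_linear)
  have "affine_image (to_matrix M) (ivec t) (ihull S) = (+) (ivec t) ` ((*v) (real_matrix (to_matrix M)) ` (convex hull (ivec ` S)))"
    by (simp add: affine_image_def ihull_def image_image)
  also have "\<dots> = convex hull ((+) (ivec t) ` ((*v) (real_matrix (to_matrix M)) ` (ivec ` S)))"
    by (simp only: convex_hull_linear_image[OF l] convex_hull_translation)
  also have "\<dots> = ihull (aff M t ` S)"
    unfolding ihull_def by (simp add: image_image real_matrix_ivec aff_def ivec_add)
  finally show ?thesis .
qed

lemma equivalent_pairs_ihull:
  "equivalent_pairs (ihull S, ihull T) X \<longleftrightarrow> (\<exists>M s t. unimod M \<and>
     (X = (ihull (aff M s ` S), ihull (aff M t ` T)) \<or> X = (ihull (aff M s ` T), ihull (aff M t ` S))))"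
proof
  assume "equivalent_pairs (ihull S, ihull T) X"
  then obtain A u v where A: "invertible A" "u \<in> int_lattice" "v \<in> int_lattice"
    "X = (affine_image A u (ihull S), affine_image A v (ihull T)) \<or> X = (affine_image A u (ihull T), affine_image A v (ihull S))"
    unfolding equivalent_pairs_def by auto
  obtain M where M: "A = to_matrix M" using to_matrix_surj .
  obtain s t where "u = ivec s" "v = ivec t" using A(2,3) unfolding range_ivec by blast
  then show "\<exists>M s t. unimod M \<and> (X = (ihull (aff M s ` S), ihull (aff M t ` T)) \<or> X = (ihull (aff M s ` T), ihull (aff M t ` S)))"
    using A(1,4) unfolding M invertible_to_matrix affine_image_ihull[symmetric] by metis
next
  assume "\<exists>M s t. unimod M \<and> (X = (ihull (aff M s ` S), ihull (aff M t ` T)) \<or> X = (ihull (aff M s ` T), ihull (aff M t ` S)))"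
  then obtain M s t where M: "unimod M" "X = (ihull (aff M s ` S), ihull (aff M t ` T)) \<or> X = (ihull (aff M s ` T), ihull (aff M t ` S))"
    by blast
  show "equivalent_pairs (ihull S, ihull T) X" unfolding equivalent_pairs_def
    using M by (intro exI[of _ "to_matrix M"] exI[of _ "ivec s"] exI[of _ "ivec t"])
      (simp add: invertible_to_matrix range_ivec affine_image_ihull)
qed

lemma unimod_det: "unimod M \<Longrightarrow> \<bar>det (real_matrix (to_matrix M))\<bar> = 1"
proof -
  assume "unimod M"
  moreover obtain a b c d where M: "M = (a, b, c, d)" by (cases M) auto
  moreover have "det (real_matrix (to_matrix M)) = of_int (a * d - b * c)" by (simp add: M det_2 real_matrix_def)
  moreover have "real_of_int \<bar>a * d - b * c\<bar> = 1" using calculation(1) by (simp add: M)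
  ultimately show ?thesis by (simp only: of_int_abs)
qed

lemma measure_affine:
  assumes "unimod M" "K \<in> lmeasurable"
  shows "measure lebesgue (affine_image (to_matrix M) u K) = measure lebesgue K"
proof -
  have l: "linear ((*v) (real_matrix (to_matrix M)))" by (rule matrix_vector_mul_linear)
  have "affine_image (to_matrix M) u K = (+) u ` ((*v) (real_matrix (to_matrix M)) ` K)"
    by (simp add: affine_image_def image_image)
  then show ?thesis using measure_linear_image[OF l assms(2)] unimod_det[OF assms(1)]
    by (simp add: measure_translation)
qed

lemma affine_image_plus:
  "affine_image A u P + affine_image A v Q = affine_image A (u + v) (P + Q)"
proof (intro set_eqI iffI)
  fix x assume "x \<in> affine_image A u P + affine_image A v Q"
  then obtain p q where "x = (u + real_matrix A *v p) + (v + real_matrix A *v q)" "p \<in> P" "q \<in> Q"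
    by (auto simp: affine_image_def elim!: set_plus_elim)
  then have "x = (u + v) + real_matrix A *v (p + q)" "p + q \<in> P + Q" by (auto simp: matrix_vector_right_distrib)
  then show "x \<in> affine_image A (u + v) (P + Q)" unfolding affine_image_def by blast
next
  fix x assume "x \<in> affine_image A (u + v) (P + Q)"
  then obtain p q where x: "x = (u + v) + real_matrix A *v (p + q)" "p \<in> P" "q \<in> Q"
    by (auto simp: affine_image_def elim!: set_plus_elim)
  then have "x = (u + real_matrix A *v p) + (v + real_matrix A *v q)" by (auto simp: matrix_vector_right_distrib)
  moreover have "u + real_matrix A *v p \<in> affine_image A u P" "v + real_matrix A *v q \<in> affine_image A v Q"
    using x by (auto simp: affine_image_def)
  ultimately show "x \<in> affine_image A u P + affine_image A v Q" using set_plus_intro by blast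
qed

lemma mixed_volume_affine:
  assumes "unimod M" "compact P" "compact Q"
  shows "mixed_volume (affine_image (to_matrix M) u P) (affine_image (to_matrix M) v Q) = mixed_volume P Q"
  using assms by (simp add: mixed_volume_def normalized_volume_def affine_image_plus measure_affine
      lmeasurable_compact compact_plus)

text \<open>A convex set has interior exactly when its area is nonzero, and unimodular maps preserve
  area.\<close>

lemma interior_affine:
  assumes "unimod M" "finite S"
  shows "interior (ihull (aff M t ` S)) \<noteq> {} \<longleftrightarrow> interior (ihull S) \<noteq> {}"
proof -
  have neg: "interior (ihull T) \<noteq> {} \<longleftrightarrow> measure lebesgue (ihull T) \<noteq> 0" if "finite T" for T
  proof -
    have "ihull T \<in> lmeasurable" using that compact_ihull lmeasurable_compact by blast
    then show ?thesis using negligible_convex_interior[OF convex_ihull, of T] negligible_iff_measure0 by blast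
  qed
  have "measure lebesgue (ihull (aff M t ` S)) = measure lebesgue (ihull S)"
    unfolding affine_image_ihull[symmetric] using measure_affine assms compact_ihull lmeasurable_compact by blast
  then show ?thesis using neg assms(2) by auto
qed

lemma aff_inverse:
  assumes "unimod M"
  obtains N t' where "unimod N" "\<And>p. aff N t' (aff M t p) = p" "\<And>p. aff M t (aff N t' p) = p"
proof -
  obtain a b c d where M: "M = (a, b, c, d)" by (cases M) auto
  define e where "e = a * d - b * c"
  have "\<bar>e\<bar> = 1" using assms by (simp add: M e_def)
  then have e: "e * e = 1" "e = 1 \<or> e = - 1" by (metis abs_mult_self_eq mult_1) (use \<open>\<bar>e\<bar> = 1\<close> in linarith)
  define N where "N = (e * d, - e * b, - e * c, e * a)"
  have l: "lin N (lin M p) = p" "lin M (lin N p) = p" for p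
  proof -
    obtain x y where p: "p = (x, y)" by (cases p)
    have "lin N (lin M p) = (e * (a * d - b * c) * x, e * (a * d - b * c) * y)"
      by (simp add: M N_def p algebra_simps)
    then show "lin N (lin M p) = p" using e(1) by (simp add: e_def[symmetric] p)
    have "lin M (lin N p) = (e * (a * d - b * c) * x, e * (a * d - b * c) * y)"
      by (simp add: M N_def p algebra_simps)
    then show "lin M (lin N p) = p" using e(1) by (simp add: e_def[symmetric] p)
  qed
  have "(e * d) * (e * a) - (- e * b) * (- e * c) = e * e * e" by (simp add: e_def algebra_simps)
  then have "unimod N" using e(2) by (auto simp: N_def)
  then show ?thesis
    by (rule that[of N "- lin N t"]) (simp_all add: aff_def lin_add l)
qed

lemma aff_image_inverse:
  assumes "unimod M"
  obtains N t' where "unimod N" "\<And>S. aff N t' ` (aff M t ` S) = S" "\<And>S. aff M t ` (aff N t' ` S) = S"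
proof -
  obtain N t' where "unimod N" "\<And>p. aff N t' (aff M t p) = p" "\<And>p. aff M t (aff N t' p) = p"
    using aff_inverse[OF assms] by blast
  then show ?thesis using that[of N t'] by (simp add: image_image)
qed

lemma maximal_pair_ihull:
  "maximal_pair (ihull S) (ihull T) \<longleftrightarrow>
    (\<forall>U. finite U \<longrightarrow> ihull S \<subseteq> ihull U \<longrightarrow> mixed_volume (ihull U) (ihull T) = mixed_volume (ihull S) (ihull T) \<longrightarrow> ihull U = ihull S) \<and>
    (\<forall>U. finite U \<longrightarrow> ihull T \<subseteq> ihull U \<longrightarrow> mixed_volume (ihull S) (ihull U) = mixed_volume (ihull S) (ihull T) \<longrightarrow> ihull U = ihull T)"
    (is "?A \<longleftrightarrow> ?B")
  if "S \<noteq> {}" "T \<noteq> {}"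
proof
  assume A: ?A
  show ?B
  proof (intro conjI allI impI)
    fix U assume U: "finite U" "ihull S \<subseteq> ihull U" "mixed_volume (ihull U) (ihull T) = mixed_volume (ihull S) (ihull T)"
    then have "lattice_polytope (ihull U)" using that ihull_ne[of U] ihull_ne[of S] lattice_polytope_ihull by blast
    then show "ihull U = ihull S" using A U unfolding maximal_pair_def by blast
  next
    fix U assume U: "finite U" "ihull T \<subseteq> ihull U" "mixed_volume (ihull S) (ihull U) = mixed_volume (ihull S) (ihull T)"
    then have "lattice_polytope (ihull U)" using that ihull_ne[of U] ihull_ne[of T] lattice_polytope_ihull by blast
    then show "ihull U = ihull T" using A U unfolding maximal_pair_def by blast
  qed
next
  assume ?B
  then show ?A unfolding maximal_pair_def lattice_polytope_ihull by blast
qed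

lemma maximal_pair_commute: "maximal_pair P Q \<longleftrightarrow> maximal_pair Q P"
proof -
  have "maximal_pair Q P" if A: "maximal_pair P Q" for P Q :: "(real^2) set"
    unfolding maximal_pair_def
  proof (intro conjI allI impI; elim conjE)
    fix X assume "lattice_polytope X" "Q \<subseteq> X" "mixed_volume X P = mixed_volume Q P"
    then show "X = Q" using A[unfolded maximal_pair_def, THEN conjunct2, rule_format, of X]
      by (simp only: mixed_volume_commute[of P])
  next
    fix X assume "lattice_polytope X" "P \<subseteq> X" "mixed_volume Q X = mixed_volume Q P"
    then show "X = P" using A[unfolded maximal_pair_def, THEN conjunct1, rule_format, of X]
      by (simp only: mixed_volume_commute[of Q])
  qed
  then show ?thesis by blast
qed

lemma ihull_aff_subset:
  assumes "unimod M" shows "ihull (aff M t ` S) \<subseteq> ihull (aff M t ` U) \<longleftrightarrow> ihull S \<subseteq> ihull U"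
proof -
  have mono: "ihull (aff M t ` S) \<subseteq> ihull (aff M t ` U)" if "ihull S \<subseteq> ihull U" for M t S U
    unfolding affine_image_ihull[symmetric] affine_image_def using that by blast
  obtain N t' where "\<And>S. aff N t' ` (aff M t ` S) = S" using aff_image_inverse[OF assms] by metis
  then show ?thesis using mono[of S U M t] mono[of "aff M t ` S" "aff M t ` U" N t'] by auto
qed

lemma mixed_volume_ihull_aff:
  "unimod M \<Longrightarrow> finite S \<Longrightarrow> finite T \<Longrightarrow>
    mixed_volume (ihull (aff M s ` S)) (ihull (aff M t ` T)) = mixed_volume (ihull S) (ihull T)"
  unfolding affine_image_ihull[symmetric] by (intro mixed_volume_affine compact_ihull)

lemma maximal_pair_aff:
  assumes "maximal_pair (ihull S) (ihull T)" "finite S" "finite T" "S \<noteq> {}" "T \<noteq> {}" "unimod M"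
  shows "maximal_pair (ihull (aff M s ` S)) (ihull (aff M t ` T))"
proof -
  note A = assms(1)[unfolded maximal_pair_ihull[OF assms(4,5)]]
  have ne: "aff M s ` S \<noteq> {}" "aff M t ` T \<noteq> {}" using assms by auto
  show ?thesis unfolding maximal_pair_ihull[OF ne]
  proof (intro conjI allI impI)
    fix U assume U: "finite U" "ihull (aff M s ` S) \<subseteq> ihull U"
      "mixed_volume (ihull U) (ihull (aff M t ` T)) = mixed_volume (ihull (aff M s ` S)) (ihull (aff M t ` T))"
    obtain N t' where N: "\<And>S. aff M s ` (aff N t' ` S) = S" using aff_image_inverse[OF assms(6)] by metis
    define U' where "U' = aff N t' ` U"
    have UU: "U = aff M s ` U'" "finite U'" using N U(1) by (auto simp: U'_def)
    have "ihull S \<subseteq> ihull U'" using U(2) unfolding UU(1) ihull_aff_subset[OF assms(6)] .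
    moreover have "mixed_volume (ihull U') (ihull T) = mixed_volume (ihull S) (ihull T)"
      using U(3) unfolding UU(1) mixed_volume_ihull_aff[OF assms(6) UU(2) assms(3)] mixed_volume_ihull_aff[OF assms(6) assms(2,3)] .
    ultimately have "ihull U' = ihull S" using A UU(2) by blast
    then show "ihull U = ihull (aff M s ` S)" unfolding UU(1) affine_image_ihull[symmetric] by simp
  next
    fix U assume U: "finite U" "ihull (aff M t ` T) \<subseteq> ihull U"
      "mixed_volume (ihull (aff M s ` S)) (ihull U) = mixed_volume (ihull (aff M s ` S)) (ihull (aff M t ` T))"
    obtain N t' where N: "\<And>S. aff M t ` (aff N t' ` S) = S" using aff_image_inverse[OF assms(6)] by metis
    define U' where "U' = aff N t' ` U"
    have UU: "U = aff M t ` U'" "finite U'" using N U(1) by (auto simp: U'_def)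
    have "ihull T \<subseteq> ihull U'" using U(2) unfolding UU(1) ihull_aff_subset[OF assms(6)] .
    moreover have "mixed_volume (ihull S) (ihull U') = mixed_volume (ihull S) (ihull T)"
      using U(3) unfolding UU(1) mixed_volume_ihull_aff[OF assms(6,2) UU(2)] mixed_volume_ihull_aff[OF assms(6) assms(2,3)] .
    ultimately have "ihull U' = ihull T" using A UU(2) by blast
    then show "ihull U = ihull (aff M t ` T)" unfolding UU(1) affine_image_ihull[symmetric] by simp
  qed
qed

lemma aff_dim_ihull: "aff_dim (ihull S) = 2 \<longleftrightarrow> interior (ihull S) \<noteq> {}"
proof
  assume a: "aff_dim (ihull S) = 2"
  show "interior (ihull S) \<noteq> {}"
  proof
    assume "interior (ihull S) = {}"
    then obtain n d where n: "n \<noteq> 0" "ihull S \<subseteq> {x. n \<bullet> x = d}"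
      using empty_interior_subset_hyperplane[OF convex_ihull] by blast
    then have "aff_dim (ihull S) \<le> aff_dim {x. n \<bullet> x = d}" by (intro aff_dim_subset)
    then show False using a aff_dim_hyperplane[OF n(1), of d] by simp
  qed
next
  assume "interior (ihull S) \<noteq> {}"
  then show "aff_dim (ihull S) = 2" using aff_dim_nonempty_interior[of "ihull S"] by simp
qed

definition maxpair :: "nat \<Rightarrow> pt set \<Rightarrow> pt set \<Rightarrow> bool" where
  "maxpair m S T \<longleftrightarrow> finite S \<and> finite T \<and> interior (ihull S) \<noteq> {} \<and> interior (ihull T) \<noteq> {} \<and>
     mixed_volume (ihull S) (ihull T) = real m \<and> maximal_pair (ihull S) (ihull T)"

lemma maxpair_ne: "maxpair m S T \<Longrightarrow> S \<noteq> {} \<and> T \<noteq> {}"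
  unfolding maxpair_def using interior_subset ihull_ne by blast

lemma maximal_pairs_eq: "maximal_pairs m = {(ihull S, ihull T) |S T. maxpair m S T}"
proof (intro set_eqI iffI)
  fix X assume "X \<in> maximal_pairs m"
  then obtain P Q where X: "X = (P, Q)" "lattice_polytope P" "lattice_polytope Q" "aff_dim P = 2" "aff_dim Q = 2"
    "mixed_volume P Q = real m" "maximal_pair P Q" unfolding maximal_pairs_def by blast
  then obtain S T where "finite S" "P = ihull S" "finite T" "Q = ihull T" unfolding lattice_polytope_ihull by blast
  then have "X = (ihull S, ihull T)" "maxpair m S T" using X aff_dim_ihull unfolding maxpair_def by auto
  then show "X \<in> {(ihull S, ihull T) |S T. maxpair m S T}" by blast
next
  fix X assume "X \<in> {(ihull S, ihull T) |S T. maxpair m S T}"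
  then obtain S T where X: "X = (ihull S, ihull T)" "maxpair m S T" by blast
  then have "S \<noteq> {}" "T \<noteq> {}" using maxpair_ne by auto
  then show "X \<in> maximal_pairs m" using X aff_dim_ihull lattice_polytope_ihull
    unfolding maximal_pairs_def maxpair_def by blast
qed

lemma maxpair_commute: "maxpair m S T \<Longrightarrow> maxpair m T S"
  unfolding maxpair_def using maximal_pair_commute mixed_volume_commute by metis

lemma maxpair_aff: "maxpair m S T \<Longrightarrow> unimod M \<Longrightarrow> maxpair m (aff M s ` S) (aff M t ` T)"
  using maxpair_ne[of m S T] unfolding maxpair_def
  by (auto simp: interior_affine mixed_volume_ihull_aff intro: maximal_pair_aff)

section \<open>Unimodular invariants of vertex lists\<close>

fun differences :: "pt list \<Rightarrow> pt list" where
  "differences [] = []"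
| "differences (x # xs) = map (\<lambda>y. y - x) xs @ differences xs"

text \<open>\<open>differences\<close> meets every unordered pair of vertices once, with a sign that
  depends on the order of the list. For even \<open>f\<close> the double sum over the vertex set,
  minus its diagonal, shows that the order does not matter.\<close>

lemma sum_list_differences:
  fixes f :: "pt \<Rightarrow> int"
  assumes "\<And>d. f (- d) = f d" "distinct vs"
  shows "2 * sum_list (map f (differences vs)) = (\<Sum>p\<in>set vs. \<Sum>q\<in>set vs. f (q - p)) - int (length vs) * f 0"
  using assms(2)
proof (induction vs)
  case (Cons x xs)
  have sym: "f (x - p) = f (p - x)" for p using assms(1)[of "p - x"] by simp
  have l: "sum_list (map f (map (\<lambda>y. y - x) xs)) = (\<Sum>q\<in>set xs. f (q - x))"
    using Cons.prems by (simp add: sum.distinct_set_conv_list comp_def)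
  have "(\<Sum>p\<in>set (x # xs). \<Sum>q\<in>set (x # xs). f (q - p)) =
    f 0 + (\<Sum>q\<in>set xs. f (q - x)) + (\<Sum>p\<in>set xs. f (p - x)) + (\<Sum>p\<in>set xs. \<Sum>q\<in>set xs. f (q - p))"
    using Cons.prems by (simp add: sum.distrib sym)
  then show ?case using Cons l by (simp add: algebra_simps)
qed simp

lemma aff_inj: assumes "unimod M" shows "inj_on (aff M t) V"
proof -
  obtain N t' where "\<And>p. aff N t' (aff M t p) = p" using aff_inverse[OF assms, of t] by metis
  then show ?thesis by (metis inj_onI)
qed

lemma sum_list_differences_aff:
  fixes f :: "pt \<Rightarrow> int"
  assumes f: "\<And>d. f (- d) = f d" and d: "distinct vs" "distinct ws" and M: "unimod M" "set ws = aff M t ` set vs"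
  shows "sum_list (map f (differences ws)) = sum_list (map (\<lambda>d. f (lin M d)) (differences vs))"
proof -
  have l: "length ws = length vs" using d M by (metis aff_inj card_image distinct_card)
  have "(\<Sum>p\<in>set ws. \<Sum>q\<in>set ws. f (q - p)) = (\<Sum>p\<in>set vs. \<Sum>q\<in>set vs. f (aff M t q - aff M t p))"
    unfolding M(2) by (simp add: sum.reindex[OF aff_inj[OF M(1)]])
  also have "\<dots> = (\<Sum>p\<in>set vs. \<Sum>q\<in>set vs. f (lin M (q - p)))" by (simp add: aff_def lin_add)
  finally have eq: "(\<Sum>p\<in>set ws. \<Sum>q\<in>set ws. f (q - p)) = (\<Sum>p\<in>set vs. \<Sum>q\<in>set vs. f (lin M (q - p)))" .
  have l0: "lin M 0 = 0" using lin_add(2)[of M 0 0] by simp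
  have "2 * sum_list (map f (differences ws)) = 2 * sum_list (map (\<lambda>d. f (lin M d)) (differences vs))"
    unfolding sum_list_differences[where f = f, OF f d(2)] eq l
    by (subst sum_list_differences[where f = "\<lambda>d. f (lin M d)"]) (simp_all add: d lin_add f l0)
  then show ?thesis by simp
qed

definition pgcd :: "pt \<Rightarrow> int" where "pgcd p = gcd (fst p) (snd p)"

text \<open>An integer matrix can only multiply the greatest common divisor by an integer; applying
  this to the inverse matrix as well gives equality.\<close>

lemma pgcd_lin: assumes "unimod M" shows "pgcd (lin M p) = pgcd p"
proof -
  have dv: "pgcd p dvd pgcd (lin N p)" for N p
    by (cases N; cases p) (auto simp: pgcd_def intro!: dvd_add dvd_mult)
  obtain N t' where N: "\<And>p. aff N t' (aff M 0 p) = p" using aff_inverse[OF assms] by metis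
  have l0: "lin K 0 = 0" for K using lin_add(2)[of K 0 0] by simp
  have "t' = 0" using N[of 0] by (simp add: aff_def l0)
  then have "lin N (lin M p) = p" using N[of p] by (simp add: aff_def)
  then have "pgcd (lin M p) dvd pgcd p" using dv[of "lin M p" N] by simp
  then show ?thesis using dv[of p M] by (simp add: pgcd_def gcd_unique zdvd_antisym_nonneg)
qed

lemma pgcd_minus [simp]: "pgcd (- p) = pgcd p" by (simp add: pgcd_def)

lemma idet_lin: "unimod M \<Longrightarrow> \<bar>idet (lin M p) (lin M q)\<bar> = \<bar>idet p q\<bar>"
proof -
  assume u: "unimod M"
  obtain a b c d x y z w where M: "M = (a, b, c, d)" and p: "p = (x, y)" "q = (z, w)"
    by (cases M; cases p; cases q) auto
  have "idet (lin M p) (lin M q) = (a * d - b * c) * idet p q" by (simp add: M p idet_def algebra_simps)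
  then show ?thesis using u by (simp add: M abs_mult)
qed

text \<open>Two invariants of vertex sets that turn out to be fine enough to separate all pairs in the classification.\<close>
definition area_inv :: "pt list \<Rightarrow> int" where
  "area_inv vs = (\<Sum>d\<leftarrow>differences vs. pgcd d * (\<Sum>e\<leftarrow>differences vs. pgcd e * \<bar>idet d e\<bar>))"

definition mixed_inv :: "pt list \<Rightarrow> pt list \<Rightarrow> int" where
  "mixed_inv vs ws = (\<Sum>d\<leftarrow>differences vs. \<Sum>e\<leftarrow>differences ws. pgcd (d + e) + pgcd (d - e))"

lemma area_inv_aff:
  assumes d: "distinct vs" "distinct ws" and M: "unimod M" "set ws = aff M t ` set vs"
  shows "area_inv ws = area_inv vs"
proof -
  have 1: "(\<Sum>e\<leftarrow>differences ws. pgcd e * \<bar>idet d e\<bar>) = (\<Sum>e\<leftarrow>differences vs. pgcd e * \<bar>idet d (lin M e)\<bar>)" for d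
    by (subst sum_list_differences_aff[OF _ d M]) (simp_all add: pgcd_lin M)
  show ?thesis unfolding area_inv_def 1
    by (subst sum_list_differences_aff[OF _ d M]) (simp_all add: pgcd_lin M idet_lin)
qed

lemma pgcd_skew: "pgcd (d - e) = pgcd (e - d)" using pgcd_minus[of "d - e"] by simp

text \<open>Summing over both signs makes the summand even in \<open>d\<close> and in
  \<open>e\<close> separately, as required for sums over \<open>differences\<close>.\<close>

lemma mixed_inv_aff:
  assumes d: "distinct vs" "distinct vs'" "distinct ws" "distinct ws'"
    and M: "unimod M" "set vs' = aff M s ` set vs" "set ws' = aff M t ` set ws"
  shows "mixed_inv vs' ws' = mixed_inv vs ws"
proof -
  have e1: "pgcd (d + - e) + pgcd (d - - e) = pgcd (d + e) + pgcd (d - e)" for d e by simp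
  have e2: "pgcd (- d + e) + pgcd (- d - e) = pgcd (d + e) + pgcd (d - e)" for d e
    using pgcd_minus[of "d + e"] pgcd_skew[of d e] by (simp add: algebra_simps del: pgcd_minus)
  have 1: "(\<Sum>e\<leftarrow>differences ws'. pgcd (d + e) + pgcd (d - e)) = (\<Sum>e\<leftarrow>differences ws. pgcd (d + lin M e) + pgcd (d - lin M e))" for d
    by (rule sum_list_differences_aff[where f = "\<lambda>e. pgcd (d + e) + pgcd (d - e)", OF e1 d(3,4) M(1,3)])
  have ev: "(\<Sum>e\<leftarrow>differences ws. pgcd (- d + lin M e) + pgcd (- d - lin M e)) =
      (\<Sum>e\<leftarrow>differences ws. pgcd (d + lin M e) + pgcd (d - lin M e))" for d by (simp only: e2)
  show ?thesis unfolding mixed_inv_def 1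
    by (subst sum_list_differences_aff[where f = "\<lambda>d. \<Sum>e\<leftarrow>differences ws. pgcd (d + lin M e) + pgcd (d - lin M e)",
        OF ev d(1,2) M(1,2)]) (simp add: lin_add(1,2)[symmetric] pgcd_lin M(1))
qed

lemma mixed_inv_commute: "mixed_inv vs ws = mixed_inv ws vs"
proof -
  have sw: "(\<Sum>d\<leftarrow>A. \<Sum>e\<leftarrow>B. f d e) = (\<Sum>e\<leftarrow>B. \<Sum>d\<leftarrow>A. f d e)" for A B :: "pt list" and f :: "pt \<Rightarrow> pt \<Rightarrow> int"
    by (induction A) (simp_all add: sum_list_addf)
  show ?thesis unfolding mixed_inv_def by (subst sw) (simp add: add.commute pgcd_skew[of _ _])
qed

lemma ihull_eq_vertices:
  assumes "convex_ok vs" "convex_ok ws" "ihull (set ws) = ihull (aff M t ` set vs)" "unimod M"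
  shows "set ws = aff M t ` set vs"
proof -
  have sub: "set ws \<subseteq> aff M t ` set vs"
    if "convex_ok ws" "ihull (set ws) = ihull (aff M t ` set vs)" for vs ws M t
  proof
    fix p assume "p \<in> set ws"
    then have "ivec p extreme_point_of ihull (set ws)" using ok_extreme[OF that(1)] by blast
    then have "ivec p \<in> ivec ` (aff M t ` set vs)" unfolding that(2) unfolding ihull_def by (rule extreme_point_of_convex_hull)
    then obtain q where "ivec p = ivec q" "q \<in> aff M t ` set vs" by blast
    then show "p \<in> aff M t ` set vs" by (simp only: ivec_inj)
  qed
  obtain N t' where N: "unimod N" "\<And>S. aff N t' ` (aff M t ` S) = S" "\<And>S. aff M t ` (aff N t' ` S) = S"
    using aff_image_inverse[OF assms(4)] by metis
  have "ihull (set vs) = ihull (aff N t' ` set ws)"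
    using assms(3) by (metis affine_image_ihull N(2))
  then have "set vs \<subseteq> aff N t' ` set ws" using sub assms(1) by blast
  then have "aff M t ` set vs \<subseteq> set ws" using N(3)[of "set ws"] by blast
  then show ?thesis using sub[OF assms(2,3)] by blast
qed

lemma equivalent_invariants:
  assumes ok: "convex_ok P" "convex_ok Q" "convex_ok P'" "convex_ok Q'"
    and eq: "equivalent_pairs (ihull (set P), ihull (set Q)) (ihull (set P'), ihull (set Q'))"
  shows "area_inv P + area_inv Q = area_inv P' + area_inv Q'" "area_inv P * area_inv Q = area_inv P' * area_inv Q'" "mixed_inv P Q = mixed_inv P' Q'"
proof -
  have ds: "distinct P" "distinct Q" "distinct P'" "distinct Q'" using ok ok_simps by auto
  obtain M s t where M: "unimod M" and
    c: "(ihull (set P') = ihull (aff M s ` set P) \<and> ihull (set Q') = ihull (aff M t ` set Q)) \<or>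
     (ihull (set P') = ihull (aff M s ` set Q) \<and> ihull (set Q') = ihull (aff M t ` set P))"
    using eq unfolding equivalent_pairs_ihull prod.inject by metis
  from c have "area_inv P + area_inv Q = area_inv P' + area_inv Q' \<and> area_inv P * area_inv Q = area_inv P' * area_inv Q' \<and> mixed_inv P Q = mixed_inv P' Q'"
  proof
    assume "ihull (set P') = ihull (aff M s ` set P) \<and> ihull (set Q') = ihull (aff M t ` set Q)"
    then have v: "set P' = aff M s ` set P" "set Q' = aff M t ` set Q" using ihull_eq_vertices ok M by blast+
    show ?thesis using area_inv_aff[OF ds(1,3) M v(1)] area_inv_aff[OF ds(2,4) M v(2)] mixed_inv_aff[OF ds(1,3,2,4) M v] by simp
  next
    assume "ihull (set P') = ihull (aff M s ` set Q) \<and> ihull (set Q') = ihull (aff M t ` set P)"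
    then have v: "set P' = aff M s ` set Q" "set Q' = aff M t ` set P" using ihull_eq_vertices ok M by blast+
    show ?thesis using area_inv_aff[OF ds(2,3) M v(1)] area_inv_aff[OF ds(1,4) M v(2)] mixed_inv_aff[OF ds(2,3,1,4) M v]
      mixed_inv_commute[of P Q] by simp
  qed
  then show "area_inv P + area_inv Q = area_inv P' + area_inv Q'" "area_inv P * area_inv Q = area_inv P' * area_inv Q'" "mixed_inv P Q = mixed_inv P' Q'" by auto
qed

section \<open>Certificates\<close>

fun point_diff :: "pt \<Rightarrow> pt \<Rightarrow> pt" where "point_diff (a, b) (c, d) = (a - c, b - d)"

lemma point_diff_eq: "point_diff p q = p - q" by (cases p; cases q) simp

lemma idet_code [code]: "idet (a, b) (c, d) = a * d - b * c" by (simp add: idet_def)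

lemma aff_code [code]: "aff (a, b, c, d) (s, t) (x, y) = (s + (a * x + b * y), t + (c * x + d * y))"
  by (simp add: aff_def)

fun all_left :: "pt \<Rightarrow> pt \<Rightarrow> pt list \<Rightarrow> bool" where
  "all_left v w [] = True"
| "all_left v w (z # zs) = (if (if z = v then True else if z = w then True else idet (point_diff z v) (point_diff w v) < 0) then all_left v w zs else False)"

fun all_edges :: "(pt \<times> pt) list \<Rightarrow> pt list \<Rightarrow> bool" where
  "all_edges [] zs = True"
| "all_edges ((v, w) # es) zs = (if all_left v w zs then all_edges es zs else False)"

lemma all_left_iff: "all_left v w zs \<longleftrightarrow> (\<forall>z\<in>set zs. z = v \<or> z = w \<or> idet (z - v) (w - v) < 0)"
  by (induction zs) (auto simp: point_diff_eq)

lemma all_edges_iff: "all_edges es zs \<longleftrightarrow> (\<forall>(v, w)\<in>set es. all_left v w zs)"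
  by (induction es zs rule: all_edges.induct) auto

lemma convex_ok_code [code]: "convex_ok vs \<longleftrightarrow> distinct vs \<and> 3 \<le> length vs \<and> all_edges (cyclic_pairs vs) vs"
  unfolding convex_ok_def all_edges_iff all_left_iff ..

fun maxl :: "pt \<Rightarrow> pt list \<Rightarrow> int" where
  "maxl q [] = 0"
| "maxl q [p] = idet p q"
| "maxl q (p # p' # ps) = (let a = idet p q; b = maxl q (p' # ps) in if a \<le> b then b else a)"

lemma maxl_isupport: "ps \<noteq> [] \<Longrightarrow> maxl q ps = isupport (set ps) q"
proof (induction q ps rule: maxl.induct)
  case (3 q p p' ps)
  have "isupport (set (p # p' # ps)) q = max (idet p q) (isupport (set (p' # ps)) q)"
    unfolding isupport_def by (simp add: Max_insert)
  then show ?case using 3 by (simp add: max_def Let_def)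
qed (auto simp: isupport_def)

text \<open>Primitive direction, lattice length and support value of an edge.\<close>

definition edge_data :: "pt \<times> pt \<Rightarrow> pt \<times> int \<times> int" where
  "edge_data = (\<lambda>(v, w). let (x, y) = point_diff w v; g = pgcd (x, y); u = (x div g, y div g) in (u, g, idet v u))"

definition edges_data :: "pt list \<Rightarrow> (pt \<times> int \<times> int) list" where
  "edges_data vs = map edge_data (cyclic_pairs vs)"

text \<open>Repeating the first entry makes every direction lie in the cone of two consecutive edge directions.\<close>
definition close_cycle :: "'a list \<Rightarrow> 'a list" where
  "close_cycle xs = xs @ [hd xs]"

text \<open>Here \<open>w = (a u + b u') / d\<close> with nonnegative \<open>a\<close>, \<open>b\<close>. Support values of lattice polygons are integers, so the bound for \<open>w\<close>
  that follows from those for \<open>u\<close> and \<open>u'\<close> may be rounded down (a Chvatal--Gomory cut). Where the rounded bounds are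
  too weak at once, bounds for intermediate directions are inserted first (\<open>add_cut\<close>).\<close>
fun cone_floor :: "pt \<Rightarrow> (pt \<times> int) list \<Rightarrow> int option" where
  "cone_floor w ((u, h) # (u', h') # r) = (let a = idet w u'; b = idet u w; d = idet u u' in
     if 0 \<le> a then if 0 \<le> b then if 0 < d then Some ((a * h + b * h') div d) else cone_floor w ((u', h') # r)
     else cone_floor w ((u', h') # r) else cone_floor w ((u', h') # r))"
| "cone_floor w _ = None"

fun add_cut :: "pt \<Rightarrow> (pt \<times> int) list \<Rightarrow> (pt \<times> int) list" where
  "add_cut w ((u, h) # (u', h') # r) = (let a = idet w u'; b = idet u w; d = idet u u' in
     if 0 \<le> a then if 0 \<le> b then if 0 < d then (u, h) # (w, (a * h + b * h') div d) # (u', h') # r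
     else (u, h) # add_cut w ((u', h') # r) else (u, h) # add_cut w ((u', h') # r) else (u, h) # add_cut w ((u', h') # r))"
| "add_cut w L = L"

fun bounded_by :: "(pt \<times> int \<times> int) list \<Rightarrow> (pt \<times> int) list \<Rightarrow> bool" where
  "bounded_by [] L = True"
| "bounded_by ((u, g, h) # es) L = (case cone_floor u L of None \<Rightarrow> False
     | Some c \<Rightarrow> if c \<le> h then bounded_by es L else False)"

text \<open>A test that every lattice polygon obeying the support bounds \<open>L\<close> lies in
  \<open>P\<close>; \<open>cuts\<close> are the directions for which rounded bounds are inserted
  beforehand.\<close>

definition dominated :: "pt list \<Rightarrow> pt list \<Rightarrow> (pt \<times> int) list \<Rightarrow> bool" where
  "dominated P cuts L = bounded_by (edges_data P) (fold add_cut cuts L)"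

definition support_bounds :: "pt list \<Rightarrow> pt list \<Rightarrow> (pt \<times> int) list" where
  "support_bounds R P = close_cycle (map (\<lambda>(u, g, h). (u, maxl u P)) (edges_data R))"

definition mixed_vol :: "pt list \<Rightarrow> pt list \<Rightarrow> int" where
  "mixed_vol R P = (\<Sum>(u, g, h)\<leftarrow>edges_data R. g * maxl u P)"

section \<open>Bounds for enlargements of a fixed polygon\<close>

fun dot :: "int list \<Rightarrow> int list \<Rightarrow> int" where
  "dot (a # as) (b # bs) = a * b + dot as bs"
| "dot _ _ = 0"

text \<open>The symbolic form of \<open>cone_floor\<close>: coefficients with respect to all support
  values, so that bounds are prepared once and only evaluated at the leaves. Denominator 0 signals
  failure.\<close>

fun cone_coeffs :: "pt \<Rightarrow> pt list \<Rightarrow> int list \<times> int" where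
  "cone_coeffs w (u # u' # r) = (let a = idet w u'; b = idet u w; d = idet u u' in
     if 0 \<le> a \<and> 0 \<le> b \<and> 0 < d then (a # b # map (\<lambda>_. 0) r, d)
     else (case cone_coeffs w (u' # r) of (v, d) \<Rightarrow> (0 # v, d)))"
| "cone_coeffs w _ = ([], 0)"

fun vadd :: "int \<Rightarrow> int list \<Rightarrow> int list \<Rightarrow> int list" where
  "vadd l (a # as) (b # bs) = (l * a + b) # vadd l as bs"
| "vadd l _ bs = bs"

text \<open>A pair \<open>(v0, rs)\<close> stands for the upper bound \<open>v0 \<bullet> h\<close> plus the sum of \<open>l * ((v \<bullet> h) div d)\<close> over
  \<open>(v, d, l) \<in> set rs\<close> for the mixed volume of a polygon \<open>L\<close> and any polygon with support vector \<open>h\<close>.\<close>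
type_synonym con = "int list \<times> (int list \<times> int \<times> int) list"

text \<open>Edges whose direction has denominator 1 involve no rounding and are merged into one
  linear form; the others are kept apart, as each is rounded on its own.\<close>

fun volume_bound :: "pt list \<Rightarrow> (pt \<times> int \<times> int) list \<Rightarrow> con option" where
  "volume_bound us [] = Some (map (\<lambda>_. 0) us, [])"
| "volume_bound us ((w, l, h) # es) = (case volume_bound us es of None \<Rightarrow> None | Some (v0, rs) \<Rightarrow>
     (case cone_coeffs w us of (v, d) \<Rightarrow>
       if d = 1 then Some (vadd l v v0, rs) else if d = 0 then None else Some (v0, (v, d, l) # rs)))"

fun extra :: "int list \<Rightarrow> (int list \<times> int \<times> int) list \<Rightarrow> int" where
  "extra h [] = 0"
| "extra h ((v, d, l) # rs) = l * (dot v h div d) + extra h rs"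

fun pruned :: "int list \<Rightarrow> int \<Rightarrow> con list \<Rightarrow> bool" where
  "pruned h m [] = False"
| "pruned h m ((v0, rs) # cs) = (if dot v0 h + extra h rs \<le> m then True else pruned h m cs)"

definition visible :: "pt \<Rightarrow> pt \<times> pt \<Rightarrow> bool" where
  "visible x e = (case e of (v, w) \<Rightarrow> 0 \<le> idet (point_diff x v) (point_diff w v))"

text \<open>The hull of \<open>R\<close> and \<open>x\<close>: the chain of edges visible from
  \<open>x\<close> is replaced by \<open>x\<close>, and a vertex disappears if both of its edges are
  visible. The output is validated by \<open>good_ext\<close>.\<close>

definition insert_point :: "pt list \<Rightarrow> pt \<Rightarrow> pt list" where
  "insert_point R x = concat (map (\<lambda>(u, v, w). let a = visible x (u, v); b = visible x (v, w) in
     (if a then if b then [] else [v] else if b then [v, x] else [v])) (zip (last R # butlast R) (cyclic_pairs R)))"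

fun inside_edges :: "(pt \<times> pt) list \<Rightarrow> pt \<Rightarrow> bool" where
  "inside_edges [] p = True"
| "inside_edges ((v, w) # es) p = (if idet (point_diff p v) (point_diff w v) \<le> 0 then inside_edges es p else False)"

definition good_ext :: "pt list \<Rightarrow> pt list \<Rightarrow> bool" where
  "good_ext R L \<longleftrightarrow> convex_ok L \<and> list_all (inside_edges (cyclic_pairs L)) R \<and> \<not> list_all (inside_edges (cyclic_pairs R)) L"

fun ext_cons :: "pt list \<Rightarrow> pt list \<Rightarrow> pt list \<Rightarrow> con list option" where
  "ext_cons R us [] = Some []"
| "ext_cons R us (x # xs) = (let L = insert_point R x in if good_ext R L then
     (case volume_bound us (edges_data L) of None \<Rightarrow> None | Some c \<Rightarrow>
       (case ext_cons R us xs of None \<Rightarrow> None | Some cs \<Rightarrow> Some (c # cs))) else None)"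

fun le_list :: "int list \<Rightarrow> int list \<Rightarrow> bool" where
  "le_list (a # as) (b # bs) = (if a \<le> b then le_list as bs else False)"
| "le_list _ _ = True"

fun mem_list :: "int list \<Rightarrow> int list list \<Rightarrow> bool" where
  "mem_list h [] = False"
| "mem_list h (k # ks) = (if h = k then True else mem_list h ks)"

text \<open>The components of \<open>(v, d, al, ev, cs, hs)\<close>: the volume \<open>v\<close> of \<open>R\<close>; the convexity relation \<open>d * b \<le> al * a\<close> between the
  last two support values; the support values \<open>ev\<close> of the first edge vector; bounds \<open>cs\<close> for polygons larger than
  \<open>R\<close>; the support vectors \<open>hs\<close> of the listed partners. The argument \<open>s\<close> is the rest of the budget 10 of mixed volume,
  so that \<open>10 - s\<close> is the mixed volume at a leaf.\<close>
type_synonym leafdata = "int \<times> int \<times> int \<times> int list \<times> con list \<times> int list list"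

text \<open>The exits in order: \<open>R\<close> is too large for this mixed volume; no polygon has
  these support values; the point \<open>u0\<close> satisfies all bounds, against the normalisation;
  a larger polygon than \<open>R\<close> has the same mixed volume; the partner is listed.\<close>

fun leaf :: "leafdata \<Rightarrow> int \<Rightarrow> int \<Rightarrow> int \<Rightarrow> int list \<Rightarrow> bool" where
  "leaf (v, d, al, ev, cs, hs) s a b h =
    (let m = 10 - s in if m < v then True else if al * a < d * b then True else if le_list ev h then True
     else if pruned h m cs then True else mem_list h hs)"

text \<open>An edge with lattice length \<open>l\<close> and support value \<open>t\<close>, preceded by edges with support values \<open>a\<close>, \<open>b\<close>, contributes
  \<open>l * t\<close> to the mixed volume and requires \<open>d * b \<le> al * a + be * t\<close>.\<close>
type_synonym level = "int \<times> int \<times> int \<times> int"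

text \<open>Lattice lengths are at least 1, so the budget excludes values above 10. The cost grows
  with \<open>t\<close>, which allows \<open>loop\<close> to stop at the first value that exceeds
  the budget.\<close>

function dfs :: "leafdata \<Rightarrow> level list \<Rightarrow> int \<Rightarrow> int \<Rightarrow> int \<Rightarrow> int list \<Rightarrow> bool"
  and loop :: "leafdata \<Rightarrow> level \<Rightarrow> level list \<Rightarrow> int \<Rightarrow> int \<Rightarrow> int \<Rightarrow> int list \<Rightarrow> int list \<Rightarrow> bool" where
  "dfs D [] s a b acc = leaf D s a b (rev acc)"
| "dfs D (st # r) s a b acc = loop D st r s a b acc [0, 1, 2, 3, 4, 5, 6, 7, 8, 9, 10]"
| "loop D st r s a b acc [] = True"
| "loop D (l, d, al, be) r s a b acc (t # ts) =
    (if s < l * t then True else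
     if (if al * a + be * t < d * b then True else dfs D r (s - l * t) b t (t # acc))
     then loop D (l, d, al, be) r s a b acc ts else False)"
  by pat_completeness auto
termination
  by (relation "measures [\<lambda>x. case x of Inl (D, L, _) \<Rightarrow> length L | Inr (D, st, r, _) \<Rightarrow> length r,
      \<lambda>x. case x of Inl _ \<Rightarrow> 0 | Inr (D, st, r, s, a, b, acc, ts) \<Rightarrow> Suc (length ts)]") auto

text \<open>The relation is sublinearity of the support function at the middle one of three
  consecutive directions. If the outer two turn by a half-turn or more, zero coefficients make it
  vacuous.\<close>

fun steps :: "(pt \<times> int) list \<Rightarrow> level list" where
  "steps ((u, l) # (u', l') # (u'', l'') # r) =
    (let d = idet u u''; a = idet u' u''; b = idet u u' in
      if 0 < d \<and> 0 \<le> a \<and> 0 \<le> b then (l'', d, a, b) else (l'', 0, 0, 0))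
     # steps ((u', l') # (u'', l'') # r)"
| "steps _ = []"

text \<open>The relation at the last direction, between its predecessor and the first one; the term
  of the first direction \<open>w\<close> is absent because its support value is normalised to
  0.\<close>

fun wrap :: "pt list \<Rightarrow> pt \<Rightarrow> int \<times> int" where
  "wrap [u, u'] w = (let d = idet u w; a = idet u' w in
    if 0 < d \<and> 0 \<le> a \<and> 0 \<le> idet u u' then (d, a) else (0, 0))"
| "wrap (u # us) w = wrap us w"
| "wrap [] w = (0, 0)"

text \<open>A partner \<open>P\<close> with its cuts, followed by a map \<open>(M, s, t)\<close> (with a swap flag) onto the \<open>k\<close>-th new partner of the same
  entry, or onto the \<open>k\<close>-th pair of a common list when the first flag is false.\<close>
type_synonym cert = "pt list \<times> pt list \<times> bool \<times> int \<times> mat \<times> pt \<times> pt \<times> bool"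
text \<open>A polygon \<open>R\<close>; for each point \<open>x\<close> by which \<open>R\<close> can grow, the index of the resulting polygon with an
  equivalence; points \<open>x\<close> outside \<open>R\<close> used to refute maximality by comparing \<open>R\<close> with \<open>conv (R \<union> {x})\<close>; partners \<open>P\<close>
  not met before, with cuts proving that \<open>P\<close> cannot be enlarged against \<open>R\<close> nor \<open>R\<close> against \<open>P\<close>; the other partners.\<close>
type_synonym entry = "pt list \<times> (pt \<times> int \<times> mat \<times> pt) list \<times> pt list \<times> (pt list \<times> pt list \<times> pt list) list \<times> cert list"

text \<open>The initial \<open>[0]\<close> is the support value of the first edge after translation.
  The second edge gets a level with zero coefficients, since a relation involves three
  directions.\<close>

definition enum_ok :: "entry \<Rightarrow> bool" where
  "enum_ok e = (case e of (R, _, xs, news, olds) \<Rightarrow>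
    let F = edges_data R; us = map fst F in
    case ext_cons R (close_cycle us) xs of None \<Rightarrow> False | Some cs \<Rightarrow>
    (case F of (u0, l0, h0) # (u1, l1, h1) # r \<Rightarrow>
      (case wrap us u0 of (d, al) \<Rightarrow>
       dfs (mixed_vol R R, d, al, map (idet u0) us, cs,
         map (\<lambda>(P, _). map (\<lambda>u. maxl u P) us) news @ map (\<lambda>(P, _). map (\<lambda>u. maxl u P) us) olds)
         ((l1, 0, 0, 0) # steps (map (\<lambda>(u, l, h). (u, l)) F)) 10 0 0 [0])
     | _ \<Rightarrow> False))"

text \<open>The two domination tests certify the two halves of maximality.\<close>

definition news_ok :: "entry \<Rightarrow> bool" where
  "news_ok e = (case e of (R, _, _, news, _) \<Rightarrow> convex_ok R \<and> list_all (\<lambda>(P, c, c').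
     convex_ok P \<and> dominated P c (support_bounds R P) \<and> dominated R c' (support_bounds P R)) news)"

fun pick :: "int \<Rightarrow> 'a list \<Rightarrow> 'a option" where
  "pick n [] = None"
| "pick n (x # xs) = (if n = 0 then Some x else pick (n - 1) xs)"

text \<open>Inclusion and equal length suffice for equality of the vertex sets, because unimodular
  affine maps are injective and vertex lists are distinct.\<close>

definition image_ok :: "mat \<Rightarrow> pt \<Rightarrow> pt list \<Rightarrow> pt list \<Rightarrow> bool" where
  "image_ok M t V W \<longleftrightarrow> list_all (\<lambda>p. aff M t p \<in> set W) V \<and> length V = length W"

text \<open>These partners carry an equivalence to a pair that is counted already; the domination
  test identifies them with what the search finds.\<close>

definition olds_ok :: "(pt list \<times> pt list) list \<Rightarrow> entry \<Rightarrow> bool" where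
  "olds_ok cross e = (case e of (R, _, _, news, olds) \<Rightarrow> list_all (\<lambda>(P, c, own, k, M, s, t, sw).
     convex_ok P \<and> dominated P c (support_bounds R P) \<and> unimod M \<and>
     (case (if own then map_option (\<lambda>(P', _). (R, P')) (pick k news) else pick k cross) of None \<Rightarrow> False
      | Some (R', P') \<Rightarrow>
        if sw then image_ok M s R P' \<and> image_ok M t P R' else image_ok M s R R' \<and> image_ok M t P P')) olds)"

text \<open>Lattice height two or more over some edge, the case that \<open>height_one_point\<close>
  rules out.\<close>

fun outside1 :: "(pt \<times> int \<times> int) list \<Rightarrow> pt \<Rightarrow> bool" where
  "outside1 [] p = False"
| "outside1 ((u, g, h) # es) p = (if h + 1 < idet p u then True else outside1 es p)"

fun inside0 :: "(pt \<times> int \<times> int) list \<Rightarrow> pt \<Rightarrow> bool" where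
  "inside0 [] p = True"
| "inside0 ((u, g, h) # es) p = (if idet p u \<le> h then inside0 es p else False)"

text \<open>The mixed volume of \<open>R\<close> and the hull of \<open>R\<close> and
  \<open>p\<close>. By monotonicity it is a lower bound for the volume of that hull, so a value
  above 10 excludes \<open>p\<close>.\<close>

fun ext_vol :: "(pt \<times> int \<times> int) list \<Rightarrow> pt \<Rightarrow> int" where
  "ext_vol [] p = 0"
| "ext_vol ((u, g, h) # es) p = (let a = idet p u in g * (if h < a then a else h)) + ext_vol es p"

definition cert_ok :: "(int \<Rightarrow> pt list option) \<Rightarrow> pt list \<Rightarrow> pt \<Rightarrow> int \<times> mat \<times> pt \<Rightarrow> bool" where
  "cert_ok look R p c = (case c of (j, M, t) \<Rightarrow> case look j of None \<Rightarrow> False | Some R' \<Rightarrow>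
     let Y = map (aff M t) (p # R) in
     unimod M \<and> list_all (\<lambda>q. q \<in> set Y) R' \<and> list_all (inside_edges (cyclic_pairs R')) Y)"

definition point_ok :: "(int \<Rightarrow> pt list option) \<Rightarrow> pt list \<Rightarrow> (pt \<times> int \<times> int) list \<Rightarrow> (pt \<times> int \<times> mat \<times> pt) list \<Rightarrow> pt \<Rightarrow> bool" where
  "point_ok look R F cs p = (if outside1 F p then True else if inside0 F p then True
     else if 10 < ext_vol F p then True
     else (case map_of cs p of None \<Rightarrow> False | Some c \<Rightarrow> cert_ok look R p c))"

text \<open>A point at height at most one over all edges lies in the box given by the four bounds.\<close>
definition growth_ok :: "(int \<Rightarrow> pt list option) \<Rightarrow> entry \<Rightarrow> bool" where
  "growth_ok look e = (case e of (R, cs, _) \<Rightarrow>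
    let F = edges_data R; L = close_cycle (map (\<lambda>(u, g, h). (u, h + 1)) F) in
    if 10 \<le> mixed_vol R R then True else
    (case (cone_floor (0, 1) L, cone_floor (0, -1) L, cone_floor (-1, 0) L, cone_floor (1, 0) L) of
      (Some b1, Some b2, Some b3, Some b4) \<Rightarrow>
        list_all (\<lambda>x. list_all (\<lambda>y. point_ok look R F cs (x, y)) [- b4 .. b3]) [- b2 .. b1]
    | _ \<Rightarrow> False))"

section \<open>Maximal partners of a fixed polygon\<close>

lemma le_divI: fixes d x y :: int assumes "0 < d" "d * x \<le> y" shows "x \<le> y div d"
  using zdiv_mono1[OF assms(2,1)] assms(1) by simp

lemma isupport_scale:
  assumes "finite T" "T \<noteq> {}" "0 \<le> g" shows "isupport T (g * a, g * b) = g * isupport T (a, b)"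
proof -
  obtain p where p: "p \<in> T" "isupport T (a, b) = idet p (a, b)" using isupport_attained[OF assms(1,2)] .
  have e: "idet q (g * a, g * b) = g * idet q (a, b)" for q by (simp add: idet_def algebra_simps)
  show ?thesis
  proof (rule antisym)
    show "isupport T (g * a, g * b) \<le> g * isupport T (a, b)"
      using isupport_ge[OF assms(1)] assms(3) by (intro isupport_le[OF assms(1,2)]) (auto simp: e mult_left_mono)
    show "g * isupport T (a, b) \<le> isupport T (g * a, g * b)"
      using isupport_ge[OF assms(1) p(1), of "(g * a, g * b)"] p(2) by (simp add: e)
  qed
qed

text \<open>Cramer's rule writes \<open>w\<close> as a nonnegative combination of \<open>u\<close>
  and \<open>u'\<close>; the claim is sublinearity of the support function, cleared of
  denominators.\<close>

lemma isupport_cone: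
  assumes "finite T" "T \<noteq> {}" "0 \<le> idet w u'" "0 \<le> idet u w" "0 < idet u u'"
  shows "idet u u' * isupport T w \<le> idet w u' * isupport T u + idet u w * isupport T u'"
proof -
  obtain p where p: "p \<in> T" "isupport T w = idet p w" using isupport_attained[OF assms(1,2)] .
  have "idet u u' * idet p w = idet w u' * idet p u + idet u w * idet p u'"
    by (simp add: idet_def algebra_simps)
  also have "\<dots> \<le> idet w u' * isupport T u + idet u w * isupport T u'"
    using isupport_ge[OF assms(1) p(1)] assms(3,4) by (intro add_mono mult_left_mono) auto
  finally show ?thesis using p(2) by simp
qed

lemma isupport_mono_ihull:
  assumes "finite S" "finite T" "S \<noteq> {}" "ihull S \<subseteq> ihull T" shows "isupport S q \<le> isupport T q"
proof -
  have "T \<noteq> {}" using assms(3,4) ihull_ne by blast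
  then have "support (ihull S) (ivec q) \<le> support (ihull T) (ivec q)" using assms ihull_ne by (intro support_mono compact_ihull) auto
  then show ?thesis using support_ihull[OF assms(1,3)] support_ihull[OF assms(2) \<open>T \<noteq> {}\<close>] by simp
qed

lemma idet_le_isupport: assumes "finite T" "ivec p \<in> ihull T" shows "idet p q \<le> isupport T q"
proof -
  have "T \<noteq> {}" using assms(2) ihull_ne by blast
  have "rdet (ivec p) (ivec q) \<le> support (ihull T) (ivec q)" using assms compact_ihull by (intro support_ge)
  then show ?thesis using support_ihull[OF assms(1) \<open>T \<noteq> {}\<close>] by (simp add: rdet_ivec)
qed

lemma edge_data_facts:
  assumes "v \<noteq> w" "edge_data (v, w) = (u, g, h)"
  shows "0 < g" "w - v = (g * fst u, g * snd u)" "h = idet v u" "pgcd u = 1"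
proof -
  obtain x y where xy: "w - v = (x, y)" by (cases "w - v")
  then have ne: "\<not> (x = 0 \<and> y = 0)" using assms(1) by (auto simp: prod_eq_iff zero_prod_def)
  have g: "g = gcd x y" and u: "u = (x div gcd x y, y div gcd x y)" and h: "h = idet v u"
    using assms(2) xy by (auto simp: edge_data_def point_diff_eq pgcd_def Let_def)
  show "0 < g" using ne g by (simp add: gcd_pos_int)
  show "w - v = (g * fst u, g * snd u)" by (simp add: xy g u)
  show "h = idet v u" by (rule h)
  show "pgcd u = 1" using ne by (simp add: u pgcd_def div_gcd_coprime[unfolded coprime_iff_gcd_eq_1])
qed

context
  fixes vs :: "pt list" assumes ok: "convex_ok vs"
begin

lemma edges_data_mem:
  assumes "(u, g, h) \<in> set (edges_data vs)"
  obtains v w where "(v, w) \<in> set (cyclic_pairs vs)" "edge_data (v, w) = (u, g, h)"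
    "0 < g" "w - v = (g * fst u, g * snd u)" "h = idet v u" "pgcd u = 1"
proof -
  obtain v w where vw: "(v, w) \<in> set (cyclic_pairs vs)" "edge_data (v, w) = (u, g, h)"
    using assms unfolding edges_data_def by auto
  then show ?thesis using that edge_data_facts[OF ok_edge(3)[OF ok vw(1)] vw(2)] by blast
qed

lemma edges_data_isupport:
  assumes "(u, g, h) \<in> set (edges_data vs)" shows "isupport (set vs) u = h"
proof -
  obtain v w where vw: "(v, w) \<in> set (cyclic_pairs vs)" "0 < g" "w - v = (g * fst u, g * snd u)" "h = idet v u"
    using edges_data_mem[OF assms] by metis
  have ne: "finite (set vs)" "set vs \<noteq> {}" using ok_simps[OF ok] by auto
  have "idet z u \<le> h" if "z \<in> set vs" for z
  proof -
    have "idet z (w - v) \<le> idet v (w - v)" using ok_edge(5)[OF ok vw(1) that] .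
    then have "g * idet z u \<le> g * h" unfolding vw(3,4) by (simp add: idet_def algebra_simps)
    then show ?thesis using vw(2) by simp
  qed
  then have "isupport (set vs) u \<le> h" by (intro isupport_le[OF ne])
  moreover have "h \<le> isupport (set vs) u" unfolding vw(4) using ok_edge(1)[OF ok vw(1)] by (intro isupport_ge) auto
  ultimately show ?thesis by simp
qed

lemma edges_data_sum:
  assumes "finite T" "T \<noteq> {}"
  shows "(\<Sum>(v, w)\<leftarrow>cyclic_pairs vs. isupport T (w - v)) = (\<Sum>(u, g, h)\<leftarrow>edges_data vs. g * isupport T u)"
proof -
  have "(case e of (v, w) \<Rightarrow> isupport T (w - v)) = (case edge_data e of (u, g, h) \<Rightarrow> g * isupport T u)" if "e \<in> set (cyclic_pairs vs)" for e
  proof -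
    obtain v w where e: "e = (v, w)" by (cases e)
    obtain u g h where p: "edge_data e = (u, g, h)" by (cases "edge_data e") auto
    note f = edge_data_facts[OF ok_edge(3)[OF ok that[unfolded e]] p[unfolded e]]
    then have "isupport T (w - v) = g * isupport T (fst u, snd u)" using isupport_scale[OF assms, of g "fst u" "snd u"] by simp
    then show ?thesis using e p by simp
  qed
  then show ?thesis unfolding edges_data_def by (simp add: comp_def cong: map_cong)
qed

lemma edges_data_mixed_volume:
  assumes "finite T" "interior (ihull T) \<noteq> {}"
  shows "mixed_volume (ihull T) (ihull (set vs)) = of_int (\<Sum>(u, g, h)\<leftarrow>edges_data vs. g * isupport T u)"
proof -
  have "T \<noteq> {}" using assms(2) interior_subset[of "ihull T"] ihull_ne by blast
  then show ?thesis
    using ok_mixed_volume[OF ok assms] edges_data_sum[OF assms(1)] mixed_volume_commute[of "ihull T"] by simp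
qed

lemma not_inside_edges:
  assumes "\<not> inside_edges (cyclic_pairs vs) p" shows "ivec p \<notin> ihull (set vs)"
proof
  assume p: "ivec p \<in> ihull (set vs)"
  have "\<exists>(v, w)\<in>set es. 0 < idet (p - v) (w - v)" if "\<not> inside_edges es p" for es
    using that by (induction es p rule: inside_edges.induct) (auto simp: point_diff_eq not_le split: if_splits simp del: idet_simps)
  then obtain v w where vw: "(v, w) \<in> set (cyclic_pairs vs)" "0 < idet (p - v) (w - v)" using assms by blast
  have "idet p (w - v) \<le> isupport (set vs) (w - v)" using p by (intro idet_le_isupport) auto
  also have "\<dots> \<le> idet v (w - v)"
    using ok_simps[OF ok] ok_edge(5)[OF ok vw(1)] by (intro isupport_le) auto
  finally show False using vw(2) by simp
qed

lemma all_inside_edges: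
  assumes "finite T" "T \<noteq> {}" "\<And>p. p \<in> T \<Longrightarrow> inside_edges (cyclic_pairs vs) p" shows "ihull T \<subseteq> ihull (set vs)"
proof (rule ok_subset[OF ok assms(1,2)])
  fix v w assume vw: "(v, w) \<in> set (cyclic_pairs vs)"
  have *: "idet (p - v) (w - v) \<le> 0" if "inside_edges es p" "(v, w) \<in> set es" for es p
    using that by (induction es p rule: inside_edges.induct) (auto simp: point_diff_eq split: if_splits simp del: idet_simps)
  show "isupport T (w - v) \<le> idet v (w - v)"
  proof (rule isupport_le[OF assms(1,2)])
    fix p assume "p \<in> T"
    then have "idet (p - v) (w - v) \<le> 0" using * assms(3) vw by blast
    then show "idet p (w - v) \<le> idet v (w - v)" by simp
  qed
qed

end

section \<open>Soundness of the support bounds and of the maximality tests\<close>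

definition valid :: "pt set \<Rightarrow> (pt \<times> int) list \<Rightarrow> bool" where
  "valid T L \<longleftrightarrow> finite T \<and> T \<noteq> {} \<and> (\<forall>(u, h)\<in>set L. isupport T u \<le> h)"

lemma cone_bound:
  assumes "finite T" "T \<noteq> {}" "0 \<le> idet w u'" "0 \<le> idet u w" "0 < idet u u'" "isupport T u \<le> h" "isupport T u' \<le> h'"
  shows "isupport T w \<le> (idet w u' * h + idet u w * h') div idet u u'"
proof -
  have "idet u u' * isupport T w \<le> idet w u' * isupport T u + idet u w * isupport T u'" using isupport_cone assms by blast
  also have "\<dots> \<le> idet w u' * h + idet u w * h'" using assms by (intro add_mono mult_left_mono) auto
  finally show ?thesis using assms(5) by (intro le_divI)
qed

lemma cone_floor_sound: "valid T L \<Longrightarrow> cone_floor w L = Some c \<Longrightarrow> isupport T w \<le> c"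
proof (induction w L rule: cone_floor.induct)
  case (1 w u h u' h' r)
  have v: "finite T" "T \<noteq> {}" "isupport T u \<le> h" "isupport T u' \<le> h'" "valid T ((u', h') # r)"
    using 1(4) by (auto simp: valid_def)
  show ?case using 1(1-3)[OF refl refl refl] 1(5) v cone_bound[OF v(1,2) _ _ _ v(3,4), of w]
    by (simp add: Let_def split: if_splits)
qed auto

lemma add_cut_sound: "valid T L \<Longrightarrow> valid T (add_cut w L)"
proof (induction w L rule: add_cut.induct)
  case (1 w u h u' h' r)
  have v: "finite T" "T \<noteq> {}" "isupport T u \<le> h" "isupport T u' \<le> h'" "valid T ((u', h') # r)"
    using 1(4) by (auto simp: valid_def)
  show ?case using 1(1-3)[OF refl refl refl] 1(4) v cone_bound[OF v(1,2) _ _ _ v(3,4), of w]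
    by (auto simp: Let_def valid_def)
qed auto

lemma bounded_by_sound:
  "bounded_by es L \<Longrightarrow> valid T L \<Longrightarrow> (u, g, h) \<in> set es \<Longrightarrow> isupport T u \<le> h"
  by (induction es L rule: bounded_by.induct) (auto split: option.splits if_splits dest: cone_floor_sound)

lemma dominated_sound:
  assumes "convex_ok P" "dominated P cs L" "valid T L" shows "ihull T \<subseteq> ihull (set P)"
proof -
  have v: "valid T (fold add_cut cs L)" using assms(3) by (induction cs arbitrary: L) (auto simp: add_cut_sound)
  have T: "finite T" "T \<noteq> {}" using assms(3) by (auto simp: valid_def)
  show ?thesis
  proof (rule ok_subset[OF assms(1) T])
    fix p w assume vw: "(p, w) \<in> set (cyclic_pairs P)"
    obtain u g h where e: "edge_data (p, w) = (u, g, h)" by (cases "edge_data (p, w)") auto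
    note f = edge_data_facts[OF ok_edge(3)[OF assms(1) vw] e]
    have "(u, g, h) \<in> set (edges_data P)" unfolding edges_data_def using vw e by force
    then have "isupport T u \<le> h" using bounded_by_sound v assms(2) unfolding dominated_def by blast
    then have "g * isupport T u \<le> g * h" using f(1) by simp
    moreover have "isupport T (w - p) = g * isupport T u" using isupport_scale[OF T, of g "fst u" "snd u"] f by simp
    moreover have "idet p (w - p) = g * h" unfolding f(2,3) by (simp add: idet_def algebra_simps)
    ultimately show "isupport T (w - p) \<le> idet p (w - p)" by simp
  qed
qed

lemma edges_data_ne: "convex_ok R \<Longrightarrow> edges_data R \<noteq> []"
  using ok_simps[of R] unfolding edges_data_def cyclic_pairs_def by (cases R) (auto simp: neq_Nil_conv)

lemma support_bounds_valid:
  assumes "convex_ok R" "P \<noteq> []" "finite T" "T \<noteq> {}" "\<And>u g h. (u, g, h) \<in> set (edges_data R) \<Longrightarrow> isupport T u \<le> maxl u P"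
  shows "valid T (support_bounds R P)"
proof -
  have "set (support_bounds R P) = set (map (\<lambda>(u, g, h). (u, maxl u P)) (edges_data R))"
    unfolding support_bounds_def close_cycle_def using edges_data_ne[OF assms(1)] by (cases "edges_data R") auto
  then show ?thesis unfolding valid_def using assms(3-5) by auto
qed

lemma sum_list_eq_pointwise:
  fixes f g :: "'a \<Rightarrow> int"
  assumes "\<And>x. x \<in> set xs \<Longrightarrow> f x \<le> g x" "sum_list (map f xs) = sum_list (map g xs)" "x \<in> set xs"
  shows "f x = g x"
  using assms
proof (induction xs)
  case (Cons y ys)
  have "sum_list (map f ys) \<le> sum_list (map g ys)" using Cons.prems(1) by (intro sum_list_mono) auto
  moreover have "f y \<le> g y" using Cons.prems(1) by simp
  ultimately have "f y = g y" "sum_list (map f ys) = sum_list (map g ys)" using Cons.prems(2) by auto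
  then show ?case using Cons by auto
qed simp

text \<open>Support values grow with the polygon and the lattice lengths are positive, so equal
  mixed volumes force equal support values in every edge direction of \<open>R\<close>. The
  certificate then confines \<open>U\<close> to \<open>P\<close>.\<close>

lemma closed_pair:
  assumes R: "convex_ok R" and P: "convex_ok P" and d: "dominated P cs (support_bounds R P)"
    and U: "finite U" "ihull (set P) \<subseteq> ihull U" "mixed_volume (ihull U) (ihull (set R)) = mixed_volume (ihull (set P)) (ihull (set R))"
  shows "ihull U = ihull (set P)"
proof
  note p = ok_simps[OF P]
  have iU: "interior (ihull U) \<noteq> {}" using ok_interior[OF P] U(2) interior_mono by blast
  have Une: "U \<noteq> {}" using iU interior_subset[of "ihull U"] ihull_ne by blast
  let ?f = "\<lambda>T (u, g, h). g * isupport T u"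
  have s: "sum_list (map (?f U) (edges_data R)) = sum_list (map (?f (set P)) (edges_data R))"
    using U(3) unfolding edges_data_mixed_volume[OF R U(1) iU] edges_data_mixed_volume[OF R finite_set ok_interior[OF P]] by simp
  have "isupport U u \<le> maxl u P" if e: "(u, g, h) \<in> set (edges_data R)" for u g h
  proof -
    have le: "?f (set P) x \<le> ?f U x" if "x \<in> set (edges_data R)" for x
    proof -
      obtain u g h where x: "x = (u, g, h)" by (cases x) auto
      have "0 < g" using edges_data_mem[OF R that[unfolded x]] by metis
      then show ?thesis using isupport_mono_ihull[OF finite_set U(1) p(3) U(2), of u] by (simp add: x)
    qed
    have "?f (set P) (u, g, h) = ?f U (u, g, h)" using sum_list_eq_pointwise[OF le s[symmetric] e] .
    moreover have "0 < g" using edges_data_mem[OF R e] by metis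
    moreover have "maxl u P = isupport (set P) u" using p by (intro maxl_isupport) auto
    ultimately show ?thesis by simp
  qed
  then have "valid U (support_bounds R P)" using p by (intro support_bounds_valid[OF R _ U(1) Une]) auto
  then show "ihull U \<subseteq> ihull (set P)" using dominated_sound[OF P d] by blast
qed (rule U(2))

lemma mixed_vol_isupport:
  "P \<noteq> [] \<Longrightarrow> mixed_vol R P = (\<Sum>(u, g, h)\<leftarrow>edges_data R. g * isupport (set P) u)"
  unfolding mixed_vol_def by (simp add: maxl_isupport)

lemma mixed_vol_mixed_volume:
  assumes "convex_ok R" "convex_ok P"
  shows "mixed_volume (ihull (set P)) (ihull (set R)) = of_int (mixed_vol R P)"
  using edges_data_mixed_volume[OF assms(1) finite_set ok_interior[OF assms(2)]] mixed_vol_isupport[of P R] ok_simps[OF assms(2)]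
  by simp

lemma news_maxpair:
  assumes R: "convex_ok R" and P: "convex_ok P" and d: "dominated P cs (support_bounds R P)" "dominated R cs' (support_bounds P R)"
    and m: "mixed_vol R P = int m"
  shows "maxpair m (set P) (set R)"
proof -
  have "maximal_pair (ihull (set P)) (ihull (set R))"
    unfolding maximal_pair_ihull[OF ok_simps(3)[OF P] ok_simps(3)[OF R]]
  proof (intro conjI allI impI)
    fix U assume "finite U" "ihull (set P) \<subseteq> ihull U" "mixed_volume (ihull U) (ihull (set R)) = mixed_volume (ihull (set P)) (ihull (set R))"
    then show "ihull U = ihull (set P)" by (rule closed_pair[OF R P d(1)])
  next
    fix U assume "finite U" "ihull (set R) \<subseteq> ihull U" "mixed_volume (ihull (set P)) (ihull U) = mixed_volume (ihull (set P)) (ihull (set R))"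
    then show "ihull U = ihull (set R)"
      by (intro closed_pair[OF P R d(2)]) (simp_all add: mixed_volume_commute[of _ "ihull (set P)"])
  qed
  then show ?thesis unfolding maxpair_def
    using mixed_vol_mixed_volume[OF R P] ok_interior[OF P] ok_interior[OF R] m by simp
qed

section \<open>Soundness of pruning by larger polygons\<close>

lemma dot_Nil [simp]: "dot v [] = 0"
  by (cases v) simp_all

text \<open>\<open>close_cycle\<close> repeats the first direction, whose support value is 0 after
  translation; support vectors therefore omit that last entry.\<close>

lemma dot_close_cycle: "dot v (hs @ [0]) = dot v hs"
proof (induction hs arbitrary: v)
  case Nil then show ?case by (cases v) simp_all
next
  case (Cons a hs) then show ?case by (cases v) simp_all
qed

lemma dot_zeros: "dot (map (\<lambda>_. 0) r) xs = 0"
proof (induction r arbitrary: xs)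
  case (Cons a r) then show ?case by (cases xs) auto
qed simp

lemma cone_coeffs_sound:
  assumes "finite T" "T \<noteq> {}"
  shows "cone_coeffs w us = (v, d) \<Longrightarrow> d \<noteq> 0 \<Longrightarrow>
    0 < d \<and> length v = length us \<and> d * isupport T w \<le> dot v (map (isupport T) us)"
proof (induction w us arbitrary: v d rule: cone_coeffs.induct)
  case (1 w u u' r)
  show ?case
  proof (cases "0 \<le> idet w u' \<and> 0 \<le> idet u w \<and> 0 < idet u u'")
    case True
    then show ?thesis using 1(2) isupport_cone[OF assms, of w u' u] by (auto simp: dot_zeros)
  next
    case False
    obtain v' d' where c: "cone_coeffs w (u' # r) = (v', d')" by (cases "cone_coeffs w (u' # r)")
    then have "v = 0 # v'" "d = d'" using 1(2) False by (auto simp: Let_def)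
    then show ?thesis using 1(1)[OF refl refl refl False c] 1(3) by simp
  qed
qed auto

lemma dot_vadd: "length a = length xs \<Longrightarrow> length b = length xs \<Longrightarrow> dot (vadd l a b) xs = l * dot a xs + dot b xs"
proof (induction l a b arbitrary: xs rule: vadd.induct)
  case (1 l a as b bs) then show ?case by (cases xs) (auto simp: algebra_simps)
qed auto

lemma length_vadd: "length a = length b \<Longrightarrow> length (vadd l a b) = length b"
  by (induction l a b rule: vadd.induct) auto

lemma volume_bound_sound:
  assumes T: "finite T" "T \<noteq> {}"
  shows "volume_bound us es = Some (v0, rs) \<Longrightarrow> \<forall>(u, g, h)\<in>set es. 0 \<le> g \<Longrightarrow> map (isupport T) us = hs @ [0] \<Longrightarrow>
    length v0 = length us \<and> (\<Sum>(u, g, h)\<leftarrow>es. g * isupport T u) \<le> dot v0 hs + extra hs rs"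
proof (induction us es arbitrary: v0 rs rule: volume_bound.induct)
  case (1 us) then show ?case by (auto simp: dot_zeros)
next
  case (2 us w l h es)
  obtain v1 rs1 where p: "volume_bound us es = Some (v1, rs1)" using 2(2) by (auto split: option.splits)
  obtain v d where c: "cone_coeffs w us = (v, d)" by (cases "cone_coeffs w us")
  have d0: "d \<noteq> 0" using 2(2) p c by (auto split: if_splits)
  note IH = 2(1)[OF p _ 2(4)]
  have l: "0 \<le> l" using 2(3) by simp
  note cs = cone_coeffs_sound[OF T c d0]
  have sz: "length us = length (hs @ [0])" using arg_cong[OF 2(4), of length] by simp
  have IH': "length v1 = length us" "(\<Sum>(u, g, h)\<leftarrow>es. g * isupport T u) \<le> dot v1 hs + extra hs rs1"
    using IH 2(3) by auto
  have b: "d * isupport T w \<le> dot v hs" using cs 2(4) by (simp add: dot_close_cycle)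
  show ?case
  proof (cases "d = 1")
    case True
    then have e: "v0 = vadd l v v1" "rs = rs1" using 2(2) p c by auto
    have "dot v0 hs = l * dot v hs + dot v1 hs"
      using dot_vadd[of v "hs @ [0]" v1 l] cs IH'(1) sz unfolding e(1) by (simp add: dot_close_cycle)
    moreover have "l * isupport T w \<le> l * dot v hs" using b True l by (simp add: mult_left_mono)
    ultimately show ?thesis using IH' e cs by (simp add: length_vadd)
  next
    case False
    then have e: "v0 = v1" "rs = (v, d, l) # rs1" using 2(2) p c d0 by auto
    have "isupport T w \<le> dot v hs div d" using b cs by (intro le_divI) simp_all
    then have "l * isupport T w \<le> l * (dot v hs div d)" using l by (simp add: mult_left_mono)
    then show ?thesis using IH' e by simp
  qed
qed

lemma ext_cons_sound: "ext_cons R us xs = Some cs \<Longrightarrow> c \<in> set cs \<Longrightarrow>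
    \<exists>L. good_ext R L \<and> volume_bound us (edges_data L) = Some c"
  by (induction R us xs arbitrary: cs rule: ext_cons.induct)
    (auto simp: Let_def split: if_splits option.splits)

lemma pruned_ex: "pruned h m cs \<Longrightarrow> \<exists>v0 rs. (v0, rs) \<in> set cs \<and> dot v0 h + extra h rs \<le> m"
  by (induction h m cs rule: pruned.induct) (auto split: if_splits)

text \<open>A polygon \<open>L\<close> containing \<open>R\<close> properly with the same mixed volume would contradict maximality.\<close>
lemma not_pruned:
  assumes R: "convex_ok R" and mp: "maxpair m T (set R)"
    and e: "ext_cons R us xs = Some cs" and h: "map (isupport T) us = hs @ [0]"
  shows "\<not> pruned hs (int m) cs"
proof
  assume "pruned hs (int m) cs"
  then obtain v0 rs where c: "(v0, rs) \<in> set cs" "dot v0 hs + extra hs rs \<le> int m" using pruned_ex by blast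
  obtain L where L: "good_ext R L" "volume_bound us (edges_data L) = Some (v0, rs)" using ext_cons_sound[OF e c(1)] by blast
  have okL: "convex_ok L" and sub: "list_all (inside_edges (cyclic_pairs L)) R" and ns: "\<not> list_all (inside_edges (cyclic_pairs R)) L"
    using L(1) by (auto simp: good_ext_def)
  have T: "finite T" "T \<noteq> {}" "interior (ihull T) \<noteq> {}" using mp maxpair_ne by (auto simp: maxpair_def)
  have "\<forall>(u, g, h)\<in>set (edges_data L). 0 \<le> g" using edges_data_mem[OF okL] by (metis (no_types, lifting) case_prodI2 less_imp_le)
  then have "(\<Sum>(u, g, h)\<leftarrow>edges_data L. g * isupport T u) \<le> int m" using volume_bound_sound[OF T(1,2) L(2) _ h] c(2) by auto
  then have "mixed_volume (ihull T) (ihull (set L)) \<le> real m"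
    unfolding edges_data_mixed_volume[OF okL T(1,3)] by linarith
  moreover have RL: "ihull (set R) \<subseteq> ihull (set L)"
    using sub ok_simps[OF R] by (intro all_inside_edges[OF okL]) (auto simp: list_all_iff)
  have "mixed_volume (ihull T) (ihull (set R)) \<le> mixed_volume (ihull T) (ihull (set L))"
    by (intro mixed_volume_mono polytope_ihull T ok_interior[OF R] RL) auto
  moreover have m: "mixed_volume (ihull T) (ihull (set R)) = real m" using mp by (simp add: maxpair_def)
  ultimately have "mixed_volume (ihull T) (ihull (set L)) = mixed_volume (ihull T) (ihull (set R))" by linarith
  moreover have "maximal_pair (ihull T) (ihull (set R))" using mp by (simp add: maxpair_def)
  ultimately have eq: "ihull (set L) = ihull (set R)"
    using RL unfolding maximal_pair_ihull[OF T(2) ok_simps(3)[OF R]] by blast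
  obtain p where "p \<in> set L" "\<not> inside_edges (cyclic_pairs R) p" using ns by (auto simp: list_all_iff)
  then show False using not_inside_edges[OF R] ihull_inc[of p "set L"] eq by blast
qed

section \<open>Soundness of the depth-first search\<close>

fun admissible :: "level list \<Rightarrow> int \<Rightarrow> int \<Rightarrow> int list \<Rightarrow> bool" where
  "admissible [] a b ts \<longleftrightarrow> ts = []"
| "admissible ((l, d, al, be) # r) a b (t # ts) \<longleftrightarrow> 1 \<le> l \<and> 0 \<le> t \<and> d * b \<le> al * a + be * t \<and> admissible r b t ts"
| "admissible _ a b [] \<longleftrightarrow> False"

fun cost :: "level list \<Rightarrow> int list \<Rightarrow> int" where
  "cost ((l, _) # r) (t # ts) = l * t + cost r ts"
| "cost _ _ = 0"

fun final_value :: "int \<Rightarrow> int list \<Rightarrow> int" where "final_value b [] = b" | "final_value b (t # ts) = final_value t ts"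
fun previous_value :: "int \<Rightarrow> int \<Rightarrow> int list \<Rightarrow> int" where "previous_value a b [] = a" | "previous_value a b (t # ts) = previous_value b t ts"

lemma cost_nonneg: "admissible L a b ts \<Longrightarrow> 0 \<le> cost L ts"
  by (induction L a b ts rule: admissible.induct) auto

text \<open>\<open>acc\<close> holds the earlier values in reverse order, so
  \<open>rev acc @ ts\<close> is the support vector that the leaf inspects.\<close>

lemma dfs_sound:
  "dfs D L s a b acc \<Longrightarrow> admissible L a b ts \<Longrightarrow> cost L ts \<le> s \<Longrightarrow> s \<le> 10 \<Longrightarrow>
    leaf D (s - cost L ts) (previous_value a b ts) (final_value b ts) (rev acc @ ts)"
  "loop D st r s a b acc qs \<Longrightarrow> sorted qs \<Longrightarrow> admissible (st # r) a b (t # ts) \<Longrightarrow> t \<in> set qs \<Longrightarrow>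
    cost (st # r) (t # ts) \<le> s \<Longrightarrow> s \<le> 10 \<Longrightarrow>
    leaf D (s - cost (st # r) (t # ts)) (previous_value b t ts) (final_value t ts) (rev acc @ t # ts)"
proof (induction D L s a b acc and D st r s a b acc qs arbitrary: ts and t ts rule: dfs_loop.induct)
  case (1 D s a b acc) then show ?case by simp
next
  case (2 D st r s a b acc)
  obtain l d al be where st: "st = (l, d, al, be)" by (cases st) auto
  obtain t ts' where ts: "ts = t # ts'" using 2(3) st by (cases ts) auto
  have a: "1 \<le> l" "0 \<le> t" "admissible r b t ts'" using 2(3) by (auto simp: st ts)
  have "l * t \<le> s" using 2(4) cost_nonneg[OF a(3)] by (simp add: st ts)
  then have "t \<le> 10" using a 2(5) mult_right_mono[of 1 l t] by simp
  then have "t = 0 \<or> t = 1 \<or> t = 2 \<or> t = 3 \<or> t = 4 \<or> t = 5 \<or> t = 6 \<or> t = 7 \<or> t = 8 \<or> t = 9 \<or> t = 10"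
    using a(2) by arith
  then have "t \<in> set [0, 1, 2, 3, 4, 5, 6, 7, 8, 9, 10]" by simp
  from 2(1)[OF _ _ _ this] 2(2-5) show ?case by (simp add: ts)
next
  case (3 D st r s a b acc) then show ?case by simp
next
  case (4 D l d al be r s a b acc q qs)
  show ?case
  proof (cases "t = q")
    case True
    have a: "1 \<le> l" "0 \<le> t" "d * b \<le> al * a + be * t" "admissible r b t ts" using 4(5) by auto
    have le: "l * t \<le> s" using 4(7) cost_nonneg[OF a(4)] by simp
    have "dfs D r (s - l * t) b t (t # acc)" using 4(3) le a(3) True by (auto split: if_splits)
    moreover have "0 \<le> l * t" using a(1,2) by simp
    then have "s - l * t \<le> 10" using 4(8) by linarith
    ultimately have "leaf D (s - l * t - cost r ts) (previous_value b t ts) (final_value t ts) (rev (t # acc) @ ts)"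
      using 4(1)[of ts] le a 4(7,8) True by simp
    then show ?thesis by (simp add: diff_diff_eq)
  next
    case False
    have a: "1 \<le> l" "0 \<le> t" "admissible r b t ts" using 4(5) by auto
    have le: "l * t \<le> s" using 4(7) cost_nonneg[OF a(3)] by simp
    have tq: "t \<in> set qs" using 4(6) False by simp
    \<comment> \<open>The candidates ascend, so \<open>q\<close> is still within the budget and the
      loop has not stopped before reaching \<open>t\<close>.\<close>
    then have "q \<le> t" using 4(4) by auto
    then have "l * q \<le> l * t" using a by simp
    then have "\<not> s < l * q" using le by linarith
    moreover from this have "if al * a + be * q < d * b then True else dfs D r (s - l * q) b q (q # acc)"
      "loop D (l, d, al, be) r s a b acc qs" using 4(3) by (auto split: if_splits)
    ultimately show ?thesis using 4(2)[of t ts] 4(4-8) tq by simp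
  qed
qed

lemma steps_admissible:
  assumes T: "finite T" "T \<noteq> {}"
  shows "\<forall>(u, l)\<in>set ul. 1 \<le> l \<and> 0 \<le> isupport T u \<Longrightarrow>
    admissible (steps ((u, l) # (u', l') # ul)) (isupport T u) (isupport T u') (map (\<lambda>(u, l). isupport T u) ul) \<and>
    cost (steps ((u, l) # (u', l') # ul)) (map (\<lambda>(u, l). isupport T u) ul) = (\<Sum>(u, l)\<leftarrow>ul. l * isupport T u)"
proof (induction ul arbitrary: u l u' l')
  case (Cons a ul)
  obtain u'' l'' where a: "a = (u'', l'')" by (cases a)
  have IH: "admissible (steps ((u', l') # (u'', l'') # ul)) (isupport T u') (isupport T u'') (map (\<lambda>(u, l). isupport T u) ul)"
    "cost (steps ((u', l') # (u'', l'') # ul)) (map (\<lambda>(u, l). isupport T u) ul) = (\<Sum>(u, l)\<leftarrow>ul. l * isupport T u)"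
    using Cons by auto
  have "1 \<le> l''" "0 \<le> isupport T u''" using Cons.prems a by auto
  moreover have "idet u u'' * isupport T u' \<le> idet u' u'' * isupport T u + idet u u' * isupport T u''"
    if "0 < idet u u''" "0 \<le> idet u' u''" "0 \<le> idet u u'"
    using isupport_cone[OF T, of u' u'' u] that by simp
  ultimately show ?case using IH by (auto simp: a Let_def)
qed simp

lemma wrap_sound:
  assumes T: "finite T" "T \<noteq> {}" "isupport T w = 0"
  shows "wrap (u # u' # us) w = (d, al) \<Longrightarrow>
    d * final_value (isupport T u') (map (isupport T) us) \<le> al * previous_value (isupport T u) (isupport T u') (map (isupport T) us)"
proof (induction us arbitrary: u u')
  case Nil
  then show ?case using isupport_cone[OF T(1,2), of u' w u] T(3) by (auto simp: Let_def split: if_splits)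
qed auto

lemma le_list_iff: "length as = length bs \<Longrightarrow> le_list as bs \<longleftrightarrow> list_all2 (\<le>) as bs"
  by (induction as bs rule: le_list.induct) auto

lemma mem_list_iff: "mem_list h ks \<longleftrightarrow> h \<in> set ks"
  by (induction h ks rule: mem_list.induct) auto

section \<open>From search results to polygons\<close>

lemma ne_memI: "x \<in> A \<Longrightarrow> A \<noteq> {}" by (rule notI) simp

text \<open>The support values in the four coordinate directions confine the points to a
  box.\<close>

lemma finite_lattice_points: assumes "finite T" shows "finite {p. ivec p \<in> ihull T}"
proof (rule finite_subset)
  show "{p. ivec p \<in> ihull T} \<subseteq> {- isupport T (0, -1) .. isupport T (0, 1)} \<times> {- isupport T (1, 0) .. isupport T (-1, 0)}"
  proof
    fix p assume "p \<in> {p. ivec p \<in> ihull T}"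
    then have "idet p q \<le> isupport T q" for q using idet_le_isupport assms by blast
    from this[of "(0, -1)"] this[of "(0, 1)"] this[of "(1, 0)"] this[of "(-1, 0)"]
    show "p \<in> {- isupport T (0, -1) .. isupport T (0, 1)} \<times> {- isupport T (1, 0) .. isupport T (-1, 0)}"
      by (cases p) (simp add: idet_def)
  qed
qed simp

lemma ihull_lattice_points: "ihull {p. ivec p \<in> ihull T} = ihull T"
proof
  show "ihull {p. ivec p \<in> ihull T} \<subseteq> ihull T" by (rule ihull_minimal[OF _ convex_ihull]) simp
  show "ihull T \<subseteq> ihull {p. ivec p \<in> ihull T}" by (rule ihull_mono) (auto intro: ihull_inc)
qed

text \<open>Translations are eliminated by moving an end point of the face of direction \<open>u0\<close> to the origin. Then \<open>u0\<close> is not in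
  the polygon, so by maximality it violates the bound for some edge of \<open>R\<close>.\<close>
lemma enum_normalised:
  assumes R: "convex_ok R" and e: "enum_ok (R, cs, xs, news, olds)" and mp: "maxpair m T (set R)"
    and m: "m \<le> 10" "mixed_vol R R \<le> int m" and F: "edges_data R = (u0, l0, h0) # F'"
    and T: "0 \<in> T" "isupport T u0 = 0" "ivec u0 \<notin> ihull T"
  shows "\<exists>P. P \<in> fst ` set news \<union> fst ` set olds \<and> map (\<lambda>u. maxl u P) (map fst (edges_data R)) = map (isupport T) (map fst (edges_data R))"
proof -
  have Tf: "finite T" "T \<noteq> {}" "interior (ihull T) \<noteq> {}" using mp maxpair_ne by (auto simp: maxpair_def)
  define us where "us = map fst (edges_data R)"
  have pos: "0 \<le> isupport T u" for u using isupport_ge[OF Tf(1) T(1), of u] by simp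
  have g: "0 < g" if "(u, g, h) \<in> set (edges_data R)" for u g h using edges_data_mem[OF R that] by metis
  have sz: "3 \<le> length (edges_data R)" using ok_simps(2)[OF R] by (simp add: edges_data_def cyclic_pairs_def)
  then obtain u1 l1 h1 F2 where F2: "F' = (u1, l1, h1) # F2" using F by (cases F') auto
  obtain con where con: "ext_cons R (close_cycle us) xs = Some con"
    using e unfolding enum_ok_def us_def by (auto simp: Let_def split: option.splits)
  obtain d al where w: "wrap us u0 = (d, al)" by (cases "wrap us u0")
  define hs where "hs = map (\<lambda>(P, _). map (\<lambda>u. maxl u P) us) news @ map (\<lambda>(P, _). map (\<lambda>u. maxl u P) us) olds"
  define D where "D = (mixed_vol R R, d, al, map (idet u0) us, con, hs)"
  have dfs: "dfs D ((l1, 0, 0, 0) # steps (map (\<lambda>(u, l, h). (u, l)) (edges_data R))) 10 0 0 [0]"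
    using e con w unfolding enum_ok_def us_def D_def hs_def by (simp add: Let_def F F2)
  define ts where "ts = map (isupport T) (map fst F2)"
  define ul where "ul = map (\<lambda>(u, l, h). (u, l)) F2"
  have ts': "ts = map (\<lambda>(u, l). isupport T u) ul" by (simp add: ts_def ul_def comp_def case_prod_beta)
  have ulpos: "\<forall>(u, l)\<in>set ul. 1 \<le> l \<and> 0 \<le> isupport T u"
    using g pos unfolding ul_def F F2 by (fastforce simp: F F2)
  have st: "admissible (steps (map (\<lambda>(u, l, h). (u, l)) (edges_data R))) (isupport T u0) (isupport T u1) ts"
    "cost (steps (map (\<lambda>(u, l, h). (u, l)) (edges_data R))) ts = (\<Sum>(u, l)\<leftarrow>ul. l * isupport T u)"
    using steps_admissible[OF Tf(1,2) ulpos, of u0 l0 u1 l1] by (simp_all add: F F2 ts' ul_def)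
  let ?L = "(l1, 0, 0, 0) # steps (map (\<lambda>(u, l, h). (u, l)) (edges_data R))"
  \<comment> \<open>The first level has zero coefficients, so the artificial predecessors
    \<open>0 0\<close> impose nothing.\<close>
  have admissible: "admissible ?L 0 0 (isupport T u1 # ts)" using st(1) T(2) g[of u1 l1 h1] pos by (simp add: F F2)
  have "real m = of_int (\<Sum>(u, g, h)\<leftarrow>edges_data R. g * isupport T u)"
    using edges_data_mixed_volume[OF R Tf(1,3)] mp by (simp add: maxpair_def)
  then have ms: "int m = (\<Sum>(u, g, h)\<leftarrow>edges_data R. g * isupport T u)" by linarith
  have "(\<Sum>(u, l)\<leftarrow>ul. l * isupport T u) = (\<Sum>(u, g, h)\<leftarrow>F2. g * isupport T u)"
    unfolding ul_def by (induction F2) auto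
  then have cost: "cost ?L (isupport T u1 # ts) = int m" using ms st(2) T(2) by (simp add: F F2)
  have lf: "leaf D (10 - int m) (previous_value 0 0 (isupport T u1 # ts)) (final_value 0 (isupport T u1 # ts)) (0 # isupport T u1 # ts)"
    using dfs_sound(1)[OF dfs admissible] cost m by simp
  have hv: "0 # isupport T u1 # ts = map (isupport T) us" by (simp add: us_def F F2 ts_def T(2))
  have "d * final_value (isupport T u1) (map (isupport T) (map fst F2)) \<le> al * previous_value (isupport T u0) (isupport T u1) (map (isupport T) (map fst F2))"
    using wrap_sound[OF Tf(1,2) T(2), of u0 u1 "map fst F2" d al] w by (simp add: us_def F F2)
  then have wr: "\<not> al * previous_value 0 0 (isupport T u1 # ts) < d * final_value 0 (isupport T u1 # ts)" by (simp add: ts_def T(2))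
  have norm: "\<not> le_list (map (idet u0) us) (map (isupport T) us)"
  proof
    assume "le_list (map (idet u0) us) (map (isupport T) us)"
    then have le: "idet u0 u \<le> isupport T u" if "u \<in> set us" for u
      using that by (simp add: le_list_iff list_all2_map1 list_all2_map2 list.rel_refl_strong list_all2_same)
    let ?U = "insert u0 T"
    have iU: "interior (ihull ?U) \<noteq> {}" using Tf(3) interior_mono[OF ihull_mono[of T ?U]] by blast
    have eqs: "isupport ?U u = isupport T u" if "u \<in> set us" for u
    proof (rule antisym)
      show "isupport ?U u \<le> isupport T u"
      proof (rule isupport_le)
        fix p assume "p \<in> ?U"
        then show "idet p u \<le> isupport T u" using le[OF that] isupport_ge[OF Tf(1), of p u] by blast
      qed (use Tf in auto)
      show "isupport T u \<le> isupport ?U u" using Tf ihull_mono[of T ?U] by (intro isupport_mono_ihull) auto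
    qed
    have "(\<Sum>(u, g, h)\<leftarrow>edges_data R. g * isupport ?U u) = (\<Sum>(u, g, h)\<leftarrow>edges_data R. g * isupport T u)"
      using eqs by (intro arg_cong[of _ _ sum_list] map_cong) (force simp: us_def)+
    then have "mixed_volume (ihull ?U) (ihull (set R)) = mixed_volume (ihull T) (ihull (set R))"
      using edges_data_mixed_volume[OF R Tf(1,3)] edges_data_mixed_volume[OF R _ iU] Tf(1) by simp
    moreover have "maximal_pair (ihull T) (ihull (set R))" using mp by (simp add: maxpair_def)
    ultimately have "ihull ?U = ihull T" using Tf(1) ihull_mono[of T ?U]
      unfolding maximal_pair_ihull[OF Tf(2) ok_simps(3)[OF R]] by blast
    then show False using T(3) ihull_inc[of u0 ?U] by blast
  qed
  have "map (isupport T) (close_cycle us) = map (isupport T) us @ [0]" by (simp add: close_cycle_def us_def F T(2))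
  then have pr: "\<not> pruned (map (isupport T) us) (int m) con" using not_pruned[OF R mp con] by blast
  have "mem_list (map (isupport T) us) hs"
    using lf m wr norm pr unfolding D_def hv by (simp add: Let_def)
  then show ?thesis unfolding mem_list_iff hs_def us_def by (auto simp: image_iff) (metis fst_conv)+
qed

text \<open>The search only finds a listed \<open>P\<close> with the support values of the
  translated partner in the edge directions of \<open>R\<close>. Domination gives one inclusion; the
  mixed volumes agree, so maximality of the partner gives equality.\<close>

theorem enum_complete:
  assumes R: "convex_ok R" and e: "enum_ok (R, cs, xs, news, olds)" and mp: "maxpair m T (set R)"
    and m: "m \<le> 10" "mixed_vol R R \<le> int m"
    and ok: "\<And>P. P \<in> fst ` set news \<union> fst ` set olds \<Longrightarrow> convex_ok P \<and> (\<exists>c. dominated P c (support_bounds R P))"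
  shows "\<exists>P t. P \<in> fst ` set news \<union> fst ` set olds \<and> ihull (aff (1, 0, 0, 1) t ` T) = ihull (set P)"
proof -
  have Tf: "finite T" "T \<noteq> {}" "interior (ihull T) \<noteq> {}" using mp maxpair_ne by (auto simp: maxpair_def)
  obtain u0 l0 h0 F' where F: "edges_data R = (u0, l0, h0) # F'"
    using edges_data_ne[OF R] by (cases "edges_data R") auto
  have "(u0, l0, h0) \<in> set (edges_data R)" by (simp add: F)
  then have "pgcd u0 = 1" using edges_data_mem[OF R] by metis
  then have u0: "u0 \<noteq> 0" by (auto simp: pgcd_def)
  \<comment> \<open>Generating by all lattice points guarantees that \<open>p0 + u0\<close>, if it
    were in the polygon, would compete with \<open>p0\<close> for the last place on the
    face.\<close>
  let ?N = "{p. ivec p \<in> ihull T}"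
  obtain t0 where "t0 \<in> T" using Tf(2) by (meson all_not_in_conv)
  then have "t0 \<in> ?N" using ihull_inc by simp
  then have N: "?N \<noteq> {}" by (rule ne_memI)
  note N = finite_lattice_points[OF Tf(1)] N
  define N0 where "N0 = {p \<in> ?N. idet p u0 = isupport ?N u0}"
  obtain n0 where "n0 \<in> ?N" "isupport ?N u0 = idet n0 u0" using isupport_attained[OF N] .
  then have "n0 \<in> N0" by (simp add: N0_def)
  then have N0: "N0 \<noteq> {}" by (rule ne_memI)
  have "finite N0" using N(1) by (simp add: N0_def)
  note N0 = this N0
  define q where "q p = fst p * fst u0 + snd p * snd u0" for p :: pt
  obtain p0 where p0: "p0 \<in> N0" "\<And>p. p \<in> N0 \<Longrightarrow> q p \<le> q p0"
  proof -
    have "Max (q ` N0) \<in> q ` N0" using N0 by (intro Max_in) auto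
    then obtain p0 where "p0 \<in> N0" "q p0 = Max (q ` N0)" by auto
    then show ?thesis using that N0(1) by auto
  qed
  have p0N: "ivec p0 \<in> ihull T" "idet p0 u0 = isupport ?N u0" using p0(1) by (auto simp: N0_def)
  have nN: "ivec (p0 + u0) \<notin> ihull T"
  proof
    assume "ivec (p0 + u0) \<in> ihull T"
    then have "p0 + u0 \<in> N0" using p0N by (simp add: N0_def)
    then have "q (p0 + u0) \<le> q p0" using p0(2) by blast
    then have "fst u0 * fst u0 + snd u0 * snd u0 \<le> 0" by (simp add: q_def algebra_simps)
    then have "fst u0 = 0" "snd u0 = 0" by (smt (verit) sum_squares_gt_zero_iff)+
    then show False using u0 by (simp add: prod_eq_iff)
  qed
  let ?I = "(1, 0, 0, 1) :: mat"
  have I: "unimod ?I" "aff ?I t p = t + p" for t p by (auto simp: aff_def) (cases p; simp)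
  define T' where "T' = aff ?I (- p0) ` ?N"
  have hT': "ihull T' = ihull (aff ?I (- p0) ` T)"
    unfolding T'_def affine_image_ihull[symmetric] ihull_lattice_points ..
  have mpN: "maxpair m ?N (set R)" using mp N unfolding maxpair_def ihull_lattice_points by simp
  have I0: "aff ?I 0 ` set R = set R" by (simp add: I(2))
  have mp': "maxpair m T' (set R)" using maxpair_aff[OF mpN I(1), of "- p0" 0] unfolding I0 T'_def .
  have T'f: "finite T'" "T' \<noteq> {}" using N by (auto simp: T'_def)
  have "0 \<in> T'" using p0N by (auto simp: T'_def I(2) image_iff intro!: exI[of _ p0])
  moreover have "isupport T' u0 = 0"
  proof (rule antisym)
    show "isupport T' u0 \<le> 0"
    proof (rule isupport_le[OF T'f])
      fix p assume "p \<in> T'"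
      then obtain r where r: "r \<in> ?N" "p = - p0 + r" unfolding T'_def I(2) by blast
      show "idet p u0 \<le> 0" using isupport_ge[OF N(1) r(1), of u0] p0N(2) by (simp add: r(2))
    qed
    show "0 \<le> isupport T' u0" using isupport_ge[OF T'f(1) \<open>0 \<in> T'\<close>, of u0] by simp
  qed
  moreover have "ivec u0 \<notin> ihull T'"
  proof
    assume a: "ivec u0 \<in> ihull T'"
    have "affine_image (to_matrix ?I) (ivec p0) (ihull T') = ihull (aff ?I p0 ` T')" by (rule affine_image_ihull)
    moreover have "aff ?I p0 ` T' = ?N" by (simp add: T'_def I(2) image_image)
    moreover have "ivec (p0 + u0) \<in> affine_image (to_matrix ?I) (ivec p0) (ihull T')"
    proof -
      have "lin ?I u0 = u0" by (cases u0) simp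
      then have "real_matrix (to_matrix ?I) *v ivec u0 = ivec u0" by (simp only: real_matrix_ivec)
      then have "ivec (p0 + u0) = ivec p0 + real_matrix (to_matrix ?I) *v ivec u0" by (simp only: ivec_add)
      then show ?thesis unfolding affine_image_def using a by blast
    qed
    ultimately show False using nN ihull_lattice_points by simp
  qed
  ultimately obtain P where P: "P \<in> fst ` set news \<union> fst ` set olds"
    "map (\<lambda>u. maxl u P) (map fst (edges_data R)) = map (isupport T') (map fst (edges_data R))"
    using enum_normalised[OF R e mp' m F] by blast
  obtain c where okP: "convex_ok P" and dP: "dominated P c (support_bounds R P)" using ok[OF P(1)] by blast
  note pP = ok_simps[OF okP]
  have eq: "maxl u P = isupport T' u" if "(u, g, h) \<in> set (edges_data R)" for u g h
    using P(2) that by (auto simp: map_eq_conv)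
  have "valid T' (support_bounds R P)" using pP eq by (intro support_bounds_valid[OF R _ T'f]) auto
  then have sub: "ihull T' \<subseteq> ihull (set P)" using dominated_sound[OF okP dP] by blast
  have iT': "interior (ihull T') \<noteq> {}" using mp' by (simp add: maxpair_def)
  have "(\<Sum>(u, g, h)\<leftarrow>edges_data R. g * isupport (set P) u) = (\<Sum>(u, g, h)\<leftarrow>edges_data R. g * isupport T' u)"
    using eq maxl_isupport[of P] pP by (intro arg_cong[of _ _ sum_list] map_cong) auto
  then have "mixed_volume (ihull (set P)) (ihull (set R)) = mixed_volume (ihull T') (ihull (set R))"
    unfolding edges_data_mixed_volume[OF R T'f(1) iT'] edges_data_mixed_volume[OF R finite_set ok_interior[OF okP]] by simp
  moreover have "maximal_pair (ihull T') (ihull (set R))" using mp' by (simp add: maxpair_def)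
  ultimately have "ihull (set P) = ihull T'" using sub
    unfolding maximal_pair_ihull[OF T'f(2) ok_simps(3)[OF R]] by blast
  then show ?thesis using P(1) hT' by metis
qed

section \<open>Growing lattice polygons by single points\<close>

lemma idet_cross: "idet u x * fst z = idet z x * fst u + idet u z * fst x"
    "idet u x * snd z = idet z x * snd u + idet u z * snd x"
  by (simp_all add: idet_def algebra_simps)

text \<open>A point seen from an edge at lattice height two or more forces another lattice point at height one.\<close>
lemma height_one_point:
  assumes u: "pgcd u = 1" and d: "2 \<le> idet (x - v) u"
  obtains y where "idet y u = idet v u + 1" "ivec y \<in> ihull {v, v + u, x}"
proof -
  define X d where "X = x - v" and "d = idet (x - v) u"
  have d0: "0 < d" "2 \<le> d" using d by (auto simp: d_def)
  obtain a b where ab: "a * fst u + b * snd u = 1" using bezout_int[of "fst u" "snd u"] u by (auto simp: pgcd_def)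
  define y0 where "y0 = (b, - a)"
  have y0: "idet y0 u = 1" using ab by (simp add: y0_def idet_def algebra_simps)
  \<comment> \<open>The lattice points at height one are the translates of \<open>y0\<close> along
    \<open>u\<close>. Rounding \<open>q / d\<close> up to \<open>k\<close> gives
    \<open>d z = r u + X\<close> with \<open>0 \<le> r < d\<close>, so \<open>z\<close> has
    coordinates \<open>r / d\<close> and \<open>1 / d\<close> of sum at most 1 and lies in the
    triangle.\<close>
  define q k r where "q = idet y0 X" and "k = - ((- q) div d)" and "r = (- q) mod d"
  have r: "0 \<le> r" "r < d" using d0 by (auto simp: r_def)
  have kd: "k * d = q + r"
    using div_mult_mod_eq[of "- q" d] by (simp only: k_def r_def mult_minus_left)
  define z where "z = y0 + (k * fst u, k * snd u)"
  have ku: "idet (k * fst u, k * snd u) w = k * idet u w" for w by (simp add: idet_def algebra_simps)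
  have uX: "idet u X = - d" using idet_skew[of u X] by (simp only: X_def d_def)
  have zu: "idet z u = 1" by (simp add: z_def ku y0)
  have zX: "idet z X = - r" unfolding z_def idet_simps ku uX using kd by (simp add: q_def)
  have uz: "idet u z = - 1" using idet_skew[of u z] zu by simp
  have f: "d * fst z = r * fst u + fst X" "d * snd z = r * snd u + snd X"
    using idet_cross[of u X z] by (simp_all add: uX zX uz)
  define s t where "s = real_of_int r / real_of_int d" and "t = 1 / real_of_int d"
  have d': "real_of_int d > 0" using d0 by simp
  have st: "0 \<le> s" "0 \<le> t" "s + t \<le> 1" using r d' by (auto simp: s_def t_def add_divide_distrib[symmetric])
  have "ivec z = s *\<^sub>R ivec u + t *\<^sub>R ivec X"
    using arg_cong[OF f(1), of real_of_int] arg_cong[OF f(2), of real_of_int] d'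
    by (simp add: vec2_eq_iff s_def t_def field_simps)
  then have "ivec (v + z) = (1 - s - t) *\<^sub>R ivec v + s *\<^sub>R ivec (v + u) + t *\<^sub>R ivec x"
    by (simp add: ivec_add ivec_diff X_def algebra_simps)
  then have "ivec (v + z) \<in> convex hull {ivec v, ivec (v + u), ivec x}"
    unfolding convex_hull_3 using st
    by (intro CollectI exI[of _ "1 - s - t"] exI[of _ s] exI[of _ t]) auto
  then have "ivec (v + z) \<in> ihull {v, v + u, x}" by (simp add: ihull_def)
  moreover have "idet (v + z) u = idet v u + 1" by (simp add: zu)
  ultimately show ?thesis using that by blast
qed

lemma pick_mem: "pick n xs = Some x \<Longrightarrow> x \<in> set xs"
  by (induction n xs rule: pick.induct) (auto split: if_splits)

text \<open>By \<open>lat\<close> and \<open>height_one_point\<close>, \<open>x\<close> has height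
  at most one over every edge, so it lies in the box scanned by \<open>growth_ok\<close>. The
  position of \<open>x\<close> and the volume bound exclude every exit of \<open>point_ok\<close>
  except the certified one.\<close>

lemma growth_step:
  assumes R: "convex_ok R" and ge: "growth_ok look (R, cs, rest)"
    and look: "\<And>j R'. look j = Some R' \<Longrightarrow> R' \<in> set Rs" and Rs: "\<And>R'. R' \<in> set Rs \<Longrightarrow> convex_ok R'"
    and x: "ivec x \<notin> ihull (set R)" and lat: "\<And>p. ivec p \<in> ihull (insert x (set R)) \<Longrightarrow> p \<noteq> x \<Longrightarrow> ivec p \<in> ihull (set R)"
    and vol: "normalized_volume (ihull (insert x (set R))) \<le> 10"
  shows "\<exists>R'\<in>set Rs. \<exists>M t. unimod M \<and> ihull (aff M t ` insert x (set R)) = ihull (set R')"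
proof -
  let ?W = "insert x (set R)"
  note Rne = ok_simps[OF R]
  have iW: "interior (ihull ?W) \<noteq> {}" using ok_interior[OF R] interior_mono[OF ihull_mono[of "set R" ?W]] by blast
  have hR: "isupport (set R) u = h" if "(u, g, h) \<in> set (edges_data R)" for u g h by (rule edges_data_isupport[OF R that])
  have g: "0 < g" if "(u, g, h) \<in> set (edges_data R)" for u g h using edges_data_mem[OF R that] by metis
  have W: "isupport ?W u = max h (idet x u)" if "(u, g, h) \<in> set (edges_data R)" for u g h
    unfolding isupport_def using Rne(3) hR[OF that] by (simp add: isupport_def max.commute)
  have ev: "ext_vol es x = (\<Sum>(u, g, h)\<leftarrow>es. g * isupport ?W u)" if "set es \<subseteq> set (edges_data R)" for es
    using that
  proof (induction es)
    case (Cons e es)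
    obtain u g h where e: "e = (u, g, h)" by (cases e) auto
    then show ?case using Cons W[of u g h] by (auto simp: Let_def max_def)
  qed simp
  have "mixed_volume (ihull ?W) (ihull (set R)) \<le> mixed_volume (ihull ?W) (ihull ?W)"
    using iW ok_interior[OF R] ihull_mono[of "set R" ?W] by (intro mixed_volume_mono polytope_ihull) auto
  also have "\<dots> \<le> 10" using vol mixed_volume_self[OF polytope_ihull, of ?W] by simp
  finally have "real_of_int (ext_vol (edges_data R) x) \<le> 10"
    using edges_data_mixed_volume[OF R _ iW] ev[of "edges_data R"] by simp
  then have ev10: "ext_vol (edges_data R) x \<le> 10" by linarith
  have "\<exists>(u, g, h)\<in>set (edges_data R). h < idet x u"
  proof (rule ccontr)
    assume n: "\<not> (\<exists>(u, g, h)\<in>set (edges_data R). h < idet x u)"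
    have "ihull {x} \<subseteq> ihull (set R)"
    proof (rule ok_subset[OF R])
      fix v w assume vw: "(v, w) \<in> set (cyclic_pairs R)"
      obtain u g h where e: "edge_data (v, w) = (u, g, h)" by (cases "edge_data (v, w)") auto
      note f = edge_data_facts[OF ok_edge(3)[OF R vw] e]
      have "(u, g, h) \<in> set (edges_data R)" unfolding edges_data_def using vw e by force
      then have "idet x u \<le> h" using n by (auto simp: not_less)
      then have "g * idet x u \<le> g * h" using f(1) by simp
      then show "isupport {x} (w - v) \<le> idet v (w - v)"
        unfolding f(2,3) isupport_def by (simp add: idet_def algebra_simps)
    qed auto
    then show False using x ihull_inc[of x "{x}"] by blast
  qed
  then obtain u1 g1 h1 where u1: "(u1, g1, h1) \<in> set (edges_data R)" "h1 < idet x u1" by blast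
  have in0: "\<not> inside0 (edges_data R) x"
  proof -
    have "idet x u \<le> h" if "inside0 es x" "(u, g, h) \<in> set es" for es u g h
      using that by (induction es x rule: inside0.induct) (auto split: if_splits)
    then show ?thesis using u1 by (meson not_less)
  qed
  have le1: "idet x u \<le> h + 1" if e: "(u, g, h) \<in> set (edges_data R)" for u g h
  proof (rule ccontr)
    assume "\<not> idet x u \<le> h + 1"
    obtain v w where vw: "(v, w) \<in> set (cyclic_pairs R)" "0 < g" "w - v = (g * fst u, g * snd u)" "h = idet v u" "pgcd u = 1"
      using edges_data_mem[OF R e] by metis
    have "2 \<le> idet (x - v) u" using \<open>\<not> idet x u \<le> h + 1\<close> vw(4) by simp
    then obtain y where y: "idet y u = idet v u + 1" "ivec y \<in> ihull {v, v + u, x}" using height_one_point[OF vw(5)] by blast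
    have v: "ivec v \<in> ihull (set R)" "ivec w \<in> ihull (set R)" using ok_edge(1,2)[OF R vw(1)] by (auto intro: ihull_inc)
    have "w = v + (g * fst u, g * snd u)" using vw(3) by (metis add_diff_cancel_left' diff_add_cancel add.commute)
    then have "ivec w = ivec v + real_of_int g *\<^sub>R ivec u" by (simp add: vec2_eq_iff)
    then have "ivec (v + u) = (1 - 1 / real_of_int g) *\<^sub>R ivec v + (1 / real_of_int g) *\<^sub>R ivec w"
      using vw(2) by (simp add: ivec_add algebra_simps)
    moreover have "\<dots> \<in> ihull (set R)" using v vw(2) by (intro convexD_alt[OF convex_ihull]) auto
    ultimately have vu: "ivec (v + u) \<in> ihull (set R)" by simp
    have sub: "ihull (set R) \<subseteq> ihull ?W" by (rule ihull_mono) auto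
    have "ihull {v, v + u, x} \<subseteq> ihull ?W"
      by (rule ihull_minimal[OF _ convex_ihull]) (use v vu sub ihull_inc[of x ?W] in auto)
    then have "ivec y \<in> ihull ?W" using y by blast
    moreover have "y \<noteq> x" using y(1) \<open>2 \<le> idet (x - v) u\<close> by auto
    ultimately have "ivec y \<in> ihull (set R)" using lat by blast
    then have "idet y u \<le> h" using idet_le_isupport[of "set R" y u] hR[OF e] by simp
    then show False using y(1) vw(4) by simp
  qed
  have out: "\<not> outside1 (edges_data R) x"
  proof -
    have "\<exists>(u, g, h)\<in>set es. h + 1 < idet x u" if "outside1 es x" for es
      using that by (induction es x rule: outside1.induct) (auto split: if_splits)
    then show ?thesis using le1 by fastforce
  qed
  have mv: "mixed_vol R R = (\<Sum>(u, g, h)\<leftarrow>edges_data R. g * isupport (set R) u)" using Rne by (intro mixed_vol_isupport) auto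
  \<comment> \<open>The edge \<open>u1\<close> that sees \<open>x\<close> makes the sum strictly
    larger than the volume of \<open>R\<close>, and both are integers. This justifies that
    \<open>growth_ok\<close> exempts polygons of volume 10.\<close>
  have "mixed_vol R R < 10"
  proof -
    have le: "(case e of (u, g, h) \<Rightarrow> g * isupport (set R) u) \<le> (case e of (u, g, h) \<Rightarrow> g * isupport ?W u)"
      if "e \<in> set (edges_data R)" for e
    proof -
      obtain u g h where e: "e = (u, g, h)" by (cases e) auto
      show ?thesis using W[of u g h] hR[of u g h] g[of u g h] that e by simp
    qed
    have "mixed_vol R R \<noteq> ext_vol (edges_data R) x"
    proof
      assume "mixed_vol R R = ext_vol (edges_data R) x"
      then have "(case (u1, g1, h1) of (u, g, h) \<Rightarrow> g * isupport (set R) u) = (case (u1, g1, h1) of (u, g, h) \<Rightarrow> g * isupport ?W u)"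
        using mv ev[of "edges_data R"] by (intro sum_list_eq_pointwise[where f = "\<lambda>e. case e of (u, g, h) \<Rightarrow> g * isupport (set R) u"
          and g = "\<lambda>e. case e of (u, g, h) \<Rightarrow> g * isupport ?W u", OF le _ u1(1)]) simp_all
      then show False using W[OF u1(1)] hR[OF u1(1)] g[OF u1(1)] u1(2) by simp
    qed
    moreover have "mixed_vol R R \<le> ext_vol (edges_data R) x"
      unfolding mv ev[OF subset_refl] by (rule sum_list_mono[OF le])
    ultimately show ?thesis using ev10 by linarith
  qed
  define L where "L = close_cycle (map (\<lambda>(u, g, h). (u, h + 1)) (edges_data R))"
  have "set L = set (map (\<lambda>(u, g, h). (u, h + 1)) (edges_data R))"
    unfolding L_def close_cycle_def using edges_data_ne[OF R] by (cases "edges_data R") auto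
  then have vL: "valid {x} L" using le1 by (fastforce simp: valid_def isupport_def)
  obtain b1 b2 b3 b4 where b: "cone_floor (0, 1) L = Some b1" "cone_floor (0, -1) L = Some b2" "cone_floor (-1, 0) L = Some b3" "cone_floor (1, 0) L = Some b4"
    and pts: "list_all (\<lambda>x. list_all (\<lambda>y. point_ok look R (edges_data R) cs (x, y)) [- b4 .. b3]) [- b2 .. b1]"
    using ge \<open>mixed_vol R R < 10\<close> unfolding growth_ok_def L_def by (auto simp: Let_def split: option.splits)
  obtain x1 x2 where xx: "x = (x1, x2)" by (cases x)
  have "x1 \<le> b1" "- b2 \<le> x1" "x2 \<le> b3" "- b4 \<le> x2"
    using cone_floor_sound[OF vL b(1)] cone_floor_sound[OF vL b(2)] cone_floor_sound[OF vL b(3)] cone_floor_sound[OF vL b(4)]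
    by (auto simp: isupport_def idet_def xx)
  then have "point_ok look R (edges_data R) cs x" using pts unfolding xx list_all_iff by simp
  then obtain j M t where c: "cert_ok look R x (j, M, t)"
    using out in0 ev10 unfolding point_ok_def by (auto split: option.splits if_splits)
  obtain R' where R': "look j = Some R'" "unimod M" "list_all (\<lambda>q. q \<in> set (map (aff M t) (x # R))) R'"
    "list_all (inside_edges (cyclic_pairs R')) (map (aff M t) (x # R))"
    using c unfolding cert_ok_def by (auto simp: Let_def split: option.splits)
  have R'm: "R' \<in> set Rs" using look R'(1) by blast
  have Y: "set (map (aff M t) (x # R)) = aff M t ` ?W" by simp
  have "ihull (aff M t ` ?W) \<subseteq> ihull (set R')"
    using R'(4) unfolding Y[symmetric] list_all_iff by (intro all_inside_edges[OF Rs[OF R'm]]) auto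
  moreover have "ihull (set R') \<subseteq> ihull (aff M t ` ?W)"
    using R'(3) unfolding Y list_all_iff by (intro ihull_mono) auto
  ultimately show ?thesis using R'm R'(2) by blast
qed

lemma ihull_aff_cong: "ihull S = ihull T \<Longrightarrow> ihull (aff M t ` S) = ihull (aff M t ` T)"
  unfolding affine_image_ihull[symmetric] by simp

lemma ivec_mem_aff: assumes "unimod M" shows "ivec (aff M t p) \<in> ihull (aff M t ` S) \<longleftrightarrow> ivec p \<in> ihull S"
proof -
  have "ihull (aff M t ` {p}) \<subseteq> ihull (aff M t ` S) \<longleftrightarrow> ihull {p} \<subseteq> ihull S" by (rule ihull_aff_subset[OF assms])
  moreover have "ihull {p} = {ivec p}" for p by (simp add: ihull_def)
  ultimately show ?thesis by simp
qed

text \<open>Otherwise the point would also be extreme in the smaller hull, and so be one of its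
  generators.\<close>

lemma extreme_removed:
  assumes "ivec v extreme_point_of ihull S" shows "ivec v \<notin> ihull (S - {v})"
proof
  assume a: "ivec v \<in> ihull (S - {v})"
  have "ihull (S - {v}) \<subseteq> ihull S" by (rule ihull_mono) auto
  then have "ivec v extreme_point_of ihull (S - {v})"
    using assms a unfolding extreme_point_of_def by blast
  then have "ivec v \<in> ivec ` (S - {v})" unfolding ihull_def by (rule extreme_point_of_convex_hull)
  then obtain w where "ivec v = ivec w" "w \<in> S - {v}" by blast
  then show False by (simp only: ivec_inj) simp
qed

lemma ihull_extremes:
  assumes "finite S" shows "ihull {p \<in> S. ivec p extreme_point_of ihull S} = ihull S"
proof -
  have "ihull S = convex hull {x. x extreme_point_of ihull S}"
    using Krein_Milman_Minkowski[OF compact_ihull[OF assms] convex_ihull] .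
  also have "{x. x extreme_point_of ihull S} = ivec ` {p \<in> S. ivec p extreme_point_of ihull S}"
    using extreme_point_of_convex_hull unfolding ihull_def by blast
  finally show ?thesis unfolding ihull_def by simp
qed

lemma noncollinear_ihull:
  assumes "a \<in> S" "b \<in> S" "c \<in> S" "idet (b - a) (c - a) \<noteq> 0" shows "interior (ihull S) \<noteq> {}"
proof (rule noncollinear_interior[OF convex_ihull])
  show "rdet (ivec b - ivec a) (ivec c - ivec a) \<noteq> 0" unfolding ivec_diff[symmetric] rdet_ivec using assms(4) by (simp only: of_int_eq_0_iff) simp
qed (use assms ihull_inc in auto)

text \<open>Take three extreme points \<open>a\<close>, \<open>b\<close>, \<open>c\<close> that are
  not collinear. For a fourth point \<open>s\<close> the signed area of the triangle is the sum of
  those of the three triangles at \<open>s\<close>. So \<open>s\<close> and two of the points are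
  not collinear either, and the third point can be removed.\<close>

lemma removable_or_triangle:
  assumes "finite S" "interior (ihull S) \<noteq> {}"
  obtains (removable) v where "v \<in> S" "ivec v \<notin> ihull (S - {v})" "interior (ihull (S - {v})) \<noteq> {}"
  | (triangle) a b c where "S = {a, b, c}" "0 < idet (b - a) (c - a)"
proof -
  let ?E = "{p \<in> S. ivec p extreme_point_of ihull S}"
  have "interior (ihull ?E) \<noteq> {}" using ihull_extremes[OF assms(1)] assms(2) by simp
  then obtain a b c where abc: "a \<in> ?E" "b \<in> ?E" "c \<in> ?E" "idet (b - a) (c - a) \<noteq> 0"
    by (rule interior_ihull_noncollinear)
  show ?thesis
  proof (cases "S = {a, b, c}")
    case True
    show ?thesis
    proof (cases "0 < idet (b - a) (c - a)")
      case True then show ?thesis using triangle \<open>S = {a, b, c}\<close> by blast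
    next
      case False
      then have "0 < idet (c - a) (b - a)" using abc(4) idet_skew[of "c - a" "b - a"] by linarith
      then show ?thesis using triangle[of a c b] \<open>S = {a, b, c}\<close> by (simp add: insert_commute)
    qed
  next
    case False
    then obtain s where s: "s \<in> S" "s \<noteq> a" "s \<noteq> b" "s \<noteq> c" using abc by auto
    have ne: "a \<noteq> b" "b \<noteq> c" "a \<noteq> c" using abc(4) by (auto simp del: idet_simps(1-4))
    have key: thesis if "p \<in> ?E" "p' \<in> S - {p}" "p'' \<in> S - {p}" "s \<in> S - {p}" "idet (p' - s) (p'' - s) \<noteq> 0" for p p' p''
    proof (rule removable[of p])
      show "interior (ihull (S - {p})) \<noteq> {}" using noncollinear_ihull[of s "S - {p}" p' p''] that by blast
    qed (use that extreme_removed in auto)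
    have "idet (b - a) (c - a) = idet (a - s) (b - s) + idet (b - s) (c - s) + idet (c - s) (a - s)"
      by (simp add: idet_def algebra_simps)
    then consider "idet (a - s) (b - s) \<noteq> 0" | "idet (b - s) (c - s) \<noteq> 0" | "idet (c - s) (a - s) \<noteq> 0"
      using abc(4) by linarith
    then show ?thesis
    proof cases
      case 1 show ?thesis by (rule key[of c a b]) (use 1 abc s ne in auto)
    next
      case 2 show ?thesis by (rule key[of a b c]) (use 2 abc s ne in auto)
    next
      case 3 show ?thesis by (rule key[of b c a]) (use 3 abc s ne in auto)
    qed
  qed
qed

text \<open>The edge from \<open>b\<close> to \<open>a\<close> is primitive, as another lattice
  point on it would be a vertex. The vertices have heights 0, 0 and \<open>D\<close> over that edge,
  and \<open>D \<ge> 2\<close> would yield a lattice point of height one. Hence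
  \<open>D = 1\<close>, and the edge vectors at \<open>a\<close> form a basis of the
  lattice.\<close>

lemma empty_triangle:
  assumes S: "S = {a, b, c}" "0 < idet (b - a) (c - a)" and lat: "\<And>p. ivec p \<in> ihull S \<Longrightarrow> p \<in> S"
  shows "\<exists>M t. unimod M \<and> aff M t ` S = {(0, 0), (1, 0), (0, 1)}"
proof -
  define u where "u = a - b"
  define D where "D = idet (b - a) (c - a)"
  have D: "idet (c - b) u = D" "0 < D" unfolding u_def D_def using S(2) by (auto simp: idet_def algebra_simps)
  have ne: "u \<noteq> 0" using D by auto
  define g where "g = pgcd u"
  have g0: "0 < g" using ne by (auto simp: g_def pgcd_def gcd_pos_int prod_eq_iff)
  define w where "w = (fst u div g, snd u div g)"
  have w: "u = (g * fst w, g * snd w)" by (simp add: w_def g_def pgcd_def prod_eq_iff)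
  have "g = 1"
  proof (rule ccontr)
    assume "g \<noteq> 1"
    then have g2: "2 \<le> g" using g0 by simp
    have "a = b + (g * fst w, g * snd w)" using w by (simp add: u_def algebra_simps)
    then have "ivec a = ivec b + real_of_int g *\<^sub>R ivec w" by (simp add: vec2_eq_iff)
    then have "ivec (b + w) = (1 - 1 / real_of_int g) *\<^sub>R ivec b + (1 / real_of_int g) *\<^sub>R ivec a"
      using g0 by (simp add: ivec_add algebra_simps)
    moreover have "\<dots> \<in> ihull S" using g2 by (intro convexD_alt[OF convex_ihull] ihull_inc) (auto simp: S)
    ultimately have "b + w \<in> S" using lat by simp
    then consider "b + w = a" | "w = 0" | "b + w = c" by (auto simp: S)
    then show False
    proof cases
      case 1
      then have "w = u" by (auto simp: u_def)
      then have "fst u = g * fst u" "snd u = g * snd u" using w by (metis fst_conv, metis snd_conv)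
      then show False using g2 ne by (auto simp: prod_eq_iff)
    next
      case 2 then show False using w ne by (simp add: prod_eq_iff)
    next
      case 3
      then have "c - b = w" by auto
      moreover have "idet w (g * fst w, g * snd w) = 0" by (simp add: idet_def)
      then have "idet w u = 0" using w by simp
      ultimately show False using D by simp
    qed
  qed
  then have pu: "pgcd u = 1" by (simp add: g_def)
  have "D < 2"
  proof (rule ccontr)
    assume "\<not> D < 2"
    then have "2 \<le> idet (c - b) u" using D by simp
    then obtain y where y: "idet y u = idet b u + 1" "ivec y \<in> ihull {b, b + u, c}" using height_one_point[OF pu] by blast
    have "{b, b + u, c} = S" by (auto simp: S u_def)
    then have "y \<in> S" using y lat by simp
    moreover have "idet a u = idet b u" by (simp add: u_def idet_skew[of a b])
    moreover have "idet c u = idet b u + D" using D(1) by simp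
    ultimately show False using y(1) \<open>\<not> D < 2\<close> by (auto simp: S)
  qed
  then have D1: "D = 1" using D by simp
  define e f where "e = b - a" and "f = c - a"
  define N where "N = (fst e, fst f, snd e, snd f)"
  have "unimod N" using D1 by (simp add: N_def D_def e_def f_def idet_def algebra_simps)
  have "aff N a (0, 0) = a" "aff N a (1, 0) = b" "aff N a (0, 1) = c"
    by (simp_all add: aff_def N_def e_def f_def prod_eq_iff)
  then have im: "S = aff N a ` {(0, 0), (1, 0), (0, 1)}" by (simp add: S(1))
  obtain M t where "unimod M" "\<And>S. aff M t ` (aff N a ` S) = S" using aff_image_inverse[OF \<open>unimod N\<close>, of a] by metis
  then show ?thesis using im by metis
qed

text \<open>Induction on the number of lattice points. Generating by the set \<open>N\<close> of all
  of them ensures that deleting an extreme point deletes exactly one lattice point, as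
  \<open>growth_step\<close> demands.\<close>

theorem growth_complete:
  fixes DB :: "entry list"
  assumes g: "\<And>e. e \<in> set DB \<Longrightarrow> growth_ok look e \<and> convex_ok (fst e)"
    and look: "\<And>j R. look j = Some R \<Longrightarrow> R \<in> set (map fst DB)"
    and base: "\<exists>R\<in>set (map fst DB). set R = {(0, 0), (1, 0), (0, 1)}"
  shows "finite S \<Longrightarrow> interior (ihull S) \<noteq> {} \<Longrightarrow> normalized_volume (ihull S) \<le> 10 \<Longrightarrow>
    \<exists>R\<in>set (map fst DB). \<exists>M t. unimod M \<and> ihull (aff M t ` S) = ihull (set R)"
proof (induction "card {p. ivec p \<in> ihull S}" arbitrary: S rule: less_induct)
  case less
  define N where "N = {p. ivec p \<in> ihull S}"
  have hN: "ihull N = ihull S" unfolding N_def by (rule ihull_lattice_points)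
  have fN: "finite N" unfolding N_def by (rule finite_lattice_points[OF less.prems(1)])
  have iN: "interior (ihull N) \<noteq> {}" using hN less.prems(2) by simp
  have latN: "p \<in> N" if "ivec p \<in> ihull N" for p using that hN by (simp add: N_def)
  from fN iN show ?case
  proof (cases rule: removable_or_triangle)
    case (removable v)
    let ?S = "N - {v}"
    have sub: "ihull ?S \<subseteq> ihull N" by (rule ihull_mono) auto
    have "{p. ivec p \<in> ihull ?S} \<subset> {p. ivec p \<in> ihull S}"
      using sub hN removable(1,2) ihull_inc[of v N] by blast
    then have "card {p. ivec p \<in> ihull ?S} < card {p. ivec p \<in> ihull S}"
      using fN by (intro psubset_card_mono) (auto simp: N_def)
    moreover have "normalized_volume (ihull ?S) \<le> 10"
    proof -
      have "measure lebesgue (ihull ?S) \<le> measure lebesgue (ihull N)"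
        using fN by (intro measure_mono_fmeasurable sub lmeasurable_compact compact_ihull fmeasurableD) auto
      then show ?thesis using less.prems(3) hN by (simp add: normalized_volume_def)
    qed
    ultimately obtain R M t where R: "R \<in> set (map fst DB)" "unimod M" "ihull (aff M t ` ?S) = ihull (set R)"
      using less.hyps[of ?S] fN removable(3) by blast
    obtain cs rest where e: "(R, cs, rest) \<in> set DB" using R(1) by auto
    have okR: "convex_ok R" using g[OF e] by simp
    define x where "x = aff M t v"
    have W: "ihull (aff M t ` N) = ihull (insert x (set R))"
    proof -
      have "N = insert v ?S" using removable(1) by blast
      then have "ihull (aff M t ` N) = convex hull (insert (ivec x) (ivec ` (aff M t ` ?S)))"
        unfolding ihull_def x_def by (metis image_insert)
      also have "\<dots> = convex hull (insert (ivec x) (convex hull (ivec ` (aff M t ` ?S))))"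
        by (metis hull_insert)
      also have "convex hull (ivec ` (aff M t ` ?S)) = convex hull (ivec ` set R)" using R(3) unfolding ihull_def .
      also have "convex hull (insert (ivec x) (convex hull (ivec ` set R))) = convex hull (insert (ivec x) (ivec ` set R))"
        by (metis hull_insert)
      finally show ?thesis unfolding ihull_def by simp
    qed
    have "\<exists>R'\<in>set (map fst DB). \<exists>M t. unimod M \<and> ihull (aff M t ` insert x (set R)) = ihull (set R')"
    proof (rule growth_step[OF okR])
      show "growth_ok look (R, cs, rest)" using g[OF e] by blast
      show "R' \<in> set (map fst DB)" if "look j = Some R'" for j R' using that by (rule look)
      show "convex_ok R'" if "R' \<in> set (map fst DB)" for R' using that g by auto
      show "ivec x \<notin> ihull (set R)" using removable(2) unfolding R(3)[symmetric] x_def ivec_mem_aff[OF R(2)] .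
      show "normalized_volume (ihull (insert x (set R))) \<le> 10"
      proof -
        have "mixed_volume (ihull (aff M t ` N)) (ihull (aff M t ` N)) = mixed_volume (ihull N) (ihull N)"
          by (rule mixed_volume_ihull_aff[OF R(2) fN fN])
        then have "normalized_volume (ihull (aff M t ` N)) = normalized_volume (ihull N)"
          using mixed_volume_self[OF polytope_ihull[OF fN]] mixed_volume_self[OF polytope_ihull[OF finite_imageI[OF fN]]] by simp
        then show ?thesis using less.prems(3) hN unfolding W[symmetric] by simp
      qed
      fix p assume p: "ivec p \<in> ihull (insert x (set R))" "p \<noteq> x"
      obtain K k where K: "\<And>p. aff M t (aff K k p) = p" using aff_inverse[OF R(2), of t] by metis
      define q where "q = aff K k p"
      have pq: "p = aff M t q" by (simp add: q_def K)
      have "ivec q \<in> ihull N" using p(1) unfolding W[symmetric] pq ivec_mem_aff[OF R(2)] .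
      moreover have "q \<noteq> v" using p(2) by (auto simp: pq x_def)
      ultimately have "q \<in> ?S" using latN by blast
      then have "ivec q \<in> ihull ?S" by (rule ihull_inc)
      then show "ivec p \<in> ihull (set R)" unfolding R(3)[symmetric] pq ivec_mem_aff[OF R(2)] .
    qed
    then obtain R' M' t' where R': "R' \<in> set (map fst DB)" "unimod M'" "ihull (aff M' t' ` insert x (set R)) = ihull (set R')" by blast
    have "ihull (aff M' t' ` (aff M t ` S)) = ihull (set R')"
      unfolding R'(3)[symmetric] by (intro ihull_aff_cong) (use W ihull_aff_cong[OF hN, of M t] in simp)
    then have "affine_image (to_matrix M') (ivec t') (affine_image (to_matrix M) (ivec t) (ihull S)) = ihull (set R')"
      by (simp only: affine_image_ihull)
    moreover obtain K where K: "to_matrix M' ** to_matrix M = to_matrix K" using to_matrix_surj by metis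
    have "invertible (to_matrix K)" unfolding K[symmetric] using R(2) R'(2)
      by (intro invertible_mult) (simp_all add: invertible_to_matrix)
    then have "unimod K" by (simp add: invertible_to_matrix)
    moreover have "ivec t' + real_matrix (to_matrix M') *v ivec t = ivec (t' + lin M' t)" by (simp only: real_matrix_ivec ivec_add)
    ultimately have "affine_image (to_matrix K) (ivec (t' + lin M' t)) (ihull S) = ihull (set R')"
      by (simp only: affine_image_comp K)
    then show ?thesis using R'(1) \<open>unimod K\<close> unfolding affine_image_ihull by blast
  next
    case (triangle a b c)
    obtain M t where M: "unimod M" "aff M t ` N = {(0, 0), (1, 0), (0, 1)}"
      using empty_triangle[OF triangle latN] by blast
    then show ?thesis using base ihull_aff_cong[OF hN[symmetric], of M t] by metis
  qed
qed

section \<open>Counting equivalence classes\<close>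

definition new_pairs :: "entry list \<Rightarrow> (pt list \<times> pt list) list" where
  "new_pairs DB = concat (map (\<lambda>(R, _, _, news, _). map (\<lambda>(P, _). (R, P)) news) DB)"

text \<open>Mixed volume, sum and product of the area invariants of the two polygons (symmetric, as pairs may be
  swapped), and the pair itself.\<close>
type_synonym rep = "int \<times> int \<times> int \<times> pt list \<times> pt list"

definition keyed :: "entry \<Rightarrow> rep list" where
  "keyed e = (case e of (R, _, _, news, _) \<Rightarrow> let w = area_inv R in
     map (\<lambda>(P, _). let w' = area_inv P in (mixed_vol R P, w + w', w * w', R, P)) news)"

definition reps :: "entry list \<Rightarrow> rep list" where
  "reps DB = concat (map keyed DB)"

text \<open>The costly invariant \<open>mixed_inv\<close> is compared only if the stored keys
  agree.\<close>

fun apart :: "rep \<Rightarrow> rep \<Rightarrow> bool" where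
  "apart (m, a, b, R, P) (m', a', b', R', P') =
    (if m = m' then if a = a' then if b = b' then mixed_inv P R \<noteq> mixed_inv P' R' else True else True else True)"

text \<open>Strict connectives: \<open>\<and>\<close> and \<open>\<or>\<close> are simplified under congruence rules, by which symbolic evaluation would traverse long
  lists repeatedly.\<close>
fun both :: "bool \<Rightarrow> bool \<Rightarrow> bool" where
  "both True b = b"
| "both False b = False"

fun either :: "bool \<Rightarrow> bool \<Rightarrow> bool" where
  "either True b = True"
| "either False b = b"

lemma both_iff [simp]: "both a b \<longleftrightarrow> a \<and> b" and either_iff [simp]: "either a b \<longleftrightarrow> a \<or> b"
  by (cases a; simp)+

fun mem_pair :: "pt list \<times> pt list \<Rightarrow> (pt list \<times> pt list) list \<Rightarrow> bool" where
  "mem_pair p [] = False"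
| "mem_pair p (q # qs) = either (p = q) (mem_pair p qs)"

fun sub_pairs :: "(pt list \<times> pt list) list \<Rightarrow> (pt list \<times> pt list) list \<Rightarrow> bool" where
  "sub_pairs [] qs = True"
| "sub_pairs (p # ps) qs = both (mem_pair p qs) (sub_pairs ps qs)"

lemma sub_pairs_iff: "sub_pairs ps qs \<longleftrightarrow> set ps \<subseteq> set qs"
proof -
  have "mem_pair p qs \<longleftrightarrow> p \<in> set qs" for p qs by (induction p qs rule: mem_pair.induct) auto
  then show ?thesis by (induction ps qs rule: sub_pairs.induct) auto
qed

fun apart_all :: "rep \<Rightarrow> rep list \<Rightarrow> bool" where
  "apart_all k [] = True"
| "apart_all k (k' # ks) = both (apart k k') (apart_all k ks)"

fun all_apart :: "rep list \<Rightarrow> bool" where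
  "all_apart [] = True"
| "all_apart (k # ks) = both (apart_all k ks) (all_apart ks)"

definition mixed_vols :: "entry list \<Rightarrow> int list" where
  "mixed_vols DB = concat (map (\<lambda>(R, _, _, news, _). map (\<lambda>(P, _). mixed_vol R P) news) DB)"

fun count_vol :: "int \<Rightarrow> int list \<Rightarrow> int" where
  "count_vol m [] = 0"
| "count_vol m (k # ks) = (if m = k then 1 + count_vol m ks else count_vol m ks)"

definition counts :: "int list \<Rightarrow> int list" where
  "counts ks = map (\<lambda>m. count_vol m ks) [1, 2, 3, 4, 5, 6, 7, 8, 9, 10]"

lemma all_apart_iff: "all_apart ks \<longleftrightarrow> sorted_wrt apart ks"
proof -
  have "apart_all k ks \<longleftrightarrow> (\<forall>k'\<in>set ks. apart k k')" for k ks by (induction ks) auto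
  then show ?thesis by (induction ks) auto
qed

lemma count_vol_length: "count_vol m (map fst ks) = int (length (filter (\<lambda>k. fst k = m) ks))"
  by (induction ks) auto

lemma map_fst_reps: "map fst (reps DB) = mixed_vols DB"
  unfolding reps_def mixed_vols_def map_concat map_map
  by (intro arg_cong[of _ _ concat] map_cong refl) (auto simp: keyed_def Let_def split: prod.splits)

text \<open>Separates the counting argument from the data: the assumptions are the tests to be
  evaluated.\<close>

locale database =
  fixes DB :: "entry list" and cross :: "(pt list \<times> pt list) list" and look :: "int \<Rightarrow> pt list option"
  assumes news: "\<And>e. e \<in> set DB \<Longrightarrow> news_ok e"
    and enum: "\<And>e. e \<in> set DB \<Longrightarrow> enum_ok e"
    and olds: "\<And>e. e \<in> set DB \<Longrightarrow> olds_ok cross e"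
    and cross: "sub_pairs cross (new_pairs DB)"
    and growth: "\<And>e. e \<in> set DB \<Longrightarrow> growth_ok look e"
    and look: "\<And>j R. look j = Some R \<Longrightarrow> R \<in> set (map fst DB)"
    and base: "\<exists>R\<in>set (map fst DB). set R = {(0, 0), (1, 0), (0, 1)}"
    and apart: "all_apart (reps DB)"
begin

lemma news_facts:
  assumes "(R, cs, xs, news, olds) \<in> set DB"
  shows "convex_ok R" "(P, c, c') \<in> set news \<Longrightarrow> convex_ok P" "(P, c, c') \<in> set news \<Longrightarrow> dominated P c (support_bounds R P)"
    "(P, c, c') \<in> set news \<Longrightarrow> dominated R c' (support_bounds P R)"
  using news[OF assms] by (auto simp: news_ok_def list_all_iff)

lemma repsE:
  assumes "(m, a, b, R, P) \<in> set (reps DB)"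
  obtains cs xs news olds c c' where "(R, cs, xs, news, olds) \<in> set DB" "(P, c, c') \<in> set news"
    "m = mixed_vol R P" "a = area_inv R + area_inv P" "b = area_inv R * area_inv P"
  using assms unfolding reps_def keyed_def by (auto simp: Let_def)

lemma repsI:
  assumes "(R, cs, xs, news, olds) \<in> set DB" "(P, c, c') \<in> set news"
  shows "(mixed_vol R P, area_inv R + area_inv P, area_inv R * area_inv P, R, P) \<in> set (reps DB)"
  unfolding reps_def keyed_def using assms by (force simp: Let_def)

lemma reps_maxpair:
  assumes "(int m, a, b, R, P) \<in> set (reps DB)" shows "maxpair m (set P) (set R)" "convex_ok P" "convex_ok R"
proof -
  obtain cs xs news olds c c' where e: "(R, cs, xs, news, olds) \<in> set DB" "(P, c, c') \<in> set news" "int m = mixed_vol R P"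
    using repsE[OF assms] by metis
  show "convex_ok P" "convex_ok R" using news_facts[OF e(1)] e(2) by blast+
  then show "maxpair m (set P) (set R)" using news_maxpair news_facts[OF e(1)] e(2,3) by metis
qed

lemma image_ok_sound:
  assumes "image_ok M t V W" "unimod M" "distinct V" "distinct W" shows "aff M t ` set V = set W"
proof -
  have "aff M t ` set V \<subseteq> set W" "length V = length W" using assms(1) by (auto simp: image_ok_def list_all_iff)
  moreover have "card (aff M t ` set V) = card (set V)" by (rule card_image[OF aff_inj[OF assms(2)]])
  ultimately show ?thesis using assms(3,4) by (intro card_subset_eq) (auto simp: distinct_card)
qed

lemma olds_equivalent:
  assumes e: "(R, cs, xs, news, olds) \<in> set DB" and o: "(P, c, crt) \<in> set olds"
  shows "convex_ok P" "dominated P c (support_bounds R P)"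
    "\<exists>m a b R' P'. (m, a, b, R', P') \<in> set (reps DB) \<and>
       equivalent_pairs (ihull (set P), ihull (set R)) (ihull (set P'), ihull (set R'))"
proof -
  obtain own k M s t sw where crt: "crt = (own, k, M, s, t, sw)" by (cases crt) auto
  let ?tgt = "if own then map_option (\<lambda>(P', _). (R, P')) (pick k news) else pick k cross"
  have *: "convex_ok P \<and> dominated P c (support_bounds R P) \<and> unimod M \<and>
     (case ?tgt of None \<Rightarrow> False | Some (R', P') \<Rightarrow>
        if sw then image_ok M s R P' \<and> image_ok M t P R' else image_ok M s R R' \<and> image_ok M t P P')"
    using olds[OF e] o unfolding olds_ok_def list_all_iff crt by fastforce
  then show okP: "convex_ok P" and "dominated P c (support_bounds R P)" by auto
  have M: "unimod M" using * by simp
  obtain R' P' where p: "?tgt = Some (R', P')"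
    and im: "if sw then image_ok M s R P' \<and> image_ok M t P R' else image_ok M s R R' \<and> image_ok M t P P'"
    using * by (cases ?tgt) auto
  have "(R', P') \<in> set (new_pairs DB)"
  proof (cases own)
    case True
    then obtain q where q: "pick k news = Some (P', q)" "R' = R" using p by auto
    then have "(P', q) \<in> set news" using pick_mem by metis
    then show ?thesis unfolding new_pairs_def using e q(2) by force
  next
    case False
    then have "(R', P') \<in> set cross" using p pick_mem by simp
    then show ?thesis using cross unfolding sub_pairs_iff by blast
  qed
  then obtain cs' xs' news' olds' c1 c2 where e': "(R', cs', xs', news', olds') \<in> set DB" "(P', c1, c2) \<in> set news'"
    unfolding new_pairs_def by auto
  have d: "distinct P'" "distinct R'" "distinct P" "distinct R"
    using news_facts[OF e'(1)] e'(2) news_facts(1)[OF e] okP ok_simps(1) by blast+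
  have "equivalent_pairs (ihull (set P), ihull (set R)) (ihull (set P'), ihull (set R'))"
  proof (cases sw)
    case True
    then have "aff M s ` set R = set P'" "aff M t ` set P = set R'" using im image_ok_sound M d by simp_all
    then show ?thesis unfolding equivalent_pairs_ihull using M by metis
  next
    case False
    then have "aff M s ` set R = set R'" "aff M t ` set P = set P'" using im image_ok_sound M d by simp_all
    then show ?thesis unfolding equivalent_pairs_ihull using M by metis
  qed
  then show "\<exists>m a b R' P'. (m, a, b, R', P') \<in> set (reps DB) \<and>
       equivalent_pairs (ihull (set P), ihull (set R)) (ihull (set P'), ihull (set R'))"
    using repsI[OF e'] by blast
qed

lemma complete_aux:
  assumes mp: "maxpair m S T" and m: "m \<le> 10" and le: "normalized_volume (ihull T) \<le> normalized_volume (ihull S)"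
  shows "\<exists>m' a b R P. (m', a, b, R, P) \<in> set (reps DB) \<and> equivalent_pairs (ihull S, ihull T) (ihull (set P), ihull (set R))"
proof -
  have ST: "finite S" "finite T" "interior (ihull S) \<noteq> {}" "interior (ihull T) \<noteq> {}" "mixed_volume (ihull S) (ihull T) = real m"
    using mp by (auto simp: maxpair_def)
  have "normalized_volume (ihull S) * normalized_volume (ihull T) \<le> (real m)\<^sup>2"
    using minkowski_inequality(1)[OF polytope_ihull ST(3) polytope_ihull ST(4)] ST by simp
  moreover have nn: "0 \<le> normalized_volume (ihull T)" by (simp add: normalized_volume_def)
  then have "normalized_volume (ihull T) * normalized_volume (ihull T) \<le> normalized_volume (ihull S) * normalized_volume (ihull T)"
    using le by (intro mult_right_mono)
  ultimately have "(normalized_volume (ihull T))\<^sup>2 \<le> (real m)\<^sup>2" by (simp add: power2_eq_square)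
  then have vT: "normalized_volume (ihull T) \<le> real m" by (rule power2_le_imp_le) simp
  have gr: "e \<in> set DB \<Longrightarrow> growth_ok look e \<and> convex_ok (fst e)" for e
    using growth news_facts(1) by (cases e) auto
  obtain R M t where R: "R \<in> set (map fst DB)" "unimod M" "ihull (aff M t ` T) = ihull (set R)"
    using growth_complete[OF gr look base ST(2,4)] vT m by fastforce
  obtain cs xs news olds where e: "(R, cs, xs, news, olds) \<in> set DB" using R(1) by auto
  have okR: "convex_ok R" using news_facts(1)[OF e] .
  \<comment> \<open>The translation of the first polygon is left open here;
    \<open>enum_complete\<close> supplies it.\<close>
  define S' where "S' = aff M 0 ` S"
  have "maxpair m S' (aff M t ` T)" unfolding S'_def by (rule maxpair_aff[OF mp R(2)])
  then have mp': "maxpair m S' (set R)" unfolding maxpair_def R(3) by simp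
  have "real_of_int (mixed_vol R R) = normalized_volume (ihull (set R))"
    using mixed_vol_mixed_volume[OF okR okR] mixed_volume_self[OF polytope_ihull[of "set R"]] by simp
  also have "\<dots> = normalized_volume (ihull T)"
    using mixed_volume_ihull_aff[OF R(2) ST(2) ST(2), of t t] mixed_volume_self[OF polytope_ihull[OF ST(2)]]
      mixed_volume_self[OF polytope_ihull[of "aff M t ` T"]] ST(2) R(3) by simp
  finally have "mixed_vol R R \<le> int m" using vT by linarith
  moreover have "convex_ok P \<and> (\<exists>c. dominated P c (support_bounds R P))" if "P \<in> fst ` set news \<union> fst ` set olds" for P
    using that
  proof
    assume "P \<in> fst ` set news"
    then obtain c c' where "(P, c, c') \<in> set news" by auto
    then show ?thesis using news_facts(2,3)[OF e] by blast
  next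
    assume "P \<in> fst ` set olds"
    then obtain c crt where "(P, c, crt) \<in> set olds" by auto
    then show ?thesis using olds_equivalent(1,2)[OF e] by blast
  qed
  ultimately obtain P u where P: "P \<in> fst ` set news \<union> fst ` set olds" "ihull (aff (1, 0, 0, 1) u ` S') = ihull (set P)"
    using enum_complete[OF okR enum[OF e] mp' m] by blast
  have eq: "equivalent_pairs (ihull S, ihull T) (ihull (set P), ihull (set R))"
  proof -
    have "aff (1, 0, 0, 1) u ` S' = aff M u ` S"
    proof -
      have "aff (1, 0, 0, 1) u (aff M 0 p) = aff M u p" for p
        by (cases "lin M p") (simp add: aff_def zero_prod_def)
      then show ?thesis by (simp add: S'_def image_image)
    qed
    then have "ihull (set P) = ihull (aff M u ` S)" "ihull (set R) = ihull (aff M t ` T)" using P(2) R(3) by simp_all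
    then show ?thesis unfolding equivalent_pairs_ihull using R(2) by blast
  qed
  from P(1) show ?thesis
  proof
    assume "P \<in> fst ` set news"
    then obtain c c' where "(P, c, c') \<in> set news" by auto
    then show ?thesis using repsI[OF e] eq by blast
  next
    assume "P \<in> fst ` set olds"
    then obtain c crt where "(P, c, crt) \<in> set olds" by auto
    from olds_equivalent(3)[OF e this] show ?thesis using eq equivalent_pairs_trans by blast
  qed
qed

lemma complete:
  assumes mp: "maxpair m S T" and m: "m \<le> 10"
  shows "\<exists>a b R P. (int m, a, b, R, P) \<in> set (reps DB) \<and> equivalent_pairs (ihull S, ihull T) (ihull (set P), ihull (set R))"
proof -
  have "\<exists>m' a b R P. (m', a, b, R, P) \<in> set (reps DB) \<and> equivalent_pairs (ihull S, ihull T) (ihull (set P), ihull (set R))"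
  proof (cases "normalized_volume (ihull T) \<le> normalized_volume (ihull S)")
    case True then show ?thesis using complete_aux[OF mp m] by blast
  next
    case False
    then obtain m' a b R P where r: "(m', a, b, R, P) \<in> set (reps DB)" "equivalent_pairs (ihull T, ihull S) (ihull (set P), ihull (set R))"
      using complete_aux[OF maxpair_commute[OF mp] m] by force
    have "equivalent_pairs (ihull S, ihull T) (ihull T, ihull S)"
    proof -
      have id: "aff (1, 0, 0, 1) 0 ` X = X" for X
      proof -
        have "aff (1, 0, 0, 1) 0 p = p" for p by (cases p) (simp add: aff_def zero_prod_def)
        then show ?thesis by simp
      qed
      show ?thesis unfolding equivalent_pairs_ihull
        by (intro exI[of _ "(1, 0, 0, 1)"] exI[of _ 0]) (simp only: id, simp)
    qed
    then show ?thesis using r equivalent_pairs_trans by blast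
  qed
  then obtain m' a b R P where r: "(m', a, b, R, P) \<in> set (reps DB)" "equivalent_pairs (ihull S, ihull T) (ihull (set P), ihull (set R))"
    by blast
  have ST: "finite S" "finite T" "mixed_volume (ihull S) (ihull T) = real m" using mp by (auto simp: maxpair_def)
  \<comment> \<open>Mixed volumes are invariant under equivalence, so the recorded value
    \<open>m'\<close> must be \<open>m\<close>.\<close>
  obtain M s t where M: "unimod M" and c: "(ihull (set P) = ihull (aff M s ` S) \<and> ihull (set R) = ihull (aff M t ` T)) \<or>
     (ihull (set P) = ihull (aff M s ` T) \<and> ihull (set R) = ihull (aff M t ` S))"
    using r(2) unfolding equivalent_pairs_ihull prod.inject by metis
  have "mixed_volume (ihull T) (ihull S) = real m" using ST(3) by (simp add: mixed_volume_commute)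
  with c have mv: "mixed_volume (ihull (set P)) (ihull (set R)) = real m"
    by (elim disjE conjE) (simp_all only: mixed_volume_ihull_aff[OF M ST(1,2)] mixed_volume_ihull_aff[OF M ST(2,1)] ST(3))
  obtain cs xs news olds c c' where e: "(R, cs, xs, news, olds) \<in> set DB" "(P, c, c') \<in> set news" "m' = mixed_vol R P"
    using repsE[OF r(1)] by metis
  have "mixed_volume (ihull (set P)) (ihull (set R)) = of_int m'"
    unfolding e(3) using news_facts[OF e(1)] e(2) by (intro mixed_vol_mixed_volume) blast+
  then have "m' = int m" using mv by linarith
  then show ?thesis using r by blast
qed

lemma reps_inequivalent:
  assumes "(m, a, b, R, P) \<in> set (reps DB)" "(m, a', b', R', P') \<in> set (reps DB)"
    and eq: "equivalent_pairs (ihull (set P), ihull (set R)) (ihull (set P'), ihull (set R'))"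
  shows "\<not> apart (m, a, b, R, P) (m, a', b', R', P')"
proof -
  have k: "a = area_inv R + area_inv P" "b = area_inv R * area_inv P" "a' = area_inv R' + area_inv P'" "b' = area_inv R' * area_inv P'"
    using repsE[OF assms(1)] repsE[OF assms(2)] by metis+
  have ok: "convex_ok P" "convex_ok R" "convex_ok P'" "convex_ok R'"
    using repsE[OF assms(1)] repsE[OF assms(2)] news_facts by metis+
  show ?thesis using equivalent_invariants[OF ok eq] by (simp add: k add.commute mult.commute)
qed

text \<open>The listed pairs of mixed volume \<open>m\<close> represent distinct classes by
  \<open>apart\<close>, and \<open>complete\<close> shows that every class is represented.\<close>

lemma N2_count:
  assumes "m \<le> 10" shows "int (N2 m) = count_vol (int m) (mixed_vols DB)"
proof -
  define L where "L = filter (\<lambda>k. fst k = int m) (reps DB)"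
  define pr :: "rep \<Rightarrow> (real^2) set \<times> (real^2) set"
    where "pr = (\<lambda>(m, a, b, R, P). (ihull (set P), ihull (set R)))"
  let ?E = "equivalence_on_pairs m"
  have L: "k \<in> set L \<Longrightarrow> \<exists>a b R P. k = (int m, a, b, R, P) \<and> k \<in> set (reps DB)" for k
    unfolding L_def by (cases k) auto
  have sw: "sorted_wrt apart L" using apart unfolding L_def all_apart_iff by (rule sorted_wrt_filter)
  have in_max: "pr k \<in> maximal_pairs m" if kL: "k \<in> set L" for k
  proof -
    obtain a b R P where k: "k = (int m, a, b, R, P)" "k \<in> set (reps DB)" using L[OF kL] by blast
    show ?thesis unfolding maximal_pairs_eq using reps_maxpair(1)[of m a b R P] k by (auto simp: pr_def)
  qed
  have neq: "\<not> equivalent_pairs (pr k) (pr k')" if kL: "k \<in> set L" "k' \<in> set L" "apart k k'" for k k'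
  proof
    assume "equivalent_pairs (pr k) (pr k')"
    moreover obtain a b R P where "k = (int m, a, b, R, P)" "k \<in> set (reps DB)" using L[OF kL(1)] by blast
    moreover obtain a' b' R' P' where "k' = (int m, a', b', R', P')" "k' \<in> set (reps DB)" using L[OF kL(2)] by blast
    ultimately show False using reps_inequivalent kL(3) by (simp add: pr_def)
  qed
  have inj: "inj_on (\<lambda>k. ?E `` {pr k}) (set L)" and dist: "distinct L"
  proof -
    have nap: "\<not> apart k k" for k by (cases k) simp
    show "distinct L"
      using sw by (induction L) (auto simp: nap)
    show "inj_on (\<lambda>k. ?E `` {pr k}) (set L)"
    proof (rule inj_onI, rule ccontr)
      fix k k' assume k: "k \<in> set L" "k' \<in> set L" "?E `` {pr k} = ?E `` {pr k'}" "k \<noteq> k'"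
      have "(pr k, pr k') \<in> ?E" using eq_equiv_class[OF k(3) equiv_equivalence_on_pairs in_max[OF k(2)]] .
      then have eq: "equivalent_pairs (pr k) (pr k')" by (simp add: equivalence_on_pairs_def)
      obtain i j where ij: "i < length L" "j < length L" "k = L ! i" "k' = L ! j" using k by (metis in_set_conv_nth)
      then have "i \<noteq> j" using k(4) by auto
      then have "apart k k' \<or> apart k' k" using sw ij unfolding sorted_wrt_iff_nth_less by (metis linorder_neqE_nat)
      then show False using neq k eq equivalent_pairs_sym by blast
    qed
  qed
  have "maximal_pairs m // ?E = (\<lambda>k. ?E `` {pr k}) ` set L"
  proof (intro set_eqI iffI)
    fix X assume "X \<in> maximal_pairs m // ?E"
    then obtain x where x: "x \<in> maximal_pairs m" "X = ?E `` {x}" by (rule quotientE)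
    then obtain S T where ST: "x = (ihull S, ihull T)" "maxpair m S T" unfolding maximal_pairs_eq by blast
    obtain a b R P where r: "(int m, a, b, R, P) \<in> set (reps DB)" "equivalent_pairs x (ihull (set P), ihull (set R))"
      using complete[OF ST(2) assms] ST(1) by blast
    let ?k = "(int m, a, b, R, P)"
    have k: "?k \<in> set L" using r(1) by (simp add: L_def)
    have "(x, pr ?k) \<in> ?E" using x(1) in_max[OF k] r(2) by (simp add: equivalence_on_pairs_def pr_def)
    then have "X = ?E `` {pr ?k}" unfolding x(2) using equiv_class_eq[OF equiv_equivalence_on_pairs] by blast
    then show "X \<in> (\<lambda>k. ?E `` {pr k}) ` set L" using k by blast
  next
    fix X assume "X \<in> (\<lambda>k. ?E `` {pr k}) ` set L"
    then show "X \<in> maximal_pairs m // ?E" using in_max by (auto intro: quotientI)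
  qed
  then have "N2 m = card (set L)" unfolding N2_def using card_image[OF inj] by simp
  also have "\<dots> = length L" by (rule distinct_card[OF dist])
  finally show ?thesis by (simp add: count_vol_length L_def flip: map_fst_reps)
qed

end

section \<open>The classification\<close>

text \<open>The polygons \<open>R\<close> with their certificates, split into lists that are tested
  separately; the very first one is the unimodular triangle at which growth starts.\<close>

definition db1 :: "entry list" where
  "db1 = [
([(0,0),(1,0),(0,1)],
 [((-1,-1),3,(1,0,0,1),(0,0)),((-1,0),1,(1,0,0,1),(0,0)),((-1,1),2,(1,0,0,1),(0,0)),((-1,2),1,(-1,0,-1,-1),(0,1)),((-1,3),3,(-1,-1,1,0),(1,0)),((0,-1),1,(0,-1,1,0),(0,0)),((0,2),1,(-1,-1,1,0),(1,0)),((1,-1),2,(2,1,-1,0),(-1,1)),((1,1),2,(1,1,-1,0),(-1,1)),((2,-1),1,(0,1,-1,-1),(0,1)),((2,0),1,(1,1,0,1),(-1,0)),((3,-1),3,(1,1,1,2),(-1,-1))],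
 [],
 [([(-1,0),(0,0),(-1,1)],[],[]),([(-2,0),(0,0),(-2,2)],[],[]),([(-3,0),(0,0),(-3,3)],[],[]),([(-4,0),(0,0),(-4,4)],[],[]),([(-5,0),(0,0),(-5,5)],[],[]),([(-6,0),(0,0),(-6,6)],[],[]),([(-7,0),(0,0),(-7,7)],[],[]),([(-8,0),(0,0),(-8,8)],[],[]),([(-9,0),(0,0),(-9,9)],[],[]),([(-10,0),(0,0),(-10,10)],[],[])],
 []),
([(0,1),(-1,0),(1,0)],
 [((-3,-1),13,(1,0,0,1),(0,0)),((-2,-1),7,(1,0,0,1),(0,0)),((-2,0),4,(1,0,0,1),(0,0)),((-1,-1),9,(-2,1,1,-1),(-1,1)),((-1,1),5,(-1,1,0,-1),(-1,1)),((0,-1),12,(1,0,0,1),(0,0)),((0,2),7,(-1,1,-1,0),(-1,0)),((1,-1),9,(2,1,-1,0),(-1,1)),((1,1),5,(-1,2,0,-1),(-1,1)),((2,-1),7,(-1,-2,0,-1),(0,0)),((2,0),4,(1,1,0,1),(-1,0)),((3,-1),13,(-1,-3,0,-1),(0,0))],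
 [],
 [([(0,0),(2,0),(1,1)],[],[]),([(0,0),(3,0),(2,1),(1,1)],[],[]),([(0,0),(4,0),(2,2)],[],[]),([(0,0),(5,0),(3,2),(2,2)],[],[]),([(0,0),(6,0),(3,3)],[],[]),([(0,0),(7,0),(4,3),(3,3)],[],[]),([(0,0),(8,0),(4,4)],[],[]),([(0,0),(9,0),(5,4),(4,4)],[],[]),([(0,0),(10,0),(5,5)],[],[])],
 []),
([(-1,1),(0,0),(1,0),(0,1)],
 [((-3,2),9,(1,0,0,1),(0,0)),((-2,1),5,(1,0,0,1),(0,0)),((-2,2),5,(2,3,-1,-1),(-2,1)),((-1,0),5,(-1,1,0,-1),(-1,1)),((-1,2),5,(-1,-2,1,1),(1,0)),((0,-1),9,(1,2,-1,-1),(-1,1)),((0,2),9,(-1,-2,1,1),(1,0)),((1,-1),5,(1,2,-1,-1),(-1,1)),((1,1),5,(1,-1,0,1),(0,0)),((2,-1),5,(-2,-3,1,1),(1,0)),((2,0),5,(-1,0,0,-1),(0,1)),((3,-1),9,(-1,0,0,-1),(0,1))],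
 [(2,-1),(1,1)],
 [([(-1,1),(0,0),(1,0),(0,1)],[],[]),([(-2,2),(0,0),(1,0),(-1,2)],[],[]),([(-3,3),(0,0),(1,0),(-2,3)],[],[]),([(-4,4),(0,0),(1,0),(-3,4)],[],[]),([(-5,5),(0,0),(1,0),(-4,5)],[],[]),([(-6,6),(0,0),(1,0),(-5,6)],[],[]),([(-7,7),(0,0),(1,0),(-6,7)],[],[]),([(-8,8),(0,0),(1,0),(-7,8)],[],[]),([(-9,9),(0,0),(1,0),(-8,9)],[],[]),([(-2,2),(0,0),(2,0),(0,2)],[],[]),([(-3,3),(0,0),(2,0),(-1,3)],[],[]),([(-4,4),(0,0),(2,0),(-2,4)],[],[]),([(-5,5),(0,0),(2,0),(-3,5)],[],[]),([(-6,6),(0,0),(2,0),(-4,6)],[],[]),([(-7,7),(0,0),(2,0),(-5,7)],[],[]),([(-8,8),(0,0),(2,0),(-6,8)],[],[]),([(-3,3),(0,0),(3,0),(0,3)],[],[]),([(-4,4),(0,0),(3,0),(-1,4)],[],[]),([(-5,5),(0,0),(3,0),(-2,5)],[],[]),([(-6,6),(0,0),(3,0),(-3,6)],[],[]),([(-7,7),(0,0),(3,0),(-4,7)],[],[]),([(-4,4),(0,0),(4,0),(0,4)],[],[]),([(-5,5),(0,0),(4,0),(-1,5)],[],[]),([(-6,6),(0,0),(4,0),(-2,6)],[],[]),([(-5,5),(0,0),(5,0),(0,5)],[],[])],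
 [([(-1,1),(0,0),(2,0),(1,1)],[],True,1,(-1,-2,1,1),(1,0),(1,0),False),([(-1,1),(0,0),(3,0),(2,1)],[],True,2,(-1,-2,1,1),(1,0),(1,0),False),([(-2,2),(0,0),(3,0),(1,2)],[],True,10,(-1,-2,1,1),(1,0),(2,0),False),([(-1,1),(0,0),(4,0),(3,1)],[],True,3,(-1,-2,1,1),(1,0),(1,0),False),([(-2,2),(0,0),(4,0),(2,2)],[],True,11,(-1,-2,1,1),(1,0),(2,0),False),([(-3,3),(0,0),(4,0),(1,3)],[],True,17,(-1,-2,1,1),(1,0),(3,0),False),([(-1,1),(0,0),(5,0),(4,1)],[],True,4,(-1,-2,1,1),(1,0),(1,0),False),([(-2,2),(0,0),(5,0),(3,2)],[],True,12,(-1,-2,1,1),(1,0),(2,0),False),([(-3,3),(0,0),(5,0),(2,3)],[],True,18,(-1,-2,1,1),(1,0),(3,0),False),([(-4,4),(0,0),(5,0),(1,4)],[],True,22,(-1,-2,1,1),(1,0),(4,0),False),([(-1,1),(0,0),(6,0),(5,1)],[],True,5,(-1,-2,1,1),(1,0),(1,0),False),([(-2,2),(0,0),(6,0),(4,2)],[],True,13,(-1,-2,1,1),(1,0),(2,0),False),([(-3,3),(0,0),(6,0),(3,3)],[],True,19,(-1,-2,1,1),(1,0),(3,0),False),([(-4,4),(0,0),(6,0),(2,4)],[],True,23,(-1,-2,1,1),(1,0),(4,0),False),([(-1,1),(0,0),(7,0),(6,1)],[],True,6,(-1,-2,1,1),(1,0),(1,0),False),([(-2,2),(0,0),(7,0)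,(5,2)],[],True,14,(-1,-2,1,1),(1,0),(2,0),False),([(-3,3),(0,0),(7,0),(4,3)],[],True,20,(-1,-2,1,1),(1,0),(3,0),False),([(-1,1),(0,0),(8,0),(7,1)],[],True,7,(-1,-2,1,1),(1,0),(1,0),False),([(-2,2),(0,0),(8,0),(6,2)],[],True,15,(-1,-2,1,1),(1,0),(2,0),False),([(-1,1),(0,0),(9,0),(8,1)],[],True,8,(-1,-2,1,1),(1,0),(1,0),False)]),
([(-1,-1),(1,0),(0,1)],
 [((-2,-2),13,(1,-2,1,-1),(-1,0)),((-1,0),9,(-2,1,1,-1),(-1,1)),((0,-1),9,(1,-2,0,1),(-1,1)),((0,2),13,(-2,1,-1,0),(-1,0)),((1,1),9,(1,1,-1,0),(-1,1)),((2,0),13,(1,1,0,1),(-1,0))],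
 [(-1,0),(1,1),(0,-1)],
 [([(-2,-1),(0,0),(-1,1)],[],[]),([(-3,-1),(-2,-1),(0,0),(-1,1),(-2,1)],[],[]),([(-4,-2),(0,0),(-2,2)],[],[]),([(-4,-2),(0,0),(-2,2),(-3,1),(-4,-1)],[],[]),([(-5,-2),(-4,-2),(0,0),(-2,2),(-3,2)],[],[]),([(-6,-3),(0,0),(-3,3)],[],[]),([(-6,-3),(0,0),(-3,3),(-4,2),(-6,-2)],[],[]),([(-3,-1),(-2,-1),(0,0),(0,1),(-1,2),(-2,1)],[],[]),([(-5,-2),(-4,-2),(0,0),(0,1),(-2,3),(-3,2)],[],[])],
 [([(-2,-1),(0,0),(0,1),(-1,2),(-2,0)],[],True,1,(-1,1,-1,0),(0,0),(-3,-1),False),([(-4,-2),(0,0),(0,1),(-1,2),(-2,2)],[],True,3,(0,-1,1,-1),(0,0),(-2,2),False),([(-4,-2),(0,0),(0,1),(-2,3),(-4,-1)],[],True,4,(-1,1,-1,0),(0,0),(-5,-2),False),([(-6,-3),(0,0),(0,1),(-2,3),(-3,3)],[],True,6,(0,-1,1,-1),(0,0),(-3,3),False),([(-2,-1),(0,0),(1,1),(0,2),(-1,1)],[],True,1,(0,-1,1,-1),(0,0),(-1,1),False),([(-2,-1),(0,0),(1,1),(0,2),(-1,2),(-2,0)],[],True,7,(1,-1,0,-1),(0,0),(0,1),False),([(-3,-1),(-2,-1),(0,0),(1,1),(-1,3)],[],True,3,(-1,1,-1,0),(0,0),(-4,-1),False),([(-4,-2),(0,0),(1,1),(-1,3),(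-2,2)],[],True,4,(0,-1,1,-1),(0,0),(-2,2),False),([(-4,-2),(0,0),(1,1),(-1,3),(-2,3),(-4,-1)],[],True,8,(1,-1,0,-1),(0,0),(0,1),False),([(-5,-2),(-4,-2),(0,0),(1,1),(-2,4)],[],True,6,(-1,1,-1,0),(0,0),(-6,-2),False)])]"

definition db2 :: "entry list" where
  "db2 = [
([(0,1),(-2,0),(1,0)],
 [((-5,-1),32,(1,0,0,1),(0,0)),((-4,-1),20,(1,0,0,1),(0,0)),((-3,-1),27,(-2,3,1,-2),(-3,2)),((-3,0),8,(1,0,0,1),(0,0)),((-2,-1),29,(-1,1,0,-1),(-1,0)),((-1,-1),28,(2,-1,-1,1),(1,0)),((-1,1),10,(-1,2,0,-1),(-2,1)),((0,-1),29,(1,0,0,1),(0,0)),((1,-1),27,(2,1,-1,0),(-1,1)),((1,1),10,(-1,3,0,-1),(-2,1)),((2,-1),20,(-1,-3,0,-1),(-1,0)),((2,0),8,(1,1,0,1),(-1,0)),((3,-1),32,(-1,-4,0,-1),(-1,0))],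
 [],
 [([(0,0),(3,0),(2,1)],[],[]),([(0,0),(4,0),(3,1),(2,1)],[],[]),([(0,0),(5,0),(4,1),(2,1)],[],[]),([(0,0),(6,0),(4,2)],[],[]),([(0,0),(7,0),(5,2),(4,2)],[],[]),([(0,0),(8,0),(6,2),(4,2)],[],[]),([(0,0),(9,0),(6,3)],[],[]),([(0,0),(10,0),(7,3),(6,3)],[],[])],
 []),
([(-2,1),(0,0),(1,0),(0,1)],
 [((-5,2),22,(1,0,0,1),(0,0)),((-4,2),15,(1,0,0,1),(0,0)),((-3,1),10,(1,0,0,1),(0,0)),((-3,2),18,(1,0,0,1),(0,0)),((-2,2),18,(2,3,-1,-1),(-2,1)),((-1,0),11,(1,0,0,1),(0,0)),((-1,2),15,(-1,-3,0,1),(1,0)),((0,2),22,(-1,-3,0,1),(1,0)),((1,-1),15,(2,1,-1,-1),(-1,1)),((1,1),10,(1,-1,0,1),(0,0)),((2,-1),6,(1,0,0,1),(0,0)),((2,0),11,(1,1,0,1),(-1,0)),((3,-1),15,(-2,-5,1,2),(1,0))],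
 [(1,1),(2,-1)],
 [([(-2,1),(0,0),(1,0),(0,1)],[],[]),([(-4,2),(0,0),(1,0),(-1,2)],[],[]),([(-6,3),(0,0),(1,0),(-2,3)],[],[]),([(-8,4),(0,0),(1,0),(-3,4)],[],[]),([(-2,1),(0,0),(2,0),(1,1)],[],[]),([(-4,2),(0,0),(2,0),(0,2)],[],[]),([(-6,3),(0,0),(2,0),(-1,3)],[],[]),([(-8,4),(0,0),(2,0),(-2,4)],[],[]),([(-2,1),(0,0),(3,0),(2,1)],[],[]),([(-4,2),(0,0),(3,0),(1,2)],[],[]),([(-6,3),(0,0),(3,0),(0,3)],[],[]),([(-2,1),(0,0),(4,0),(3,1)],[],[]),([(-4,2),(0,0),(4,0),(2,2)],[],[]),([(-6,3),(0,0),(4,0),(1,3)],[],[]),([(-2,1),(0,0),(5,0),(4,1)],[],[]),([(-4,2),(0,0),(5,0),(3,2)],[],[]),([(-2,1),(0,0),(6,0),(5,1)],[],[]),([(-4,2),(0,0),(6,0),(4,2)],[],[]),([(-2,1),(0,0),(7,0),(6,1)],[],[]),([(-2,1),(0,0),(8,0),(7,1)],[],[])],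
 []),
([(-2,1),(2,-1),(0,1)],
 [((-5,2),45,(1,0,0,1),(0,0)),((-4,2),19,(1,0,0,1),(0,0)),((-3,1),19,(2,3,-1,-2),(-1,1)),((-3,2),23,(1,0,0,1),(0,0)),((-2,2),23,(-1,-3,0,1),(1,0)),((-1,0),23,(2,3,-1,-2),(-1,1)),((-1,2),19,(-1,-3,0,1),(1,0)),((0,2),45,(-2,-3,1,1),(1,0)),((1,-1),23,(1,3,-1,-2),(-1,1)),((1,1),19,(-2,-3,1,1),(1,0)),((2,0),23,(-2,-3,1,1),(1,0)),((3,-2),19,(1,3,-1,-2),(-1,1)),((3,-1),23,(-1,0,1,1),(0,0)),((4,-2),19,(-1,0,1,1),(0,0)),((5,-3),45,(1,3,-1,-2),(-1,1))],
 [],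
 [([(-4,2),(0,0),(-2,2)],[],[]),([(-6,3),(0,0),(-3,3)],[],[]),([(-8,4),(0,0),(-4,4)],[],[]),([(-10,5),(0,0),(-5,5)],[],[])],
 []),
([(1,0),(0,1),(-2,-1)],
 [((-4,-2),34,(1,0,0,1),(0,0)),((-3,-1),22,(1,-4,0,1),(-1,1)),((-2,0),29,(-1,1,0,-1),(-1,0)),((-1,-1),15,(1,-3,0,1),(-1,1)),((-1,1),22,(1,2,0,-1),(-1,1)),((0,2),34,(1,-2,0,-1),(0,0)),((1,1),15,(1,1,0,-1),(-1,1)),((2,0),20,(1,1,0,1),(-1,0))],
 [(-1,-1),(1,1)],
 [([(-2,-2),(1,-1),(0,0)],[],[]),([(-3,-3),(0,-2),(1,-1),(0,0)],[(0,1)],[]),([(-3,-3),(-2,-3),(1,-2),(1,-1),(0,0)],[],[]),([(-4,-4),(2,-2),(0,0)],[],[]),([(-4,-4),(-3,-4),(0,-3),(2,-2),(0,0)],[],[]),([(-5,-5),(1,-3),(2,-2),(0,0)],[(0,1)],[]),([(-3,-2),(-2,-2),(1,-1),(0,0),(-1,0)],[],[]),([(-4,-3),(-3,-3),(0,-2),(1,-1),(0,0),(-1,0)],[(0,1)],[]),([(-5,-4),(-4,-4),(2,-2),(0,0),(-1,0)],[],[])],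
 [([(-4,-3),(-1,-2),(1,-1),(0,0),(-1,0)],[],True,2,(1,-2,0,-1),(0,0),(-2,-3),False),([(-5,-4),(1,-2),(1,-1),(0,0),(-1,0)],[],True,4,(1,-2,0,-1),(0,0),(-3,-4),False)]),
([(0,1),(-3,0),(1,0)],
 [((-7,-1),74,(1,0,0,1),(0,0)),((-6,-1),48,(1,0,0,1),(0,0)),((-5,-1),63,(-2,5,1,-3),(-5,3)),((-4,-1),64,(-1,2,0,-1),(-2,0)),((-4,0),14,(1,0,0,1),(0,0)),((-3,-1),62,(-2,3,1,-2),(-3,2)),((-2,-1),65,(1,-1,0,1),(1,0)),((-1,-1),62,(2,-1,-1,1),(1,0)),((-1,1),17,(-1,3,0,-1),(-3,1)),((0,-1),64,(1,0,0,1),(0,0)),((1,-1),63,(2,1,-1,0),(-1,1)),((1,1),17,(-1,4,0,-1),(-3,1)),((2,-1),48,(-1,-4,0,-1),(-2,0)),((2,0),14,(1,1,0,1),(-1,0)),((3,-1),74,(-1,-5,0,-1),(-2,0))],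
 [],
 [([(0,0),(4,0),(3,1)],[],[]),([(0,0),(5,0),(4,1),(3,1)],[],[]),([(0,0),(6,0),(5,1),(3,1)],[],[]),([(0,0),(7,0),(6,1),(3,1)],[],[]),([(0,0),(8,0),(6,2)],[],[]),([(0,0),(9,0),(7,2),(6,2)],[],[]),([(0,0),(10,0),(8,2),(6,2)],[],[])],
 []),
([(-3,2),(0,0),(1,0),(0,1)],
 [((-5,3),27,(1,0,0,1),(0,0)),((-2,1),18,(1,0,0,1),(0,0)),((-2,2),18,(1,3,-1,-2),(-3,2)),((1,-1),22,(2,1,-1,-1),(-1,1)),((1,1),22,(1,-1,0,1),(0,0)),((2,-1),15,(-3,-5,1,2),(1,0)),((2,0),15,(2,5,-1,-2),(-4,2)),((3,-1),28,(1,0,0,1),(0,0))],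
 [(2,-1),(2,0),(-2,2),(-2,1)],
 [([(-3,2),(0,0),(1,0),(0,1)],[],[]),([(-4,3),(-3,2),(0,0),(1,0),(-1,2)],[],[]),([(-6,4),(0,0),(1,0),(-1,2),(-3,3)],[],[]),([(-6,4),(0,0),(1,0),(-2,3),(-5,4)],[],[]),([(-7,5),(-6,4),(0,0),(1,0),(-2,3),(-4,4)],[],[]),([(-9,6),(0,0),(1,0),(-3,4)],[],[]),([(-4,3),(-3,2),(0,0),(2,0),(1,1),(-1,2)],[],[]),([(-6,4),(0,0),(2,0),(0,2)],[],[]),([(-6,4),(0,0),(2,0),(0,2),(-2,3),(-5,4)],[],[]),([(-7,5),(-6,4),(0,0),(2,0),(-1,3)],[],[]),([(-6,4),(0,0),(3,0),(2,1),(0,2)],[],[]),([(-3,2),(0,0),(2,-1),(3,-1),(2,0),(0,1)],[],[]),([(-4,3),(-3,2),(0,0),(2,-1),(3,-1),(1,1),(-1,2)],[],[]),([(-6,4),(0,0),(2,-1),(3,-1),(0,2),(-2,3),(-5,4)],[],[]),([(-6,4),(0,0),(2,-1),(4,-1),(2,1),(0,2)],[],[])],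
 [([(-3,2),(0,0),(2,0),(1,1),(-2,2)],[],True,1,(1,0,-1,-1),(0,1),(-1,2),False),([(-4,3),(-3,2),(0,0),(3,0),(2,1)],[],True,3,(1,0,-1,-1),(0,1),(-2,3),False),([(-6,4),(0,0),(3,0),(1,2),(-5,4)],[],True,9,(1,0,-1,-1),(0,1),(-1,3),False),([(-6,4),(0,0),(4,0),(3,1)],[],True,5,(1,0,-1,-1),(0,1),(-3,4),False),([(-3,2),(0,0),(2,-1),(3,-1),(1,1),(-2,2)],[],True,6,(1,0,-1,-1),(0,1),(-1,2),False),([(-6,4),(0,0),(2,-1),(3,-1),(0,2)],[],True,10,(1,0,-1,-1),(0,1),(0,2),False),([(-3,2),(0,0),(2,-1),(4,-1),(3,0)],[],True,2,(1,0,-1,-1),(0,1),(-3,3),False),([(-3,2),(0,0),(2,-1),(4,-1),(3,0),(1,1),(-2,2)],[],True,12,(1,0,-1,-1),(0,1),(-1,2),False),([(-4,3),(-3,2),(0,0),(2,-1),(4,-1),(2,1)],[],True,8,(1,0,-1,-1),(0,1),(-2,3),False),([(-3,2),(0,0),(2,-1),(5,-1),(4,0),(-2,2)],[],True,4,(1,0,-1,-1),(0,1),(-4,4),False),([(-4,3),(-3,2),(0,0),(2,-1),(5,-1),(4,0),(2,1)],[],True,13,(1,0,-1,-1),(0,1),(-2,3),False)])]"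

definition db3 :: "entry list" where
  "db3 = [
([(-3,1),(0,0),(1,0),(0,1)],
 [((-7,2),59,(1,0,0,1),(0,0)),((-6,2),39,(1,0,0,1),(0,0)),((-5,2),42,(-2,-5,1,3),(0,0)),((-4,1),17,(1,0,0,1),(0,0)),((-4,2),43,(-1,-4,0,1),(1,0)),((-3,2),43,(1,0,0,1),(0,0)),((-2,2),42,(2,3,-1,-1),(-2,1)),((-1,0),16,(1,0,0,1),(0,0)),((-1,2),39,(-1,-4,0,1),(1,0)),((0,2),59,(-1,-4,0,1),(1,0)),((1,1),17,(1,-1,0,1),(0,0)),((2,-1),19,(2,3,-1,-2),(-1,1)),((2,0),16,(1,1,0,1),(-1,0)),((3,-1),19,(-2,-5,1,2),(1,0))],
 [(1,1)],
 [([(-6,2),(0,0),(-2,2)],[],[]),([(-9,3),(0,0),(-3,3)],[],[]),([(-3,1),(0,0),(1,0),(0,1)],[],[]),([(-6,2),(0,0),(1,0),(-1,2)],[],[]),([(-9,3),(0,0),(1,0),(-2,3)],[],[]),([(-3,1),(0,0),(2,0),(1,1)],[],[]),([(-6,2),(0,0),(2,0),(0,2)],[],[]),([(-3,1),(0,0),(3,0),(2,1)],[],[]),([(-6,2),(0,0),(3,0),(1,2)],[],[]),([(-3,1),(0,0),(4,0),(3,1)],[],[]),([(-6,2),(0,0),(4,0),(2,2)],[],[]),([(-3,1),(0,0),(5,0),(4,1)],[],[]),([(-3,1),(0,0),(6,0),(5,1)],[],[]),([(-3,1),(0,0),(7,0),(6,1)],[],[])],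
 []),
([(-2,1),(-1,0),(1,0),(0,1)],
 [((-4,2),36,(1,0,0,1),(0,0)),((-3,1),16,(1,0,0,1),(0,0)),((-3,2),23,(-2,-3,1,2),(0,0)),((-2,0),16,(-1,1,0,-1),(-2,1)),((-2,2),30,(1,0,0,1),(0,0)),((-1,-1),36,(1,2,0,-1),(-1,1)),((-1,2),23,(2,1,-1,0),(0,0)),((0,-1),23,(-2,-1,1,0),(-1,1)),((0,2),36,(-1,-2,0,1),(0,0)),((1,-1),30,(-1,0,0,-1),(-1,1)),((1,1),16,(1,-1,0,1),(0,0)),((2,-1),23,(2,3,-1,-2),(-1,1)),((2,0),16,(-1,0,0,-1),(-1,1)),((3,-1),36,(-1,0,0,-1),(-1,1))],
 [(-3,1),(-3,2)],
 [([(-2,2),(0,0),(1,0),(-1,2)],[],[]),([(-3,3),(0,0),(1,0),(-2,3)],[],[]),([(-4,4),(0,0),(1,0),(-3,4)],[],[]),([(-1,1),(0,0),(2,0),(1,1)],[],[]),([(-2,2),(0,0),(2,0),(0,2)],[],[]),([(-3,3),(0,0),(2,0),(-1,3)],[],[]),([(-4,4),(0,0),(2,0),(-2,4)],[],[]),([(-1,1),(0,0),(3,0),(2,1)],[],[]),([(-2,2),(0,0),(3,0),(1,2)],[],[]),([(-3,3),(0,0),(3,0),(0,3)],[],[]),([(-1,1),(0,0),(4,0),(3,1)],[],[]),([(-2,2),(0,0),(4,0),(2,2)],[],[]),([(-3,3),(0,0),(4,0),(1,3)],[],[]),([(-1,1),(0,0),(5,0),(4,1)],[],[]),([(-2,2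),(0,0),(5,0),(3,2)],[],[]),([(-1,1),(0,0),(6,0),(5,1)],[],[]),([(-2,2),(0,0),(6,0),(4,2)],[],[]),([(-1,1),(0,0),(7,0),(6,1)],[],[]),([(-1,1),(0,0),(8,0),(7,1)],[],[])],
 []),
([(-1,0),(0,-1),(1,0),(0,1)],
 [((-2,0),29,(1,0,0,1),(0,0)),((-1,-1),18,(1,-2,0,1),(-1,1)),((-1,1),18,(-2,-1,1,0),(-1,1)),((0,-2),29,(0,1,-1,0),(0,0)),((0,2),29,(0,-1,1,0),(0,0)),((1,-1),18,(2,1,-1,0),(-1,1)),((1,1),18,(-1,2,0,-1),(-1,1)),((2,0),29,(-1,0,0,-1),(0,0))],
 [(-1,1),(-1,-1),(1,1),(1,-1)],
 [([(-1,1),(0,0),(1,1),(0,2)],[],[]),([(-2,2),(0,0),(1,1),(-1,3)],[],[]),([(-3,3),(0,0),(1,1),(-2,4)],[],[]),([(-4,4),(0,0),(1,1),(-3,5)],[],[]),([(-1,1),(0,0),(1,1),(1,2),(0,3),(-1,2)],[],[]),([(-2,2),(0,0),(1,1),(1,2),(0,3),(-1,3)],[],[]),([(-2,2),(0,0),(1,1),(1,2),(-1,4),(-2,3)],[],[]),([(-3,3),(0,0),(1,1),(1,2),(-1,4),(-2,4)],[],[]),([(-3,3),(0,0),(1,1),(1,2),(-2,5),(-3,4)],[],[]),([(-2,2),(0,0),(2,2),(0,4)],[],[]),([(-2,2),(0,0),(2,2),(0,4),(-1,4),(-2,3)],[],[]),([(-3,3),(0,0),(2,2),(-1,5)],[]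,[]),([(-2,2),(0,0),(2,2),(2,3),(0,5),(-2,3)],[],[]),([(-1,1),(0,0),(1,0),(2,1),(2,2),(1,3),(0,3),(-1,2)],[],[]),([(-2,2),(0,0),(1,0),(2,1),(2,2),(0,4),(-1,4),(-2,3)],[],[])],
 [([(-1,1),(0,0),(2,2),(1,3)],[],True,1,(0,-1,1,0),(0,0),(1,1),False),([(-1,1),(0,0),(2,2),(1,3),(0,3),(-1,2)],[],True,5,(0,1,-1,0),(0,0),(-2,2),False),([(-1,1),(0,0),(2,2),(2,3),(1,4),(-1,2)],[],True,6,(-1,0,0,1),(0,0),(0,0),False),([(-2,2),(0,0),(2,2),(2,3),(1,4),(0,4)],[],True,10,(0,-1,1,0),(0,0),(2,2),False),([(-1,1),(0,0),(3,3),(2,4)],[],True,2,(0,-1,1,0),(0,0),(1,1),False),([(-1,1),(0,0),(3,3),(2,4),(1,4),(-1,2)],[],True,7,(0,1,-1,0),(0,0),(-3,3),False),([(-2,2),(0,0),(3,3),(1,5)],[],True,11,(0,-1,1,0),(0,0),(2,2),False),([(-1,1),(0,0),(3,3),(3,4),(2,5),(-1,2)],[],True,8,(-1,0,0,1),(0,0),(0,0),False),([(-1,1),(0,0),(4,4),(3,5)],[],True,3,(0,-1,1,0),(0,0),(1,1),False),([(-1,1),(0,0),(1,0),(2,1),(1,2),(0,2)],[],True,4,(0,-1,1,0),(0,0),(1,1),False),([(-1,1),(0,0),(1,0),(2,1),(0,3),(-1,2)],[],True,5,(-1,0,0,-1),(0,0),(0,3),False),([(-2,2),(0,0),(1,0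),(2,1),(0,3),(-1,3)],[],True,6,(0,-1,-1,0),(0,0),(1,2),False),([(-2,2),(0,0),(1,0),(2,1),(-1,4),(-2,3)],[],True,7,(-1,0,0,-1),(0,0),(-1,4),False),([(-3,3),(0,0),(1,0),(2,1),(-1,4),(-2,4)],[],True,8,(0,-1,-1,0),(0,0),(1,2),False),([(-1,1),(0,0),(1,0),(2,1),(2,2),(1,3)],[],True,5,(0,-1,1,0),(0,0),(1,1),False),([(-2,2),(0,0),(1,0),(2,1),(2,2),(0,4)],[],True,10,(-1,0,0,-1),(0,0),(0,4),False),([(-1,1),(0,0),(1,0),(3,2),(2,3),(1,3)],[],True,6,(0,-1,1,0),(0,0),(1,1),False),([(-1,1),(0,0),(1,0),(3,2),(1,4),(-1,2)],[],True,10,(0,1,-1,0),(0,0),(-2,3),False),([(-2,2),(0,0),(1,0),(3,2),(1,4),(0,4)],[],True,12,(0,-1,1,0),(0,0),(2,2),False),([(-1,1),(0,0),(1,0),(3,2),(3,3),(2,4)],[],True,7,(0,-1,1,0),(0,0),(1,1),False),([(-1,1),(0,0),(1,0),(3,2),(3,3),(2,4),(1,4),(-1,2)],[],True,14,(0,-1,1,0),(0,0),(2,1),False),([(-1,1),(0,0),(1,0),(4,3),(3,4),(2,4)],[],True,8,(0,-1,1,0),(0,0),(1,1),False)])]"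

definition db4 :: "entry list" where
  "db4 = [
([(-3,-1),(1,0),(0,1)],
 [((-2,-1),22,(1,-4,0,1),(-1,1)),((-2,0),27,(-2,3,1,-2),(-3,2)),((1,1),22,(1,1,0,-1),(-1,1)),((2,0),32,(1,1,0,1),(-1,0))],
 [(-2,0),(1,1),(-2,-1)],
 [([(-4,-1),(0,0),(-1,1)],[],[]),([(-5,-1),(-4,-1),(0,0),(-1,1),(-2,1)],[],[]),([(-6,-1),(-4,-1),(0,0),(-1,1),(-3,1)],[],[]),([(-8,-2),(0,0),(-2,2)],[],[]),([(-5,-1),(-4,-1),(0,0),(0,1),(-1,2),(-4,0)],[],[]),([(-6,-1),(-4,-1),(0,0),(0,1),(-1,2),(-3,1)],[],[]),([(-4,-1),(0,0),(1,1),(0,2),(-3,0)],[(0,1)],[]),([(-5,-1),(-4,-1),(0,0),(1,1),(0,2),(-2,1)],[(0,1)],[]),([(-5,-1),(-4,-1),(0,0),(1,1),(0,2),(-1,2),(-4,0)],[(0,1)],[])],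
 [([(-4,-1),(0,0),(2,1),(1,2),(-1,1)],[(1,1)],True,6,(1,-3,0,-1),(0,0),(1,1),False),([(-4,-1),(0,0),(2,1),(1,2),(0,2),(-3,0)],[(1,1)],True,7,(1,-3,0,-1),(0,0),(1,1),False),([(-5,-1),(-4,-1),(0,0),(2,1),(1,2),(0,2),(-2,1)],[(1,1)],True,8,(1,-3,0,-1),(0,0),(1,1),False),([(-4,-1),(0,0),(3,1),(2,2),(1,2),(-1,1)],[],True,4,(1,-3,0,-1),(0,0),(0,1),False),([(-4,-1),(0,0),(3,1),(2,2),(0,2),(-3,0)],[],True,5,(1,-3,0,-1),(0,0),(0,1),False)]),
([(0,1),(-4,0),(1,0)],
 [((-8,-1),100,(1,0,0,1),(0,0)),((-7,-1),120,(-2,7,1,-4),(-7,4)),((-6,-1),122,(-1,3,0,-1),(-3,0)),((-5,-1),118,(-2,5,1,-3),(-5,3)),((-5,0),21,(1,0,0,1),(0,0)),((-4,-1),121,(-1,2,0,-1),(-2,0)),((-3,-1),119,(2,-3,-1,2),(3,-1)),((-2,-1),121,(1,-1,0,1),(1,0)),((-1,-1),118,(2,-1,-1,1),(1,0)),((-1,1),26,(-1,4,0,-1),(-4,1)),((0,-1),122,(1,0,0,1),(0,0)),((1,-1),120,(2,1,-1,0),(-1,1)),((1,1),26,(-1,5,0,-1),(-4,1)),((2,-1),100,(-1,-5,0,-1),(-3,0)),((2,0),21,(1,1,0,1),(-1,0))],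
 [],
 [([(0,0),(5,0),(4,1)],[],[]),([(0,0),(6,0),(5,1),(4,1)],[],[]),([(0,0),(7,0),(6,1),(4,1)],[],[]),([(0,0),(8,0),(7,1),(4,1)],[],[]),([(0,0),(9,0),(8,1),(4,1)],[],[]),([(0,0),(10,0),(8,2)],[],[])],
 []),
([(0,0),(1,0),(0,1),(-4,2)],
 [((-7,3),61,(1,0,0,1),(0,0)),((-5,2),44,(1,4,-1,-3),(-3,2)),((-3,1),43,(-1,-4,0,1),(1,0)),((-3,2),30,(-1,-3,1,2),(1,0)),((-1,0),36,(1,0,0,1),(0,0)),((1,-1),61,(2,1,-1,-1),(-1,1)),((1,1),39,(1,-1,0,1),(0,0)),((2,-1),19,(1,0,0,1),(0,0)),((2,0),23,(-2,-5,1,3),(2,-1)),((3,-1),36,(-2,-5,1,2),(1,0))],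
 [(2,0),(2,-1),(-3,2)],
 [([(-5,2),(-1,0),(0,0),(-1,1)],[],[]),([(-6,2),(-2,0),(0,0),(-1,1),(-5,2)],[],[]),([(-9,3),(-3,0),(0,0),(-1,1)],[],[]),([(-8,3),(-2,0),(0,0),(-1,1),(-4,2)],[],[]),([(-9,3),(-3,0),(0,0),(-1,1),(-4,2),(-8,3)],[],[]),([(-7,3),(-1,0),(0,0),(-1,1),(-3,2)],[],[]),([(-8,3),(-2,0),(0,0),(-1,1),(-3,2),(-7,3)],[],[]),([(-7,3),(-1,0),(0,0),(-2,2),(-6,3)],[],[]),([(-10,4),(-2,0),(0,0),(-2,2)],[],[]),([(-9,4),(-1,0),(0,0),(-2,2),(-5,3)],[],[]),([(-9,4),(-1,0),(0,0),(-2,2),(-4,3),(-8,4)],[],[])],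
 []),
([(-3,1),(-1,0),(1,0),(0,1)],
 [((-6,2),82,(1,0,0,1),(0,0)),((-5,2),50,(-2,-5,1,3),(0,0)),((-4,1),24,(1,0,0,1),(0,0)),((-4,2),68,(-1,-3,0,1),(0,0)),((-3,2),67,(2,3,-1,-1),(0,0)),((-2,0),25,(1,0,0,1),(0,0)),((-2,2),68,(1,0,0,1),(0,0)),((-1,2),50,(2,1,-1,0),(0,0)),((0,-1),53,(-2,-1,1,0),(-1,1)),((0,2),82,(-1,-3,0,1),(0,0)),((1,-1),35,(-2,-3,1,1),(-1,1)),((1,1),24,(1,-1,0,1),(0,0)),((2,-1),35,(2,3,-1,-2),(-1,1)),((2,0),25,(1,1,0,1),(-1,0)),((3,-1),53,(2,5,-1,-3),(-1,1))],
 [(2,0),(1,-1)],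
 [([(-4,2),(0,0),(1,0),(-1,2)],[],[]),([(-6,3),(0,0),(1,0),(-2,3)],[],[]),([(-2,1),(0,0),(2,0),(1,1)],[],[]),([(-4,2),(0,0),(2,0),(0,2)],[],[]),([(-2,1),(0,0),(3,0),(2,1)],[],[]),([(-4,2),(0,0),(3,0),(1,2)],[],[]),([(-2,1),(0,0),(4,0),(3,1)],[],[]),([(-4,2),(0,0),(4,0),(2,2)],[],[]),([(-2,1),(0,0),(5,0),(4,1)],[],[]),([(-2,1),(0,0),(6,0),(5,1)],[],[]),([(-2,1),(0,0),(7,0),(6,1)],[],[])],
 []),
([(-4,1),(0,0),(1,0),(0,1)],
 [((-9,2),116,(1,0,0,1),(0,0)),((-8,2),86,(1,0,0,1),(0,0)),((-7,2),96,(-2,-7,1,4),(0,0)),((-6,2),94,(-1,-5,0,1),(1,0)),((-5,1),26,(1,0,0,1),(0,0)),((-5,2),95,(1,1,0,1),(0,0)),((-4,2),95,(-1,-4,0,1),(1,0)),((-3,2),94,(1,0,0,1),(0,0)),((-2,2),96,(2,3,-1,-1),(-2,1)),((-1,0),24,(1,0,0,1),(0,0)),((-1,2),86,(-1,-5,0,1),(1,0)),((0,2),116,(-1,-5,0,1),(1,0)),((1,1),26,(1,-1,0,1),(0,0)),((2,0),24,(1,1,0,1),(-1,0)),((3,-1),47,(-2,-5,1,2),(1,0))],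
 [(-1,0)],
 [([(-8,2),(0,0),(-2,2)],[],[]),([(-4,1),(0,0),(1,0),(0,1)],[],[]),([(-8,2),(0,0),(1,0),(-1,2)],[],[]),([(-4,1),(0,0),(2,0),(1,1)],[],[]),([(-8,2),(0,0),(2,0),(0,2)],[],[]),([(-4,1),(0,0),(3,0),(2,1)],[],[]),([(-4,1),(0,0),(4,0),(3,1)],[],[]),([(-4,1),(0,0),(5,0),(4,1)],[],[]),([(-4,1),(0,0),(6,0),(5,1)],[],[])],
 [])]"

definition db5 :: "entry list" where
  "db5 = [
([(-3,2),(-2,1),(0,0),(1,0),(0,1)],
 [((-5,3),42,(1,0,0,1),(0,0)),((-4,2),30,(-1,-3,1,2),(1,0)),((-3,1),43,(1,0,0,1),(0,0)),((-2,2),31,(1,0,0,1),(0,0)),((-1,0),23,(-2,-3,1,2),(0,0)),((1,-1),44,(1,0,0,1),(0,0)),((1,1),42,(-2,-3,1,2),(0,0)),((2,-1),23,(1,0,0,1),(0,0)),((2,0),30,(1,1,0,1),(-1,0)),((3,-1),43,(-2,-3,1,2),(0,0))],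
 [(-2,2),(2,0),(2,-1),(-1,0),(-4,2)],
 [([(-1,1),(0,0),(2,-1),(3,-1),(2,0)],[],[]),([(-2,2),(0,0),(2,-1),(3,-1),(1,1)],[],[]),([(-3,3),(0,0),(2,-1),(3,-1),(0,2)],[],[]),([(-1,1),(0,0),(2,-1),(4,-1),(3,0),(0,1)],[],[]),([(-2,2),(0,0),(2,-1),(4,-1),(3,0),(1,1)],[],[]),([(-2,2),(0,0),(2,-1),(4,-1),(2,1),(-1,2)],[],[]),([(-3,3),(0,0),(2,-1),(4,-1),(2,1),(0,2)],[],[]),([(-2,2),(0,0),(2,-1),(5,-1),(4,0)],[],[]),([(-2,2),(0,0),(2,-1),(5,-1),(4,0),(2,1),(-1,2)],[],[]),([(-1,1),(0,0),(4,-2),(6,-2),(5,-1)],[],[]),([(-1,1),(0,0),(4,-2),(6,-2),(5,-1),(3,0),(0,1)],[],[]),([(-2,2),(0,0),(4,-2),(6,-2),(4,0)],[],[]),([(-1,1),(0,0),(4,-2),(7,-2),(6,-1),(0,1)],[],[])],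
 [([(-1,1),(0,0),(4,-2),(5,-2),(4,-1),(2,0)],[],True,3,(-2,-3,1,2),(0,0),(4,-1),False),([(-1,1),(0,0),(4,-2),(5,-2),(3,0),(0,1)],[],True,4,(-2,-3,1,2),(0,0),(4,-1),False),([(-2,2),(0,0),(4,-2),(5,-2),(3,0),(1,1)],[],True,5,(-2,-3,1,2),(0,0),(4,-1),False),([(-2,2),(0,0),(4,-2),(5,-2),(2,1),(-1,2)],[],True,6,(-2,-3,1,2),(0,0),(4,-1),False),([(-1,1),(0,0),(6,-3),(7,-3),(5,-1)],[],True,7,(-2,-3,1,2),(0,0),(5,-1),False),([(-1,1),(0,0),(6,-3),(7,-3),(5,-1),(3,0),(0,1)],[],True,8,(-2,-3,1,2),(0,0),(5,-1),False),([(-1,1),(0,0),(6,-3),(8,-3),(7,-2),(5,-1)],[],True,12,(-2,-3,1,2),(0,0),(7,-2),False)]),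
([(0,1),(-4,2),(2,-1)],
 [((-7,3),99,(1,0,0,1),(0,0)),((-5,2),80,(1,0,0,1),(0,0)),((-3,1),81,(1,0,0,1),(0,0)),((-3,2),35,(1,0,0,1),(0,0)),((-1,0),76,(2,3,-1,-2),(-1,1)),((1,-1),77,(1,3,-1,-2),(-1,1)),((1,1),73,(1,0,0,1),(0,0)),((2,0),52,(-2,-3,1,1),(1,0)),((3,-2),73,(1,3,-1,-2),(-1,1)),((3,-1),53,(-1,0,1,1),(0,0)),((4,-2),47,(1,0,0,1),(0,0))],
 [(-3,2)],
 [([(0,0),(6,-3),(4,-1)],[],[]),([(0,0),(8,-4),(6,-2),(4,-1)],[],[]),([(0,0),(10,-5),(7,-2),(4,-1)],[],[]),([(-1,0),(7,-4),(4,-1),(0,0)],[],[])],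
 []),
([(1,0),(0,1),(-4,-1)],
 [((-5,-1),59,(1,-6,0,1),(-1,1)),((-3,-1),39,(1,-5,0,1),(-1,1)),((-3,0),64,(-1,2,0,-1),(-2,0)),((-1,1),59,(1,2,0,-1),(-1,1)),((1,1),39,(1,1,0,-1),(-1,1)),((2,0),48,(1,1,0,1),(-1,0))],
 [(-3,-1),(1,1)],
 [([(-4,-2),(1,-1),(0,0)],[],[]),([(-6,-3),(-1,-2),(1,-1),(0,0)],[(0,1),(1,1)],[]),([(-6,-3),(-5,-3),(0,-2),(1,-1),(0,0)],[(0,1)],[]),([(-5,-2),(-4,-2),(1,-1),(0,0),(-1,0)],[],[]),([(-6,-2),(-4,-2),(1,-1),(0,0),(-2,0)],[],[])],
 [([(-7,-3),(-2,-2),(1,-1),(0,0),(-1,0)],[(4,1)],True,2,(1,-4,0,-1),(0,0),(-5,-3),False)]),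
([(0,1),(-5,0),(1,0)],
 [((-6,0),33,(1,0,0,1),(0,0)),((-1,1),40,(-1,5,0,-1),(-5,1)),((1,1),40,(-1,6,0,-1),(-5,1)),((2,0),33,(1,1,0,1),(-1,0))],
 [],
 [([(0,0),(6,0),(5,1)],[],[]),([(0,0),(7,0),(6,1),(5,1)],[],[]),([(0,0),(8,0),(7,1),(5,1)],[],[]),([(0,0),(9,0),(8,1),(5,1)],[],[]),([(0,0),(10,0),(9,1),(5,1)],[],[])],
 []),
([(-5,2),(0,0),(1,0),(0,1)],
 [((-4,2),44,(1,4,-1,-3),(-3,2)),((-3,1),42,(-2,-5,1,3),(0,0)),((1,1),59,(1,-1,0,1),(0,0)),((2,-1),45,(1,0,0,1),(0,0)),((2,0),36,(1,1,0,1),(-1,0)),((3,-1),61,(-3,-8,1,3),(1,0))],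
 [(2,0),(-4,2),(-3,1)],
 [([(-7,3),(-5,2),(0,0),(-2,2)],[],[]),([(-10,4),(0,0),(-2,2),(-5,3)],[(-2,1)],[]),([(-5,2),(0,0),(1,0),(0,1)],[],[]),([(-7,3),(-5,2),(0,0),(1,0),(0,1),(-2,2)],[],[]),([(-7,3),(-5,2),(0,0),(1,0),(-1,2),(-6,3)],[],[]),([(-5,2),(0,0),(2,0),(1,1),(-4,2)],[],[]),([(-7,3),(-5,2),(0,0),(2,0),(1,1),(-2,2)],[(-2,1)],[]),([(-5,2),(0,0),(3,0),(2,1),(-3,2)],[],[]),([(-5,2),(0,0),(3,-1),(2,0),(0,1)],[],[]),([(-5,2),(0,0),(3,-1),(1,1),(-4,2)],[],[]),([(-5,2),(0,0),(3,-1),(4,-1),(3,0),(0,1)],[(-2,1)],[]),([(-5,2),(0,0),(3,-1),(4,-1),(3,0),(1,1),(-4,2)],[],[]),([(-5,2),(0,0),(3,-1),(5,-1),(4,0),(0,1)],[],[])],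
 []),
([(0,1),(-3,2),(-2,1),(2,-1)],
 [((-5,3),50,(1,0,0,1),(0,0)),((-4,2),35,(1,0,0,1),(0,0)),((-3,1),76,(1,0,0,1),(0,0)),((-2,2),41,(1,0,0,1),(0,0)),((-1,0),51,(-1,0,0,-1),(-1,1)),((1,-1),66,(1,0,0,1),(0,0)),((1,1),77,(1,0,0,1),(0,0)),((2,0),66,(-2,-3,1,1),(1,0)),((3,-2),52,(1,0,0,1),(0,0)),((3,-1),67,(1,0,0,1),(0,0)),((4,-2),53,(1,0,0,1),(0,0)),((5,-3),102,(1,0,0,1),(0,0))],
 [(-2,2),(-4,2)],
 [([(0,0),(1,-1),(5,-3),(3,-1)],[],[]),([(0,0),(1,-1),(7,-4),(5,-2),(3,-1)],[],[]),([(0,0),(1,-1),(9,-5),(6,-2)],[],[]),([(0,0),(2,-2),(6,-4),(3,-1)],[],[]),([(0,0),(2,-2),(8,-5),(5,-2),(3,-1)],[],[]),([(0,0),(3,-3),(7,-5),(3,-1)],[],[]),([(-1,0),(0,-1),(6,-4),(3,-1),(0,0)],[],[])],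
 [])]"

definition db6 :: "entry list" where
  "db6 = [
([(-4,1),(-1,0),(1,0),(0,1)],
 [((-7,2),110,(-2,-7,1,4),(0,0)),((-6,2),134,(-1,-4,0,1),(0,0)),((-5,1),38,(1,0,0,1),(0,0)),((-5,2),125,(-2,-5,1,3),(0,0)),((-4,2),135,(1,1,0,1),(0,0)),((-3,2),125,(2,3,-1,-1),(0,0)),((-2,0),37,(1,0,0,1),(0,0)),((-2,2),134,(1,0,0,1),(0,0)),((-1,2),110,(2,1,-1,0),(0,0)),((1,-1),78,(-2,-3,1,1),(-1,1)),((1,1),38,(1,-1,0,1),(0,0)),((2,-1),46,(-2,-5,1,2),(-1,1)),((2,0),37,(1,1,0,1),(-1,0)),((3,-1),78,(2,5,-1,-3),(-1,1))],
 [(-5,1),(2,-1)],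
 [([(-6,2),(0,0),(1,0),(-1,2)],[],[]),([(-3,1),(0,0),(2,0),(1,1)],[],[]),([(-6,2),(0,0),(2,0),(0,2)],[],[]),([(-3,1),(0,0),(3,0),(2,1)],[],[]),([(-3,1),(0,0),(4,0),(3,1)],[],[]),([(-3,1),(0,0),(5,0),(4,1)],[],[]),([(-3,1),(0,0),(6,0),(5,1)],[],[])],
 []),
([(-3,1),(-2,0),(1,0),(0,1)],
 [((-5,2),103,(-2,-5,1,3),(0,0)),((-4,1),37,(1,0,0,1),(0,0)),((-4,2),79,(-2,-3,1,2),(-2,1)),((-3,0),37,(-1,1,0,-1),(-3,1)),((-3,2),89,(-2,-3,1,2),(0,0)),((-2,-1),103,(-2,1,1,-1),(-3,2)),((-2,2),89,(2,1,-1,0),(2,-1)),((-1,-1),79,(-2,-1,1,0),(-3,2)),((-1,2),79,(2,1,-1,0),(0,0)),((0,-1),89,(-2,-1,1,0),(-1,1)),((0,2),103,(2,-1,-1,1),(2,-1)),((1,-1),89,(2,3,-1,-2),(1,0)),((1,1),37,(1,-1,0,1),(0,0)),((2,-1),79,(2,3,-1,-2),(-1,1)),((2,0),37,(-1,0,0,-1),(-2,1)),((3,-1),103,(2,5,-1,-3),(-1,1))],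
 [(-4,1),(-4,2)],
 [([(-3,3),(0,0),(1,0),(-2,3)],[],[]),([(-2,2),(0,0),(2,0),(0,2)],[],[]),([(-1,1),(0,0),(3,0),(2,1)],[],[]),([(-2,2),(0,0),(3,0),(1,2)],[],[]),([(-1,1),(0,0),(4,0),(3,1)],[],[]),([(-2,2),(0,0),(4,0),(2,2)],[],[]),([(-1,1),(0,0),(5,0),(4,1)],[],[]),([(-1,1),(0,0),(6,0),(5,1)],[],[]),([(-1,1),(0,0),(7,0),(6,1)],[],[])],
 [([(-2,2),(0,0),(1,0),(-1,2)],[],False,0,(-1,-2,1,1),(-1,2),(1,0),True)]),
([(-5,1),(0,0),(1,0),(0,1)],
 [((-6,1),40,(1,0,0,1),(0,0)),((-1,0),38,(1,0,0,1),(0,0)),((1,1),40,(1,-1,0,1),(0,0)),((2,0),38,(1,1,0,1),(-1,0))],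
 [(-1,0)],
 [([(-10,2),(0,0),(-2,2)],[],[]),([(-5,1),(0,0),(1,0),(0,1)],[],[]),([(-5,1),(0,0),(2,0),(1,1)],[],[]),([(-5,1),(0,0),(3,0),(2,1)],[],[]),([(-5,1),(0,0),(4,0),(3,1)],[],[]),([(-5,1),(0,0),(5,0),(4,1)],[],[])],
 []),
([(-5,3),(0,0),(1,0),(0,1)],
 [((-7,4),63,(1,0,0,1),(0,0)),((-2,1),42,(1,0,0,1),(0,0)),((-2,2),42,(1,0,-1,-1),(0,1)),((2,-1),39,(-4,-7,1,2),(1,0)),((2,0),39,(3,7,-1,-2),(-6,2)),((3,-1),62,(1,0,0,1),(0,0))],
 [(-2,2),(2,0),(2,-1),(-2,1)],
 [([(-5,3),(0,0),(1,0),(0,1)],[],[]),([(-6,4),(-5,3),(0,0),(1,0),(-1,2)],[(-1,0)],[]),([(-8,5),(-5,3),(0,0),(1,0),(-1,2),(-3,3)],[],[]),([(-6,4),(-5,3),(0,0),(2,0),(1,1),(-1,2)],[(-1,0)],[]),([(-5,3),(0,0),(2,-1),(3,-1),(2,0),(0,1)],[],[]),([(-5,3),(0,0),(4,-2),(5,-2),(4,-1),(0,1)],[],[])],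
 [([(-5,3),(0,0),(2,0),(1,1),(-4,3)],[(1,-1)],True,1,(1,0,-1,-1),(0,1),(-1,2),False),([(-5,3),(0,0),(2,-1),(3,-1),(1,1),(-4,3)],[(1,-1)],True,3,(1,0,-1,-1),(0,1),(-1,2),False),([(-5,3),(0,0),(2,-1),(4,-1),(3,0),(-2,2)],[],True,2,(1,0,-1,-1),(0,1),(-3,3),False)]),
([(-3,2),(0,0),(3,-1),(0,1)],
 [((-5,3),62,(1,0,0,1),(0,0)),((-2,1),43,(-2,-3,1,2),(0,0)),((-2,2),43,(1,3,-1,-2),(-3,2)),((2,-1),43,(-1,-3,1,2),(0,0)),((2,0),43,(2,3,-1,-2),(-3,2)),((5,-2),62,(-1,0,0,-1),(0,1))],
 [(-2,2),(-2,1),(2,0),(2,-1)],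
 [([(-3,2),(0,0),(3,-1),(0,1)],[],[]),([(-6,4),(0,0),(3,-1),(-3,3)],[],[]),([(-4,3),(-3,2),(0,0),(3,-1),(2,0),(-1,2)],[],[]),([(-6,4),(0,0),(3,-1),(2,0),(-1,2),(-3,3)],[],[]),([(-4,3),(-3,2),(0,0),(3,-1),(4,-1),(1,1),(-1,2)],[],[]),([(-3,2),(0,0),(2,-1),(5,-2),(2,0),(0,1)],[],[]),([(-3,2),(0,0),(4,-2),(7,-3),(4,-1),(0,1)],[],[])],
 [([(-3,2),(0,0),(3,-1),(4,-1),(1,1),(-2,2)],[],True,2,(-1,0,1,1),(0,0),(0,0),False),([(-3,2),(0,0),(6,-2),(3,0)],[],True,1,(-1,0,1,1),(0,0),(0,0),False),([(-3,2),(0,0),(6,-2),(3,0),(1,1),(-2,2)],[],True,3,(-1,0,1,1),(0,0),(0,0),False),([(-4,3),(-3,2),(0,0),(2,-1),(5,-2),(-1,2)],[],True,3,(-1,0,0,-1),(0,1),(-1,2),False),([(-3,2),(0,0),(2,-1),(5,-2),(4,-1),(1,1),(-2,2)],[],True,4,(-1,0,0,-1),(0,1),(1,1),False),([(-3,2),(0,0),(2,-1),(5,-2),(6,-2),(3,0)],[],True,3,(1,0,-1,-1),(0,1),(-3,3),False)]),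
([(0,-1),(1,0),(0,1),(-2,0)],
 [((-3,0),64,(1,0,0,1),(0,0)),((-1,-1),43,(1,-2,0,1),(-1,1)),((-1,1),43,(1,2,0,-1),(-1,1)),((1,-1),42,(2,1,-1,0),(-1,1)),((1,1),42,(2,-1,-1,0),(-1,1)),((2,0),65,(1,0,0,1),(0,0))],
 [(1,1),(1,-1),(-1,-1),(-1,1)],
 [([(-3,0),(-1,-1),(0,0),(-1,1)],[],[]),([(-4,-1),(-2,-2),(0,0),(-1,1),(-3,0)],[],[]),([(-5,-1),(-3,-2),(-2,-2),(0,0),(-1,1)],[],[]),([(-4,0),(-2,-1),(-1,-1),(0,0),(-1,1),(-2,1)],[],[]),([(-4,-1),(-2,-2),(0,0),(-1,1),(-2,1),(-4,0)],[(-1,-1)],[]),([(-5,0),(-3,-1),(-1,-1),(0,0),(-1,1),(-3,1)],[],[]),([(-3,0),(-1,-1),(0,0),(0,1),(-1,2),(-3,1)],[(-1,-1)],[]),([(-4,0),(-2,-1),(-1,-1),(0,0),(0,1),(-1,2),(-3,1)],[],[])],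
 [([(-4,1),(-3,0),(-1,-1),(0,0),(-2,2)],[],True,1,(1,0,0,-1),(0,0),(0,0),False),([(-4,0),(-2,-1),(-1,-1),(0,0),(-2,2),(-4,1)],[(-1,-1)],True,4,(1,0,0,-1),(0,0),(0,0),False),([(-5,1),(-1,-1),(0,0),(-2,2),(-3,2)],[],True,2,(1,0,0,-1),(0,0),(0,0),False),([(-4,1),(-3,0),(-1,-1),(0,0),(0,1),(-1,2),(-2,2)],[],True,7,(1,0,0,-1),(0,0),(0,1),False)])]"

definition db7 :: "entry list" where
  "db7 = [
([(-2,2),(-2,1),(-1,0),(1,0),(0,1)],
 [((-3,1),68,(1,0,0,1),(0,0)),((-3,2),41,(-1,-3,1,2),(1,0)),((-3,3),69,(1,0,0,1),(0,0)),((-2,0),35,(-2,-1,1,1),(-2,1)),((-1,-1),92,(1,0,0,1),(0,0)),((-1,2),41,(2,1,-1,0),(0,0)),((0,-1),66,(-2,-1,1,0),(-1,1)),((1,-1),70,(-1,0,0,-1),(-1,1)),((1,1),68,(-1,-2,0,1),(0,0)),((2,-1),66,(2,3,-1,-2),(-1,1)),((2,0),35,(2,3,-1,-1),(-2,1)),((3,-1),92,(-1,-2,0,1),(0,0))],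
 [(-1,2),(-3,2),(2,0),(-2,0)],
 [([(0,0),(1,-1),(3,-1),(2,0),(0,1)],[],[]),([(0,0),(1,-1),(4,-1),(3,0),(1,1),(0,1)],[],[]),([(0,0),(1,-1),(4,-1),(2,1),(0,2)],[],[]),([(0,0),(1,-1),(5,-1),(4,0),(0,2)],[],[]),([(0,0),(2,-2),(4,-2),(2,0),(0,1)],[],[]),([(0,0),(2,-2),(5,-2),(3,0),(1,1),(0,1)],[],[]),([(0,0),(3,-3),(5,-3),(2,0),(0,1)],[],[])],
 [([(0,0),(2,-2),(5,-2),(4,-1),(0,1)],[],True,2,(-1,-2,0,1),(0,0),(2,1),False)]),
([(-3,2),(-2,1),(0,0),(1,0),(0,1),(-2,2)],
 [((-5,3),71,(-2,-3,1,1),(0,1)),((-4,2),41,(-2,-3,1,1),(0,1)),((-4,3),41,(-1,0,0,-1),(-2,2)),((-3,1),71,(-1,-3,1,2),(1,0)),((-3,3),71,(-1,0,0,-1),(-2,2)),((-1,0),41,(-1,-3,1,2),(1,0)),((-1,2),41,(1,3,-1,-2),(-3,2)),((1,-1),71,(1,0,0,1),(0,0)),((1,1),71,(1,3,-1,-2),(-3,2)),((2,-1),41,(1,0,0,1),(0,0)),((2,0),41,(2,3,-1,-1),(-2,1)),((3,-1),71,(2,3,-1,-1),(-2,1))],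
 [(-4,3),(-1,2),(2,0),(2,-1),(-1,0),(-4,2)],
 [([(-1,1),(0,0),(2,-1),(3,-1),(2,0),(0,1)],[],[]),([(-2,2),(0,0),(2,-1),(3,-1),(1,1),(-1,2)],[],[]),([(-3,3),(0,0),(2,-1),(3,-1),(0,2),(-2,3)],[],[]),([(-2,2),(0,0),(2,-1),(4,-1),(3,0),(-1,2)],[],[]),([(-2,2),(0,0),(2,-1),(4,-1),(2,1),(0,2)],[],[])],
 [([(-1,1),(0,0),(2,-1),(4,-1),(3,0),(1,1)],[],True,1,(-1,-3,1,2),(1,0),(2,-1),False),([(-1,1),(0,0),(2,-1),(5,-1),(4,0),(2,1)],[],True,2,(-1,-3,1,2),(1,0),(2,-1),False),([(-1,1),(0,0),(4,-2),(5,-2),(4,-1),(0,1)],[],True,1,(-2,-3,1,1),(0,1),(3,-1),False),([(-1,1),(0,0),(4,-2),(5,-2),(3,0),(1,1)],[],True,3,(-1,-3,1,2),(1,0),(2,-1),False),([(-2,2),(0,0),(4,-2),(5,-2),(3,0),(-1,2)],[],True,4,(-2,-3,1,1),(0,1),(4,-1),False),([(-1,1),(0,0),(4,-2),(6,-2),(5,-1),(1,1)],[],True,4,(-1,-3,1,2),(1,0),(2,-1),False),([(-1,1),(0,0),(6,-3),(7,-3),(6,-2),(0,1)],[],True,2,(-2,-3,1,1),(0,1),(3,-1),False)]),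
([(-5,-1),(1,0),(0,1)],
 [((-4,-1),59,(1,-6,0,1),(-1,1)),((-3,0),63,(-2,5,1,-3),(-5,3)),((1,1),59,(1,1,0,-1),(-1,1)),((2,0),74,(1,1,0,1),(-1,0))],
 [(-3,0),(1,1),(-4,-1)],
 [([(-6,-1),(0,0),(-1,1)],[],[]),([(-7,-1),(-6,-1),(0,0),(-1,1),(-2,1)],[],[])],
 []),
([(0,1),(-6,0),(1,0)],
 [((-7,0),49,(1,0,0,1),(0,0)),((-1,1),60,(-1,6,0,-1),(-6,1)),((1,1),60,(-1,7,0,-1),(-6,1)),((2,0),49,(1,1,0,1),(-1,0))],
 [],
 [([(0,0),(7,0),(6,1)],[],[]),([(0,0),(8,0),(7,1),(6,1)],[],[]),([(0,0),(9,0),(8,1),(6,1)],[],[]),([(0,0),(10,0),(9,1),(6,1)],[],[])],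
 []),
([(-4,-2),(1,0),(0,1)],
 [((-3,-1),61,(-3,4,1,-1),(-4,2)),((-1,-1),61,(2,-5,-1,2),(-2,1)),((1,1),61,(1,1,0,-1),(-1,1))],
 [(-3,-1),(1,1),(-1,-1)],
 [([(-5,-2),(0,0),(-1,1)],[],[]),([(-6,-2),(-5,-2),(0,0),(-1,1),(-2,1)],[],[])],
 [([(-5,-2),(0,0),(1,1),(0,2),(-4,-1)],[],True,1,(-2,3,-1,1),(-2,-1),(-6,-2),False),([(-5,-2),(0,0),(2,1),(1,2),(-1,1)],[],True,1,(1,-3,1,-2),(-1,0),(-1,1),False)]),
([(0,1),(-3,2),(-4,2),(2,-1)],
 [((-6,3),46,(1,0,0,1),(0,0)),((-5,2),109,(1,4,-1,-3),(-3,2)),((-5,3),79,(1,0,0,1),(0,0)),((-3,1),131,(1,0,0,1),(0,0)),((-2,2),54,(1,0,0,1),(0,0)),((-1,0),126,(-1,0,0,-1),(-1,1)),((1,-1),129,(1,3,-1,-2),(-1,1)),((1,1),108,(1,0,0,1),(0,0)),((2,0),88,(-1,-4,1,3),(2,-1)),((3,-2),107,(3,4,-2,-3),(-1,1)),((3,-1),89,(-1,0,1,1),(0,0)),((4,-2),78,(1,0,0,1),(0,0))],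
 [(-6,3),(-2,2)],
 [([(-1,0),(5,-3),(3,-1),(0,0)],[],[]),([(-1,0),(7,-4),(5,-2),(3,-1),(0,0)],[],[]),([(-2,0),(6,-4),(3,-1),(0,0)],[],[])],
 []),
([(-4,2),(-1,0),(1,0),(0,1)],
 [((-3,1),68,(-1,-3,0,1),(0,0)),((-3,2),66,(1,0,-1,-1),(1,0)),((0,-1),102,(-2,-1,1,0),(-1,1)),((1,-1),92,(1,2,0,-1),(-1,1)),((1,1),82,(1,-1,0,1),(0,0)),((2,-1),76,(2,3,-1,-2),(-1,1)),((2,0),53,(-2,-5,1,3),(2,-1)),((3,-1),115,(1,0,0,1),(0,0))],
 [(-3,2),(2,0),(-3,1)],
 [([(-3,2),(0,0),(2,0),(1,1)],[],[]),([(-4,3),(-3,2),(0,0),(2,0),(0,2)],[],[]),([(-3,2),(0,0),(3,0),(2,1),(-2,2)],[],[]),([(-3,2),(0,0),(2,-1),(3,-1),(1,1)],[],[]),([(-3,2),(0,0),(2,-1),(4,-1),(3,0),(1,1)],[],[])],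
 []),
([(-4,1),(-2,0),(1,0),(0,1)],
 [((-5,1),56,(1,0,0,1),(0,0)),((-3,0),57,(1,0,0,1),(0,0)),((0,-1),104,(-2,-1,1,0),(-1,1)),((1,-1),123,(-2,-3,1,1),(-1,1)),((1,1),56,(1,-1,0,1),(0,0)),((2,-1),104,(2,5,-1,-3),(1,0)),((2,0),57,(1,1,0,1),(-1,0))],
 [(-5,1),(0,-1)],
 [([(-4,2),(0,0),(1,0),(-1,2)],[],[]),([(-4,2),(0,0),(2,0),(0,2)],[],[]),([(-2,1),(0,0),(3,0),(2,1)],[],[]),([(-2,1),(0,0),(4,0),(3,1)],[],[]),([(-2,1),(0,0),(5,0),(4,1)],[],[]),([(-2,1),(0,0),(6,0),(5,1)],[],[])],
 [])]"

definition db8 :: "entry list" where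
  "db8 = [
([(-5,1),(-1,0),(1,0),(0,1)],
 [((-6,1),58,(1,0,0,1),(0,0)),((-2,0),56,(1,0,0,1),(0,0)),((1,1),58,(1,-1,0,1),(0,0)),((2,-1),98,(-2,-5,1,2),(-1,1)),((2,0),56,(1,1,0,1),(-1,0)),((3,-1),98,(2,5,-1,-3),(-1,1))],
 [(-2,0)],
 [([(-8,2),(0,0),(-2,2)],[],[]),([(-4,1),(0,0),(2,0),(1,1)],[],[]),([(-4,1),(0,0),(3,0),(2,1)],[],[]),([(-4,1),(0,0),(4,0),(3,1)],[],[]),([(-4,1),(0,0),(5,0),(4,1)],[],[])],
 []),
([(-6,2),(0,0),(1,0),(0,1)],
 [((-7,2),93,(1,5,-1,-4),(-3,2)),((-5,2),69,(-1,-4,1,3),(1,0)),((-4,1),94,(-1,-5,0,1),(1,0)),((-1,0),82,(1,0,0,1),(0,0)),((1,1),86,(1,-1,0,1),(0,0)),((2,-1),99,(2,3,-1,-2),(-1,1)),((2,0),50,(-2,-7,1,4),(2,-1)),((3,-1),73,(1,1,0,1),(0,0))],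
 [(2,0),(-5,2)],
 [([(-9,3),(0,0),(-1,1),(-3,2)],[],[]),([(-9,3),(0,0),(-2,2),(-8,3)],[],[]),([(-6,2),(0,0),(1,0),(0,1)],[],[]),([(-9,3),(0,0),(1,0),(0,1),(-3,2)],[(-2,1)],[]),([(-6,2),(0,0),(2,0),(1,1),(-5,2)],[],[])],
 []),
([(-6,1),(0,0),(1,0),(0,1)],
 [((-7,1),60,(1,0,0,1),(0,0)),((-1,0),58,(1,0,0,1),(0,0)),((1,1),60,(1,-1,0,1),(0,0)),((2,0),58,(1,1,0,1),(-1,0))],
 [(1,1)],
 [([(-6,1),(0,0),(1,0),(0,1)],[],[]),([(-6,1),(0,0),(2,0),(1,1)],[],[]),([(-6,1),(0,0),(3,0),(2,1)],[],[]),([(-6,1),(0,0),(4,0),(3,1)],[],[])],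
 []),
([(0,1),(-2,2),(-3,2),(-2,1),(2,-1)],
 [((-5,3),91,(1,0,0,1),(0,0)),((-4,2),54,(1,0,0,1),(0,0)),((-4,3),55,(1,0,0,1),(0,0)),((-3,1),128,(-1,-3,0,1),(1,0)),((-3,3),91,(-1,-3,0,1),(1,0)),((-1,0),90,(-1,0,0,-1),(-1,1)),((-1,2),54,(1,3,-1,-2),(-3,2)),((1,-1),97,(-1,-3,0,1),(1,0)),((1,1),128,(1,0,0,1),(0,0)),((2,0),90,(-2,-3,1,1),(1,0)),((3,-2),88,(-1,-3,0,1),(1,0)),((3,-1),97,(1,0,0,1),(0,0)),((4,-2),88,(1,0,0,1),(0,0))],
 [(-4,3),(-4,2),(-1,2)],
 [([(-1,0),(0,-1),(4,-3),(2,-1),(0,0)],[],[]),([(-1,0),(0,-1),(6,-4),(4,-2),(0,0)],[],[]),([(-2,0),(-1,-1),(5,-4),(2,-1),(0,0)],[],[])],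
 [([(-1,0),(1,-2),(5,-4),(2,-1),(0,0)],[],True,1,(-1,-3,0,1),(1,0),(-1,0),False)]),
([(-5,3),(-2,1),(0,0),(1,0),(0,1)],
 [((-7,4),96,(1,0,0,1),(0,0)),((-4,2),68,(-1,-3,1,2),(1,0)),((-2,2),71,(-2,-3,1,1),(0,1)),((-1,0),77,(-2,-3,1,2),(0,0)),((1,-1),80,(-3,-4,1,1),(-1,1)),((2,-1),50,(1,0,0,1),(0,0)),((2,0),69,(1,1,0,1),(-1,0)),((3,-1),95,(-2,-3,1,2),(0,0))],
 [(-2,2),(-4,2),(2,0),(2,-1)],
 [([(-6,4),(0,0),(1,0),(-1,2)],[],[]),([(-4,3),(-3,2),(0,0),(2,0),(1,1)],[],[]),([(-6,4),(0,0),(2,0),(1,1),(-1,2)],[],[]),([(-3,2),(0,0),(2,-1),(3,-1),(2,0)],[],[]),([(-4,3),(-3,2),(0,0),(2,-1),(3,-1),(1,1)],[],[]),([(-3,2),(0,0),(2,-1),(4,-1),(3,0),(-2,2)],[(0,-1)],[]),([(-3,2),(0,0),(4,-2),(5,-2),(4,-1),(2,0)],[],[])],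
 []),
([(-3,1),(0,0),(1,0),(0,1),(-3,2)],
 [((-4,1),94,(1,0,0,1),(0,0)),((-4,2),70,(1,3,-1,-2),(-2,1)),((-2,2),71,(-1,-3,1,2),(1,0)),((-1,0),67,(2,3,-1,-1),(0,0)),((1,1),95,(1,0,0,1),(0,0)),((2,-1),76,(1,0,0,1),(0,0)),((2,0),68,(1,1,0,1),(-1,0)),((3,-1),81,(-2,-5,1,2),(1,0))],
 [(-4,2),(-2,2),(-1,0),(2,0)],
 [([(-6,2),(0,0),(-1,1),(-3,2),(-6,3)],[],[]),([(-5,2),(-3,1),(0,0),(-2,2),(-5,3)],[],[]),([(-6,2),(0,0),(-2,2),(-5,3),(-6,3)],[],[]),([(-3,1),(0,0),(1,0),(0,1),(-3,2)],[],[]),([(-6,2),(0,0),(1,0),(0,1),(-6,3)],[],[]),([(-5,2),(-3,1),(0,0),(1,0),(0,1),(-2,2),(-5,3)],[],[]),([(-4,2),(-3,1),(0,0),(1,0),(-1,2),(-4,3)],[],[]),([(-3,1),(0,0),(2,0),(1,1),(-2,2),(-3,2)],[],[])],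
 []),
([(1,-1),(1,0),(0,1),(-3,2),(-2,1)],
 [((-5,3),80,(-3,-4,1,1),(-1,1)),((-4,2),92,(-1,-1,1,2),(-1,0)),((-2,2),71,(1,0,0,1),(0,0)),((-1,0),66,(-2,-3,1,2),(0,0)),((1,1),80,(2,1,-1,-1),(-1,1)),((2,-2),93,(1,0,0,1),(0,0)),((2,-1),66,(1,0,0,1),(0,0)),((2,0),92,(1,1,0,1),(-1,0))],
 [(-2,2),(-1,0),(2,-1)],
 [([(-4,1),(-1,-1),(0,-1),(0,0),(-3,1)],[],[]),([(-4,1),(-3,0),(0,-2),(0,0),(-3,1)],[],[]),([(-6,2),(0,-2),(0,0)],[],[]),([(-5,2),(-4,1),(-1,-1),(0,-1),(0,0),(-2,1)],[],[]),([(-5,2),(-3,0),(0,-2),(0,0),(-2,1)],[],[]),([(-4,2),(-3,1),(0,-1),(0,0),(-1,1)],[],[]),([(-5,2),(-4,1),(-1,-1),(0,-1),(0,0),(-1,1),(-4,2)],[],[]),([(-5,3),(-3,1),(0,-1),(0,0),(-2,2)],[],[])],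
 [([(-5,2),(-2,0),(0,-1),(0,0),(-2,1)],[],True,0,(-2,-3,1,2),(0,0),(-4,1),False),([(-5,2),(-2,0),(0,-1),(0,0),(-1,1),(-4,2)],[],True,3,(-2,-3,1,2),(0,0),(-4,1),False),([(-6,3),(0,-1),(0,0),(-1,1),(-3,2)],[],True,1,(-2,-3,1,2),(0,0),(-3,0),False),([(-6,3),(-5,2),(-2,0),(0,-1),(0,0),(-1,1),(-3,2)],[],True,6,(-2,-3,1,2),(0,0),(-4,1),False),([(-6,3),(0,-1),(0,0),(-2,2),(-5,3)],[],True,4,(-2,-3,1,2),(0,0),(-3,0),False)])]"

definition db9 :: "entry list" where
  "db9 = [
([(-5,2),(2,-1),(0,1)],
 [((-4,2),80,(1,0,0,1),(0,0)),((-3,1),80,(2,3,-1,-2),(-1,1)),((2,0),102,(-2,-3,1,1),(1,0)),((3,-1),102,(-1,0,1,1),(0,0))],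
 [(-4,2),(-3,1)],
 [([(-7,3),(0,0),(-2,2)],[],[]),([(-7,3),(0,0),(1,0),(0,1),(-2,2)],[],[])],
 []),
([(0,1),(-6,3),(2,-1)],
 [((-8,4),98,(1,4,0,-1),(-4,2)),((-5,3),104,(-1,-4,1,3),(4,-2)),((-2,2),105,(-1,0,1,1),(-2,1)),((2,0),105,(-1,-4,1,3),(2,-1)),((3,-1),104,(-1,0,1,1),(0,0)),((4,-2),98,(1,0,0,1),(0,0))],
 [],
 [([(0,0),(8,-4),(6,-2)],[],[]),([(0,0),(10,-5),(8,-3),(6,-2)],[],[])],
 []),
([(0,1),(-4,2),(4,-2)],
 [((-3,2),78,(1,0,0,1),(0,0)),((3,-1),78,(-1,0,1,1),(0,0))],
 [(3,-1),(-3,2)],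
 [([(0,0),(8,-4),(4,-1)],[],[]),([(0,0),(10,-5),(6,-2),(4,-1)],[],[])],
 []),
([(1,0),(0,1),(-6,-1)],
 [((-7,-1),116,(1,-8,0,1),(-1,1)),((-5,-1),86,(1,-7,0,1),(-1,1)),((-4,0),122,(-1,3,0,-1),(-3,0)),((-1,1),116,(1,2,0,-1),(-1,1)),((1,1),86,(1,1,0,-1),(-1,1)),((2,0),100,(1,1,0,1),(-1,0))],
 [(-5,-1),(1,1)],
 [([(-6,-2),(1,-1),(0,0)],[],[]),([(-7,-2),(-6,-2),(1,-1),(0,0),(-1,0)],[],[])],
 []),
([(0,1),(-7,0),(1,0)],
 [((-8,0),75,(1,0,0,1),(0,0)),((-1,1),87,(-1,7,0,-1),(-7,1)),((1,1),87,(-1,8,0,-1),(-7,1)),((2,0),75,(1,1,0,1),(-1,0))],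
 [],
 [([(0,0),(8,0),(7,1)],[],[]),([(0,0),(9,0),(8,1),(7,1)],[],[]),([(0,0),(10,0),(9,1),(7,1)],[],[])],
 []),
([(0,1),(-5,3),(-2,1),(2,-1)],
 [((-7,4),110,(1,0,0,1),(0,0)),((-4,2),79,(1,0,0,1),(0,0)),((-2,2),91,(1,0,0,1),(0,0)),((1,-1),109,(1,0,0,1),(0,0)),((2,0),130,(-2,-3,1,1),(1,0)),((3,-2),107,(1,0,0,1),(0,0)),((3,-1),125,(1,0,0,1),(0,0)),((4,-2),103,(1,0,0,1),(0,0))],
 [(-2,2),(-4,2)],
 [([(0,0),(3,-2),(7,-4),(5,-2)],[],[]),([(0,0),(3,-2),(9,-5),(7,-3),(5,-2)],[],[]),([(0,0),(6,-4),(8,-5),(5,-2)],[],[])],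
 []),
([(-1,0),(2,-1),(0,1),(-3,2)],
 [((-4,2),126,(-1,0,0,-1),(-1,1)),((-3,1),126,(-2,-3,1,2),(0,0)),((-2,2),90,(-1,0,0,-1),(-1,1)),((1,-1),90,(1,0,0,1),(0,0)),((2,0),126,(2,3,-1,-2),(-1,1)),((3,-1),126,(1,0,0,1),(0,0))],
 [(-2,2),(3,-1),(-4,2),(1,-1)],
 [([(-7,3),(-6,2),(0,0),(-1,1)],[],[]),([(-6,3),(-5,2),(-3,1),(0,0),(-1,1),(-3,2)],[],[]),([(-5,3),(-3,1),(0,0),(-2,2)],[],[]),([(-6,3),(-5,2),(-3,1),(0,0),(-2,2),(-5,3)],[],[]),([(-6,4),(-3,1),(0,0),(-3,3)],[],[])],
 [([(-4,2),(-3,1),(0,0),(1,0),(0,1),(-3,2)],[],True,1,(2,3,-1,-2),(-1,1),(-3,2),False),([(-5,3),(-3,1),(0,0),(1,0),(0,1),(-2,2)],[],True,3,(-1,0,0,-1),(-1,1),(-5,3),False)]),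
([(-3,2),(-2,1),(3,-2),(0,1)],
 [((-5,3),107,(1,0,0,1),(0,0)),((-4,2),107,(3,4,-2,-3),(-1,1)),((-2,2),88,(-1,-3,0,1),(1,0)),((1,-1),88,(3,5,-2,-3),(-1,1))],
 [(-2,2),(1,-1)],
 [([(-1,1),(0,0),(5,-3),(2,0)],[],[]),([(-2,2),(0,0),(5,-3),(1,1)],[],[]),([(0,0),(5,-3),(7,-4),(5,-2),(3,-1)],[],[(-1,0)]),([(0,0),(5,-3),(7,-4),(4,-1),(1,0)],[],[])],
 [([(0,0),(3,-2),(8,-5),(5,-2),(3,-1)],[],True,3,(3,4,-2,-3),(-1,1),(0,0),False)]),
([(0,1),(-3,2),(-2,1),(4,-2)],
 [((-5,3),103,(1,0,0,1),(0,0)),((-4,2),78,(1,0,0,1),(0,0)),((-2,2),88,(1,0,0,1),(0,0)),((3,-1),89,(1,0,0,1),(0,0))],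
 [(-2,2),(-4,2),(3,-1)],
 [([(0,0),(1,-1),(7,-4),(3,-1)],[],[]),([(0,0),(1,-1),(9,-5),(5,-2),(3,-1)],[],[])],
 []),
([(2,-1),(0,1),(-2,2),(-4,2)],
 [((-6,3),105,(-1,0,1,1),(-2,1)),((-5,3),124,(1,0,0,1),(2,-1)),((-4,3),106,(-3,-4,2,3),(0,0)),((-1,2),72,(1,0,0,1),(0,0)),((2,0),106,(-1,-4,1,3),(2,-1)),((3,-1),124,(-1,0,1,1),(0,0)),((4,-2),105,(1,0,0,1),(0,0))],
 [(-6,3),(-1,2)],
 [([(-4,1),(2,-2),(0,0),(-2,1)],[],[]),([(-6,2),(2,-2),(0,0),(-4,2)],[],[])],
 [([(-7,3),(1,-1),(0,0),(-6,3)],[],False,1,(1,3,-1,-2),(-3,2),(-2,0),True)]),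
([(-4,3),(-2,1),(2,-1),(0,1)],
 [((-6,4),106,(-1,0,0,-1),(-2,2)),((-5,3),127,(-1,0,0,-1),(-2,2)),((-5,4),106,(1,3,0,-1),(-3,2)),((-4,2),106,(-3,-4,2,3),(0,0)),((-3,3),127,(3,5,-2,-3),(-3,2)),((-1,0),106,(-3,-5,2,3),(1,0)),((-1,2),106,(3,5,-2,-3),(-3,2)),((1,-1),127,(-3,-5,2,3),(1,0)),((2,0),106,(3,4,-2,-3),(-2,2)),((3,-2),106,(-1,-3,0,1),(1,0)),((3,-1),127,(1,0,0,1),(0,0)),((4,-2),106,(1,0,0,1),(0,0))],
 [(-5,4),(-6,4)],
 [([(-4,4),(0,0),(2,-1),(-2,3)],[],[]),([(-2,2),(0,0),(4,-2),(2,0)],[],[]),([(-3,3),(0,0),(4,-2),(1,1)],[],[])],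
 [([(-3,3),(0,0),(2,-1),(-1,2)],[],False,2,(-2,-3,1,1),(1,1),(1,0),True),([(-1,1),(0,0),(6,-3),(5,-2)],[],False,2,(0,-1,1,2),(1,0),(-2,0),True),([(-2,2),(0,0),(6,-3),(4,-1)],[],True,2,(-3,-5,2,3),(1,0),(4,-2),False),([(-1,1),(0,0),(8,-4),(7,-3)],[],True,0,(-3,-5,2,3),(1,0),(2,-1),False)])]"

definition db10 :: "entry list" where
  "db10 = [
([(-5,1),(-2,0),(1,0),(0,1)],
 [((-6,1),84,(1,0,0,1),(0,0)),((-3,0),83,(1,0,0,1),(0,0)),((1,1),84,(1,-1,0,1),(0,0)),((2,0),83,(1,1,0,1),(-1,0))],
 [(2,0),(1,-1)],
 [([(-3,1),(0,0),(3,0),(2,1)],[],[]),([(-3,1),(0,0),(4,0),(3,1)],[],[]),([(-3,1),(0,0),(5,0),(4,1)],[],[])],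
 []),
([(-4,1),(-3,0),(1,0),(0,1)],
 [((-5,1),83,(1,0,0,1),(0,0)),((-4,0),83,(-1,1,0,-1),(-4,1)),((1,1),83,(1,-1,0,1),(0,0)),((2,0),83,(-1,0,0,-1),(-3,1))],
 [(2,0),(-5,2)],
 [([(-1,1),(0,0),(4,0),(3,1)],[],[]),([(-1,1),(0,0),(5,0),(4,1)],[],[]),([(-1,1),(0,0),(6,0),(5,1)],[],[])],
 [([(-2,2),(0,0),(1,0),(-1,2)],[],False,3,(-1,-2,1,1),(-2,3),(1,0),True),([(-2,2),(0,0),(2,0),(0,2)],[],False,4,(-1,-3,1,2),(-1,2),(2,-1),True)]),
([(-6,1),(-1,0),(1,0),(0,1)],
 [((-7,1),85,(1,0,0,1),(0,0)),((-2,0),84,(1,0,0,1),(0,0)),((1,1),85,(1,-1,0,1),(0,0)),((2,0),84,(1,1,0,1),(-1,0))],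
 [(2,0)],
 [([(-5,1),(0,0),(2,0),(1,1)],[],[]),([(-5,1),(0,0),(3,0),(2,1)],[],[]),([(-5,1),(0,0),(4,0),(3,1)],[],[])],
 []),
([(-7,2),(0,0),(1,0),(0,1)],
 [((-6,2),93,(1,5,-1,-4),(-3,2)),((-4,1),96,(-2,-7,1,4),(0,0)),((1,1),116,(1,-1,0,1),(0,0)),((2,0),82,(1,1,0,1),(-1,0))],
 [(-6,2),(2,0),(-4,1)],
 [([(-7,2),(0,0),(1,0),(0,1)],[],[]),([(-7,2),(0,0),(2,0),(1,1),(-6,2)],[],[])],
 []),
([(-7,1),(0,0),(1,0),(0,1)],
 [((-8,1),87,(1,0,0,1),(0,0)),((-1,0),85,(1,0,0,1),(0,0)),((1,1),87,(1,-1,0,1),(0,0)),((2,0),85,(1,1,0,1),(-1,0))],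
 [(1,1)],
 [([(-7,1),(0,0),(1,0),(0,1)],[],[]),([(-7,1),(0,0),(2,0),(1,1)],[],[]),([(-7,1),(0,0),(3,0),(2,1)],[],[])],
 []),
([(-7,3),(0,0),(1,0),(0,1)],
 [((-5,2),92,(0,1,-1,-3),(-2,2)),((-3,2),92,(-1,-3,1,2),(1,0)),((2,-1),99,(1,0,0,1),(0,0)),((2,0),77,(-2,-5,1,3),(2,-1)),((3,-1),102,(3,8,-2,-5),(-3,2))],
 [(-5,2),(-3,2),(2,0)],
 [([(-9,4),(-7,3),(0,0),(-2,2)],[],[]),([(-7,3),(0,0),(1,0),(0,1)],[],[]),([(-7,3),(0,0),(3,-1),(2,0),(0,1)],[],[])],
 []),
([(0,0),(3,-1),(0,1),(-5,3)],
 [((-7,4),118,(1,0,0,1),(0,0)),((-2,1),95,(-2,-3,1,2),(0,0)),((-2,2),95,(1,3,-1,-2),(-3,2)),((2,-1),94,(-1,-3,1,2),(0,0)),((2,0),94,(2,3,-1,-2),(-3,2)),((5,-2),119,(1,0,0,1),(0,0))],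
 [(-2,1),(-2,2),(2,0),(2,-1)],
 [([(-8,4),(-3,1),(0,0),(-3,2)],[],[]),([(-10,5),(-5,2),(-3,1),(0,0),(-3,2),(-5,3)],[],[])],
 []),
([(-7,4),(0,0),(1,0),(0,1)],
 [((-9,5),120,(1,0,0,1),(0,0)),((-2,1),96,(1,0,0,1),(0,0)),((-2,2),96,(1,0,-1,-1),(0,1)),((2,-1),86,(-5,-9,1,2),(1,0)),((2,0),86,(4,9,-1,-2),(-8,2)),((3,-1),118,(1,0,0,1),(0,0))],
 [(-2,2),(-2,1),(2,0),(2,-1)],
 [([(-7,4),(0,0),(1,0),(0,1)],[],[]),([(-7,4),(0,0),(2,-1),(3,-1),(2,0),(0,1)],[],[])],
 []),
([(0,-1),(1,0),(0,1),(-3,0)],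
 [((-4,0),122,(1,0,0,1),(0,0)),((-1,-1),94,(1,-2,0,1),(-1,1)),((-1,1),94,(1,2,0,-1),(-1,1)),((1,-1),96,(2,1,-1,0),(-1,1)),((1,1),96,(2,-1,-1,0),(-1,1)),((2,0),121,(1,0,0,1),(0,0))],
 [(-1,-1),(-1,1),(1,1),(1,-1)],
 [([(-4,0),(-1,-1),(0,0),(-1,1)],[],[]),([(-5,0),(-2,-1),(-1,-1),(0,0),(-1,1),(-2,1)],[],[])],
 []),
([(-2,0),(0,-1),(2,0),(0,1)],
 [((-3,0),121,(1,0,0,1),(0,0)),((-1,-1),95,(1,-2,0,1),(-1,1)),((-1,1),95,(1,2,0,-1),(-1,1)),((1,-1),95,(-1,-2,0,1),(-1,1)),((1,1),95,(-1,2,0,-1),(-1,1)),((3,0),121,(-1,0,0,-1),(0,0))],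
 [(-1,1),(-1,-1),(1,1),(1,-1)],
 [([(-2,1),(0,0),(2,1),(0,2)],[],[]),([(-2,1),(0,0),(1,0),(3,1),(1,2),(0,2)],[],[])],
 []),
([(0,1),(-3,2),(-2,1),(1,-1),(2,-1)],
 [((-5,3),109,(1,0,0,1),(0,0)),((-4,2),129,(1,3,-1,-2),(-1,1)),((-2,2),97,(-1,-3,0,1),(1,0)),((-1,0),90,(1,0,0,1),(0,0)),((2,-2),130,(1,0,0,1),(0,0)),((2,0),138,(1,0,0,1),(0,0)),((3,-2),88,(3,5,-2,-3),(-1,1)),((3,-1),126,(-1,0,1,1),(0,0))],
 [(-1,0),(3,-2),(3,-1),(-2,2)],
 [([(0,0),(3,-2),(5,-3),(6,-3),(5,-2),(3,-1)],[],[]),([(0,0),(6,-4),(7,-4),(5,-2),(3,-1)],[],[]),([(0,0),(1,-1),(4,-3),(5,-3),(3,-1)],[],[]),([(0,0),(1,-1),(4,-3),(6,-3),(5,-2),(3,-1)],[],[]),([(0,0),(2,-2),(5,-4),(6,-4),(3,-1)],[],[]),([(-1,0),(2,-2),(4,-2),(3,-1),(0,0)],[],[]),([(-1,0),(2,-2),(4,-3),(5,-3),(3,-1),(0,0)],[],[])],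
 []),
([(0,1),(-3,2),(-2,1),(2,-1),(3,-1)],
 [((-5,3),125,(1,0,0,1),(0,0)),((-4,2),89,(-1,0,1,1),(0,0)),((-2,2),97,(1,0,0,1),(0,0)),((-1,0),126,(1,0,0,1),(0,0)),((1,-1),126,(-1,0,1,1),(0,0)),((2,0),97,(-1,0,1,1),(0,0)),((4,-2),89,(1,0,0,1),(0,0)),((5,-2),125,(-1,0,1,1),(0,0))],
 [(2,0),(-2,2),(4,-2),(-4,2)],
 [([(0,0),(1,-1),(5,-3),(6,-3),(3,-1)],[],[]),([(0,0),(1,-1),(7,-4),(8,-4),(5,-2),(3,-1)],[],[]),([(0,0),(2,-2),(4,-3),(6,-3),(3,-1)],[],[])],
 [])]"

definition db11 :: "entry list" where
  "db11 = [
([(-3,1),(-1,0),(1,0),(0,1),(-2,2)],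
 [((-4,1),134,(1,0,0,1),(0,0)),((-3,2),97,(-2,-3,1,2),(0,0)),((-2,0),89,(2,1,-1,0),(2,-1)),((-1,2),91,(2,1,-1,0),(0,0)),((1,-1),131,(-2,-3,1,1),(-1,1)),((1,1),135,(1,0,0,1),(0,0)),((2,-1),129,(-1,-3,0,1),(1,0)),((2,0),79,(2,3,-1,-1),(-2,1))],
 [(-3,2),(-2,0),(-1,2),(2,0)],
 [([(-4,2),(0,0),(1,0),(-1,2),(-3,3)],[],[]),([(-2,1),(0,0),(2,0),(1,1),(-1,2)],[],[]),([(-2,1),(0,0),(3,0),(2,1),(0,2),(-1,2)],[],[])],
 []),
([(-3,3),(-2,1),(-1,0),(1,0),(0,1)],
 [((-4,4),133,(1,0,0,1),(0,0)),((-3,2),91,(-1,-3,1,2),(1,0)),((-2,0),108,(-2,-1,1,1),(-2,1)),((-1,2),91,(1,-1,-1,0),(1,0)),((0,-1),130,(-2,-1,1,0),(-1,1)),((1,-1),139,(1,0,0,1),(0,0)),((2,-1),130,(2,3,-1,-2),(-1,1)),((2,0),108,(2,3,-1,-1),(-2,1))],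
 [(-1,2),(-3,2)],
 [([(-1,2),(0,0),(3,0),(2,1),(-1,3)],[],[]),([(-1,2),(0,0),(1,-1),(3,-1),(2,0)],[],[]),([(-1,2),(0,0),(2,-2),(4,-2),(2,0)],[],[])],
 [([(-1,2),(0,0),(3,0),(0,2)],[(0,-1)],False,5,(-1,-3,1,2),(6,-3),(3,-2),True),([(-1,2),(0,0),(1,-1),(4,-1),(1,1)],[],True,0,(-1,-2,0,1),(0,0),(2,1),False)]),
([(1,-1),(1,0),(0,1),(-2,2),(-2,1),(-1,0)],
 [((-3,1),131,(-2,-3,1,1),(-1,1)),((-3,2),97,(-1,-3,1,2),(1,0)),((-3,3),139,(1,0,0,1),(0,0)),((-2,0),131,(-2,-1,1,1),(-2,1)),((-1,2),97,(1,-1,-1,0),(1,0)),((0,-1),97,(-1,1,1,0),(-1,1)),((1,1),131,(2,1,-1,-1),(-1,1)),((2,-2),139,(-1,0,0,-1),(-1,1)),((2,-1),97,(1,3,-1,-2),(-1,1)),((2,0),131,(2,3,-1,-1),(-2,1))],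
 [(-1,2),(-3,2),(0,-1),(2,-1)],
 [([(-3,0),(-1,-1),(0,-1),(0,0),(-2,1),(-3,1)],[],[]),([(-3,0),(-2,-1),(0,-2),(0,0),(-2,1),(-3,1)],[],[]),([(-3,1),(-2,0),(0,-1),(0,0),(-1,1),(-3,2)],[],[]),([(-4,2),(-2,0),(0,-1),(0,0),(-2,2),(-4,3)],[],[])],
 [([(-2,-1),(0,-2),(0,0),(-2,1)],[],False,6,(-1,1,0,-1),(-4,2),(-1,0),True),([(-4,1),(0,-1),(0,0),(-4,2)],[],False,6,(-1,-3,0,1),(-2,1),(-1,0),True),([(-4,1),(-3,0),(-1,-1),(0,-1),(0,0),(-4,2)],[],True,1,(1,2,0,-1),(-1,1),(0,0),False),([(-3,0),(-1,-1),(0,-1),(0,0),(-1,1),(-3,2)],[],True,1,(-1,0,0,-1),(-1,1),(-3,0),False),([(-4,1),(0,-1),(0,0),(-1,1),(-3,2),(-4,2)],[],True,1,(-1,-2,0,1),(0,0),(-2,-1),False)]),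
([(1,-1),(1,0),(0,1),(-2,2),(-3,2),(-2,1)],
 [((-5,3),132,(-3,-4,1,1),(-1,1)),((-4,2),128,(-2,-3,1,1),(0,1)),((-4,3),91,(1,3,0,-1),(-3,2)),((-3,3),141,(-1,0,0,-1),(-2,2)),((-1,0),97,(-1,-3,1,2),(1,0)),((-1,2),91,(1,3,-1,-2),(-3,2)),((1,1),132,(1,-1,0,1),(0,0)),((2,-2),140,(1,0,0,1),(0,0)),((2,-1),97,(-1,-3,0,1),(1,0)),((2,0),128,(1,0,-1,-1),(0,1))],
 [(-1,0),(2,-1),(-1,2),(-4,3)],
 [([(-4,1),(-3,0),(0,-2),(0,0),(-2,1)],[],[]),([(-5,2),(-4,1),(-1,-1),(0,-1),(0,0),(-4,2)],[],[]),([(-4,2),(-3,1),(0,-1),(0,0),(-1,1),(-3,2)],[],[]),([(-5,3),(-3,1),(0,-1),(0,0),(-2,2),(-4,3)],[],[])],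
 [([(-4,1),(-1,-1),(0,-1),(0,0),(-2,1)],[],False,7,(1,3,-1,-2),(2,-1),(1,-1),True),([(-5,2),(-2,0),(0,-1),(0,0),(-4,2)],[],False,7,(1,3,0,-1),(2,-1),(0,1),True),([(-5,2),(-2,0),(0,-1),(0,0),(-1,1),(-3,2)],[],True,1,(-2,-3,1,2),(0,0),(-4,1),False),([(-6,3),(0,-1),(0,0),(-1,1),(-5,3)],[],True,0,(-2,-3,1,2),(0,0),(-3,0),False)]),
([(-4,2),(2,-1),(-1,2)],
 [],
 [],
 [([(-6,3),(0,0),(-3,3)],[],[])],
 []),
([(1,1),(-4,2),(2,-1)],
 [((-3,2),108,(1,0,0,1),(0,0)),((2,0),107,(-2,-5,1,3),(2,-1))],
 [(2,0),(-3,2)],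
 [([(0,0),(6,-3),(5,-1)],[],[])],
 []),
([(-7,-1),(1,0),(0,1)],
 [((-6,-1),116,(1,-8,0,1),(-1,1)),((-4,0),120,(-2,7,1,-4),(-7,4)),((1,1),116,(1,1,0,-1),(-1,1))],
 [(-4,0),(1,1),(-6,-1)],
 [([(-8,-1),(0,0),(-1,1)],[],[])],
 []),
([(0,1),(-8,0),(1,0)],
 [((-9,0),101,(1,0,0,1),(0,0)),((-1,1),117,(-1,8,0,-1),(-8,1)),((1,1),117,(-1,9,0,-1),(-8,1)),((2,0),101,(1,1,0,1),(-1,0))],
 [],
 [([(0,0),(9,0),(8,1)],[],[]),([(0,0),(10,0),(9,1),(8,1)],[],[])],
 []),
([(0,1),(-3,2),(-3,1),(2,-1)],
 [((-4,2),131,(1,0,0,1),(0,0)),((-2,2),128,(-1,-3,0,1),(1,0)),((-1,0),126,(-2,-3,1,2),(0,0))],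
 [(-4,2),(-1,0),(-2,2)],
 [([(0,-1),(5,-3),(3,-1),(0,0)],[],[])],
 []),
([(1,1),(-3,2),(-2,1),(2,-1)],
 [((-4,2),108,(1,0,0,1),(0,0)),((-2,2),128,(1,0,0,1),(0,0)),((2,0),129,(1,0,0,1),(0,0))],
 [(-2,2),(-4,2),(2,0)],
 [([(0,0),(1,-1),(5,-3),(4,-1)],[],[])],
 []),
([(0,1),(-3,2),(-4,2),(4,-2)],
 [((-6,3),98,(1,0,0,1),(0,0)),((-2,2),105,(1,0,0,1),(0,0)),((3,-1),123,(1,0,0,1),(0,0))],
 [(3,-1),(-6,3),(-2,2)],
 [([(-1,0),(7,-4),(3,-1),(0,0)],[],[])],
 []),
([(0,1),(-5,3),(-4,2),(2,-1)],
 [((-6,3),104,(-1,-4,1,3),(4,-2)),((-2,2),124,(1,0,0,1),(2,-1))],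
 [(-2,2),(-6,3)],
 [([(0,0),(1,-1),(7,-4),(5,-2)],[],[])],
 [])]"

definition db12 :: "entry list" where
  "db12 = [
([(0,1),(-4,2),(-5,2),(2,-1)],
 [((-3,1),132,(1,0,0,1),(0,0)),((-3,2),109,(1,4,-1,-3),(-3,2))],
 [(-3,1),(-3,2)],
 [([(0,0),(7,-3),(8,-3),(7,-2),(4,-1)],[],[]),([(-1,0),(6,-3),(4,-1),(0,0)],[],[])],
 []),
([(0,1),(-4,2),(-3,1),(2,-1)],
 [((-5,2),132,(1,0,0,1),(0,0)),((-3,2),131,(1,0,0,1),(0,0)),((-1,0),131,(2,3,-1,-2),(-1,1))],
 [(-1,0),(-5,2),(-3,2)],
 [([(0,0),(1,-1),(6,-3),(4,-1)],[],[])],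
 []),
([(-6,2),(-1,0),(1,0),(0,1)],
 [((-5,2),130,(1,1,-1,-2),(1,0)),((-4,1),134,(-1,-4,0,1),(0,0)),((2,0),103,(-2,-7,1,4),(2,-1))],
 [(-5,2),(2,0),(-4,1)],
 [([(-5,2),(0,0),(2,0),(1,1)],[],[])],
 []),
([(-5,1),(-3,0),(1,0),(0,1)],
 [((-6,1),111,(1,0,0,1),(0,0)),((-4,0),112,(1,0,0,1),(0,0)),((1,1),111,(1,-1,0,1),(0,0)),((2,0),112,(1,1,0,1),(-1,0))],
 [(2,0),(2,-1)],
 [([(-2,1),(0,0),(4,0),(3,1)],[],[]),([(-2,1),(0,0),(5,0),(4,1)],[],[])],
 []),
([(-6,1),(-2,0),(1,0),(0,1)],
 [((-7,1),113,(1,0,0,1),(0,0)),((-3,0),111,(1,0,0,1),(0,0)),((1,1),113,(1,-1,0,1),(0,0)),((2,0),111,(1,1,0,1),(-1,0))],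
 [(-3,0)],
 [([(-4,1),(0,0),(3,0),(2,1)],[],[]),([(-4,1),(0,0),(4,0),(3,1)],[],[])],
 []),
([(-7,1),(-1,0),(1,0),(0,1)],
 [((-8,1),114,(1,0,0,1),(0,0)),((-2,0),113,(1,0,0,1),(0,0)),((1,1),114,(1,-1,0,1),(0,0)),((2,0),113,(1,1,0,1),(-1,0))],
 [(1,1)],
 [([(-6,1),(0,0),(2,0),(1,1)],[],[]),([(-6,1),(0,0),(3,0),(2,1)],[],[])],
 []),
([(-8,2),(0,0),(1,0),(0,1)],
 [((-7,2),133,(-1,-5,1,4),(1,0)),((2,0),110,(-2,-9,1,5),(2,-1))],
 [(-7,2),(2,0)],
 [([(-8,2),(0,0),(1,0),(0,1)],[],[])],
 []),
([(-8,1),(0,0),(1,0),(0,1)],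
 [((-9,1),117,(1,0,0,1),(0,0)),((-1,0),114,(1,0,0,1),(0,0)),((1,1),117,(1,-1,0,1),(0,0)),((2,0),114,(1,1,0,1),(-1,0))],
 [(-9,1)],
 [([(-8,1),(0,0),(1,0),(0,1)],[],[]),([(-8,1),(0,0),(2,0),(1,1)],[],[])],
 []),
([(4,-2),(0,1),(-2,2),(-3,2),(-2,1)],
 [((-4,2),105,(1,0,0,1),(0,0)),((-4,3),106,(1,0,0,1),(0,0)),((3,-1),136,(1,0,0,1),(0,0))],
 [(3,-1),(-4,3),(-4,2)],
 [([(-1,0),(1,-2),(5,-4),(4,-3),(0,0)],[],[]),([(-3,1),(-2,0),(4,-3),(0,0),(-2,1)],[],[])],
 []),
([(0,1),(-3,2),(-2,1),(4,-2),(3,-1)],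
 [((-4,2),123,(1,0,0,1),(0,0)),((-2,2),136,(1,0,0,1),(0,0)),((2,0),124,(1,0,0,1),(0,0)),((6,-3),104,(1,0,0,1),(0,0))],
 [(-2,2),(-4,2),(2,0),(6,-3)],
 [([(0,0),(1,-1),(7,-4),(6,-3),(3,-1)],[],[])],
 []),
([(0,1),(-3,2),(-1,0),(1,-1),(2,-1)],
 [((-2,2),137,(1,3,-1,-2),(-1,1)),((0,-1),106,(-1,1,1,0),(-1,1)),((3,-2),106,(3,5,-2,-3),(-1,1))],
 [(-2,2),(2,0),(-4,2),(3,-2),(0,-1)],
 [([(0,0),(1,-1),(5,-3),(6,-3),(5,-2),(3,-1)],[],[]),([(0,0),(2,-2),(4,-3),(5,-3),(3,-1)],[],[])],
 [([(-1,0),(0,-1),(2,-2),(4,-2),(3,-1),(0,0)],[],True,0,(-2,-3,1,2),(0,0),(3,-1),False)]),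
([(0,1),(-2,2),(-5,3),(-2,1),(2,-1)],
 [((-4,2),124,(1,0,0,1),(2,-1)),((-4,3),127,(-1,0,0,-1),(-2,2))],
 [(-4,3),(-4,2),(3,-2)],
 [([(-3,1),(0,-1),(4,-3),(2,-1),(0,0)],[],[])],
 [([(-3,1),(-2,0),(1,-2),(3,-3),(0,0)],[],False,8,(3,5,-2,-3),(0,-1),(4,-2),True)]),
([(1,0),(0,1),(-2,2),(-2,1),(-1,-1)],
 [((-2,0),129,(1,2,0,-1),(0,1)),((-1,2),128,(1,-1,-1,0),(1,0)),((0,-1),138,(1,-1,0,1),(1,0))],
 [(0,-1),(-2,0),(-1,2)],
 [([(-2,0),(-1,-2),(1,-1),(0,0),(-2,1)],[],[])],
 [([(-4,2),(-3,0),(-2,-1),(0,0)],[],False,9,(2,3,-1,-1),(5,-2),(2,-1),True)]),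
([(2,-2),(1,0),(0,1),(-3,2),(-2,1)],
 [((-2,2),140,(1,0,0,1),(0,0)),((-1,0),130,(-2,-3,1,2),(0,0)),((2,-1),130,(1,0,0,1),(0,0))],
 [(-2,2),(-1,0),(2,-1)],
 [([(-4,2),(-3,1),(1,-2),(0,0),(-1,1)],[],[])],
 []),
([(-4,1),(0,0),(1,0),(0,1),(-3,2)],
 [((-4,2),139,(1,3,-1,-2),(-2,1)),((-2,2),140,(-1,-3,1,2),(1,0)),((-1,0),125,(2,3,-1,-1),(0,0)),((2,0),134,(1,1,0,1),(-1,0))],
 [(-4,2),(-2,2),(2,0),(-1,0)],
 [([(-4,1),(0,0),(1,0),(0,1),(-3,2)],[],[])],
 []),
([(-3,2),(-3,1),(0,0),(1,0),(1,1)],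
 [((-4,2),139,(-1,-3,1,2),(1,0)),((-2,2),141,(-1,-3,1,2),(1,0)),((-1,0),125,(-2,-3,1,2),(0,0)),((2,0),135,(1,1,0,1),(-1,0))],
 [(-2,2),(-4,2),(-1,0),(2,0)],
 [([(0,0),(3,-1),(4,-1),(4,0),(0,1)],[],[])],
 []),
([(-7,4),(-2,1),(0,0),(1,0),(0,1)],
 [((-4,2),134,(-1,-3,1,2),(1,0)),((-2,2),140,(-2,-3,1,1),(0,1)),((2,-1),110,(1,0,0,1),(0,0)),((2,0),133,(1,1,0,1),(-1,0))],
 [(-2,2),(-4,2),(2,0),(2,-1)],
 [([(-5,3),(0,0),(2,-1),(3,-1),(2,0)],[],[])],
 []),
([(3,-1),(0,1),(-2,2),(-3,2),(-2,1),(2,-1)],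
 [((-4,2),124,(-1,0,1,1),(0,0)),((-4,3),127,(1,0,0,1),(0,0)),((2,0),137,(-1,0,0,-1),(0,1)),((4,-2),136,(1,0,0,1),(0,0))],
 [(2,0),(4,-2),(-4,3),(-1,0),(-4,2)],
 [([(-1,0),(1,-2),(3,-3),(4,-3),(3,-2),(0,0)],[],[]),([(-3,1),(-2,0),(2,-2),(3,-2),(0,0),(-2,1)],[],[])],
 [([(-2,0),(-1,-1),(1,-2),(3,-2),(0,0)],[],False,10,(-1,0,1,1),(3,-2),(0,1),True)])]"

definition db13 :: "entry list" where
  "db13 = [
([(4,-2),(0,1),(-6,3)],
 [],
 [],
 [([(-6,2),(4,-3),(0,0)],[],[])],
 []),
([(-7,3),(2,-1),(0,1)],
 [],
 [(-5,2)],
 [([(-9,4),(0,0),(-2,2)],[],[])],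
 []),
([(1,0),(0,1),(-8,-1)],
 [],
 [(-7,-1)],
 [([(-8,-2),(1,-1),(0,0)],[],[])],
 []),
([(0,1),(-9,0),(1,0)],
 [],
 [],
 [([(0,0),(10,0),(9,1)],[],[])],
 []),
([(0,1),(-3,2),(-2,1),(5,-3)],
 [],
 [(3,-2),(4,-2)],
 [([(0,0),(1,-1),(8,-5),(3,-1)],[],[])],
 []),
([(0,1),(-5,3),(-2,1),(4,-2)],
 [],
 [(-2,2),(-4,2)],
 [([(0,0),(3,-2),(9,-5),(5,-2)],[],[])],
 []),
([(0,1),(-3,2),(-2,1),(6,-3)],
 [],
 [(-4,2),(-2,2)],
 [([(0,0),(1,-1),(9,-5),(3,-1)],[],[])],
 []),
([(4,-2),(0,1),(-2,2),(-4,2)],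
 [],
 [(3,-1)],
 [([(-4,1),(4,-3),(0,0),(-2,1)],[],[])],
 []),
([(4,-2),(0,1),(-4,3),(-2,1)],
 [],
 [(3,-1),(-5,4)],
 [([(-4,2),(-2,0),(4,-3),(0,0)],[],[])],
 []),
([(-5,3),(-2,1),(3,-2),(0,1)],
 [],
 [(-2,2)],
 [([(-3,2),(0,0),(5,-3),(2,0)],[],[])],
 []),
([(1,1),(-3,2),(-4,2),(2,-1)],
 [],
 [(2,0)],
 [([(-1,0),(5,-3),(4,-1),(0,0)],[],[])],
 []),
([(1,-1),(2,-1),(0,1),(-5,3)],
 [],
 [(-2,2),(-4,2)],
 [([(-7,4),(-1,0),(0,0),(-2,2)],[],[])],
 []),
([(-7,4),(-2,1),(2,-1),(0,1)],
 [],
 [(-2,2),(-4,2)],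
 [([(-5,3),(0,0),(4,-2),(2,0)],[],[])],
 []),
([(-6,1),(-3,0),(1,0),(0,1)],
 [],
 [(1,1)],
 [([(-3,1),(0,0),(4,0),(3,1)],[],[])],
 []),
([(-5,1),(-4,0),(1,0),(0,1)],
 [],
 [(-6,2),(1,1)],
 [([(-1,1),(0,0),(5,0),(4,1)],[],[])],
 []),
([(-7,1),(-2,0),(1,0),(0,1)],
 [],
 [(1,1)],
 [([(-5,1),(0,0),(3,0),(2,1)],[],[])],
 []),
([(-8,1),(-1,0),(1,0),(0,1)],
 [],
 [(1,1)],
 [([(-7,1),(0,0),(2,0),(1,1)],[],[])],
 []),
([(-4,2),(-1,0),(3,-1),(0,1)],
 [],
 [(-3,2),(-3,1)],
 [([(-3,2),(0,0),(4,-1),(1,1)],[],[])],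
 []),
([(-9,2),(0,0),(1,0),(0,1)],
 [],
 [(-8,2),(-5,1)],
 [([(-9,2),(0,0),(1,0),(0,1)],[],[])],
 []),
([(-9,1),(0,0),(1,0),(0,1)],
 [],
 [(-10,1)],
 [([(-9,1),(0,0),(1,0),(0,1)],[],[])],
 []),
([(0,0),(3,-1),(0,1),(-7,4)],
 [],
 [(-2,1),(-2,2)],
 [([(-10,5),(-3,1),(0,0),(-3,2)],[],[])],
 []),
([(-5,3),(0,0),(5,-2),(0,1)],
 [],
 [(-2,2),(-2,1)],
 [([(-5,3),(0,0),(5,-2),(0,1)],[],[])],
 []),
([(-9,5),(0,0),(1,0),(0,1)],
 [],
 [(-2,2),(-2,1)],
 [([(-9,5),(0,0),(1,0),(0,1)],[],[])],
 []),
([(0,-1),(2,0),(0,1),(-3,0)],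
 [],
 [(-1,-1),(-1,1)],
 [([(-5,0),(-2,-1),(0,0),(-2,1)],[],[])],
 []),
([(-4,0),(0,-1),(1,0),(0,1)],
 [],
 [(-1,1),(-1,-1)],
 [([(-4,1),(0,0),(1,1),(0,2)],[],[])],
 []),
([(0,1),(-3,2),(-4,2),(4,-2),(3,-1)],
 [],
 [(2,0),(6,-3)],
 [([(-1,0),(7,-4),(6,-3),(3,-1),(0,0)],[],[])],
 []),
([(2,0),(0,1),(-3,2),(-2,1),(4,-2)],
 [],
 [(-2,2),(-4,2)],
 [([(-3,1),(-2,0),(4,-3),(2,-1),(0,0)],[],[])],
 []),
([(0,1),(-5,3),(-2,1),(2,-1),(3,-1)],
 [],
 [(-2,2),(-4,2),(2,0)],
 [([(0,0),(3,-2),(7,-4),(8,-4),(5,-2)],[],[])],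
 []),
([(-1,0),(2,-1),(3,-1),(0,1),(-3,2)],
 [],
 [(2,0),(-2,2)],
 [([(-5,3),(-3,1),(0,0),(1,0),(-2,2)],[],[])],
 []),
([(2,-1),(3,-1),(0,1),(-4,3),(-2,1)],
 [],
 [(2,0),(4,-2),(1,-1),(-5,4)],
 [([(-7,4),(-5,2),(-1,0),(0,0),(-3,2)],[],[])],
 []),
([(1,1),(-2,2),(-3,2),(-2,1),(2,-1)],
 [],
 [(2,0),(-1,2)],
 [([(-1,0),(0,-1),(4,-3),(3,-1),(0,0)],[],[])],
 []),
([(-3,2),(-2,1),(2,-1),(2,0),(1,1)],
 [],
 [(-2,2),(-4,2)],
 [([(-1,1),(0,0),(4,-2),(4,-1),(3,0)],[],[])],
 []),
([(0,1),(-3,2),(-2,1),(2,-2),(2,-1)],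
 [],
 [(-1,0),(3,-2)],
 [([(0,0),(1,-1),(5,-4),(5,-3),(3,-1)],[],[])],
 []),
([(0,1),(-3,2),(-4,2),(-3,1),(2,-1)],
 [],
 [(-1,0),(-5,2)],
 [([(-1,0),(0,-1),(5,-3),(3,-1),(0,0)],[],[])],
 []),
([(0,1),(-4,2),(-5,2),(-3,1),(2,-1)],
 [],
 [(-1,0),(-8,3),(-3,2)],
 [([(-1,0),(1,-1),(6,-3),(4,-1),(0,0)],[],[])],
 []),
([(-4,4),(-2,1),(-1,0),(1,0),(0,1)],
 [],
 [(-1,2),(-3,2)],
 [([(-2,3),(0,0),(1,-1),(3,-1),(2,0)],[],[])],
 []),
([(-4,1),(-1,0),(1,0),(0,1),(-2,2)],
 [],
 [(-3,2),(-2,0)],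
 [([(-3,1),(0,0),(2,0),(1,1),(-1,2)],[],[])],
 []),
([(-2,2),(-3,1),(-1,0),(1,0),(1,1)],
 [],
 [(-1,2),(2,0),(-3,2)],
 [([(0,0),(2,-1),(4,-1),(4,0),(1,1)],[],[])],
 []),
([(4,-2),(3,-1),(0,1),(-2,2),(-3,2),(-2,1)],
 [],
 [(2,0),(-4,3),(-4,2)],
 [([(-6,3),(-5,2),(1,-1),(0,0),(-3,2),(-5,3)],[],[])],
 []),
([(2,-1),(3,-1),(2,0),(-2,2),(-3,2),(-2,1)],
 [],
 [(4,-1),(4,-2),(1,1),(-1,0)],
 [([(-6,3),(-5,2),(-1,0),(0,0),(-1,1),(-5,3)],[],[])],
 []),
([(-3,2),(-2,1),(1,-1),(2,-1),(2,0),(0,1)],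
 [],
 [(-1,0),(-2,2),(3,-1)],
 [([(-1,1),(0,0),(3,-2),(4,-2),(4,-1),(2,0)],[],[])],
 []),
([(-3,3),(-2,1),(-1,0),(1,-1),(1,0),(0,1)],
 [],
 [(-1,2),(-3,2),(2,-1),(0,-1)],
 [([(-1,2),(0,0),(1,-1),(3,-2),(3,-1),(2,0)],[],[])],
 [])]"

definition db14 :: "entry list" where
  "db14 = [
([(2,-2),(1,0),(0,1),(-2,2),(-3,2),(-2,1)],
 [],
 [(-1,0),(2,-1)],
 [([(-4,2),(-3,1),(1,-2),(0,0),(-1,1),(-3,2)],[],[])],
 []),
([(1,-1),(1,0),(0,1),(-3,3),(-3,2),(-2,1)],
 [],
 [(-1,0),(2,-1),(-4,3),(-1,2)],
 [([(-4,2),(-3,1),(0,-1),(0,0),(-1,1),(-4,3)],[],[])],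
 [])]"

text \<open>Targets for partners that are equivalent to a new pair of another entry; one test shows
  that all of them occur in the database.\<close>

definition DB_cross :: "(pt list \<times> pt list) list" where
  "DB_cross = [([(-2,1),(-1,0),(1,0),(0,1)],[(-3,3),(0,0),(1,0),(-2,3)]),
([(-4,1),(-2,0),(1,0),(0,1)],[(-4,2),(0,0),(1,0),(-1,2)]),
([(-3,1),(-2,0),(1,0),(0,1)],[(-2,2),(0,0),(2,0),(0,2)]),
([(-2,1),(-1,0),(1,0),(0,1)],[(-4,4),(0,0),(1,0),(-3,4)]),
([(-4,3),(-2,1),(2,-1),(0,1)],[(-4,4),(0,0),(2,-1),(-2,3)]),
([(-3,2),(-2,1),(3,-2),(0,1)],[(0,0),(5,-3),(7,-4),(5,-2),(3,-1)]),
([(-1,0),(2,-1),(0,1),(-3,2)],[(-6,3),(-5,2),(-3,1),(0,0),(-1,1),(-3,2)]),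
([(0,1),(-3,2),(-2,1),(1,-1),(2,-1)],[(0,0),(3,-2),(5,-3),(6,-3),(5,-2),(3,-1)]),
([(4,-2),(0,1),(-2,2),(-3,2),(-2,1)],[(-1,0),(1,-2),(5,-4),(4,-3),(0,0)]),
([(0,1),(-4,2),(-5,2),(2,-1)],[(0,0),(7,-3),(8,-3),(7,-2),(4,-1)]),
([(0,1),(-3,2),(-1,0),(1,-1),(2,-1)],[(0,0),(1,-1),(5,-3),(6,-3),(5,-2),(3,-1)])]"

text \<open>The growth certificates refer to positions in this list, so that a lookup passes over
  polygons only and not over whole entries.\<close>

definition DB_polygons :: "pt list list" where
  "DB_polygons = [[(0,0),(1,0),(0,1)],
[(0,1),(-1,0),(1,0)],
[(-1,1),(0,0),(1,0),(0,1)],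
[(-1,-1),(1,0),(0,1)],
[(0,1),(-2,0),(1,0)],
[(-2,1),(0,0),(1,0),(0,1)],
[(-2,1),(2,-1),(0,1)],
[(1,0),(0,1),(-2,-1)],
[(0,1),(-3,0),(1,0)],
[(-3,2),(0,0),(1,0),(0,1)],
[(-3,1),(0,0),(1,0),(0,1)],
[(-2,1),(-1,0),(1,0),(0,1)],
[(-1,0),(0,-1),(1,0),(0,1)],
[(-3,-1),(1,0),(0,1)],
[(0,1),(-4,0),(1,0)],
[(0,0),(1,0),(0,1),(-4,2)],
[(-3,1),(-1,0),(1,0),(0,1)],
[(-4,1),(0,0),(1,0),(0,1)],
[(-3,2),(-2,1),(0,0),(1,0),(0,1)],
[(0,1),(-4,2),(2,-1)],
[(1,0),(0,1),(-4,-1)],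
[(0,1),(-5,0),(1,0)],
[(-5,2),(0,0),(1,0),(0,1)],
[(0,1),(-3,2),(-2,1),(2,-1)],
[(-4,1),(-1,0),(1,0),(0,1)],
[(-3,1),(-2,0),(1,0),(0,1)],
[(-5,1),(0,0),(1,0),(0,1)],
[(-5,3),(0,0),(1,0),(0,1)],
[(-3,2),(0,0),(3,-1),(0,1)],
[(0,-1),(1,0),(0,1),(-2,0)],
[(-2,2),(-2,1),(-1,0),(1,0),(0,1)],
[(-3,2),(-2,1),(0,0),(1,0),(0,1),(-2,2)],
[(-5,-1),(1,0),(0,1)],
[(0,1),(-6,0),(1,0)],
[(-4,-2),(1,0),(0,1)],
[(0,1),(-3,2),(-4,2),(2,-1)],
[(-4,2),(-1,0),(1,0),(0,1)],
[(-4,1),(-2,0),(1,0),(0,1)],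
[(-5,1),(-1,0),(1,0),(0,1)],
[(-6,2),(0,0),(1,0),(0,1)],
[(-6,1),(0,0),(1,0),(0,1)],
[(0,1),(-2,2),(-3,2),(-2,1),(2,-1)],
[(-5,3),(-2,1),(0,0),(1,0),(0,1)],
[(-3,1),(0,0),(1,0),(0,1),(-3,2)],
[(1,-1),(1,0),(0,1),(-3,2),(-2,1)],
[(-5,2),(2,-1),(0,1)],
[(0,1),(-6,3),(2,-1)],
[(0,1),(-4,2),(4,-2)],
[(1,0),(0,1),(-6,-1)],
[(0,1),(-7,0),(1,0)],
[(0,1),(-5,3),(-2,1),(2,-1)],
[(-1,0),(2,-1),(0,1),(-3,2)],
[(-3,2),(-2,1),(3,-2),(0,1)],
[(0,1),(-3,2),(-2,1),(4,-2)],
[(2,-1),(0,1),(-2,2),(-4,2)],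
[(-4,3),(-2,1),(2,-1),(0,1)],
[(-5,1),(-2,0),(1,0),(0,1)],
[(-4,1),(-3,0),(1,0),(0,1)],
[(-6,1),(-1,0),(1,0),(0,1)],
[(-7,2),(0,0),(1,0),(0,1)],
[(-7,1),(0,0),(1,0),(0,1)],
[(-7,3),(0,0),(1,0),(0,1)],
[(0,0),(3,-1),(0,1),(-5,3)],
[(-7,4),(0,0),(1,0),(0,1)],
[(0,-1),(1,0),(0,1),(-3,0)],
[(-2,0),(0,-1),(2,0),(0,1)],
[(0,1),(-3,2),(-2,1),(1,-1),(2,-1)],
[(0,1),(-3,2),(-2,1),(2,-1),(3,-1)],
[(-3,1),(-1,0),(1,0),(0,1),(-2,2)],
[(-3,3),(-2,1),(-1,0),(1,0),(0,1)],
[(1,-1),(1,0),(0,1),(-2,2),(-2,1),(-1,0)],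
[(1,-1),(1,0),(0,1),(-2,2),(-3,2),(-2,1)],
[(-4,2),(2,-1),(-1,2)],
[(1,1),(-4,2),(2,-1)],
[(-7,-1),(1,0),(0,1)],
[(0,1),(-8,0),(1,0)],
[(0,1),(-3,2),(-3,1),(2,-1)],
[(1,1),(-3,2),(-2,1),(2,-1)],
[(0,1),(-3,2),(-4,2),(4,-2)],
[(0,1),(-5,3),(-4,2),(2,-1)],
[(0,1),(-4,2),(-5,2),(2,-1)],
[(0,1),(-4,2),(-3,1),(2,-1)],
[(-6,2),(-1,0),(1,0),(0,1)],
[(-5,1),(-3,0),(1,0),(0,1)],
[(-6,1),(-2,0),(1,0),(0,1)],
[(-7,1),(-1,0),(1,0),(0,1)],
[(-8,2),(0,0),(1,0),(0,1)],
[(-8,1),(0,0),(1,0),(0,1)],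
[(4,-2),(0,1),(-2,2),(-3,2),(-2,1)],
[(0,1),(-3,2),(-2,1),(4,-2),(3,-1)],
[(0,1),(-3,2),(-1,0),(1,-1),(2,-1)],
[(0,1),(-2,2),(-5,3),(-2,1),(2,-1)],
[(1,0),(0,1),(-2,2),(-2,1),(-1,-1)],
[(2,-2),(1,0),(0,1),(-3,2),(-2,1)],
[(-4,1),(0,0),(1,0),(0,1),(-3,2)],
[(-3,2),(-3,1),(0,0),(1,0),(1,1)],
[(-7,4),(-2,1),(0,0),(1,0),(0,1)],
[(3,-1),(0,1),(-2,2),(-3,2),(-2,1),(2,-1)],
[(4,-2),(0,1),(-6,3)],
[(-7,3),(2,-1),(0,1)],
[(1,0),(0,1),(-8,-1)],
[(0,1),(-9,0),(1,0)],
[(0,1),(-3,2),(-2,1),(5,-3)],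
[(0,1),(-5,3),(-2,1),(4,-2)],
[(0,1),(-3,2),(-2,1),(6,-3)],
[(4,-2),(0,1),(-2,2),(-4,2)],
[(4,-2),(0,1),(-4,3),(-2,1)],
[(-5,3),(-2,1),(3,-2),(0,1)],
[(1,1),(-3,2),(-4,2),(2,-1)],
[(1,-1),(2,-1),(0,1),(-5,3)],
[(-7,4),(-2,1),(2,-1),(0,1)],
[(-6,1),(-3,0),(1,0),(0,1)],
[(-5,1),(-4,0),(1,0),(0,1)],
[(-7,1),(-2,0),(1,0),(0,1)],
[(-8,1),(-1,0),(1,0),(0,1)],
[(-4,2),(-1,0),(3,-1),(0,1)],
[(-9,2),(0,0),(1,0),(0,1)],
[(-9,1),(0,0),(1,0),(0,1)],
[(0,0),(3,-1),(0,1),(-7,4)],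
[(-5,3),(0,0),(5,-2),(0,1)],
[(-9,5),(0,0),(1,0),(0,1)],
[(0,-1),(2,0),(0,1),(-3,0)],
[(-4,0),(0,-1),(1,0),(0,1)],
[(0,1),(-3,2),(-4,2),(4,-2),(3,-1)],
[(2,0),(0,1),(-3,2),(-2,1),(4,-2)],
[(0,1),(-5,3),(-2,1),(2,-1),(3,-1)],
[(-1,0),(2,-1),(3,-1),(0,1),(-3,2)],
[(2,-1),(3,-1),(0,1),(-4,3),(-2,1)],
[(1,1),(-2,2),(-3,2),(-2,1),(2,-1)],
[(-3,2),(-2,1),(2,-1),(2,0),(1,1)],
[(0,1),(-3,2),(-2,1),(2,-2),(2,-1)],
[(0,1),(-3,2),(-4,2),(-3,1),(2,-1)],
[(0,1),(-4,2),(-5,2),(-3,1),(2,-1)],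
[(-4,4),(-2,1),(-1,0),(1,0),(0,1)],
[(-4,1),(-1,0),(1,0),(0,1),(-2,2)],
[(-2,2),(-3,1),(-1,0),(1,0),(1,1)],
[(4,-2),(3,-1),(0,1),(-2,2),(-3,2),(-2,1)],
[(2,-1),(3,-1),(2,0),(-2,2),(-3,2),(-2,1)],
[(-3,2),(-2,1),(1,-1),(2,-1),(2,0),(0,1)],
[(-3,3),(-2,1),(-1,0),(1,-1),(1,0),(0,1)],
[(2,-2),(1,0),(0,1),(-2,2),(-3,2),(-2,1)],
[(1,-1),(1,0),(0,1),(-3,3),(-3,2),(-2,1)]]"

definition DB_look :: "int \<Rightarrow> pt list option" where
  "DB_look j = pick j DB_polygons"

definition DB :: "entry list" where
  "DB = db1 @ db2 @ db3 @ db4 @ db5 @ db6 @ db7 @ db8 @ db9 @ db10 @ db11 @ db12 @ db13 @ db14"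

lemma DB_apart: "all_apart (reps DB)"
  by code_simp

lemma db1_news: "list_all news_ok db1"
  by code_simp

lemma db1_enum: "list_all enum_ok db1"
  by code_simp

lemma db1_olds: "list_all (olds_ok DB_cross) db1"
  by code_simp

lemma db1_growth: "list_all (growth_ok DB_look) db1"
  by code_simp

lemma db2_news: "list_all news_ok db2"
  by code_simp

lemma db2_enum: "list_all enum_ok db2"
  by code_simp

lemma db2_olds: "list_all (olds_ok DB_cross) db2"
  by code_simp

lemma db2_growth: "list_all (growth_ok DB_look) db2"
  by code_simp

lemma db3_news: "list_all news_ok db3"
  by code_simp

lemma db3_enum: "list_all enum_ok db3"
  by code_simp

lemma db3_olds: "list_all (olds_ok DB_cross) db3"
  by code_simp

lemma db3_growth: "list_all (growth_ok DB_look) db3"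
  by code_simp

lemma db4_news: "list_all news_ok db4"
  by code_simp

lemma db4_enum: "list_all enum_ok db4"
  by code_simp

lemma db4_olds: "list_all (olds_ok DB_cross) db4"
  by code_simp

lemma db4_growth: "list_all (growth_ok DB_look) db4"
  by code_simp

lemma db5_news: "list_all news_ok db5"
  by code_simp

lemma db5_enum: "list_all enum_ok db5"
  by code_simp

lemma db5_olds: "list_all (olds_ok DB_cross) db5"
  by code_simp

lemma db5_growth: "list_all (growth_ok DB_look) db5"
  by code_simp

lemma db6_news: "list_all news_ok db6"
  by code_simp

lemma db6_enum: "list_all enum_ok db6"
  by code_simp

lemma db6_olds: "list_all (olds_ok DB_cross) db6"
  by code_simp

lemma db6_growth: "list_all (growth_ok DB_look) db6"
  by code_simp

lemma db7_news: "list_all news_ok db7"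
  by code_simp

lemma db7_enum: "list_all enum_ok db7"
  by code_simp

lemma db7_olds: "list_all (olds_ok DB_cross) db7"
  by code_simp

lemma db7_growth: "list_all (growth_ok DB_look) db7"
  by code_simp

lemma db8_news: "list_all news_ok db8"
  by code_simp

lemma db8_enum: "list_all enum_ok db8"
  by code_simp

lemma db8_olds: "list_all (olds_ok DB_cross) db8"
  by code_simp

lemma db8_growth: "list_all (growth_ok DB_look) db8"
  by code_simp

lemma db9_news: "list_all news_ok db9"
  by code_simp

lemma db9_enum: "list_all enum_ok db9"
  by code_simp

lemma db9_olds: "list_all (olds_ok DB_cross) db9"
  by code_simp

lemma db9_growth: "list_all (growth_ok DB_look) db9"
  by code_simp

lemma db10_news: "list_all news_ok db10"
  by code_simp

lemma db10_enum: "list_all enum_ok db10"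
  by code_simp

lemma db10_olds: "list_all (olds_ok DB_cross) db10"
  by code_simp

lemma db10_growth: "list_all (growth_ok DB_look) db10"
  by code_simp

lemma db11_news: "list_all news_ok db11"
  by code_simp

lemma db11_enum: "list_all enum_ok db11"
  by code_simp

lemma db11_olds: "list_all (olds_ok DB_cross) db11"
  by code_simp

lemma db11_growth: "list_all (growth_ok DB_look) db11"
  by code_simp

lemma db12_news: "list_all news_ok db12"
  by code_simp

lemma db12_enum: "list_all enum_ok db12"
  by code_simp

lemma db12_olds: "list_all (olds_ok DB_cross) db12"
  by code_simp

lemma db12_growth: "list_all (growth_ok DB_look) db12"
  by code_simp

lemma db13_news: "list_all news_ok db13"
  by code_simp

lemma db13_enum: "list_all enum_ok db13"
  by code_simp

lemma db13_olds: "list_all (olds_ok DB_cross) db13"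
  by code_simp

lemma db13_growth: "list_all (growth_ok DB_look) db13"
  by code_simp

lemma db14_news: "list_all news_ok db14"
  by code_simp

lemma db14_enum: "list_all enum_ok db14"
  by code_simp

lemma db14_olds: "list_all (olds_ok DB_cross) db14"
  by code_simp

lemma db14_growth: "list_all (growth_ok DB_look) db14"
  by code_simp

lemma DB_polygons: "DB_polygons = map fst DB"
  by code_simp

lemma DB_cross: "sub_pairs DB_cross (new_pairs DB)"
  by code_simp

lemma DB_counts: "counts (mixed_vols DB) = [1, 3, 6, 13, 18, 38, 46, 87, 118, 202]"
  by code_simp

lemma DB_database: "database DB DB_cross DB_look"
proof
  have split: "list_all P DB" if "list_all P db1" "list_all P db2" "list_all P db3" "list_all P db4" "list_all P db5" "list_all P db6" "list_all P db7" "list_all P db8" "list_all P db9" "list_all P db10" "list_all P db11" "list_all P db12" "list_all P db13" "list_all P db14" for P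
    using that unfolding DB_def by simp
  show "news_ok e" if "e \<in> set DB" for e
    using split[OF db1_news db2_news db3_news db4_news db5_news db6_news db7_news db8_news db9_news db10_news db11_news db12_news db13_news db14_news] that by (simp add: list_all_iff)
  show "enum_ok e" if "e \<in> set DB" for e
    using split[OF db1_enum db2_enum db3_enum db4_enum db5_enum db6_enum db7_enum db8_enum db9_enum db10_enum db11_enum db12_enum db13_enum db14_enum] that by (simp add: list_all_iff)
  show "olds_ok DB_cross e" if "e \<in> set DB" for e
    using split[OF db1_olds db2_olds db3_olds db4_olds db5_olds db6_olds db7_olds db8_olds db9_olds db10_olds db11_olds db12_olds db13_olds db14_olds] that by (simp add: list_all_iff)
  show "growth_ok DB_look e" if "e \<in> set DB" for e
    using split[OF db1_growth db2_growth db3_growth db4_growth db5_growth db6_growth db7_growth db8_growth db9_growth db10_growth db11_growth db12_growth db13_growth db14_growth] that by (simp add: list_all_iff)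
  show "sub_pairs DB_cross (new_pairs DB)" by (rule DB_cross)
  show "R \<in> set (map fst DB)" if "DB_look j = Some R" for j R
    using pick_mem[of j DB_polygons R] that by (simp add: DB_look_def DB_polygons)
  show "\<exists>R\<in>set (map fst DB). set R = {(0, 0), (1, 0), (0, 1)}"
  proof
    show "fst (hd db1) \<in> set (map fst DB)" by (simp add: DB_def db1_def)
    show "set (fst (hd db1)) = {(0, 0), (1, 0), (0, 1)}" by (simp add: db1_def)
  qed
qed (rule DB_apart)

theorem theorem1p9:
  shows "N2 1 = 1 \<and> N2 2 = 3 \<and> N2 3 = 6 \<and> N2 4 = 13 \<and> N2 5 = 18 \<and>
    N2 6 = 38 \<and> N2 7 = 46 \<and> N2 8 = 87 \<and> N2 9 = 118 \<and> N2 10 = 202"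
proof -
  note N = database.N2_count[OF DB_database]
  show ?thesis
    using DB_counts[unfolded counts_def] N[of 1] N[of 2] N[of 3] N[of 4] N[of 5] N[of 6] N[of 7] N[of 8] N[of 9] N[of 10] by simp
qed

end
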